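(* Let $F=\mathbb R$ and $n\ge2$. The operator $M:\mathcal C_+\to\mathcal C_-$, $Mf(\xi)=\int_{\xi\cdot x=1}f(x)\,d\mu_\xi$, is an isomorphism. For every integer $k\ge0$ and $\varphi\in\mathcal C_-(\mathbb R_{>0})\otimes H^k$, the inverse $M^{-1}:\mathcal C_-\to\mathcal C_+$ is given by the formula $$M^{-1}\varphi=\beta_k*\mathrm{Inv}(\varphi),$$ where $\beta_k$ is the distribution on $\mathbb R_{>0}$ defined by $$\beta_k(t)=\frac{1}{2^{n+k-2}\,\pi^{\frac{n-1}2}\,\Gamma\!\left(\frac{n+2k-1}2\right)}\;t^{k-1}\left(-\frac{d}{dt}\right)^{n+k-1}\left(t^{-k+1}(1-t^2)_+^{\frac{n+2k-3}2}\right)dt.$$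
   Context: Notation. $n\ge2$, $K=O(n)$, all functions are complex valued; $\|\cdot\|$ is the Euclidean norm on $\mathbb R^n$, $\xi\cdot x=\sum\xi_ix_i$, and $\mathbb R^n$ has Lebesgue measure. $\mathcal C$ is the space of $K$-finite $C^\infty$ functions on $\mathbb R^n\setminus\{0\}$, where $g\in GL_n(\mathbb R)$ acts by $(g\cdot f)(x)=f(g^{-1}x)$. $\mathcal C_+\subset\mathcal C$ is the subspace of functions with bounded support in $\mathbb R^n$; $\mathcal C_-\subset\mathcal C$ is the subspace of functions vanishing in a neighborhood of $0$. Similarly $\mathcal C(\mathbb R_{>0})$ is the space of smooth functions on $\mathbb R_{>0}$, $\mathcal C_+(\mathbb R_{>0})$ the subspace of functions vanishing for all large $r$, $\mathcal C_-(\mathbb R_{>0})$ the subspace of functions vanishing near $0$, and $\mathcal C_c(\mathbb R_{>0})$ the compactly supported ones. For $f\in\mathcal C_+$ and $\xi\in\mathbb R^n\setminus\{0\}$, $Mf(\xi)=\int_{\xi\cdot x=1}f(x)\,d\mu_\xi$, where $d\mu_\xi$ is the measure on the hyperplane $\{\xi\cdot x=t\}$ with $d\mu_\xi\,dt=dx$. This gives an operator $M:\mathcal C_+\to\mathcal C_-$. $H^k$ is the space of harmonic homogeneous polynomials of degree $k$ on $\mathbb R^n$. For $u\in\mathcal C(\mathbb R_{>0})$ and $Y\in H^k$, $u\otimes Y\in\mathcal C$ denotes the function $(u\otimes Y)(x)=u(\|x\|)\,Y(x/\|x\|)$. One has $\mathcal C=\bigoplus_{k\ge0}\mathcal C(\mathbb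 R_{>0})\otimes H^k$, and $\mathcal C_\pm(\mathbb R_{>0})\otimes H^k\subset\mathcal C_\pm$. $\mathrm{Inv}:\mathcal C_-\to\mathcal C_+$ is the isomorphism $(\mathrm{Inv}\,\varphi)(x)=\|x\|^{-n}\varphi(x/\|x\|^2)$. $A$ is the algebra (under multiplicative convolution) of distributions on $\mathbb R_{>0}$ supported on $(0,1]$. It acts on $\mathcal C_+$ through the action of $\mathbb R_{>0}$ (viewed as scalar matrices): $(\beta*f)(x)=\int_{\mathbb R_{>0}}\beta(t)\,f(t^{-1}x)$, i.e. the distribution $\beta$ applied to $t\mapsto f(t^{-1}x)$. The derivative $\frac d{dt}$ is taken in the sense of generalized functions on $\mathbb R_{>0}$. For $\mathrm{Re}(\lambda)>-1$ the generalized function $(1-t)_+^\lambda$ is defined by $\langle(1-t)_+^\lambda,f_0(t)dt\rangle=\int_0^1(1-t)^\lambda f_0(t)\,dt$ for $f_0\in\mathcal C_c(\mathbb R_{>0})$ (and by analytic continuation for other $\lambda$ not a negative integer), and $(1-t^2)_+^\lambda=(1+t)^\lambda(1-t)_+^\lambda$. *)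

theory Defs
  imports "HOL-Analysis.Analysis" "HOL-Library.Function_Algebras"
begin

subsection \<open>Complex-valued functions as a vector space\<close>

definition cscale :: "complex \<Rightarrow> ('a \<Rightarrow> complex) \<Rightarrow> 'a \<Rightarrow> complex" where
  "cscale c f = (\<lambda>x. c * f x)"

interpretation cfun: vector_space cscale
  by standard (auto simp: cscale_def fun_eq_iff algebra_simps)


subsection \<open>Smooth functions\<close>

text \<open>
  The following two notions are meant for open sets \<open>S\<close>. The clause for
  \<open>Suc k\<close> says that \<open>f\<close> is differentiable and that each of its directional derivatives
  is of class \<open>C\<close> to the \<open>k\<close>; in finite dimension this is the usual class.
\<close>

primrec Ck_on ::
  "nat \<Rightarrow> ('a::euclidean_space \<Rightarrow> 'b::real_normed_vector) \<Rightarrow> 'a set \<Rightarrow> bool" where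
  "Ck_on 0 f S \<longleftrightarrow> continuous_on S f"
| "Ck_on (Suc k) f S \<longleftrightarrow>
     f differentiable_on S \<and> (\<forall>v. Ck_on k (\<lambda>x. frechet_derivative f (at x) v) S)"

definition smooth_on ::
  "('a::euclidean_space \<Rightarrow> 'b::real_normed_vector) \<Rightarrow> 'a set \<Rightarrow> bool" where
  "smooth_on f S \<longleftrightarrow> (\<forall>k. Ck_on k f S)"


subsection \<open>The function spaces\<close>

text \<open>
  A function on the punctured space (on the positive half-line) is encoded as a total
  function with value \<open>0\<close> at the origin (on the nonpositive reals), so that
  equality of total functions is equality on the actual domain.
\<close>

definition mat_act :: "real^'n^'n \<Rightarrow> (real^'n \<Rightarrow> complex) \<Rightarrow> real^'n \<Rightarrow> complex" where
  "mat_act g f = (\<lambda>x. f (matrix_inv g *v x))"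

definition K_finite :: "(real^'n \<Rightarrow> complex) \<Rightarrow> bool" where
  "K_finite f \<longleftrightarrow>
     (\<exists>B. finite B \<and> cfun.span {mat_act g f | g. orthogonal_matrix g} \<subseteq> cfun.span B)"

definition C_space :: "(real^'n \<Rightarrow> complex) set" where
  "C_space = {f. smooth_on f (- {0}) \<and> K_finite f \<and> f 0 = 0}"

definition C_plus :: "(real^'n \<Rightarrow> complex) set" where
  "C_plus = {f \<in> C_space. bounded {x. f x \<noteq> 0}}"

definition C_minus :: "(real^'n \<Rightarrow> complex) set" where
  "C_minus = {f \<in> C_space. \<forall>\<^sub>F x in at 0. f x = 0}"

definition Cpos :: "(real \<Rightarrow> complex) set" where
  "Cpos = {u. smooth_on u {0<..} \<and> (\<forall>r\<le>0. u r = 0)}"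

definition Cpos_plus :: "(real \<Rightarrow> complex) set" where
  "Cpos_plus = {u \<in> Cpos. \<forall>\<^sub>F r in at_top. u r = 0}"

definition Cpos_minus :: "(real \<Rightarrow> complex) set" where
  "Cpos_minus = {u \<in> Cpos. \<forall>\<^sub>F r in at_right 0. u r = 0}"

definition Cpos_c :: "(real \<Rightarrow> complex) set" where
  "Cpos_c = Cpos_plus \<inter> Cpos_minus"


subsection \<open>Integration over hyperplanes\<close>

definition hyperplane_proj :: "'a::euclidean_space \<Rightarrow> real \<Rightarrow> 'a \<Rightarrow> 'a" where
  "hyperplane_proj \<xi> t y = y - ((\<xi> \<bullet> y - t) / (\<xi> \<bullet> \<xi>)) *\<^sub>R \<xi>"

text \<open>
  The measure on the hyperplane \<open>\<xi> \<bullet> x = t\<close> whose product with \<open>dt\<close> is Lebesgue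
  measure: the measure of a subset of the hyperplane is the volume of the prism over it,
  in the direction of \<open>\<xi>\<close>, inside the slab \<open>t \<le> \<xi> \<bullet> y \<le> t + 1\<close>. The lemmas below
  show that it lives on the hyperplane, that these measures disintegrate Lebesgue
  measure, and that translations permute them; these properties determine the family.
\<close>

definition hyperplane_measure :: "'a::euclidean_space \<Rightarrow> real \<Rightarrow> 'a measure" where
  "hyperplane_measure \<xi> t =
     distr (restrict_space lborel {y. t \<le> \<xi> \<bullet> y \<and> \<xi> \<bullet> y \<le> t + 1}) borel
       (hyperplane_proj \<xi> t)"

lemma hyperplane_proj_measurable [measurable]: "hyperplane_proj \<xi> t \<in> borel_measurable borel"
  unfolding hyperplane_proj_def by measurable

lemma slab_sets [measurable]: "{y::'a::euclidean_space. t \<le> \<xi> \<bullet> y \<and> \<xi> \<bullet> y \<le> t + 1} \<in> sets borel"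
  by measurable

lemma nn_integral_hyperplane_measure:
  fixes f :: "'a::euclidean_space \<Rightarrow> ennreal"
  assumes [measurable]: "f \<in> borel_measurable borel"
  shows "(\<integral>\<^sup>+x. f x \<partial>hyperplane_measure \<xi> t) =
         (\<integral>\<^sup>+y. f (hyperplane_proj \<xi> t y) * indicator {0..1} (\<xi> \<bullet> y - t) \<partial>lborel)"
proof -
  have m: "hyperplane_proj \<xi> t \<in>
      restrict_space lborel {y. t \<le> \<xi> \<bullet> y \<and> \<xi> \<bullet> y \<le> t + 1} \<rightarrow>\<^sub>M borel"
    by (rule measurable_restrict_space1) simp
  have "(\<integral>\<^sup>+x. f x \<partial>hyperplane_measure \<xi> t) =
        (\<integral>\<^sup>+y. f (hyperplane_proj \<xi> t y) *
            indicator {y. t \<le> \<xi> \<bullet> y \<and> \<xi> \<bullet> y \<le> t + 1} y \<partial>lborel)"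
    unfolding hyperplane_measure_def
    by (subst nn_integral_distr[OF m]) (simp_all add: nn_integral_restrict_space)
  also have "\<dots> = (\<integral>\<^sup>+y. f (hyperplane_proj \<xi> t y) * indicator {0..1} (\<xi> \<bullet> y - t) \<partial>lborel)"
    by (rule nn_integral_cong) (auto simp: indicator_def algebra_simps)
  finally show ?thesis .
qed

lemma hyperplane_measure_concentrated:
  assumes "\<xi> \<noteq> 0"
  shows "AE x in hyperplane_measure \<xi> t. \<xi> \<bullet> x = t"
proof -
  have "\<xi> \<bullet> hyperplane_proj \<xi> t y = t" for y
    using assms by (simp add: hyperplane_proj_def inner_diff_right)
  moreover have "hyperplane_proj \<xi> t \<in>
      restrict_space lborel {y. t \<le> \<xi> \<bullet> y \<and> \<xi> \<bullet> y \<le> t + 1} \<rightarrow>\<^sub>M borel"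
    by (rule measurable_restrict_space1) simp
  ultimately show ?thesis
    unfolding hyperplane_measure_def by (subst AE_distr_iff) auto
qed

lemma hyperplane_measure_disintegration:
  fixes f :: "'a::euclidean_space \<Rightarrow> ennreal"
  assumes [measurable]: "f \<in> borel_measurable borel"
  shows "(\<integral>\<^sup>+t. (\<integral>\<^sup>+x. f x \<partial>hyperplane_measure \<xi> t) \<partial>lborel) = (\<integral>\<^sup>+x. f x \<partial>lborel)"
proof -
  define F where "F y s = f (y - (s / (\<xi> \<bullet> \<xi>)) *\<^sub>R \<xi>) * indicator {0..1::real} s" for y s
  have [measurable]: "(\<lambda>(y, s). F y s) \<in> borel_measurable (borel \<Otimes>\<^sub>M borel)"
    unfolding F_def by measurable
  have F1 [measurable]: "(\<lambda>s. F y s) \<in> borel_measurable borel" for y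
    unfolding F_def by measurable
  have shift: "(\<integral>\<^sup>+x. f (x + v) \<partial>lborel) = (\<integral>\<^sup>+x. f x \<partial>lborel)" for v
    by (subst (2) lborel_distr_plus[of v, symmetric], subst nn_integral_distr)
      (simp_all add: add.commute)
  have "(\<integral>\<^sup>+t. (\<integral>\<^sup>+x. f x \<partial>hyperplane_measure \<xi> t) \<partial>lborel) =
        (\<integral>\<^sup>+t. (\<integral>\<^sup>+y. F y (\<xi> \<bullet> y - t) \<partial>lborel) \<partial>lborel)"
    by (simp add: nn_integral_hyperplane_measure F_def hyperplane_proj_def)
  also have "\<dots> = (\<integral>\<^sup>+y. (\<integral>\<^sup>+t. F y (\<xi> \<bullet> y - t) \<partial>lborel) \<partial>lborel)"
    by (rule lborel_pair.Fubini') (simp add: F_def split_beta')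
  also have "\<dots> = (\<integral>\<^sup>+y. (\<integral>\<^sup>+s. F y s \<partial>lborel) \<partial>lborel)"
  proof (rule nn_integral_cong)
    fix y
    show "(\<integral>\<^sup>+t. F y (\<xi> \<bullet> y - t) \<partial>lborel) = (\<integral>\<^sup>+s. F y s \<partial>lborel)"
      using nn_integral_real_affine[OF F1[of y], of "-1" "\<xi> \<bullet> y"] by simp
  qed
  also have "\<dots> = (\<integral>\<^sup>+s. (\<integral>\<^sup>+y. F y s \<partial>lborel) \<partial>lborel)"
    by (rule lborel_pair.Fubini'[symmetric]) (simp add: F_def split_beta')
  also have "\<dots> = (\<integral>\<^sup>+s. (\<integral>\<^sup>+x. f x \<partial>lborel) * indicator {0..1::real} s \<partial>lborel)"
  proof (rule nn_integral_cong)
    fix s :: real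
    show "(\<integral>\<^sup>+y. F y s \<partial>lborel) = (\<integral>\<^sup>+x. f x \<partial>lborel) * indicator {0..1::real} s"
      unfolding F_def using shift[of "- (s / (\<xi> \<bullet> \<xi>)) *\<^sub>R \<xi>"]
      by (simp add: nn_integral_multc)
  qed
  also have "\<dots> = (\<integral>\<^sup>+x. f x \<partial>lborel)"
    by (simp add: nn_integral_cmult_indicator)
  finally show ?thesis .
qed

lemma hyperplane_measure_translation:
  fixes f :: "'a::euclidean_space \<Rightarrow> ennreal"
  assumes [measurable]: "f \<in> borel_measurable borel"
  shows "(\<integral>\<^sup>+x. f (x + v) \<partial>hyperplane_measure \<xi> t) =
         (\<integral>\<^sup>+x. f x \<partial>hyperplane_measure \<xi> (t + \<xi> \<bullet> v))"
proof -
  define G where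
    "G y = f (hyperplane_proj \<xi> (t + \<xi> \<bullet> v) y) * indicator {0..1} (\<xi> \<bullet> y - (t + \<xi> \<bullet> v))" for y
  have [measurable]: "G \<in> borel_measurable borel"
    unfolding G_def by measurable
  have "(\<integral>\<^sup>+x. f (x + v) \<partial>hyperplane_measure \<xi> t) = (\<integral>\<^sup>+y. G (v + y) \<partial>lborel)"
    by (subst nn_integral_hyperplane_measure)
      (auto simp: G_def hyperplane_proj_def inner_add_right algebra_simps)
  also have "\<dots> = (\<integral>\<^sup>+y. G y \<partial>lborel)"
    by (subst (2) lborel_distr_plus[of v, symmetric], subst nn_integral_distr) simp_all
  also have "\<dots> = (\<integral>\<^sup>+x. f x \<partial>hyperplane_measure \<xi> (t + \<xi> \<bullet> v))"
    by (subst nn_integral_hyperplane_measure) (auto simp: G_def[abs_def])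
  finally show ?thesis .
qed

definition M_op :: "(real^'n \<Rightarrow> complex) \<Rightarrow> real^'n \<Rightarrow> complex" where
  "M_op f \<xi> = (if \<xi> = 0 then 0 else (LINT x|hyperplane_measure \<xi> 1. f x))"


subsection \<open>Harmonic polynomials\<close>

definition homogeneous_poly :: "nat \<Rightarrow> (real^'n \<Rightarrow> complex) \<Rightarrow> bool" where
  "homogeneous_poly k Y \<longleftrightarrow>
     (\<exists>c :: ('n \<Rightarrow> nat) \<Rightarrow> complex. \<forall>x.
        Y x = (\<Sum>\<alpha> | sum \<alpha> UNIV = k. c \<alpha> * (\<Prod>i\<in>UNIV. complex_of_real (x $ i) ^ \<alpha> i)))"

lemma finite_multi_indices: "finite {\<alpha> :: 'n::finite \<Rightarrow> nat. sum \<alpha> UNIV = k}"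
proof (rule finite_subset)
  show "{\<alpha> :: 'n \<Rightarrow> nat. sum \<alpha> UNIV = k} \<subseteq> PiE UNIV (\<lambda>_. {..k})"
    by (auto intro: member_le_sum)
qed (auto intro: finite_PiE)

definition laplacian :: "(real^'n \<Rightarrow> complex) \<Rightarrow> real^'n \<Rightarrow> complex" where
  "laplacian f x =
     (\<Sum>i\<in>UNIV. frechet_derivative
        (\<lambda>y. frechet_derivative f (at y) (axis i 1)) (at x) (axis i 1))"

definition harmonic_poly :: "nat \<Rightarrow> (real^'n \<Rightarrow> complex) set" where
  "harmonic_poly k = {Y. homogeneous_poly k Y \<and> (\<forall>x. laplacian Y x = 0)}"

text \<open>
  At the origin the value is \<open>0\<close> for \<open>u\<close> in \<open>Cpos\<close>, in accordance with the convention
  for functions on the punctured space.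
\<close>

definition radial_tensor ::
  "(real \<Rightarrow> complex) \<Rightarrow> (real^'n \<Rightarrow> complex) \<Rightarrow> real^'n \<Rightarrow> complex" where
  "radial_tensor u Y x = u (norm x) * Y (x /\<^sub>R norm x)"

definition tensor_space ::
  "(real \<Rightarrow> complex) set \<Rightarrow> (real^'n \<Rightarrow> complex) set \<Rightarrow> (real^'n \<Rightarrow> complex) set" where
  "tensor_space U H = cfun.span {radial_tensor u Y | u Y. u \<in> U \<and> Y \<in> H}"

definition Inv_op :: "(real^'n \<Rightarrow> complex) \<Rightarrow> real^'n \<Rightarrow> complex" where
  "Inv_op \<phi> x = \<phi> (x /\<^sub>R (norm x)\<^sup>2) / complex_of_real (norm x ^ CARD('n))"


subsection \<open>Generalized functions and distributions on the positive half-line\<close>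

text \<open>
  A generalized function \<open>G\<close> is represented by the functional sending \<open>f\<close> in \<open>Cpos_c\<close> to
  its pairing with \<open>f(t) dt\<close>. The same functional represents the distribution \<open>G dt\<close>,
  which is paired with functions.
\<close>

type_synonym gen_fun = "(real \<Rightarrow> complex) \<Rightarrow> complex"

definition gf_mult :: "(real \<Rightarrow> real) \<Rightarrow> gen_fun \<Rightarrow> gen_fun" where
  "gf_mult a G = (\<lambda>f. G (\<lambda>t. complex_of_real (a t) * f t))"

definition gf_deriv :: "gen_fun \<Rightarrow> gen_fun" where
  "gf_deriv G = (\<lambda>f. - G (\<lambda>t. vector_derivative f (at t)))"

text \<open>
  The generalized functions \<open>(1 - t)\<^sub>+\<close> and \<open>(1 - t\<^sup>2)\<^sub>+\<close> raised to the power \<open>s\<close>, for \<open>s > -1\<close>.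
\<close>

definition one_minus_plus :: "real \<Rightarrow> gen_fun" where
  "one_minus_plus s = (\<lambda>f. LBINT t:{0..1}. complex_of_real ((1 - t) powr s) * f t)"

definition one_minus_sq_plus :: "real \<Rightarrow> gen_fun" where
  "one_minus_sq_plus s = gf_mult (\<lambda>t. (1 + t) powr s) (one_minus_plus s)"

definition beta_dist :: "nat \<Rightarrow> nat \<Rightarrow> gen_fun" where
  "beta_dist n k =
     cscale (complex_of_real
         (1 / (2 ^ (n + k - 2) * pi powr ((real n - 1) / 2)
               * Gamma ((real n + 2 * real k - 1) / 2))))
       (gf_mult (\<lambda>t. t powi (int k - 1))
         (((\<lambda>G. - gf_deriv G) ^^ (n + k - 1))
           (gf_mult (\<lambda>t. t powi (1 - int k))
             (one_minus_sq_plus ((real n + 2 * real k - 3) / 2)))))"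

text \<open>
  The value of a distribution \<open>\<beta>\<close> supported on \<open>{0<..1}\<close> on a smooth function \<open>g\<close> on the
  half-line that vanishes near \<open>0\<close> but need not have compact support: it is the value of
  \<open>\<beta>\<close> on any test function that agrees with \<open>g\<close> on a neighbourhood of \<open>{0<..1}\<close>.
\<close>

definition dist_apply :: "gen_fun \<Rightarrow> (real \<Rightarrow> complex) \<Rightarrow> complex" where
  "dist_apply \<beta> g =
     (THE c. \<forall>h\<in>Cpos_c. (\<exists>b>1. \<forall>t\<in>{0<..<b}. h t = g t) \<longrightarrow> \<beta> h = c)"

definition mult_conv :: "gen_fun \<Rightarrow> (real^'n \<Rightarrow> complex) \<Rightarrow> real^'n \<Rightarrow> complex" where
  "mult_conv \<beta> f x = (if x = 0 then 0 else dist_apply \<beta> (\<lambda>t. f (x /\<^sub>R t)))"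

end

theory Submission
  imports Defs "HOL-Computational_Algebra.Fundamental_Theorem_Algebra"
begin

text \<open>
  On a function \<open>U (x \<bullet> x) * Y x\<close> with \<open>Y\<close> harmonic of degree \<open>k\<close>, Euler's identity and
  integration by parts along the hyperplane reduce the integral to that of a radial function, so
  that \<open>M\<close> acts on the radial part alone.  There it is, up to inversion of the variable, a power
  of the operator \<open>P\<close> of integration of \<open>U (p + y\<^sup>2)\<close> over \<open>y\<close>, corrected by \<open>k\<close> derivatives;
  since \<open>P\<close> twice is \<open>\<pi>\<close> times integration from \<open>p\<close> to infinity, \<open>P\<close> is invertible, and its
  powers are inverted explicitly by Abel's formula, whose kernel becomes \<open>\<beta>\<^sub>k\<close> after the
  substitution \<open>t = r / sqrt (r\<^sup>2 + y\<^sup>2)\<close>.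

  A K-finite function restricted to a circle spans under rotations a finite-dimensional space
  closed under differentiation, hence is a trigonometric polynomial of bounded degree; a function
  with this property on all great circles is a polynomial on each sphere.  This splits every
  function of \<open>C_space\<close> into finitely many products of radial functions and harmonic polynomials.
\<close>

subsection \<open>Smooth functions\<close>

text \<open>Functions in \<open>C_plus\<close> may blow up arbitrarily at the origin, so nothing can
  be integrated across it; every integral converges because the hyperplane keeps the distance 1 /
  norm \<xi> from 0. Accordingly the radial profiles in \<open>fplus\<close> vanish far out but
  satisfy no condition at 0, and on them d/dp is injective, with inverse minus integration to
  infinity. The variable p = x \<bullet> x is chosen because integration in a perpendicular
  direction then commutes with d/dp. On one harmonic component the inversion formula itself gives
  injectivity, while surjectivity comes from inverting the factors of the radial operator one after
  the other.

  K-finiteness enters only as finite dimensionality of a span. The obstacle is uniformity: the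
  degree bound has to serve all radii at once, or the number of harmonic components could grow with
  r. Therefore all circles of all radii form a single family obeying a single differential equation.
  Expansions in finite-dimensional function spaces are made at interpolation nodes: coefficients are
  then values of the function, and smoothness in r and vanishing of f on a sphere pass to
  them.\<close>

lemma Ck_on_SucI:
  fixes f :: "'a::euclidean_space \<Rightarrow> 'b::real_normed_vector"
  assumes "open S" "\<And>x. x \<in> S \<Longrightarrow> (f has_derivative f' x) (at x)"
    and "\<And>v. Ck_on k (\<lambda>x. f' x v) S"
    and cong: "\<And>f g :: 'a \<Rightarrow> 'b. (\<And>x. x \<in> S \<Longrightarrow> f x = g x) \<Longrightarrow> Ck_on k f S \<Longrightarrow> Ck_on k g S"
  shows "Ck_on (Suc k) f S"
proof -
  have "f differentiable_on S"
    using assms(2) by (meson differentiableI differentiable_at_imp_differentiable_on)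
  moreover have "Ck_on k (\<lambda>x. frechet_derivative f (at x) v) S" for v
    using assms(2) by (intro cong[OF _ assms(3)[of v]]) (metis assms(2) frechet_derivative_at)
  ultimately show ?thesis by simp
qed

text \<open>The induction step is \<open>Ck_on_SucI\<close> with the induction hypothesis in the
  place of its premise \<open>cong\<close>. That rule takes congruence as a premise to make this
  possible; \<open>Ck_on_SucI'\<close> has it discharged.\<close>

lemma Ck_on_cong_imp:
  assumes "open S" "\<And>x. x \<in> S \<Longrightarrow> f x = g x" "Ck_on k f S"
  shows "Ck_on k g S"
  using assms
proof (induction k arbitrary: f g)
  case 0
  then show ?case using continuous_on_eq by simp
next
  case (Suc k)
  show ?case
  proof (rule Ck_on_SucI[where f' = "\<lambda>x. frechet_derivative f (at x)"])
    fix x assume x: "x \<in> S"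
    have "f differentiable at x"
      using Suc.prems x by (auto simp: differentiable_on_eq_differentiable_at)
    then have "(f has_derivative frechet_derivative f (at x)) (at x)"
      using frechet_derivative_works by blast
    then show "(g has_derivative frechet_derivative f (at x)) (at x)"
      using has_derivative_transform_within_open[OF _ Suc.prems(1) x] Suc.prems(2) by blast
  qed (use Suc in auto)
qed

lemmas Ck_on_SucI' = Ck_on_SucI[OF _ _ _ Ck_on_cong_imp]

lemma Ck_on_Suc_has_derivative:
  assumes "open S" "Ck_on (Suc k) f S" "x \<in> S"
  shows "(f has_derivative frechet_derivative f (at x)) (at x)"
  using assms by (simp add: differentiable_on_eq_differentiable_at frechet_derivative_works)

lemma Ck_on_SucD: "Ck_on (Suc k) f S \<Longrightarrow> Ck_on k f S"
  by (induction k arbitrary: f) (auto intro: differentiable_imp_continuous_on)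

lemma Ck_on_const [simp]: "open S \<Longrightarrow> Ck_on k (\<lambda>_. c) S"
proof (induction k arbitrary: c)
  case (Suc k)
  show ?case
    by (rule Ck_on_SucI'[where f' = "\<lambda>_ _. 0"]) (use Suc in auto)
qed auto

lemma Ck_on_add:
  assumes "open S" "Ck_on k f S" "Ck_on k g S"
  shows "Ck_on k (\<lambda>x. f x + g x) S"
  using assms
proof (induction k arbitrary: f g)
  case (Suc k)
  show ?case
    by (rule Ck_on_SucI'[where f' = "\<lambda>x v. frechet_derivative f (at x) v + frechet_derivative g (at x) v"])
      (use Suc in \<open>auto intro!: has_derivative_add Ck_on_Suc_has_derivative[of S k]\<close>)
qed (auto intro: continuous_on_add)

lemma Ck_on_bilinear:
  assumes bl: "bounded_bilinear pr" and S: "open S" "Ck_on k f S" "Ck_on k g S"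
  shows "Ck_on k (\<lambda>x. pr (f x) (g x)) S"
  using S
proof (induction k arbitrary: f g)
  case 0
  then show ?case using bounded_bilinear.continuous_on[OF bl] by simp
next
  case (Suc k)
  show ?case
  proof (rule Ck_on_SucI'[where f' = "\<lambda>x v. pr (f x) (frechet_derivative g (at x) v)
        + pr (frechet_derivative f (at x) v) (g x)"])
    show "((\<lambda>x. pr (f x) (g x)) has_derivative (\<lambda>v. pr (f x) (frechet_derivative g (at x) v)
        + pr (frechet_derivative f (at x) v) (g x))) (at x)" if "x \<in> S" for x
      by (rule bounded_bilinear.FDERIV[OF bl])
        (use Suc.prems Ck_on_Suc_has_derivative that in \<open>blast+\<close>)
    show "Ck_on k (\<lambda>x. pr (f x) (frechet_derivative g (at x) v)
        + pr (frechet_derivative f (at x) v) (g x)) S" for v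
      using Suc.prems Ck_on_SucD[OF Suc.prems(2)] Ck_on_SucD[OF Suc.prems(3)]
      by (intro Ck_on_add Suc.IH) auto
  qed (use Suc in auto)
qed

lemma Ck_on_linear_comp:
  assumes L: "bounded_linear L" and S: "open S" "Ck_on k f S"
  shows "Ck_on k (\<lambda>x. L (f x)) S"
  using S
proof (induction k arbitrary: f)
  case 0
  then show ?case using bounded_linear.continuous_on[OF L] by simp
next
  case (Suc k)
  show ?case
    by (rule Ck_on_SucI'[where f' = "\<lambda>x v. L (frechet_derivative f (at x) v)"])
      (use Suc in \<open>auto intro!: bounded_linear.has_derivative[OF L] Ck_on_Suc_has_derivative[of S k]\<close>)
qed

text \<open>An operator on functions, so that higher derivatives are the iterates
  \<open>vd ^^ k\<close>. Where the function is not differentiable the value is arbitrary, which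
  confines identities between iterates to open sets.\<close>

definition vd :: "(real \<Rightarrow> 'b::real_normed_vector) \<Rightarrow> real \<Rightarrow> 'b" where
  "vd f = (\<lambda>x. vector_derivative f (at x))"

lemma vdI: "(f has_vector_derivative d) (at x) \<Longrightarrow> vd f x = d"
  by (simp add: vd_def vector_derivative_at)

lemma frechet_derivative_vd:
  assumes "f differentiable at x"
  shows "frechet_derivative f (at x) v = v *\<^sub>R vd f x"
  using assms frechet_derivative_at[of f "\<lambda>v. v *\<^sub>R vd f x" x]
  by (metis vd_def vector_derivative_works has_vector_derivative_def)

lemma Ck_on_Suc_real:
  fixes f :: "real \<Rightarrow> 'b::real_normed_vector"
  assumes "open S"
  shows "Ck_on (Suc k) f S \<longleftrightarrow>
    (\<forall>x\<in>S. (f has_vector_derivative vd f x) (at x)) \<and> Ck_on k (vd f) S"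
proof
  assume *: "Ck_on (Suc k) f S"
  then have d: "f differentiable at x" if "x \<in> S" for x
    using assms that by (auto simp: differentiable_on_eq_differentiable_at)
  have "Ck_on k (\<lambda>x. frechet_derivative f (at x) 1) S"
    using * by simp
  then have "Ck_on k (vd f) S"
    by (rule Ck_on_cong_imp[OF assms, rotated]) (simp add: frechet_derivative_vd d)
  then show "(\<forall>x\<in>S. (f has_vector_derivative vd f x) (at x)) \<and> Ck_on k (vd f) S"
    using d by (simp add: vd_def vector_derivative_works)
next
  assume *: "(\<forall>x\<in>S. (f has_vector_derivative vd f x) (at x)) \<and> Ck_on k (vd f) S"
  show "Ck_on (Suc k) f S"
  proof (rule Ck_on_SucI'[where f' = "\<lambda>x v. v *\<^sub>R vd f x"])
    show "Ck_on k (\<lambda>x. v *\<^sub>R vd f x) S" for v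
      using * assms Ck_on_linear_comp[OF bounded_linear_scaleR_right] by blast
  qed (use * assms in \<open>auto simp: has_vector_derivative_def\<close>)
qed

lemma Ck_on_compose_real:
  fixes \<phi> :: "'a::euclidean_space \<Rightarrow> real" and u :: "real \<Rightarrow> 'b::real_normed_vector"
  assumes "open S" "open T" "\<And>x. x \<in> S \<Longrightarrow> \<phi> x \<in> T" "Ck_on k u T" "Ck_on k \<phi> S"
  shows "Ck_on k (\<lambda>x. u (\<phi> x)) S"
  using assms
proof (induction k arbitrary: u)
  case 0
  then show ?case
    using continuous_on_compose2[of T u S \<phi>] by auto
next
  case (Suc k)
  show ?case
  proof (rule Ck_on_SucI'[where f' = "\<lambda>x v. frechet_derivative \<phi> (at x) v *\<^sub>R vd u (\<phi> x)"])
    fix x assume x: "x \<in> S"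
    then have "(u has_derivative (\<lambda>v. v *\<^sub>R vd u (\<phi> x))) (at (\<phi> x))"
      using Suc.prems by (auto simp: Ck_on_Suc_real has_vector_derivative_def simp del: Ck_on.simps)
    then show "((\<lambda>x. u (\<phi> x)) has_derivative (\<lambda>v. frechet_derivative \<phi> (at x) v *\<^sub>R vd u (\<phi> x))) (at x)"
      using Ck_on_Suc_has_derivative[OF Suc.prems(1,5) x] by (rule has_derivative_compose[rotated])
  next
    fix v
    have "Ck_on k (\<lambda>x. vd u (\<phi> x)) S"
      using Suc.prems Ck_on_SucD[OF Suc.prems(5)]
      by (intro Suc.IH) (auto simp: Ck_on_Suc_real simp del: Ck_on.simps)
    then show "Ck_on k (\<lambda>x. frechet_derivative \<phi> (at x) v *\<^sub>R vd u (\<phi> x)) S"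
      using Suc.prems by (intro Ck_on_bilinear[OF bounded_bilinear_scaleR]) auto
  qed (use Suc in auto)
qed

text \<open>Covers the two kinds of curves to which functions on the punctured space are restricted
  later: circles, with \<open>\<phi>\<close> and \<open>\<psi>\<close> multiples of cosine and sine,
  and rays.\<close>

lemma Ck_on_compose_curve:
  fixes f :: "'a::euclidean_space \<Rightarrow> 'b::real_normed_vector" and \<phi> \<psi> :: "real \<Rightarrow> real"
  assumes "open S" "open T" "\<And>t. t \<in> T \<Longrightarrow> \<phi> t *\<^sub>R a + \<psi> t *\<^sub>R b + c \<in> S"
    "Ck_on k f S" "Ck_on k \<phi> T" "Ck_on k \<psi> T"
  shows "Ck_on k (\<lambda>t. f (\<phi> t *\<^sub>R a + \<psi> t *\<^sub>R b + c)) T"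
  using assms
proof (induction k arbitrary: f)
  case 0
  have "continuous_on T (\<lambda>t. \<phi> t *\<^sub>R a + \<psi> t *\<^sub>R b + c)"
    using 0 by (auto intro!: continuous_intros)
  then show ?case
    using 0 continuous_on_compose2[of S f T] by auto
next
  case (Suc k)
  define \<gamma> where "\<gamma> t = \<phi> t *\<^sub>R a + \<psi> t *\<^sub>R b + c" for t
  show ?case
  proof (rule Ck_on_SucI'[where f' = "\<lambda>t v. v *\<^sub>R (vd \<phi> t *\<^sub>R frechet_derivative f (at (\<gamma> t)) a
        + vd \<psi> t *\<^sub>R frechet_derivative f (at (\<gamma> t)) b)"])
    fix t assume t: "t \<in> T"
    have \<gamma>: "(\<gamma> has_derivative (\<lambda>v. (v *\<^sub>R vd \<phi> t) *\<^sub>R a + (v *\<^sub>R vd \<psi> t) *\<^sub>R b + 0)) (at t)"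
      unfolding \<gamma>_def using Suc.prems t
      by (intro has_derivative_add has_derivative_const has_derivative_scaleR_left)
        (auto simp: Ck_on_Suc_real has_vector_derivative_def simp del: Ck_on.simps)
    have fd: "(f has_derivative frechet_derivative f (at (\<gamma> t))) (at (\<gamma> t))"
      by (rule Ck_on_Suc_has_derivative[OF Suc.prems(1,4)]) (use Suc.prems(3) t in \<open>simp add: \<gamma>_def\<close>)
    then have lin: "linear (frechet_derivative f (at (\<gamma> t)))"
      by (rule has_derivative_linear)
    have "((\<lambda>t. f (\<gamma> t)) has_derivative (\<lambda>v. frechet_derivative f (at (\<gamma> t))
        ((v *\<^sub>R vd \<phi> t) *\<^sub>R a + (v *\<^sub>R vd \<psi> t) *\<^sub>R b + 0))) (at t)"
      by (rule has_derivative_compose[OF \<gamma> fd])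
    then show "((\<lambda>t. f (\<phi> t *\<^sub>R a + \<psi> t *\<^sub>R b + c)) has_derivative
        (\<lambda>v. v *\<^sub>R (vd \<phi> t *\<^sub>R frechet_derivative f (at (\<gamma> t)) a
        + vd \<psi> t *\<^sub>R frechet_derivative f (at (\<gamma> t)) b))) (at t)"
      by (simp add: \<gamma>_def[symmetric] linear_add[OF lin] linear_scale[OF lin] scaleR_add_right)
  next
    fix v
    have *: "Ck_on k (\<lambda>t. frechet_derivative f (at (\<gamma> t)) w) T" for w
      unfolding \<gamma>_def using Suc.prems Ck_on_SucD[OF Suc.prems(5)] Ck_on_SucD[OF Suc.prems(6)]
      by (intro Suc.IH) auto
    show "Ck_on k (\<lambda>t. v *\<^sub>R (vd \<phi> t *\<^sub>R frechet_derivative f (at (\<gamma> t)) a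
        + vd \<psi> t *\<^sub>R frechet_derivative f (at (\<gamma> t)) b)) T"
      using Suc.prems *
      by (intro Ck_on_linear_comp[OF bounded_linear_scaleR_right, of T k _ v] Ck_on_add Ck_on_bilinear[OF bounded_bilinear_scaleR])
        (auto simp: Ck_on_Suc_real simp del: Ck_on.simps)
  qed (use Suc in auto)
qed

lemma smooth_on_cong_imp:
  "open S \<Longrightarrow> (\<And>x. x \<in> S \<Longrightarrow> f x = g x) \<Longrightarrow> smooth_on f S \<Longrightarrow> smooth_on g S"
  unfolding smooth_on_def using Ck_on_cong_imp by blast

lemma smooth_on_const [simp]: "open S \<Longrightarrow> smooth_on (\<lambda>_. c) S"
  by (simp add: smooth_on_def)

lemma smooth_on_add:
  "open S \<Longrightarrow> smooth_on f S \<Longrightarrow> smooth_on g S \<Longrightarrow> smooth_on (\<lambda>x. f x + g x) S"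
  by (simp add: smooth_on_def Ck_on_add)

lemma smooth_on_mult:
  fixes f g :: "'a::euclidean_space \<Rightarrow> 'b::real_normed_algebra"
  shows "open S \<Longrightarrow> smooth_on f S \<Longrightarrow> smooth_on g S \<Longrightarrow> smooth_on (\<lambda>x. f x * g x) S"
  by (simp add: smooth_on_def Ck_on_bilinear[OF bounded_bilinear_mult])

lemma smooth_on_linear_comp:
  "bounded_linear L \<Longrightarrow> open S \<Longrightarrow> smooth_on f S \<Longrightarrow> smooth_on (\<lambda>x. L (f x)) S"
  by (simp add: smooth_on_def Ck_on_linear_comp)

lemma smooth_on_uminus:
  "open S \<Longrightarrow> smooth_on f S \<Longrightarrow> smooth_on (\<lambda>x. - f x) S"
  by (rule smooth_on_linear_comp[OF bounded_linear_minus[OF bounded_linear_ident]])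

lemma smooth_on_diff:
  "open S \<Longrightarrow> smooth_on f S \<Longrightarrow> smooth_on g S \<Longrightarrow> smooth_on (\<lambda>x. f x - g x) S"
  using smooth_on_add[of S f "\<lambda>x. - g x"] by (simp add: smooth_on_uminus)

lemma smooth_on_cmult:
  fixes f :: "'a::euclidean_space \<Rightarrow> 'b::real_normed_algebra"
  shows "open S \<Longrightarrow> smooth_on f S \<Longrightarrow> smooth_on (\<lambda>x. c * f x) S"
  by (rule smooth_on_linear_comp[OF bounded_linear_mult_right])

lemma smooth_on_sum:
  "open S \<Longrightarrow> (\<And>i. i \<in> I \<Longrightarrow> smooth_on (f i) S) \<Longrightarrow> smooth_on (\<lambda>x. \<Sum>i\<in>I. f i x) S"
  by (induction I rule: infinite_finite_induct) (auto intro: smooth_on_add)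

lemma smooth_on_compose_real:
  fixes \<phi> :: "'a::euclidean_space \<Rightarrow> real" and u :: "real \<Rightarrow> 'b::real_normed_vector"
  assumes "open S" "open T" "\<And>x. x \<in> S \<Longrightarrow> \<phi> x \<in> T" "smooth_on u T" "smooth_on \<phi> S"
  shows "smooth_on (\<lambda>x. u (\<phi> x)) S"
  using assms Ck_on_compose_real[of S T \<phi> _ u] by (simp add: smooth_on_def)

lemma smooth_on_compose_curve:
  fixes f :: "'a::euclidean_space \<Rightarrow> 'b::real_normed_vector" and \<phi> \<psi> :: "real \<Rightarrow> real"
  assumes "open S" "open T" "\<And>t. t \<in> T \<Longrightarrow> \<phi> t *\<^sub>R a + \<psi> t *\<^sub>R b + c \<in> S"
    "smooth_on f S" "smooth_on \<phi> T" "smooth_on \<psi> T"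
  shows "smooth_on (\<lambda>t. f (\<phi> t *\<^sub>R a + \<psi> t *\<^sub>R b + c)) T"
  using assms Ck_on_compose_curve[of S T \<phi> a \<psi> b c _ f] by (simp add: smooth_on_def)

text \<open>A class of functions closed under directional derivatives consists of smooth functions.
  This suits families such as all \<open>line_int V\<close>, where no formula for a single member
  exhibits its smoothness.\<close>

lemma smooth_on_coinduct:
  fixes f :: "'a::euclidean_space \<Rightarrow> 'b::real_normed_vector"
  assumes "open S" "f \<in> X"
    and step: "\<And>g. g \<in> X \<Longrightarrow> \<exists>g'. (\<forall>x\<in>S. (g has_derivative g' x) (at x)) \<and> (\<forall>v. (\<lambda>x. g' x v) \<in> X)"
  shows "smooth_on f S"
proof -
  have "Ck_on k g S" if "g \<in> X" for k g
    using that
  proof (induction k arbitrary: g)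
    case 0
    obtain g' where "\<forall>x\<in>S. (g has_derivative g' x) (at x)"
      using step[OF 0] by blast
    then show ?case
      by (metis Ck_on.simps(1) assms(1) continuous_on_eq_continuous_at has_derivative_continuous)
  next
    case (Suc k)
    obtain g' where "\<forall>x\<in>S. (g has_derivative g' x) (at x)" "\<forall>v. (\<lambda>x. g' x v) \<in> X"
      using step[OF Suc.prems] by blast
    show ?case
      by (rule Ck_on_SucI'[where f' = g'])
        (use \<open>open S\<close> Suc.IH \<open>\<forall>v. (\<lambda>x. g' x v) \<in> X\<close> \<open>\<forall>x\<in>S. (g has_derivative g' x) (at x)\<close> in auto)
  qed
  then show ?thesis using assms(2) by (simp add: smooth_on_def)
qed

lemma smooth_on_linear:
  assumes "bounded_linear f" "open S" shows "smooth_on f S"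
proof (rule smooth_on_coinduct[where X = "insert f (range (\<lambda>c _. c))"])
  fix g assume "g \<in> insert f (range (\<lambda>c _. c))"
  then consider "g = f" | c where "g = (\<lambda>_. c)" by auto
  then show "\<exists>g'. (\<forall>x\<in>S. (g has_derivative g' x) (at x)) \<and> (\<forall>v. (\<lambda>x. g' x v) \<in> insert f (range (\<lambda>c _. c)))"
  proof cases
    case 1 then show ?thesis
      using assms(1) bounded_linear_imp_has_derivative by (intro exI[of _ "\<lambda>_. f"]) auto
  next
    case 2 then show ?thesis
      by (intro exI[of _ "\<lambda>_ _. 0"]) auto
  qed
qed (use assms in auto)

lemma smooth_on_inner_left: "open S \<Longrightarrow> smooth_on (\<lambda>x. x \<bullet> a) S"
  by (intro smooth_on_linear bounded_linear_inner_left)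

lemma smooth_on_norm_sq: "open S \<Longrightarrow> smooth_on (\<lambda>x::'a::euclidean_space. x \<bullet> x) S"
  unfolding smooth_on_def
  by (auto intro!: Ck_on_bilinear[OF bounded_bilinear_inner]
      simp: smooth_on_linear[OF bounded_linear_ident, unfolded smooth_on_def])

lemma smooth_on_real_coinduct:
  fixes f :: "real \<Rightarrow> 'b::real_normed_vector"
  assumes "open S" "f \<in> X"
    and step: "\<And>g. g \<in> X \<Longrightarrow> \<exists>g'\<in>X. \<forall>x\<in>S. (g has_vector_derivative g' x) (at x)"
    and scale: "\<And>g c. g \<in> X \<Longrightarrow> (\<lambda>x. c *\<^sub>R g x) \<in> X"
  shows "smooth_on f S"
proof (rule smooth_on_coinduct[of S f X])
  fix g assume "g \<in> X"
  then obtain g' where "g' \<in> X" "\<forall>x\<in>S. (g has_vector_derivative g' x) (at x)"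
    using step by blast
  then show "\<exists>g'. (\<forall>x\<in>S. (g has_derivative g' x) (at x)) \<and> (\<forall>v. (\<lambda>x. g' x v) \<in> X)"
    using scale by (intro exI[of _ "\<lambda>x v. v *\<^sub>R g' x"]) (auto simp: has_vector_derivative_def)
qed (use assms in auto)

lemma smooth_on_vd:
  fixes f :: "real \<Rightarrow> 'b::real_normed_vector"
  assumes "open S" "smooth_on f S"
  shows "smooth_on (vd f) S"
  using assms Ck_on_Suc_real[OF assms(1)] unfolding smooth_on_def by blast

lemma smooth_on_has_vd:
  fixes f :: "real \<Rightarrow> 'b::real_normed_vector"
  assumes "smooth_on f S" "open S" "x \<in> S"
  shows "(f has_vector_derivative vd f x) (at x)"
  using assms Ck_on_Suc_real[OF assms(2), of 0] unfolding smooth_on_def by blast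

lemma smooth_on_imp_continuous_on: "smooth_on f S \<Longrightarrow> continuous_on S f"
  unfolding smooth_on_def by (metis Ck_on.simps(1))

lemma smooth_on_vd_funpow:
  fixes f :: "real \<Rightarrow> 'b::real_normed_vector"
  assumes "open S" "smooth_on f S"
  shows "smooth_on ((vd ^^ k) f) S"
  using assms by (induction k) (auto intro: smooth_on_vd)

lemma smooth_on_real_vdI:
  fixes f :: "real \<Rightarrow> 'b::real_normed_vector"
  assumes "open S" "\<And>x. x \<in> S \<Longrightarrow> (f has_vector_derivative g x) (at x)" "smooth_on g S"
  shows "smooth_on f S"
proof -
  have "vd f x = g x" if "x \<in> S" for x
    using assms that vdI by blast
  then have "Ck_on (Suc k) f S" for k
    using assms Ck_on_cong_imp[OF assms(1), of g "vd f" k]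
    by (simp add: Ck_on_Suc_real smooth_on_def del: Ck_on.simps)
  then show ?thesis
    unfolding smooth_on_def using Ck_on_SucD by blast
qed

lemma vd_cong_open:
  assumes "open S" "x \<in> S" "\<And>y. y \<in> S \<Longrightarrow> f y = g y"
  shows "vd f x = vd g x"
proof -
  have "(f has_vector_derivative D) (at x) \<longleftrightarrow> (g has_vector_derivative D) (at x)" for D
    using has_vector_derivative_transform_within_open[of f D x S g]
      has_vector_derivative_transform_within_open[of g D x S f] assms by auto
  then show ?thesis
    unfolding vd_def vector_derivative_def by simp
qed

lemma vd_funpow_cong_open:
  assumes "open S" "x \<in> S" "\<And>y. y \<in> S \<Longrightarrow> f y = g y"
  shows "(vd ^^ k) f x = (vd ^^ k) g x"
  using assms(2)
proof (induction k arbitrary: x)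
  case (Suc k)
  then show ?case using vd_cong_open[OF assms(1) Suc.prems, of "(vd ^^ k) f" "(vd ^^ k) g"] by simp
qed (use assms in auto)

text \<open>The derivative is a product of copies of the function itself, so the product rule alone
  raises the order by one. The square root below works in the same way, with the reciprocal already
  known to be smooth.\<close>

lemma smooth_on_inverse: "smooth_on (\<lambda>x::real. inverse x) {0<..}"
proof -
  have d: "(inverse has_vector_derivative - (inverse x * inverse x)) (at x)" if "x > 0" for x :: real
    unfolding has_real_derivative_iff_has_vector_derivative[symmetric] using that
    by (auto intro!: derivative_eq_intros)
  have "Ck_on k (inverse :: real \<Rightarrow> real) {0<..}" for k
  proof (induction k)
    case (Suc k)
    have "Ck_on k (\<lambda>x::real. - (inverse x * inverse x)) {0<..}"
      using Ck_on_linear_comp[OF bounded_linear_minus[OF bounded_linear_ident] _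
          Ck_on_bilinear[OF bounded_bilinear_mult _ Suc Suc]] by simp
    then have "Ck_on k (vd inverse :: real \<Rightarrow> real) {0<..}"
      by (rule Ck_on_cong_imp[rotated 2]) (simp_all add: vdI[OF d])
    then show ?case
      using d vdI[OF d] by (simp add: Ck_on_Suc_real del: Ck_on.simps)
  qed (auto intro!: continuous_intros)
  then show ?thesis by (simp add: smooth_on_def)
qed

lemma smooth_on_sqrt: "smooth_on sqrt {0<..}"
proof -
  have d: "(sqrt has_vector_derivative (1/2) * (sqrt x * inverse x)) (at x)" if "x > 0" for x :: real
    unfolding has_real_derivative_iff_has_vector_derivative[symmetric] using that
    by (auto intro!: derivative_eq_intros simp: field_simps)
  have "Ck_on k sqrt {0<..}" for k
  proof (induction k)
    case (Suc k)
    have "Ck_on k (inverse :: real \<Rightarrow> real) {0<..}"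
      using smooth_on_inverse by (simp add: smooth_on_def)
    then have "Ck_on k (\<lambda>x::real. (1/2) * (sqrt x * inverse x)) {0<..}"
      using Suc by (intro Ck_on_bilinear[OF bounded_bilinear_mult]) auto
    then have "Ck_on k (vd sqrt) {0<..}"
      by (rule Ck_on_cong_imp[rotated 2]) (simp_all add: vdI[OF d])
    moreover have "(sqrt has_vector_derivative vd sqrt x) (at x)" if "x > 0" for x
      by (simp only: vdI[OF d[OF that]] d[OF that])
    ultimately show ?case
      by (simp add: Ck_on_Suc_real del: Ck_on.simps)
  qed (auto intro!: continuous_intros)
  then show ?thesis by (simp add: smooth_on_def)
qed

lemma smooth_on_power:
  fixes f :: "'a::euclidean_space \<Rightarrow> 'b::real_normed_algebra_1"
  shows "open S \<Longrightarrow> smooth_on f S \<Longrightarrow> smooth_on (\<lambda>x. f x ^ k) S"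
  by (induction k) (auto intro: smooth_on_mult)

lemma smooth_on_of_real:
  "open S \<Longrightarrow> smooth_on f S \<Longrightarrow> smooth_on (\<lambda>x. complex_of_real (f x)) S"
  by (rule smooth_on_linear_comp[OF bounded_linear_of_real])

lemma smooth_on_ident: "open S \<Longrightarrow> smooth_on (\<lambda>x::real. x) S"
  by (rule smooth_on_linear[OF bounded_linear_ident])

subsection \<open>Half-order integrals and Abel inversion\<close>

lemma vd_cmult:
  fixes g :: "real \<Rightarrow> complex"
  assumes "open S" "smooth_on g S" "x \<in> S"
  shows "vd (\<lambda>x. c * g x) x = c * vd g x"
  by (intro vdI has_vector_derivative_mult_right smooth_on_has_vd[OF assms(2,1,3)])

lemma vd_funpow_cmult:
  fixes g :: "real \<Rightarrow> complex"
  assumes "open S" "smooth_on g S" "x \<in> S"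
  shows "(vd ^^ k) (\<lambda>x. c * g x) x = c * (vd ^^ k) g x"
  using assms(3)
proof (induction k arbitrary: x)
  case (Suc k)
  have "(vd ^^ Suc k) (\<lambda>x. c * g x) x = vd (\<lambda>x. c * (vd ^^ k) g x) x"
    using vd_cong_open[OF assms(1) Suc.prems, of "(vd ^^ k) (\<lambda>x. c * g x)"] Suc.IH by simp
  also have "\<dots> = c * vd ((vd ^^ k) g) x"
    by (rule vd_cmult[OF assms(1) smooth_on_vd_funpow[OF assms(1,2)] Suc.prems])
  finally show ?case by simp
qed simp

lemma vd_funpow_add:
  fixes f g :: "real \<Rightarrow> complex"
  assumes "open S" "smooth_on f S" "smooth_on g S" "x \<in> S"
  shows "(vd ^^ k) (\<lambda>x. f x + g x) x = (vd ^^ k) f x + (vd ^^ k) g x"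
  using assms(4)
proof (induction k arbitrary: x)
  case (Suc k)
  have "(vd ^^ Suc k) (\<lambda>x. f x + g x) x = vd (\<lambda>x. (vd ^^ k) f x + (vd ^^ k) g x) x"
    using vd_cong_open[OF assms(1) Suc.prems, of "(vd ^^ k) (\<lambda>x. f x + g x)"] Suc.IH by simp
  also have "\<dots> = vd ((vd ^^ k) f) x + vd ((vd ^^ k) g) x"
    by (intro vdI has_vector_derivative_add smooth_on_has_vd[OF _ assms(1) Suc.prems]
        smooth_on_vd_funpow assms)
  finally show ?case by simp
qed simp

text \<open>Leibniz rule for a factor whose second derivative vanishes. For \<open>k = 0\<close> the
  truncated index \<open>k - 1\<close> is harmless, its coefficient being 0.\<close>

lemma vd_funpow_times_id:
  fixes g :: "real \<Rightarrow> complex"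
  assumes "open S" "smooth_on g S" "t \<in> S"
  shows "(vd ^^ k) (\<lambda>t. of_real t * g t) t = of_real t * (vd ^^ k) g t + of_nat k * (vd ^^ (k - 1)) g t"
  using assms(3)
proof (induction k arbitrary: t)
  case (Suc k)
  have sm: "smooth_on ((vd ^^ j) g) S" for j
    using assms smooth_on_vd_funpow by blast
  have "(vd ^^ Suc k) (\<lambda>t. of_real t * g t) t
      = vd (\<lambda>t. of_real t * (vd ^^ k) g t + of_nat k * (vd ^^ (k - 1)) g t) t"
    using vd_cong_open[OF assms(1) Suc.prems, of "(vd ^^ k) (\<lambda>t. of_real t * g t)"] Suc.IH by simp
  also have "\<dots> = (of_real t * vd ((vd ^^ k) g) t + of_real 1 * (vd ^^ k) g t)
      + of_nat k * vd ((vd ^^ (k - 1)) g) t"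
    by (intro vdI has_vector_derivative_add has_vector_derivative_mult_right
        has_vector_derivative_mult has_vector_derivative_of_real
        smooth_on_has_vd[OF sm assms(1) Suc.prems]) (auto intro!: derivative_eq_intros)
  also have "of_nat k * vd ((vd ^^ (k - 1)) g) t = of_nat k * (vd ^^ k) g t"
    by (cases k) auto
  finally show ?case by (simp add: algebra_simps)
qed simp

lemma vd_compose:
  fixes u :: "real \<Rightarrow> 'b::real_normed_vector"
  assumes "open T" "smooth_on u T" "\<phi> x \<in> T" "(\<phi> has_real_derivative d) (at x)"
  shows "((\<lambda>x. u (\<phi> x)) has_vector_derivative d *\<^sub>R vd u (\<phi> x)) (at x)"
  using vector_diff_chain_at[of \<phi> d x u "vd u (\<phi> x)"] assms smooth_on_has_vd[OF assms(2,1,3)]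
  by (simp add: o_def has_real_derivative_iff_has_vector_derivative)

text \<open>Radial profiles, in the variable r or r^2. Values at nonpositive arguments are
  unconstrained, unlike in \<open>Cpos_plus\<close>, so identities between profiles are asserted for
  positive arguments; near 0 any growth is allowed.\<close>

definition fplus :: "(real \<Rightarrow> complex) set" where
  "fplus = {U. smooth_on U {0<..} \<and> (\<forall>\<^sub>F r in at_top. U r = 0)}"

lemma fplus_smooth: "U \<in> fplus \<Longrightarrow> smooth_on U {0<..}"
  by (simp add: fplus_def)

lemma fplus_bound:
  assumes "U \<in> fplus" obtains R where "R > 0" "\<And>x. x \<ge> R \<Longrightarrow> U x = 0"
proof -
  obtain R where "\<And>x. x \<ge> R \<Longrightarrow> U x = 0"
    using assms by (auto simp: fplus_def eventually_at_top_linorder)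
  then have "\<And>x. x \<ge> max R 1 \<Longrightarrow> U x = 0" by simp
  then show ?thesis using that[of "max R 1"] by simp
qed

lemma fplusI: "smooth_on U {0<..} \<Longrightarrow> (\<And>x. x \<ge> R \<Longrightarrow> U x = 0) \<Longrightarrow> U \<in> fplus"
  by (auto simp: fplus_def eventually_at_top_linorder)

lemma fplus_has_vd: "U \<in> fplus \<Longrightarrow> x > 0 \<Longrightarrow> (U has_vector_derivative vd U x) (at x)"
  using smooth_on_has_vd[OF fplus_smooth] by auto

lemma fplus_continuous: "U \<in> fplus \<Longrightarrow> A \<subseteq> {0<..} \<Longrightarrow> continuous_on A U"
  using smooth_on_imp_continuous_on[OF fplus_smooth] continuous_on_subset by blast

lemma fplus_vd:
  assumes "U \<in> fplus" shows "vd U \<in> fplus"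
proof -
  obtain R where R: "R > 0" "\<And>x. x \<ge> R \<Longrightarrow> U x = 0" using fplus_bound[OF assms] by blast
  have "vd U x = 0" if "x \<ge> R + 1" for x
    using vd_cong_open[of "{R<..}" x U "\<lambda>_. 0"] R that vdI[of "\<lambda>_. 0::complex" 0 x] by auto
  then show ?thesis
    using fplus_smooth[OF assms] by (intro fplusI) (auto intro: smooth_on_vd)
qed

lemma fplus_vd_funpow: "U \<in> fplus \<Longrightarrow> (vd ^^ k) U \<in> fplus"
  by (induction k) (auto intro: fplus_vd)

lemma fplus_cmult: "U \<in> fplus \<Longrightarrow> (\<lambda>x. c * U x) \<in> fplus"
  by (auto simp: fplus_def intro!: smooth_on_cmult elim: eventually_mono)

lemma fplus_diff: "U \<in> fplus \<Longrightarrow> V \<in> fplus \<Longrightarrow> (\<lambda>x. U x - V x) \<in> fplus"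
  by (auto simp: fplus_def intro!: smooth_on_diff elim: eventually_elim2)

lemma fplus_smooth_mult: "smooth_on a {0<..} \<Longrightarrow> U \<in> fplus \<Longrightarrow> (\<lambda>x. a x * U x) \<in> fplus"
  by (auto simp: fplus_def intro!: smooth_on_mult elim: eventually_mono)

lemma fplus_compose:
  assumes "U \<in> fplus" "smooth_on \<phi> {0<..}" "\<And>x. x > 0 \<Longrightarrow> \<phi> x > 0" "filterlim \<phi> at_top at_top"
  shows "(\<lambda>x. U (\<phi> x)) \<in> fplus"
  using assms smooth_on_compose_real[of "{0<..}" "{0<..}" \<phi> U] filterlim_iff[of \<phi> at_top at_top]
  by (auto simp: fplus_def)

lemma fplus_compose_square: "U \<in> fplus \<Longrightarrow> (\<lambda>t. U (t\<^sup>2)) \<in> fplus"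
  by (rule fplus_compose)
    (auto intro!: smooth_on_power smooth_on_ident filterlim_pow_at_top filterlim_ident)

lemma fplus_compose_sqrt: "U \<in> fplus \<Longrightarrow> (\<lambda>t. U (sqrt t)) \<in> fplus"
  by (rule fplus_compose) (auto intro!: smooth_on_sqrt sqrt_at_top)

text \<open>A constant that vanishes for large arguments is 0. Hence antiderivatives within
  \<open>fplus\<close> are unique, and identities can be checked after differentiation, as in
  \<open>fplus_eqI\<close>.\<close>

lemma fplus_zero:
  assumes "U \<in> fplus" "\<And>x. x > 0 \<Longrightarrow> vd U x = 0" "x > 0" shows "U x = 0"
proof -
  obtain R where R: "R > 0" "\<And>x. x \<ge> R \<Longrightarrow> U x = 0" using fplus_bound[OF assms(1)] by blast
  obtain c where "\<And>x. x \<in> {0<..} \<Longrightarrow> U x = c"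
    using has_vector_derivative_zero_constant[of "{0<..}" U] assms(2) fplus_has_vd[OF assms(1)]
    by (metis convex_real_interval(3) greaterThan_iff has_vector_derivative_at_within)
  then have "U x = U (max x R)"
    using assms(3) by simp
  then show ?thesis using R by simp
qed

lemma fplus_eqI:
  assumes "U \<in> fplus" "V \<in> fplus" "\<And>x. x > 0 \<Longrightarrow> vd U x = vd V x" "x > 0"
  shows "U x = V x"
proof -
  have "U x - V x = 0"
  proof (rule fplus_zero[of "\<lambda>x. U x - V x" x])
    fix x :: real assume "x > 0"
    then show "vd (\<lambda>x. U x - V x) x = 0"
      using vdI[OF has_vector_derivative_diff[OF fplus_has_vd[OF assms(1)] fplus_has_vd[OF assms(2)]]] assms(3)
      by simp
  qed (use assms fplus_diff in auto)
  then show ?thesis by simp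
qed

section \<open>Integration from a point to infinity\<close>

lemma integral_atLeast_eq:
  fixes f :: "real \<Rightarrow> 'b::banach"
  assumes "\<And>x. x > b \<Longrightarrow> f x = 0"
  shows "integral {a..} f = integral {a..b} f"
proof -
  have "(\<lambda>x. if x \<in> {a..} then f x else 0) = (\<lambda>x. if x \<in> {a..b} then f x else 0)"
    using assms by auto
  then show ?thesis
    by (metis integral_restrict_UNIV)
qed

definition tail_int :: "(real \<Rightarrow> complex) \<Rightarrow> real \<Rightarrow> complex" where
  "tail_int U q = integral {q..} U"

lemma tail_int_has_vd:
  assumes "U \<in> fplus" "q > 0"
  shows "(tail_int U has_vector_derivative - U q) (at q)"
proof -
  obtain R where R: "R > 0" "\<And>x. x \<ge> R \<Longrightarrow> U x = 0" using fplus_bound[OF assms(1)] by blast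
  \<comment> \<open>Past \<open>c\<close> the function vanishes, and \<open>c\<close> exceeds q.
    Near q the integral to infinity is therefore the fixed integral from q/2 to \<open>c\<close>
    minus one with a variable upper end.\<close>
  define c where "c = max R (q + 1)"
  have cont: "continuous_on {q/2..c} U"
    using assms by (intro fplus_continuous[OF assms(1)]) auto
  have eq: "integral {q/2..c} U - integral {q/2..x} U = tail_int U x" if "x \<in> {q/2<..<c}" for x
  proof -
    have "integral {q/2..x} U + integral {x..c} U = integral {q/2..c} U"
      using that cont by (intro Henstock_Kurzweil_Integration.integral_combine integrable_continuous_interval) auto
    moreover have "tail_int U x = integral {x..c} U"
      unfolding tail_int_def by (rule integral_atLeast_eq) (use R in \<open>auto simp: c_def\<close>)
    ultimately show ?thesis by (simp add: algebra_simps)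
  qed
  have q: "q \<in> {q/2<..<c}" using assms by (auto simp: c_def)
  have "((\<lambda>x. integral {q/2..x} U) has_vector_derivative U q) (at q within {q/2..c})"
    using q by (intro integral_has_vector_derivative[OF cont]) auto
  then have "((\<lambda>x. integral {q/2..x} U) has_vector_derivative U q) (at q)"
    using q at_within_Icc_at[of "q/2" q c] by auto
  then have "((\<lambda>x. integral {q/2..c} U - integral {q/2..x} U) has_vector_derivative 0 - U q) (at q)"
    by (intro has_vector_derivative_diff has_vector_derivative_const)
  then have "(tail_int U has_vector_derivative 0 - U q) (at q)"
    by (rule has_vector_derivative_transform_within_open[where S = "{q/2<..<c}"]) (use eq q in auto)
  then show ?thesis by simp
qed

lemma vd_tail_int: "U \<in> fplus \<Longrightarrow> q > 0 \<Longrightarrow> vd (tail_int U) q = - U q"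
  by (simp add: tail_int_has_vd vdI)

lemma tail_int_fplus:
  assumes "U \<in> fplus" shows "tail_int U \<in> fplus"
proof -
  obtain R where R: "R > 0" "\<And>x. x \<ge> R \<Longrightarrow> U x = 0" using fplus_bound[OF assms] by blast
  have "tail_int U x = 0" if "x \<ge> R" for x
    unfolding tail_int_def using R that by (intro integral_unique has_integral_is_0) auto
  moreover have "smooth_on (tail_int U) {0<..}"
    by (rule smooth_on_real_vdI[where g = "\<lambda>q. - U q"])
      (use tail_int_has_vd[OF assms] fplus_smooth[OF assms] in \<open>auto intro: smooth_on_uminus\<close>)
  ultimately show ?thesis by (intro fplusI)
qed

lemma tail_int_vd:
  assumes "U \<in> fplus" "q > 0" shows "tail_int (vd U) q = - U q"
proof -
  have "tail_int (vd U) q = (\<lambda>x. (-1) * U x) q"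
  proof (rule fplus_eqI[OF _ _ _ assms(2)])
    show "vd (tail_int (vd U)) x = vd (\<lambda>x. (-1) * U x) x" if "x > 0" for x
      using vd_tail_int[OF fplus_vd[OF assms(1)] that] vd_cmult[OF _ fplus_smooth[OF assms(1)], of x "-1"] that by auto
  qed (auto intro!: tail_int_fplus fplus_vd fplus_cmult[of U "-1", simplified] assms)
  then show ?thesis by simp
qed

lemma tail_int_cong:
  "(\<And>x. x > 0 \<Longrightarrow> U x = V x) \<Longrightarrow> q > 0 \<Longrightarrow> tail_int U q = tail_int V q"
  unfolding tail_int_def by (rule Henstock_Kurzweil_Integration.integral_cong) auto

text \<open>The operator P of the overview. If q is the squared norm of the foot of the
  perpendicular, q + y^2 is the squared norm along a line, so this integrates a radial function over
  one perpendicular direction. Substituting p = q + y^2 gives the kernel (p - q)^(-1/2): up to the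
  factor sqrt pi this is the Weyl fractional integral of order 1/2.\<close>

definition line_int :: "(real \<Rightarrow> complex) \<Rightarrow> real \<Rightarrow> complex" where
  "line_int U q = (LBINT y. U (q + y\<^sup>2))"

lemma line_int_cong:
  "(\<And>x. x > 0 \<Longrightarrow> U x = V x) \<Longrightarrow> q > 0 \<Longrightarrow> line_int U q = line_int V q"
  unfolding line_int_def by (intro Bochner_Integration.integral_cong refl) (simp add: add_pos_nonneg)

lemma continuous_on_fplus_square:
  "U \<in> fplus \<Longrightarrow> q > 0 \<Longrightarrow> continuous_on A (\<lambda>y. U (q + y\<^sup>2))"
  by (rule continuous_on_compose2[OF fplus_continuous[of U "{0<..}"]])
    (auto intro!: continuous_intros simp: add_pos_nonneg)

text \<open>Supplies \<open>1 + b\<close> as a root-free radius beyond which y^2 is at least b; it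
  serves as the cut-off for integrals over y.\<close>

lemma square_ge: "b \<le> y\<^sup>2" if "b > 0" "\<bar>y\<bar> \<ge> 1 + b" for b y :: real
proof -
  have "b * 1 \<le> (1 + b) * (1 + b)" using that by (intro mult_mono) auto
  also have "\<dots> \<le> \<bar>y\<bar> * \<bar>y\<bar>" using that by (intro mult_mono) auto
  finally show ?thesis by (simp add: power2_eq_square)
qed

lemma line_int_eq_integral:
  assumes "U \<in> fplus" "q > 0" "R > 0" "\<And>x. x \<ge> R \<Longrightarrow> U x = 0"
  shows "line_int U q = integral {-(1 + R)..1 + R} (\<lambda>y. U (q + y\<^sup>2))"
    and "integrable lborel (\<lambda>y. U (q + y\<^sup>2))"
proof -
  have eq: "(\<lambda>y. U (q + y\<^sup>2)) = (\<lambda>y. indicator {-(1 + R)..1 + R} y *\<^sub>R U (q + y\<^sup>2))"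
  proof
    fix y
    show "U (q + y\<^sup>2) = indicator {-(1 + R)..1 + R} y *\<^sub>R U (q + y\<^sup>2)"
      using assms square_ge[of R y] by (auto simp: indicator_def)
  qed
  have int: "set_integrable lborel {-(1 + R)..1 + R} (\<lambda>y. U (q + y\<^sup>2))"
    by (rule borel_integrable_atLeastAtMost') (rule continuous_on_fplus_square[OF assms(1,2)])
  show "line_int U q = integral {-(1 + R)..1 + R} (\<lambda>y. U (q + y\<^sup>2))"
    unfolding line_int_def set_borel_integral_eq_integral(2)[OF int, symmetric] set_lebesgue_integral_def
    by (subst eq) simp
  show "integrable lborel (\<lambda>y. U (q + y\<^sup>2))"
    using int unfolding set_integrable_def by (subst eq)
qed

lemma line_int_has_vd:
  assumes "U \<in> fplus" "q > 0"
  shows "(line_int U has_vector_derivative line_int (vd U) q) (at q)"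
proof -
  obtain R where R: "R > 0" "\<And>x. x \<ge> R \<Longrightarrow> U x = 0" using fplus_bound[OF assms(1)] by blast
  obtain R' where R': "R' > 0" "\<And>x. x \<ge> R' \<Longrightarrow> vd U x = 0" using fplus_bound[OF fplus_vd[OF assms(1)]] by blast
  \<comment> \<open>One cut-off for both U and its derivative, so that the integral over a fixed
    compact interval can be differentiated in the parameter.\<close>
  define c where "c = max R R'"
  have c: "c > 0" "\<And>x. x \<ge> c \<Longrightarrow> U x = 0" "\<And>x. x \<ge> c \<Longrightarrow> vd U x = 0"
    using R R' by (auto simp: c_def)
  have "((\<lambda>q. integral (cbox (-(1 + c)) (1 + c)) (\<lambda>y. U (q + y\<^sup>2))) has_vector_derivative
      integral (cbox (-(1 + c)) (1 + c)) (\<lambda>y. vd U (q + y\<^sup>2))) (at q within {0<..})"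
  proof (rule leibniz_rule_vector_derivative)
    fix x t :: real assume "x \<in> {0<..}"
    then have "((\<lambda>x. U (x + t\<^sup>2)) has_vector_derivative 1 *\<^sub>R vd U (x + t\<^sup>2)) (at x)"
      by (intro vd_compose[of "{0<..}"] fplus_smooth[OF assms(1)])
        (auto intro!: derivative_eq_intros simp: add_pos_nonneg)
    then show "((\<lambda>x. U (x + t\<^sup>2)) has_vector_derivative vd U (x + t\<^sup>2)) (at x within {0<..})"
      by (simp add: has_vector_derivative_at_within)
  next
    fix x :: real assume "x \<in> {0<..}"
    then show "(\<lambda>y. U (x + y\<^sup>2)) integrable_on cbox (- (1 + c)) (1 + c)"
      by (intro integrable_continuous continuous_on_fplus_square[OF assms(1)]) auto
  next
    show "continuous_on ({0<..} \<times> cbox (- (1 + c)) (1 + c)) (\<lambda>(x, t). vd U (x + t\<^sup>2))"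
      unfolding split_beta
      by (rule continuous_on_compose2[OF fplus_continuous[OF fplus_vd[OF assms(1)], of "{0<..}"]])
        (auto intro!: continuous_intros simp: add_pos_nonneg)
  qed (use assms in auto)
  then have *: "((\<lambda>q. integral (cbox (-(1 + c)) (1 + c)) (\<lambda>y. U (q + y\<^sup>2))) has_vector_derivative
      line_int (vd U) q) (at q)"
    using assms line_int_eq_integral(1)[OF fplus_vd[OF assms(1)] assms(2) c(1,3)]
    by (simp add: at_within_open[of q "{0<..}"])
  show ?thesis
    by (rule has_vector_derivative_transform_within_open[OF *, of "{0<..}"])
      (use assms line_int_eq_integral(1)[OF assms(1) _ c(1,2)] in auto)
qed

lemma vd_line_int: "U \<in> fplus \<Longrightarrow> q > 0 \<Longrightarrow> vd (line_int U) q = line_int (vd U) q"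
  by (simp add: line_int_has_vd vdI)

lemma line_int_fplus:
  assumes "U \<in> fplus" shows "line_int U \<in> fplus"
proof -
  obtain R where R: "R > 0" "\<And>x. x \<ge> R \<Longrightarrow> U x = 0" using fplus_bound[OF assms] by blast
  have "line_int U x = 0" if "x \<ge> R" for x
    unfolding line_int_def using R that by (auto intro!: integral_eq_zero_AE simp: add_increasing2)
  moreover have "smooth_on (line_int U) {0<..}"
  \<comment> \<open>The derivative falls on the integrand, hence the image of \<open>fplus\<close>
    under \<open>line_int\<close> is closed under differentiation.\<close>
  proof (rule smooth_on_real_coinduct[where X = "line_int ` fplus"])
    fix g assume "g \<in> line_int ` fplus"
    then show "\<exists>g'\<in>line_int ` fplus. \<forall>x\<in>{0<..}. (g has_vector_derivative g' x) (at x)"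
      using line_int_has_vd fplus_vd by auto
  next
    fix g and c :: real assume "g \<in> line_int ` fplus"
    then obtain V where V: "V \<in> fplus" "g = line_int V" by auto
    then have "(\<lambda>x. c *\<^sub>R g x) = line_int (\<lambda>x. complex_of_real c * V x)"
      by (auto simp: line_int_def scaleR_conv_of_real)
    then show "(\<lambda>x. c *\<^sub>R g x) \<in> line_int ` fplus"
      using fplus_cmult[OF V(1)] by auto
  qed (use assms in auto)
  ultimately show ?thesis by (intro fplusI)
qed

lemma line_int_funpow_fplus: "U \<in> fplus \<Longrightarrow> (line_int ^^ k) U \<in> fplus"
  by (induction k) (auto intro: line_int_fplus)

lemma tail_int_funpow_fplus: "U \<in> fplus \<Longrightarrow> (tail_int ^^ k) U \<in> fplus"
  by (induction k) (auto intro: tail_int_fplus)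

lemma line_int_funpow_cong:
  "(\<And>x. x > 0 \<Longrightarrow> U x = V x) \<Longrightarrow> q > 0 \<Longrightarrow> (line_int ^^ k) U q = (line_int ^^ k) V q"
  by (induction k arbitrary: q) (auto intro: line_int_cong)

lemma tail_int_funpow_cong:
  "(\<And>x. x > 0 \<Longrightarrow> U x = V x) \<Longrightarrow> q > 0 \<Longrightarrow> (tail_int ^^ k) U q = (tail_int ^^ k) V q"
  by (induction k arbitrary: q) (auto intro: tail_int_cong)

lemma vd_line_int_funpow:
  assumes "U \<in> fplus" "q > 0" shows "vd ((line_int ^^ k) U) q = (line_int ^^ k) (vd U) q"
  using assms(2)
proof (induction k arbitrary: q)
  case (Suc k)
  then show ?case
    using vd_line_int[OF line_int_funpow_fplus[OF assms(1)] Suc.prems]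
      line_int_cong[OF Suc.IH Suc.prems] by simp
qed simp

lemma line_int_cmult: "line_int (\<lambda>x. c * U x) = (\<lambda>q. c * line_int U q)"
  by (simp add: line_int_def fun_eq_iff)

lemma tail_int_cmult: "tail_int (\<lambda>x. c * U x) = (\<lambda>q. c * tail_int U q)"
  by (simp add: tail_int_def fun_eq_iff)

lemma line_int_funpow_cmult: "(line_int ^^ k) (\<lambda>x. c * U x) = (\<lambda>q. c * (line_int ^^ k) U q)"
  by (induction k) (simp_all add: line_int_cmult)

lemma tail_int_funpow_cmult: "(tail_int ^^ k) (\<lambda>x. c * U x) = (\<lambda>q. c * (tail_int ^^ k) U q)"
  by (induction k) (simp_all add: tail_int_cmult)

text \<open>A disc has area pi times its squared radius, so the squared norm of a point of the plane
  has the constant density pi on the half-line. The sign is there because the two measures are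
  compared on upper half-lines, which have finite measure only for the negated variable.\<close>

lemma distr_neg_norm_square:
  "distr lborel borel (\<lambda>p::real \<times> real. - (norm p)\<^sup>2)
    = density lborel (\<lambda>s. ennreal (pi * indicator {..0} s))"
proof (rule measure_eqI_lessThan)
  have l: "emeasure (distr lborel borel (\<lambda>p::real \<times> real. - (norm p)\<^sup>2)) {x<..} = ennreal (pi * max 0 (- x))" for x
  proof -
    have "{p::real \<times> real. x < - (norm p)\<^sup>2} = ball 0 (sqrt (max 0 (- x)))"
    proof -
      have "x < - (norm p)\<^sup>2 \<longleftrightarrow> norm p < sqrt (max 0 (- x))" for p :: "real \<times> real"
      proof -
        have "norm p < sqrt (max 0 (- x)) \<longleftrightarrow> (norm p)\<^sup>2 < max 0 (- x)"
          by (metis real_sqrt_less_iff real_sqrt_abs abs_norm_cancel)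
        moreover have "0 \<le> (norm p)\<^sup>2" by simp
        ultimately show ?thesis by linarith
      qed
      then show ?thesis by auto
    qed
    then have "emeasure (distr lborel borel (\<lambda>p::real \<times> real. - (norm p)\<^sup>2)) {x<..}
        = emeasure lborel (ball (0::real \<times> real) (sqrt (max 0 (- x))))"
      by (subst emeasure_distr) (auto simp: vimage_def)
    also have "\<dots> = ennreal (pi * max 0 (- x))"
      by (subst emeasure_ball) (simp_all add: unit_ball_vol_2)
    finally show ?thesis .
  qed
  then show "emeasure (distr lborel borel (\<lambda>p::real \<times> real. - (norm p)\<^sup>2)) {x<..} < \<infinity>" for x
    by simp
  fix x :: real
  have "emeasure (density lborel (\<lambda>s. ennreal (pi * indicator {..0} s))) {x<..}
      = (\<integral>\<^sup>+s. ennreal pi * indicator {x<..0} s \<partial>lborel)"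
    by (subst emeasure_density) (auto intro!: nn_integral_cong simp: indicator_def)
  also have "\<dots> = ennreal (pi * max 0 (- x))"
    by (simp add: nn_integral_cmult_indicator ennreal_mult'' max_def)
  finally show "emeasure (distr lborel borel (\<lambda>p::real \<times> real. - (norm p)\<^sup>2)) {x<..}
      = emeasure (density lborel (\<lambda>s. ennreal (pi * indicator {..0} s))) {x<..}"
    using l by simp
qed auto

text \<open>The two integrations form one over the plane, of a function of the squared norm, whose
  distribution is known from \<open>distr_neg_norm_square\<close>. In terms of fractional integrals:
  two steps of order 1/2 make one of order 1.\<close>

lemma line_int_line_int:
  assumes "U \<in> fplus" "q > 0"
  shows "line_int (line_int U) q = of_real pi * tail_int U q"
proof -
  obtain R where R: "R > 0" "\<And>x. x \<ge> R \<Longrightarrow> U x = 0" using fplus_bound[OF assms(1)] by blast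
  define F where "F p = U (q + (norm p)\<^sup>2)" for p :: "real \<times> real"
  define h where "h s = indicator {..0} s *\<^sub>R U (q - s)" for s
  have F_ind: "F = (\<lambda>p. indicator (cball 0 (1 + R)) p *\<^sub>R F p)"
  proof
    fix p
    show "F p = indicator (cball 0 (1 + R)) p *\<^sub>R F p"
      using square_ge[OF R(1), of "norm p"] R assms by (auto simp: F_def indicator_def)
  qed
  have "continuous_on (cball 0 (1 + R)) F"
    unfolding F_def
    by (rule continuous_on_compose2[OF fplus_continuous[OF assms(1), of "{0<..}"]])
      (use assms in \<open>auto intro!: continuous_intros simp: add_pos_nonneg\<close>)
  then have F_int: "integrable lborel F"
    by (subst F_ind) (intro borel_integrable_compact compact_cball)
  have h_meas: "h \<in> borel_measurable borel"
    unfolding h_def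
    by (rule borel_measurable_continuous_on_indicator)
      (auto intro!: continuous_on_compose2[OF fplus_continuous[OF assms(1), of "{0<..}"]] continuous_intros,
        use assms in linarith)
  have "line_int (line_int U) q = (LBINT z. LBINT y. F (z, y))"
    by (simp add: line_int_def F_def norm_prod_def add.assoc)
  also have "\<dots> = integral\<^sup>L (lborel \<Otimes>\<^sub>M lborel) F"
    by (rule lborel_pair.integral_fst') (simp add: lborel_prod F_int)
  also have "\<dots> = integral\<^sup>L lborel (\<lambda>p::real \<times> real. h (- (norm p)\<^sup>2))"
    by (simp add: lborel_prod h_def F_def[abs_def])
  also have "\<dots> = integral\<^sup>L (density lborel (\<lambda>s. ennreal (pi * indicator {..0} s))) h"
    by (subst distr_neg_norm_square[symmetric], subst integral_distr) (use h_meas in auto)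
  also have "\<dots> = (LBINT s. (pi * indicator {..0} s) *\<^sub>R h s)"
    by (rule integral_density) (use h_meas in auto)
  also have "\<dots> = of_real pi * (LBINT s. h s)"
    by (subst integral_mult_right_zero[symmetric], rule Bochner_Integration.integral_cong)
      (auto simp: h_def indicator_def scaleR_conv_of_real)
  also have "(LBINT s. h s) = (LBINT x. h (q + (-1) * x))"
    by (subst lborel_integral_real_affine[of "-1" _ q]) auto
  also have "\<dots> = (LBINT x:{q..max R q}. U x)"
    unfolding set_lebesgue_integral_def
    by (rule Bochner_Integration.integral_cong) (use R in \<open>auto simp: h_def indicator_def\<close>)
  also have "\<dots> = integral {q..max R q} U"
    by (rule set_borel_integral_eq_integral borel_integrable_atLeastAtMost' fplus_continuous assms)+
      (use assms in auto)
  also have "\<dots> = tail_int U q"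
    unfolding tail_int_def by (rule integral_atLeast_eq[symmetric]) (use R in auto)
  finally show ?thesis .
qed

lemma line_int_surj:
  assumes "H \<in> fplus" obtains X where "X \<in> fplus" "\<And>q. q > 0 \<Longrightarrow> line_int X q = H q"
proof
  \<comment> \<open>Another \<open>line_int\<close> turns this into minus the tail integral of the
    derivative of H, which is H.\<close>
  let ?X = "\<lambda>q. (- 1 / of_real pi) * line_int (vd H) q"
  show "?X \<in> fplus" by (intro fplus_cmult line_int_fplus fplus_vd assms)
  show "line_int ?X q = H q" if "q > 0" for q
    using line_int_line_int[OF fplus_vd[OF assms] that] tail_int_vd[OF assms that]
    by (subst line_int_cmult) simp
qed

lemma tail_int_surj:
  assumes "H \<in> fplus" obtains X where "X \<in> fplus" "\<And>q. q > 0 \<Longrightarrow> tail_int X q = H q"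
proof
  show "(\<lambda>q. (-1) * vd H q) \<in> fplus" by (intro fplus_cmult fplus_vd assms)
  show "tail_int (\<lambda>q. (-1) * vd H q) q = H q" if "q > 0" for q
    using tail_int_vd[OF assms that] by (simp add: tail_int_def)
qed

lemma line_int_funpow_surj:
  assumes "H \<in> fplus" shows "\<exists>X\<in>fplus. \<forall>q>0. (line_int ^^ k) X q = H q"
proof (induction k)
  case (Suc k)
  then obtain X where X: "X \<in> fplus" "\<forall>q>0. (line_int ^^ k) X q = H q" by blast
  obtain Y where Y: "Y \<in> fplus" "\<And>q. q > 0 \<Longrightarrow> line_int Y q = X q"
    using line_int_surj[OF X(1)] by blast
  then have "(line_int ^^ Suc k) Y q = H q" if "q > 0" for q
    using X(2) line_int_funpow_cong[OF Y(2) that, where k = k] that by (simp add: funpow_swap1)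
  then show ?case using Y(1) by blast
qed (use assms in auto)

lemma tail_int_funpow_surj:
  assumes "H \<in> fplus" shows "\<exists>X\<in>fplus. \<forall>q>0. (tail_int ^^ k) X q = H q"
proof (induction k)
  case (Suc k)
  then obtain X where X: "X \<in> fplus" "\<forall>q>0. (tail_int ^^ k) X q = H q" by blast
  obtain Y where Y: "Y \<in> fplus" "\<And>q. q > 0 \<Longrightarrow> tail_int Y q = X q"
    using tail_int_surj[OF X(1)] by blast
  then have "(tail_int ^^ Suc k) Y q = H q" if "q > 0" for q
    using X(2) tail_int_funpow_cong[OF Y(2) that, where k = k] that by (simp add: funpow_swap1)
  then show ?case using Y(1) by blast
qed (use assms in auto)

text \<open>With s = sqrt (r^2 + y^2) as variable this is the integral of (s^2 - r^2)^((j - 2) / 2)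
  w(s) over s > r, the Abel kernel of order j/2. Written in y the integrand is continuous even for j
  = 1.\<close>

definition abel_int :: "nat \<Rightarrow> (real \<Rightarrow> complex) \<Rightarrow> real \<Rightarrow> complex" where
  "abel_int j w r =
    integral {0..} (\<lambda>y. of_real (y ^ (j - 1) / sqrt (r\<^sup>2 + y\<^sup>2)) * w (sqrt (r\<^sup>2 + y\<^sup>2)))"

text \<open>Closed form of the sequence with the values pi and 2 pi at 1 and 2 and the recursion
  \<open>abel_const_rec\<close>. In \<open>abel_inversion\<close> each step of length two
  contributes 2 pi from \<open>vd_line_int_square\<close> and j from an integration by
  parts.\<close>

definition abel_const :: "nat \<Rightarrow> real" where
  "abel_const j = pi powr (real j / 2) * 2 ^ (j - 1) * Gamma (real j / 2)"

lemma abel_const_1: "abel_const 1 = pi"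
  by (simp add: abel_const_def Gamma_one_half_real powr_half_sqrt)

lemma abel_const_2: "abel_const 2 = 2 * pi"
  by (simp add: abel_const_def)

lemma abel_const_rec:
  assumes "j \<ge> 1" shows "abel_const (Suc (Suc j)) = 2 * pi * real j * abel_const j"
proof -
  have "Gamma (real j / 2 + 1) = real j / 2 * Gamma (real j / 2)"
    using assms by (intro Gamma_plus1) auto
  moreover have "real (Suc (Suc j)) / 2 = real j / 2 + 1" by simp
  moreover have "2 ^ (Suc (Suc j) - 1) = 4 * (2::real) ^ (j - 1)"
    using assms by (cases j) auto
  ultimately show ?thesis
    unfolding abel_const_def by (simp only: powr_add) (simp add: field_simps)
qed

lemma hyp_pos: "r > 0 \<Longrightarrow> sqrt (r\<^sup>2 + y\<^sup>2) > 0" for r y :: real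
  by (simp add: add_pos_nonneg)

lemma abel_int_cong:
  "(\<And>x. x > 0 \<Longrightarrow> w x = w' x) \<Longrightarrow> r > 0 \<Longrightarrow> abel_int j w r = abel_int j w' r"
  unfolding abel_int_def
  using hyp_pos by (intro Henstock_Kurzweil_Integration.integral_cong) metis

lemma abel_int_cmult: "abel_int j (\<lambda>x. c * w x) r = c * abel_int j w r"
  unfolding abel_int_def integral_mult_right[symmetric]
  by (rule Henstock_Kurzweil_Integration.integral_cong) simp

lemma hyp_ge: "R > 0 \<Longrightarrow> y > R \<Longrightarrow> sqrt (r\<^sup>2 + y\<^sup>2) \<ge> R" for R r y :: real
  using real_sqrt_le_mono[of "R\<^sup>2" "r\<^sup>2 + y\<^sup>2"] power_mono[of R y 2]
  by (simp add: add_increasing)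

lemma continuous_on_hyp:
  assumes "w \<in> fplus" "r > 0" shows "continuous_on A (\<lambda>y. w (sqrt (r\<^sup>2 + y\<^sup>2)))"
  by (rule continuous_on_compose2[OF fplus_continuous[OF assms(1), of "{0<..}"]])
    (use assms hyp_pos in \<open>auto intro!: continuous_intros\<close>)

lemma hyp_deriv:
  assumes "r > 0"
  shows "((\<lambda>y. sqrt (r\<^sup>2 + y\<^sup>2)) has_real_derivative y / sqrt (r\<^sup>2 + y\<^sup>2)) (at y)"
proof -
  have "((\<lambda>y. r\<^sup>2 + y\<^sup>2) has_real_derivative 2 * y) (at y)"
    by (auto intro!: derivative_eq_intros)
  from DERIV_chain2[OF DERIV_real_sqrt this] show ?thesis
    using assms by (simp add: add_pos_nonneg field_simps)
qed

lemma hyp_has_vd: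
  assumes "w \<in> fplus" "r > 0"
  shows "((\<lambda>y. w (sqrt (r\<^sup>2 + y\<^sup>2))) has_vector_derivative
    (y / sqrt (r\<^sup>2 + y\<^sup>2)) *\<^sub>R vd w (sqrt (r\<^sup>2 + y\<^sup>2))) (at y)"
  by (rule vd_compose[OF _ fplus_smooth[OF assms(1)] _ hyp_deriv[OF assms(2)]])
    (use hyp_pos[OF assms(2), of y] in auto)

lemma vd_square:
  assumes "U \<in> fplus" "t > 0"
  shows "vd (\<lambda>t. U (t\<^sup>2)) t = of_real (2 * t) * vd U (t\<^sup>2)"
proof -
  have "((\<lambda>t. t\<^sup>2) has_real_derivative 2 * t) (at t)"
    by (auto intro!: derivative_eq_intros)
  then show ?thesis
    using vdI[OF vd_compose[OF _ fplus_smooth[OF assms(1)], of "\<lambda>t. t\<^sup>2" t "2 * t"]] assms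
    by (simp add: scaleR_conv_of_real)
qed

text \<open>Two of the line integrations amount to pi times integration to infinity, which the
  derivative undoes; the inner function t^2 contributes 2 t.\<close>

lemma vd_line_int_square:
  assumes "U \<in> fplus" "t > 0"
  shows "vd (\<lambda>t. (line_int ^^ Suc (Suc j)) U (t\<^sup>2)) t
    = (- 2 * of_real pi) * (of_real t * (line_int ^^ j) U (t\<^sup>2))"
proof -
  have V: "(line_int ^^ j) U \<in> fplus" by (rule line_int_funpow_fplus[OF assms(1)])
  have "vd (\<lambda>t. (line_int ^^ Suc (Suc j)) U (t\<^sup>2)) t
      = vd (\<lambda>t. of_real pi * tail_int ((line_int ^^ j) U) (t\<^sup>2)) t"
    by (rule vd_cong_open[of "{0<..}"]) (use assms line_int_line_int[OF V] in auto)
  also have "\<dots> = of_real pi * (of_real (2 * t) * vd (tail_int ((line_int ^^ j) U)) (t\<^sup>2))"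
    using vd_cmult[OF _ fplus_smooth[OF fplus_compose_square[OF tail_int_fplus[OF V]]]]
      vd_square[OF tail_int_fplus[OF V]] assms by simp
  finally show ?thesis
    using assms by (simp add: vd_tail_int[OF V] algebra_simps)
qed

text \<open>
  Raising the order by two reduces to an integration by parts, so that only the classical
  Abel equation \<open>j = 1\<close> and the trivial case \<open>j = 2\<close> have to be solved.
\<close>

lemma abel_inversion:
  assumes "U \<in> fplus" "j \<ge> 1" "r > 0"
  shows "abel_int j ((vd ^^ j) (\<lambda>t. (line_int ^^ j) U (t\<^sup>2))) r
    = (-1) ^ j * of_real (abel_const j * r ^ (j - 1)) * U (r\<^sup>2)"
  using assms(2)
proof (induction j rule: induct_nat_012)
  case 1
  obtain R where R: "R > 0" "\<And>x. x \<ge> R \<Longrightarrow> line_int (vd U) x = 0"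
    using fplus_bound[OF line_int_fplus[OF fplus_vd[OF assms(1)]]] by blast
  have r2: "r\<^sup>2 > 0" using assms by simp
  let ?g = "\<lambda>y. line_int (vd U) (r\<^sup>2 + y\<^sup>2)"
  have cont: "continuous_on A ?g" for A
    by (rule continuous_on_fplus_square[OF line_int_fplus[OF fplus_vd[OF assms(1)]] r2])
  have "abel_int 1 (vd (\<lambda>t. line_int U (t\<^sup>2))) r
      = abel_int 1 (\<lambda>t. of_real (2 * t) * line_int (vd U) (t\<^sup>2)) r"
    by (rule abel_int_cong)
      (use assms vd_square[OF line_int_fplus] vd_line_int in auto)
  \<comment> \<open>The factor 2 t of the derivative cancels the root in the kernel. What remains is
    even in y, hence another application of \<open>line_int\<close>: the classical solution of
    Abel's equation.\<close>
  also have "\<dots> = integral {0..} (\<lambda>y. 2 * ?g y)"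
    unfolding abel_int_def
    by (rule Henstock_Kurzweil_Integration.integral_cong)
      (use hyp_pos[OF assms(3)] in \<open>auto simp: add_nonneg_nonneg less_imp_neq[symmetric]\<close>)
  also have "\<dots> = 2 * integral {0..1 + R} ?g"
    by (subst integral_atLeast_eq[of "1 + R"]) (use R square_ge[OF R(1)] in \<open>auto simp: add_increasing\<close>)
  also have "\<dots> = integral {-(1 + R)..1 + R} ?g"
  proof -
    have "integral {- (1 + R)..0} ?g = integral {0..1 + R} ?g"
      using Henstock_Kurzweil_Integration.integral_reflect_real[where f = ?g and a = 0 and b = "1 + R"] by simp
    moreover have "integral {- (1 + R)..0} ?g + integral {0..1 + R} ?g = integral {- (1 + R)..1 + R} ?g"
      using R by (intro Henstock_Kurzweil_Integration.integral_combine integrable_continuous_interval cont) auto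
    ultimately show ?thesis by simp
  qed
  also have "\<dots> = line_int (line_int (vd U)) (r\<^sup>2)"
    by (rule line_int_eq_integral(1)[OF line_int_fplus[OF fplus_vd[OF assms(1)]] r2 R, symmetric])
  also have "\<dots> = - of_real pi * U (r\<^sup>2)"
    using line_int_line_int[OF fplus_vd[OF assms(1)] r2] tail_int_vd[OF assms(1) r2] by simp
  finally show ?case using abel_const_1 by simp
next
  case (ge2 j)
  define W where "W t = (line_int ^^ j) U (t\<^sup>2)" for t
  define h where "h = (vd ^^ j) W"
  have W: "W \<in> fplus"
    unfolding W_def using fplus_compose_square[OF line_int_funpow_fplus[OF assms(1)]] .
  have h: "h \<in> fplus" "vd h \<in> fplus"
    unfolding h_def using fplus_vd_funpow[OF W] fplus_vd by auto
  obtain R where R: "R > 0" "\<And>x. x \<ge> R \<Longrightarrow> h x = 0" using fplus_bound[OF h(1)] by blast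
  obtain R' where R': "R' > 0" "\<And>x. x \<ge> R' \<Longrightarrow> vd h x = 0" using fplus_bound[OF h(2)] by blast
  define c where "c = 1 + max R R'"
  have c: "c > 0" "h (sqrt (r\<^sup>2 + y\<^sup>2)) = 0" "vd h (sqrt (r\<^sup>2 + y\<^sup>2)) = 0" if "y \<ge> c" for y
  proof -
    show "c > 0" using R by (simp add: c_def)
    have "y > max R R'" using that unfolding c_def by linarith
    then have "sqrt (r\<^sup>2 + y\<^sup>2) \<ge> max R R'" using R by (intro hyp_ge) auto
    then show "h (sqrt (r\<^sup>2 + y\<^sup>2)) = 0" "vd h (sqrt (r\<^sup>2 + y\<^sup>2)) = 0" using R R' by auto
  qed
  let ?s = "\<lambda>y. sqrt (r\<^sup>2 + y\<^sup>2)"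
  have s0: "?s y > 0" "?s y \<noteq> 0" "(?s y)\<^sup>2 = r\<^sup>2 + y\<^sup>2" for y
    using hyp_pos[OF assms(3), of y] by (auto simp: add_nonneg_nonneg)
  have vdW: "(vd ^^ Suc (Suc j)) (\<lambda>t. (line_int ^^ Suc (Suc j)) U (t\<^sup>2)) x
      = (- 2 * of_real pi) * (of_real x * vd h x + of_nat (Suc j) * h x)" if "x > 0" for x
  proof -
    have "(vd ^^ Suc (Suc j)) (\<lambda>t. (line_int ^^ Suc (Suc j)) U (t\<^sup>2)) x
        = (vd ^^ Suc j) (vd (\<lambda>t. (line_int ^^ Suc (Suc j)) U (t\<^sup>2))) x"
      by (simp add: funpow_swap1)
    also have "\<dots> = (vd ^^ Suc j) (\<lambda>t. (- 2 * of_real pi) * (of_real t * W t)) x"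
      by (rule vd_funpow_cong_open[of "{0<..}"])
        (use that vd_line_int_square[OF assms(1), of _ j] in \<open>auto simp: W_def\<close>)
    also have "\<dots> = (- 2 * of_real pi) * (vd ^^ Suc j) (\<lambda>t. of_real t * W t) x"
      by (rule vd_funpow_cmult[of "{0<..}"])
        (use that fplus_smooth[OF W] in \<open>auto intro!: smooth_on_mult smooth_on_of_real smooth_on_ident\<close>)
    also have "(vd ^^ Suc j) (\<lambda>t. of_real t * W t) x = of_real x * vd h x + of_nat (Suc j) * h x"
      using vd_funpow_times_id[of "{0<..}" W x "Suc j"] that fplus_smooth[OF W] by (simp add: h_def)
    finally show ?thesis .
  qed
  let ?G = "\<lambda>y. of_real (y ^ Suc j / ?s y) * (of_real (?s y) * vd h (?s y) + of_nat (Suc j) * h (?s y))"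
  have "abel_int (Suc (Suc j)) ((vd ^^ Suc (Suc j)) (\<lambda>t. (line_int ^^ Suc (Suc j)) U (t\<^sup>2))) r
      = abel_int (Suc (Suc j)) (\<lambda>x. (- 2 * of_real pi) * (of_real x * vd h x + of_nat (Suc j) * h x)) r"
    by (rule abel_int_cong[OF vdW assms(3)])
  also have "\<dots> = (- 2 * of_real pi) * integral {0..} ?G"
    by (subst abel_int_cmult) (simp add: abel_int_def)
  also have "integral {0..} ?G = integral {0..c} ?G"
    by (rule integral_atLeast_eq) (use c in auto)
  finally have A: "abel_int (Suc (Suc j)) ((vd ^^ Suc (Suc j)) (\<lambda>t. (line_int ^^ Suc (Suc j)) U (t\<^sup>2))) r
      = (- 2 * of_real pi) * integral {0..c} ?G" .
  show ?case
  proof (cases "j = 0")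
    case True
    \<comment> \<open>For order 2 the integrand is an exact derivative, and only the boundary term
      at y = 0 survives.\<close>
    have "((\<lambda>y. of_real (?s y) * h (?s y)) has_vector_derivative ?G y) (at y)" for y
    proof -
      have "((\<lambda>y. of_real (?s y) * h (?s y)) has_vector_derivative
          of_real (?s y) * ((y / ?s y) *\<^sub>R vd h (?s y)) + of_real (y / ?s y) * h (?s y)) (at y)"
        by (intro has_vector_derivative_mult hyp_has_vd[OF h(1) assms(3)]
            has_vector_derivative_of_real[OF hyp_deriv[OF assms(3)]])
      then show ?thesis using True by (simp add: scaleR_conv_of_real algebra_simps)
    qed
    then have "(?G has_integral (of_real (?s c) * h (?s c) - of_real (?s 0) * h (?s 0))) {0..c}"
      using c(1)[OF order_refl] by (intro fundamental_theorem_of_calculus) (auto intro: has_vector_derivative_at_within)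
    then have "integral {0..c} ?G = - of_real r * h r"
      using assms(3) c(2)[of c] by (simp add: integral_unique)
    moreover have "h r = U (r\<^sup>2)" using True by (simp add: h_def W_def)
    ultimately show ?thesis using A True abel_const_2 by (simp add: numeral_2_eq_2)
  next
    case False
    \<comment> \<open>The derivative of y^j s h(s), with s = sqrt (r^2 + y^2). Because s^2 - y^2 =
      r^2 it exceeds \<open>?G\<close> by j r^2 times the integrand of order j, and its own integral
      is 0: the boundary term vanishes at y = 0 since j > 0, and at \<open>c\<close> since h
      does.\<close>
    let ?F' = "\<lambda>y. of_real (y ^ j * ?s y) * ((y / ?s y) *\<^sub>R vd h (?s y))
        + of_real (real j * y ^ (j - 1) * ?s y + y ^ j * (y / ?s y)) * h (?s y)"
    have "((\<lambda>y. of_real (y ^ j * ?s y) * h (?s y)) has_vector_derivative ?F' y) (at y)" for y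
    proof -
      have "((\<lambda>y. y ^ j * ?s y) has_real_derivative
          (real j * y ^ (j - 1) * ?s y + y ^ j * (y / ?s y))) (at y)"
        using DERIV_mult[OF DERIV_pow[of j y] hyp_deriv[OF assms(3)]] by (simp add: mult.commute add.commute)
      then show ?thesis
        by (intro has_vector_derivative_mult has_vector_derivative_of_real hyp_has_vd[OF h(1) assms(3)])
    qed
    then have F': "(?F' has_integral (of_real (c ^ j * ?s c) * h (?s c) - of_real (0 ^ j * ?s 0) * h (?s 0))) {0..c}"
      using c(1)[OF order_refl] by (intro fundamental_theorem_of_calculus) (auto intro: has_vector_derivative_at_within)
    let ?H = "\<lambda>y. of_real (y ^ (j - 1) / ?s y) * h (?s y)"
    have "(?H has_integral integral {0..c} ?H) {0..c}"
      by (intro integrable_integral integrable_continuous_interval continuous_intros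
          continuous_on_hyp[OF h(1) assms(3)]) (use s0 in auto)
    moreover have "integral {0..c} ?H = abel_int j h r"
      unfolding abel_int_def by (rule integral_atLeast_eq[symmetric]) (use c in auto)
    ultimately have H: "(?H has_integral abel_int j h r) {0..c}" by simp
    have GH: "?G y = ?F' y - of_real (real j * r\<^sup>2) * ?H y" for y
    proof -
      define s where "s = ?s y"
      have s: "s \<noteq> 0" and r2: "r\<^sup>2 = s\<^sup>2 - y\<^sup>2" using s0[of y] by (auto simp: s_def)
      have "real j * y ^ (j - 1) * s + y ^ j * (y / s) - real j * r\<^sup>2 * (y ^ (j - 1) / s)
          = real (Suc j) * (y ^ Suc j / s)"
      proof -
        obtain i where "j = Suc i" using False by (cases j) auto
        then show ?thesis unfolding r2 using s by (simp add: field_simps power2_eq_square)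
      qed
      then have "of_real (real j * y ^ (j - 1) * s + y ^ j * (y / s)) * h s
          - of_real (real j * r\<^sup>2) * (of_real (y ^ (j - 1) / s) * h s)
          = of_real (real (Suc j) * (y ^ Suc j / s)) * h s"
        by (metis (no_types) left_diff_distrib mult.assoc of_real_diff of_real_mult)
      moreover have "of_real (y ^ j * s) * ((y / s) *\<^sub>R vd h s) = of_real (y ^ Suc j / s) * (of_real s * vd h s)"
        using s by (simp add: scaleR_conv_of_real)
      ultimately show ?thesis
        unfolding s_def[symmetric] by (simp add: algebra_simps add_divide_distrib)
    qed
    have "of_real (c ^ j * ?s c) * h (?s c) - of_real (0 ^ j * ?s 0) * h (?s 0) = 0"
      using c(2)[of c] False by simp
    then have "(?F' has_integral 0) {0..c}" using F' by (simp only:)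
    then have "((\<lambda>y. ?F' y - of_real (real j * r\<^sup>2) * ?H y) has_integral
        (0 - of_real (real j * r\<^sup>2) * abel_int j h r)) {0..c}"
      by (intro has_integral_diff has_integral_mult_right H)
    then have "(?G has_integral (0 - of_real (real j * r\<^sup>2) * abel_int j h r)) {0..c}"
      by (simp only: GH)
    then have "integral {0..c} ?G = - of_real (real j * r\<^sup>2) * abel_int j h r"
      by (simp add: integral_unique)
    moreover have "abel_int j h r = (-1) ^ j * of_real (abel_const j * r ^ (j - 1)) * U (r\<^sup>2)"
      using ge2(1) False by (simp add: h_def W_def[abs_def])
    moreover have "r ^ (Suc (Suc j) - 1) = r\<^sup>2 * r ^ (j - 1)"
      using False by (cases j) (auto simp: power2_eq_square)
    ultimately show ?thesis
      using abel_const_rec[of j] False unfolding A by simp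
  qed
qed simp


lemma vd_line_tail_square:
  assumes "U \<in> fplus" "t > 0"
  shows "vd (\<lambda>t. (line_int ^^ m) ((tail_int ^^ Suc k) U) (t\<^sup>2)) t
    = - 2 * of_real t * (line_int ^^ m) ((tail_int ^^ k) U) (t\<^sup>2)"
proof -
  have V: "(tail_int ^^ k) U \<in> fplus" "tail_int ((tail_int ^^ k) U) \<in> fplus"
    using assms by (auto intro: tail_int_funpow_fplus tail_int_fplus)
  have t2: "t\<^sup>2 > 0" using assms by simp
  have "vd (\<lambda>t. (line_int ^^ m) (tail_int ((tail_int ^^ k) U)) (t\<^sup>2)) t
      = of_real (2 * t) * vd ((line_int ^^ m) (tail_int ((tail_int ^^ k) U))) (t\<^sup>2)"
    by (rule vd_square[OF line_int_funpow_fplus[OF V(2)] assms(2)])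
  also have "vd ((line_int ^^ m) (tail_int ((tail_int ^^ k) U))) (t\<^sup>2)
      = (line_int ^^ m) (vd (tail_int ((tail_int ^^ k) U))) (t\<^sup>2)"
    by (rule vd_line_int_funpow[OF V(2) t2])
  also have "\<dots> = (line_int ^^ m) (\<lambda>x. (-1) * (tail_int ^^ k) U x) (t\<^sup>2)"
    by (rule line_int_funpow_cong[OF _ t2]) (simp add: vd_tail_int[OF V(1)])
  also have "\<dots> = - (line_int ^^ m) ((tail_int ^^ k) U) (t\<^sup>2)"
  by (simp only: line_int_funpow_cmult) simp
  finally show ?thesis by simp
qed

text \<open>For m = n - 1 and t the distance of the hyperplane from the origin,
  \<open>integral_hyperplane_harm\<close> identifies this as the radial part of the integral of U (x
  \<bullet> x) Y x, Y harmonic of degree k. The factors -1/2 cancel the -2 of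
  \<open>vd_line_tail_square\<close>: the leading term is t^k times \<open>(line_int ^^ m) U\<close>
  at t^2, the others contain more tail integrals.\<close>

definition lam :: "nat \<Rightarrow> nat \<Rightarrow> (real \<Rightarrow> complex) \<Rightarrow> real \<Rightarrow> complex" where
  "lam m k U t = (-1/2) ^ k * (vd ^^ k) (\<lambda>t. (line_int ^^ m) ((tail_int ^^ k) U) (t\<^sup>2)) t"

lemma line_tail_square_fplus:
  "U \<in> fplus \<Longrightarrow> (\<lambda>t. (line_int ^^ m) ((tail_int ^^ k) U) (t\<^sup>2)) \<in> fplus"
  by (intro fplus_compose_square line_int_funpow_fplus tail_int_funpow_fplus)

lemma lam_fplus: "U \<in> fplus \<Longrightarrow> lam m k U \<in> fplus"
  unfolding lam_def[abs_def] by (intro fplus_cmult fplus_vd_funpow line_tail_square_fplus)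

text \<open>One derivative uses up one tail integral and leaves a factor t, over which the other k
  derivatives pass by the Leibniz rule. This is the recurrence that the Funk-Hecke induction
  produces; for \<open>k = 0\<close> the index \<open>k - 1\<close> is truncated but its coefficient
  is 0.\<close>

lemma lam_Suc:
  assumes "U \<in> fplus" "t > 0"
  shows "lam m (Suc k) U t = of_real t * lam m k U t - of_nat k / 2 * lam m (k - 1) (tail_int U) t"
proof -
  let ?G = "\<lambda>k t. (line_int ^^ m) ((tail_int ^^ k) U) (t\<^sup>2)"
  have sm: "smooth_on (?G j) {0<..}" for j
    by (rule fplus_smooth[OF line_tail_square_fplus[OF assms(1)]])
  have "(vd ^^ Suc k) (?G (Suc k)) t = (vd ^^ k) (vd (?G (Suc k))) t"
    by (simp add: funpow_swap1)
  also have "\<dots> = (vd ^^ k) (\<lambda>t. (- 2) * (of_real t * ?G k t)) t"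
    by (rule vd_funpow_cong_open[of "{0<..}"])
      (use assms vd_line_tail_square[OF assms(1)] in \<open>auto simp del: funpow.simps\<close>)
  also have "\<dots> = (- 2) * (vd ^^ k) (\<lambda>t. of_real t * ?G k t) t"
    by (rule vd_funpow_cmult[of "{0<..}"])
      (use assms sm in \<open>auto intro!: smooth_on_mult smooth_on_of_real smooth_on_ident\<close>)
  also have "(vd ^^ k) (\<lambda>t. of_real t * ?G k t) t
      = of_real t * (vd ^^ k) (?G k) t + of_nat k * (vd ^^ (k - 1)) (?G k) t"
    by (rule vd_funpow_times_id[of "{0<..}"]) (use assms sm in auto)
  finally have *: "(vd ^^ Suc k) (?G (Suc k)) t
      = (- 2) * (of_real t * (vd ^^ k) (?G k) t + of_nat k * (vd ^^ (k - 1)) (?G k) t)" .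
  show ?thesis
  proof (cases k)
    case 0
    then show ?thesis using * by (simp add: lam_def)
  next
    case (Suc i)
    have "?G k = (\<lambda>t. (line_int ^^ m) ((tail_int ^^ i) (tail_int U)) (t\<^sup>2))"
      by (simp add: Suc funpow_swap1)
    then have "lam m (k - 1) (tail_int U) t = (-1/2) ^ i * (vd ^^ (k - 1)) (?G k) t"
      by (simp add: lam_def Suc)
    moreover have "lam m (Suc k) U t = (-1/2) ^ Suc k * (vd ^^ Suc k) (?G (Suc k)) t"
      and "lam m k U t = (-1/2) ^ k * (vd ^^ k) (?G k) t"
      by (simp_all only: lam_def)
    moreover have "((-1/2) * ((-1/2) * p)) * ((-2) * (s * X + n * Y)) = s * (((-1/2) * p) * X) - n / 2 * (p * Y)"
      for p s X n Y :: complex by (simp add: field_simps)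
    ultimately show ?thesis
      unfolding * by (simp only: Suc power_Suc diff_Suc_1)
  qed
qed

text \<open>Trades every tail integral for two line integrations, which makes \<open>lam\<close> a
  multiple of a derivative of a pure power of \<open>line_int\<close>.\<close>

lemma line_int_funpow_tail_int:
  assumes "U \<in> fplus" "q > 0"
  shows "(line_int ^^ (m + 2 * k)) U q = of_real pi ^ k * (line_int ^^ m) ((tail_int ^^ k) U) q"
  using assms
proof (induction k arbitrary: U)
  case (Suc k)
  have "(line_int ^^ (m + 2 * Suc k)) U q = (line_int ^^ (m + 2 * k)) (line_int (line_int U)) q"
    by (simp add: funpow_swap1)
  also have "\<dots> = of_real pi ^ k * (line_int ^^ m) ((tail_int ^^ k) (line_int (line_int U))) q"
    using Suc by (intro Suc.IH line_int_fplus)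
  also have "(line_int ^^ m) ((tail_int ^^ k) (line_int (line_int U))) q
      = (line_int ^^ m) (\<lambda>x. of_real pi * (tail_int ^^ k) (tail_int U) x) q"
  proof (rule line_int_funpow_cong[OF _ Suc.prems(2)])
    fix x :: real assume x: "x > 0"
    have "(tail_int ^^ k) (line_int (line_int U)) x = (tail_int ^^ k) (\<lambda>x. of_real pi * tail_int U x) x"
      by (rule tail_int_funpow_cong[OF line_int_line_int[OF Suc.prems(1)] x])
    then show "(tail_int ^^ k) (line_int (line_int U)) x = of_real pi * (tail_int ^^ k) (tail_int U) x"
      by (simp add: tail_int_funpow_cmult)
  qed
  finally show ?case by (simp add: line_int_funpow_cmult funpow_swap1)
qed simp

text \<open>After that trade \<open>lam m k U\<close> is the k-th derivative of the power
  \<open>m + 2 * k\<close> of \<open>line_int\<close>, and m + k further derivatives lead to the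
  situation of \<open>abel_inversion\<close>. The denominator (2 pi)^k collects 2^k from the
  definition of \<open>lam\<close> and pi^k from the trade.\<close>

lemma lam_inverse:
  assumes "U \<in> fplus" "r > 0" "m \<ge> 1"
  shows "abel_int (m + 2 * k) ((vd ^^ (m + k)) (lam m k U)) r
    = (-1) ^ (m + k) * of_real (abel_const (m + 2 * k) * r ^ (m + 2 * k - 1) / (2 * pi) ^ k) * U (r\<^sup>2)"
proof -
  let ?W = "\<lambda>t. (line_int ^^ (m + 2 * k)) U (t\<^sup>2)" and ?G = "\<lambda>t. (line_int ^^ m) ((tail_int ^^ k) U) (t\<^sup>2)"
  let ?c = "(-1/2) ^ k / of_real pi ^ k :: complex"
  have W: "smooth_on ?W {0<..}"
    by (rule fplus_smooth[OF fplus_compose_square[OF line_int_funpow_fplus[OF assms(1)]]])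
  have "(vd ^^ (m + k)) (lam m k U) x = ?c * (vd ^^ (m + 2 * k)) ?W x" if "x > 0" for x
  proof -
    have G: "?G t = (1 / of_real pi ^ k) * ?W t" if "t > 0" for t
      using line_int_funpow_tail_int[OF assms(1), of "t\<^sup>2" m k] that by simp
    have lam: "lam m k U t = ?c * (vd ^^ k) ?W t" if "t > 0" for t
    proof -
      have "(vd ^^ k) ?G t = (vd ^^ k) (\<lambda>t. (1 / of_real pi ^ k) * ?W t) t"
        by (rule vd_funpow_cong_open[of "{0<..}"]) (use that G in auto)
      also have "\<dots> = (1 / of_real pi ^ k) * (vd ^^ k) ?W t"
        by (rule vd_funpow_cmult[of "{0<..}"]) (use that W in auto)
      finally show ?thesis by (simp add: lam_def)
    qed
    have "(vd ^^ (m + k)) (lam m k U) x = (vd ^^ (m + k)) (\<lambda>t. ?c * (vd ^^ k) ?W t) x"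
      by (rule vd_funpow_cong_open[of "{0<..}"]) (use that lam in auto)
    also have "\<dots> = ?c * (vd ^^ (m + k)) ((vd ^^ k) ?W) x"
      by (rule vd_funpow_cmult[of "{0<..}"]) (use that W in \<open>auto intro!: smooth_on_vd_funpow\<close>)
    also have "(vd ^^ (m + k)) ((vd ^^ k) ?W) = (vd ^^ (m + 2 * k)) ?W"
    proof -
      have "m + 2 * k = (m + k) + k" by simp
      then show ?thesis by (simp only: funpow_add o_apply)
    qed
    finally show ?thesis .
  qed
  then have "abel_int (m + 2 * k) ((vd ^^ (m + k)) (lam m k U)) r
      = ?c * abel_int (m + 2 * k) ((vd ^^ (m + 2 * k)) ?W) r"
    by (subst abel_int_cmult[symmetric], intro abel_int_cong[OF _ assms(2)]) simp
  also have "\<dots> = ?c * ((-1) ^ (m + 2 * k) * of_real (abel_const (m + 2 * k) * r ^ (m + 2 * k - 1)) * U (r\<^sup>2))"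
    using assms by (subst abel_inversion) auto
  also have "\<dots> = (-1) ^ (m + k) * of_real (abel_const (m + 2 * k) * r ^ (m + 2 * k - 1) / (2 * pi) ^ k) * U (r\<^sup>2)"
  proof -
    have "?c * (-1) ^ (m + 2 * k) = (-1) ^ (m + k) * of_real (1 / (2 * pi) ^ k)"
    proof -
      have "(-1/2) ^ k = (-1) ^ k * (1 / 2 :: complex) ^ k" by (simp flip: power_mult_distrib)
      then show ?thesis by (simp add: power_add power_mult power_mult_distrib power_divide)
    qed
    then show ?thesis by (simp add: field_simps)
  qed
  finally show ?thesis .
qed

lemma vd_funpow_tail_int:
  assumes "w \<in> fplus" "t > 0" shows "(vd ^^ k) ((tail_int ^^ k) w) t = (-1) ^ k * w t"
  using assms
proof (induction k arbitrary: t)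
  case (Suc k)
  have V: "(tail_int ^^ k) w \<in> fplus" by (rule tail_int_funpow_fplus[OF Suc.prems(1)])
  have "(vd ^^ Suc k) ((tail_int ^^ Suc k) w) t = (vd ^^ k) (vd (tail_int ((tail_int ^^ k) w))) t"
    by (simp add: funpow_swap1)
  also have "\<dots> = (vd ^^ k) (\<lambda>x. (-1) * (tail_int ^^ k) w x) t"
    by (rule vd_funpow_cong_open[of "{0<..}"]) (use Suc.prems vd_tail_int[OF V] in auto)
  also have "\<dots> = (-1) * (vd ^^ k) ((tail_int ^^ k) w) t"
    by (rule vd_funpow_cmult[of "{0<..}"]) (use Suc.prems fplus_smooth[OF V] in auto)
  finally show ?case using Suc by simp
qed simp

lemma lam_surj_aux: "(-1/2) ^ k * (2 ^ k * (-1) ^ k) = (1::complex)"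
  by (simp flip: power_mult_distrib)

text \<open>The equation is solved from the outside inwards: \<open>G\<close> undoes the k
  derivatives, \<open>V\<close> the line integrations in the variable t^2, and \<open>U\<close> the
  tail integrals.\<close>

lemma lam_surj:
  assumes "w \<in> fplus" shows "\<exists>U\<in>fplus. \<forall>t>0. lam m k U t = w t"
proof -
  define G where "G t = 2 ^ k * (tail_int ^^ k) w t" for t
  have G: "G \<in> fplus"
    unfolding G_def by (intro fplus_cmult tail_int_funpow_fplus assms)
  obtain V where V: "V \<in> fplus" "\<forall>q>0. (line_int ^^ m) V q = G (sqrt q)"
    using line_int_funpow_surj[OF fplus_compose_sqrt[OF G]] by blast
  obtain U where U: "U \<in> fplus" "\<And>q. q > 0 \<Longrightarrow> (tail_int ^^ k) U q = V q"
    using tail_int_funpow_surj[OF V(1)] by blast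
  have "lam m k U t = w t" if "t > 0" for t
  proof -
    have "(vd ^^ k) (\<lambda>t. (line_int ^^ m) ((tail_int ^^ k) U) (t\<^sup>2)) t = (vd ^^ k) G t"
      by (rule vd_funpow_cong_open[of "{0<..}"])
        (use that V(2) line_int_funpow_cong[OF U(2), where k = m] in auto)
    also have "\<dots> = 2 ^ k * (vd ^^ k) ((tail_int ^^ k) w) t"
      unfolding G_def[abs_def]
      by (rule vd_funpow_cmult[of "{0<..}"]) (use that fplus_smooth[OF tail_int_funpow_fplus[OF assms]] in auto)
    also have "\<dots> = 2 ^ k * ((-1) ^ k * w t)"
      by (simp only: vd_funpow_tail_int[OF assms that])
    finally show ?thesis
      unfolding lam_def using lam_surj_aux[of k] by (metis mult.assoc mult_1)
  qed
  then show ?thesis using U(1) by blast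
qed

subsection \<open>Homogeneous and harmonic polynomials\<close>

lemma span_addI:
  "f \<in> cfun.span S \<Longrightarrow> g \<in> cfun.span S \<Longrightarrow> (\<lambda>x. f x + g x) \<in> cfun.span S"
  using cfun.span_add[of f S g] by (simp add: plus_fun_def)

lemma span_diffI:
  "f \<in> cfun.span S \<Longrightarrow> g \<in> cfun.span S \<Longrightarrow> (\<lambda>x. f x - g x) \<in> cfun.span S"
  using cfun.span_diff[of f S g] by (simp add: fun_diff_def)

lemma span_cmultI: "f \<in> cfun.span S \<Longrightarrow> (\<lambda>x. c * f x) \<in> cfun.span S"
  using cfun.span_scale[of f S c] by (simp add: cscale_def)

lemma span_zeroI: "(\<lambda>x. 0) \<in> cfun.span S"
  using cfun.span_zero[of S] by (simp add: zero_fun_def)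

lemma span_sumI:
  "(\<And>i. i \<in> I \<Longrightarrow> F i \<in> cfun.span S) \<Longrightarrow> (\<lambda>x. \<Sum>i\<in>I. F i x) \<in> cfun.span S"
  by (induction I rule: infinite_finite_induct) (auto intro: span_zeroI span_addI)

lemma span_fun_induct [consumes 1, case_names zero add base]:
  assumes "f \<in> cfun.span S" "P (\<lambda>x. 0)"
    and "\<And>c f g. P f \<Longrightarrow> P g \<Longrightarrow> P (\<lambda>x. c * f x + g x)" "\<And>f. f \<in> S \<Longrightarrow> P f"
  shows "P f"
  using assms(1)
proof (induction rule: cfun.span_induct_alt)
  case base
  then show ?case using assms(2) by (simp add: zero_fun_def)
next
  case (step c x y)
  then show ?case using assms(3)[OF assms(4)[of x], of y c] by (simp add: cscale_def plus_fun_def)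
qed

definition dird :: "'a::real_normed_vector \<Rightarrow> ('a \<Rightarrow> 'b::real_normed_vector) \<Rightarrow> 'a \<Rightarrow> 'b" where
  "dird v f x = frechet_derivative f (at x) v"

lemma dirdI: "(f has_derivative f') (at x) \<Longrightarrow> dird v f x = f' v"
  unfolding dird_def by (metis frechet_derivative_at)

lemma dird_works: "f differentiable at x \<longleftrightarrow> (f has_derivative (\<lambda>v. dird v f x)) (at x)"
  unfolding dird_def by (metis frechet_derivative_works)

text \<open>Homogeneous polynomials generated by products with arbitrary linear forms. Without
  reference to a basis, composition with linear maps and the rules for directional derivatives
  become plain inductions; \<open>hpoly_monomial\<close> and \<open>harmonic_poly_harm\<close> make
  the connection with monomials.\<close>

inductive hpoly :: "nat \<Rightarrow> ('a::euclidean_space \<Rightarrow> complex) \<Rightarrow> bool" where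
  hpoly_const: "hpoly 0 (\<lambda>_. c)"
| hpoly_mult: "hpoly k f \<Longrightarrow> hpoly (Suc k) (\<lambda>x. of_real (x \<bullet> a) * f x)"
| hpoly_add: "hpoly k f \<Longrightarrow> hpoly k g \<Longrightarrow> hpoly k (\<lambda>x. f x + g x)"

lemma hpoly_zero: "hpoly k (\<lambda>_. 0)"
proof (induction k)
  case (Suc k)
  from hpoly_mult[OF this, of 0] show ?case by simp
qed (rule hpoly_const)

lemma hpoly_cmult: "hpoly k f \<Longrightarrow> hpoly k (\<lambda>x. c * f x)"
proof (induction rule: hpoly.induct)
  case (hpoly_mult k f a)
  from hpoly.hpoly_mult[OF hpoly_mult(2), of a] show ?case by (simp add: mult.left_commute)
qed (auto simp: distrib_left intro: hpoly.intros)

lemma hpoly_sum: "(\<And>i. i \<in> I \<Longrightarrow> hpoly k (F i)) \<Longrightarrow> hpoly k (\<lambda>x. \<Sum>i\<in>I. F i x)"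
  by (induction I rule: infinite_finite_induct) (auto intro: hpoly_zero hpoly_add)

lemma hpoly_0_const: "hpoly 0 f \<Longrightarrow> \<exists>c. f = (\<lambda>_. c)"
  by (induction "0::nat" f rule: hpoly.induct) auto

lemma of_real_inner_has_derivative:
  "((\<lambda>x. complex_of_real (x \<bullet> a)) has_derivative (\<lambda>v. of_real (v \<bullet> a))) (at x)"
  by (intro has_derivative_of_real bounded_linear_imp_has_derivative bounded_linear_inner_left)

lemma hpoly_differentiable: "hpoly k f \<Longrightarrow> f differentiable at x"
proof (induction rule: hpoly.induct)
  case (hpoly_mult k f a)
  have "(\<lambda>x. complex_of_real (x \<bullet> a)) differentiable at x"
    using of_real_inner_has_derivative differentiableI by blast
  then show ?case using hpoly_mult(2) by (rule differentiable_mult)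
qed (auto intro: differentiable_add)

lemma hpoly_has_derivative: "hpoly k f \<Longrightarrow> (f has_derivative (\<lambda>v. dird v f x)) (at x)"
  using hpoly_differentiable dird_works by blast

lemma dird_mult_inner:
  assumes "\<And>x. f differentiable at x"
  shows "dird v (\<lambda>x. complex_of_real (x \<bullet> a) * f x) = (\<lambda>x. of_real (v \<bullet> a) * f x + of_real (x \<bullet> a) * dird v f x)"
proof
  fix x
  have "((\<lambda>x. complex_of_real (x \<bullet> a) * f x) has_derivative
      (\<lambda>v. of_real (x \<bullet> a) * dird v f x + of_real (v \<bullet> a) * f x)) (at x)"
    using assms by (intro has_derivative_mult of_real_inner_has_derivative) (simp add: dird_works)
  then show "dird v (\<lambda>x. complex_of_real (x \<bullet> a) * f x) x = of_real (v \<bullet> a) * f x + of_real (x \<bullet> a) * dird v f x"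
    by (simp add: dirdI)
qed

lemma dird_add:
  assumes "\<And>x. f differentiable at x" "\<And>x. g differentiable at x"
  shows "dird v (\<lambda>x. f x + g x) = (\<lambda>x. dird v f x + dird v g x)"
proof
  fix x
  have "((\<lambda>x. f x + g x) has_derivative (\<lambda>v. dird v f x + dird v g x)) (at x)"
    using assms by (intro has_derivative_add) (simp_all add: dird_works)
  then show "dird v (\<lambda>x. f x + g x) x = dird v f x + dird v g x"
    by (simp add: dirdI)
qed

lemma dird_const [simp]: "dird v (\<lambda>_. c) = (\<lambda>_. 0)"
  by (simp add: dird_def fun_eq_iff)

lemma dird_cmult:
  fixes f :: "'a::real_normed_vector \<Rightarrow> complex"
  assumes "\<And>x. f differentiable at x"
  shows "dird v (\<lambda>x. c * f x) = (\<lambda>x. c * dird v f x)"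
proof
  fix x
  have "((\<lambda>x. c * f x) has_derivative (\<lambda>v. c * dird v f x)) (at x)"
    using assms by (intro has_derivative_mult_right) (simp_all add: dird_works)
  then show "dird v (\<lambda>x. c * f x) x = c * dird v f x"
    by (simp add: dirdI)
qed

text \<open>In degree 0 the derivative is 0, which is homogeneous of every degree, so the truncated
  \<open>k - 1\<close> is correct there as well.\<close>

lemma hpoly_dird: "hpoly k f \<Longrightarrow> hpoly (k - 1) (dird v f)"
proof (induction rule: hpoly.induct)
  case (hpoly_mult k f a)
  have "hpoly k (\<lambda>x. of_real (x \<bullet> a) * dird v f x)"
  proof (cases k)
    case 0
    then obtain c where "f = (\<lambda>_. c)" using hpoly_0_const hpoly_mult(1) by blast
    then show ?thesis by (simp add: hpoly_zero)
  next
    case (Suc i)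
    then show ?thesis using hpoly_mult(2) hpoly.hpoly_mult[of i "dird v f" a] by simp
  qed
  then have "hpoly k (\<lambda>x. of_real (v \<bullet> a) * f x + of_real (x \<bullet> a) * dird v f x)"
    using hpoly_mult(1) by (intro hpoly_add hpoly_cmult)
  then show ?case
    using dird_mult_inner[of f v a] hpoly_differentiable[OF hpoly_mult(1)] by simp
next
  case (hpoly_add k f g)
  have "dird v (\<lambda>x. f x + g x) = (\<lambda>x. dird v f x + dird v g x)"
    using hpoly_add hpoly_differentiable by (intro dird_add) blast+
  then show ?case using hpoly_add by (simp add: hpoly.hpoly_add)
qed (auto intro: hpoly_zero)

lemma dird_commute: "hpoly k f \<Longrightarrow> dird v (dird w f) = dird w (dird v f)"
proof (induction rule: hpoly.induct)
  case (hpoly_mult k f a)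
  have d: "f differentiable at x" "dird u f differentiable at x" for u x
    using hpoly_mult(1) hpoly_dird hpoly_differentiable by blast+
  have d': "(\<lambda>x. of_real (x \<bullet> a) * dird u f x) differentiable at x" for u x
    using d of_real_inner_has_derivative[of a x] differentiableI by (intro differentiable_mult) blast+
  have "dird v (dird w (\<lambda>x. complex_of_real (x \<bullet> a) * f x))
    = (\<lambda>x. of_real (w \<bullet> a) * dird v f x + (of_real (v \<bullet> a) * dird w f x + of_real (x \<bullet> a) * dird v (dird w f) x))" for v w
    using d d' by (simp add: dird_mult_inner dird_add dird_cmult)
  then show ?case using hpoly_mult(2) by (simp add: fun_eq_iff algebra_simps)
next
  case (hpoly_add k f g)
  have d: "f differentiable at x" "dird u f differentiable at x" "g differentiable at x" "dird u g differentiable at x" for u x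
    using hpoly_add hpoly_dird hpoly_differentiable by blast+
  then show ?case using hpoly_add by (simp add: dird_add)
qed simp

lemma hpoly_scale: "hpoly k f \<Longrightarrow> f (s *\<^sub>R x) = of_real s ^ k * f x"
  by (induction rule: hpoly.induct) (auto simp: algebra_simps)

lemma hpoly_euler: "hpoly k f \<Longrightarrow> dird x f x = of_nat k * f x"
proof (induction rule: hpoly.induct)
  case (hpoly_mult k f a)
  have d: "f differentiable at x" for x
    using hpoly_mult(1) hpoly_differentiable by blast
  show ?case
    using fun_cong[OF dird_mult_inner[of f x a, OF d], of x] hpoly_mult by (simp add: algebra_simps)
next
  case (hpoly_add k f g)
  have d: "f differentiable at x" "g differentiable at x" for x
    using hpoly_add hpoly_differentiable by blast+
  show ?case
    using fun_cong[OF dird_add[of f g x, OF d], of x] hpoly_add by (simp add: algebra_simps)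
qed simp

lemma hpoly_smooth: "hpoly k f \<Longrightarrow> open S \<Longrightarrow> smooth_on f S"
proof (induction rule: hpoly.induct)
  case (hpoly_mult k f a)
  then show ?case by (intro smooth_on_mult smooth_on_of_real smooth_on_inner_left)
qed (auto intro: smooth_on_add)

lemma hpoly_linear_compose: "hpoly k f \<Longrightarrow> linear h \<Longrightarrow> hpoly k (\<lambda>x. f (h x))"
proof (induction rule: hpoly.induct)
  case (hpoly_mult k f a)
  have "h x \<bullet> a = x \<bullet> adjoint h a" for x
    by (metis hpoly_mult.prems adjoint_works inner_commute)
  then show ?case using hpoly.hpoly_mult[OF hpoly_mult.IH[OF hpoly_mult.prems], of "adjoint h a"] by simp
qed (auto intro: hpoly.intros)

lemma hpoly_normsq:
  assumes "hpoly k f" shows "hpoly (Suc (Suc k)) (\<lambda>x. of_real (x \<bullet> x) * f x)"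
proof -
  have "hpoly (Suc (Suc k)) (\<lambda>x. \<Sum>b\<in>Basis. of_real (x \<bullet> b) * (of_real (x \<bullet> b) * f x))"
    by (intro hpoly_sum hpoly_mult assms)
  moreover have "(\<Sum>b\<in>Basis. of_real (x \<bullet> b) * (of_real (x \<bullet> b) * f x)) = of_real (x \<bullet> x) * f x" for x
    by (simp add: euclidean_inner[of x x] sum_distrib_right mult.assoc)
  ultimately show ?thesis by simp
qed

lemma dird_normsq:
  fixes f :: "'a::real_inner \<Rightarrow> complex"
  assumes "\<And>x. f differentiable at x"
  shows "dird v (\<lambda>x. complex_of_real (x \<bullet> x) * f x)
    = (\<lambda>x. 2 * (of_real (x \<bullet> v) * f x) + of_real (x \<bullet> x) * dird v f x)"
proof
  fix x :: 'a
  have "((\<lambda>x::'a. x \<bullet> x) has_derivative (\<lambda>v. x \<bullet> v + v \<bullet> x)) (at x)"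
    by (rule has_derivative_inner[OF has_derivative_ident has_derivative_ident])
  then have "((\<lambda>x. complex_of_real (x \<bullet> x) * f x) has_derivative
      (\<lambda>v. of_real (x \<bullet> x) * dird v f x + of_real (x \<bullet> v + v \<bullet> x) * f x)) (at x)"
    using assms by (intro has_derivative_mult has_derivative_of_real) (simp_all add: dird_works)
  then show "dird v (\<lambda>x. complex_of_real (x \<bullet> x) * f x) x = 2 * (of_real (x \<bullet> v) * f x) + of_real (x \<bullet> x) * dird v f x"
    by (simp add: dirdI inner_commute algebra_simps)
qed

lemma laplacian_eq:
  fixes f :: "real^'n \<Rightarrow> complex"
  shows "laplacian f x = (\<Sum>i\<in>UNIV. dird (axis i 1) (dird (axis i 1) f) x)"
  by (simp add: laplacian_def dird_def[abs_def])

lemma hpoly_laplacian: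
  fixes f :: "real^'n \<Rightarrow> complex"
  assumes "hpoly k f" shows "hpoly (k - 2) (laplacian f)"
proof -
  have "hpoly (k - 1 - 1) (\<lambda>x. \<Sum>i\<in>UNIV. dird (axis i 1) (dird (axis i 1) f) x)"
    by (intro hpoly_sum hpoly_dird assms)
  moreover have "laplacian f = (\<lambda>x. \<Sum>i\<in>UNIV. dird (axis i 1) (dird (axis i 1) f) x)"
    by (simp add: fun_eq_iff laplacian_eq)
  ultimately show ?thesis by (simp add: numeral_2_eq_2)
qed

lemma hpoly_dird_eq_0:
  assumes "hpoly 0 f" shows "dird v f = (\<lambda>_. 0)"
  using hpoly_0_const[OF assms] by auto

lemma laplacian_low_degree:
  fixes f :: "real^'n \<Rightarrow> complex"
  assumes "hpoly k f" "k < 2" shows "laplacian f x = 0"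
proof -
  have "hpoly 0 (dird v f)" for v
    using hpoly_dird[OF assms(1), of v] assms(2) by (cases k) auto
  then show ?thesis by (simp add: laplacian_eq hpoly_dird_eq_0)
qed

lemma laplacian_add_cmult:
  assumes "hpoly k f" "hpoly l g"
  shows "laplacian (\<lambda>x. c * f x + g x) x = c * laplacian f x + laplacian g x"
proof -
  have d: "f differentiable at x" "dird u f differentiable at x" "g differentiable at x" "dird u g differentiable at x"
    "(\<lambda>x. c * f x) differentiable at x" "(\<lambda>x. c * dird u f x) differentiable at x" for u x
    using assms hpoly_dird hpoly_differentiable hpoly_cmult by blast+
  then show ?thesis
    by (simp add: laplacian_eq dird_add dird_cmult sum.distrib sum_distrib_left)
qed

text \<open>The cross terms add up to four times the derivative of f in the direction x, which is k
  f by Euler's identity; the second derivatives of the squared norm give 2 in each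
  coordinate.\<close>

lemma laplacian_normsq:
  fixes f :: "real^'n \<Rightarrow> complex"
  assumes "hpoly k f"
  shows "laplacian (\<lambda>x. of_real (x \<bullet> x) * f x) x
    = of_real (2 * real CARD('n) + 4 * real k) * f x + of_real (x \<bullet> x) * laplacian f x"
proof -
  have d: "f differentiable at x" "dird u f differentiable at x" for u x
    using assms hpoly_dird hpoly_differentiable by blast+
  have d': "(\<lambda>x. complex_of_real (x \<bullet> u) * f x) differentiable at x" "(\<lambda>x. of_real (x \<bullet> x) * dird u f x) differentiable at x"
    for u x
    using assms hpoly_dird hpoly_differentiable hpoly_mult hpoly_normsq by blast+
  have d'': "(\<lambda>x. 2 * (complex_of_real (x \<bullet> u) * f x)) differentiable at x" for u x
    using assms hpoly_cmult hpoly_differentiable hpoly_mult by blast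
  have "dird v (dird v (\<lambda>x. complex_of_real (x \<bullet> x) * f x)) x
      = 2 * of_real (v \<bullet> v) * f x + 4 * (of_real (x \<bullet> v) * dird v f x) + of_real (x \<bullet> x) * dird v (dird v f) x" for v
    unfolding dird_normsq[OF d(1)] dird_add[OF d'' d'(2)] dird_cmult[OF d'(1)]
      dird_mult_inner[OF d(1)] dird_normsq[OF d(2)] by (simp add: algebra_simps)
  then have "laplacian (\<lambda>x. of_real (x \<bullet> x) * f x) x
      = (\<Sum>i\<in>(UNIV::'n set). 2 * f x + 4 * (of_real (x $ i) * dird (axis i 1) f x) + of_real (x \<bullet> x) * dird (axis i 1) (dird (axis i 1) f) x)"
    by (simp add: laplacian_eq inner_axis)
  also have "\<dots> = of_nat CARD('n) * (2 * f x) + 4 * (\<Sum>i\<in>UNIV. of_real (x $ i) * dird (axis i 1) f x)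
      + of_real (x \<bullet> x) * laplacian f x"
    by (simp add: sum.distrib sum_distrib_left laplacian_eq)
  also have "(\<Sum>i\<in>UNIV. of_real (x $ i) * dird (axis i 1) f x) = of_nat k * f x"
  proof -
    have lin: "linear (\<lambda>v. dird v f x)"
      using hpoly_has_derivative[OF assms] has_derivative_linear by blast
    have "of_nat k * f x = dird (\<Sum>i\<in>UNIV. x $ i *s axis i 1) f x"
      by (simp only: basis_expansion hpoly_euler[OF assms])
    also have "\<dots> = (\<Sum>i\<in>UNIV. of_real (x $ i) * dird (axis i 1) f x)"
      by (simp only: linear_sum[OF lin] scalar_mult_eq_scaleR linear_scale[OF lin])
        (simp add: scaleR_conv_of_real)
    finally show ?thesis by simp
  qed
  finally show ?thesis by (simp add: algebra_simps)
qed

text \<open>With Q = R / c - (x \<bullet> x) S the equation reduces to Laplacian Q = c S. By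
  \<open>laplacian_normsq\<close> this is an equation of the same kind for S, two degrees lower and
  with c + d in place of c. The constant stays positive, so the division by c never fails.\<close>

lemma hpoly_solve:
  fixes R :: "real^'n \<Rightarrow> complex"
  assumes "hpoly m R" "c > 0"
  shows "\<exists>Q. hpoly m Q \<and> (\<forall>x. of_real c * Q x + of_real (x \<bullet> x) * laplacian Q x = R x)"
  using assms
proof (induction m arbitrary: R c rule: less_induct)
  case (less m)
  have R': "hpoly m (\<lambda>x. (1 / of_real c) * R x)" by (rule hpoly_cmult[OF less.prems(1)])
  show ?case
  proof (cases "m < 2")
    case True
    then show ?thesis
      using R' laplacian_low_degree[OF R'] less.prems(2) by (intro exI[of _ "\<lambda>x. (1 / of_real c) * R x"]) auto
  next
    case False
    define d where "d = 2 * real CARD('n) + 4 * real (m - 2)"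
    obtain S where S: "hpoly (m - 2) S"
      "\<And>x. of_real (c + d) * S x + of_real (x \<bullet> x) * laplacian S x = (1 / of_real c) * laplacian R x"
    proof -
      have "hpoly (m - 2) (\<lambda>x. (1 / of_real c) * laplacian R x)"
        by (intro hpoly_cmult hpoly_laplacian less.prems)
      moreover have "m - 2 < m" "c + d > 0"
        using less.prems False by (auto simp: d_def add_pos_nonneg simp del: of_nat_diff)
      ultimately show ?thesis using less.IH that by blast
    qed
    define Q where "Q x = (1 / of_real c) * R x + (-1) * (of_real (x \<bullet> x) * S x)" for x
    have nS: "hpoly m (\<lambda>x. of_real (x \<bullet> x) * S x)"
      using hpoly_normsq[OF S(1)] False by (simp add: numeral_2_eq_2 Suc_diff_Suc)
    have "hpoly m Q"
      unfolding Q_def by (intro hpoly_add hpoly_cmult less.prems nS)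
    moreover have "of_real c * Q x + of_real (x \<bullet> x) * laplacian Q x = R x" for x
    proof -
      have "laplacian Q x = (1 / of_real c) * laplacian R x + laplacian (\<lambda>x. (-1) * (of_real (x \<bullet> x) * S x)) x"
        unfolding Q_def by (rule laplacian_add_cmult[OF less.prems(1) hpoly_cmult[OF nS]])
      also have "laplacian (\<lambda>x. (-1) * (of_real (x \<bullet> x) * S x)) x = - laplacian (\<lambda>x. of_real (x \<bullet> x) * S x) x"
        using laplacian_add_cmult[OF nS hpoly_zero[of 0], of "-1" x] by (simp add: laplacian_eq)
      also have "laplacian (\<lambda>x. of_real (x \<bullet> x) * S x) x = of_real d * S x + of_real (x \<bullet> x) * laplacian S x"
        by (simp add: laplacian_normsq[OF S(1)] d_def)
      finally have "laplacian Q x = of_real c * S x"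
        unfolding S(2)[of x, symmetric] by (simp add: algebra_simps)
      then show ?thesis using less.prems(2) by (simp add: Q_def algebra_simps)
    qed
    ultimately show ?thesis by blast
  qed
qed

text \<open>Built on \<open>hpoly\<close>, to have its inductions at hand;
  \<open>harmonic_poly_harm\<close> leads here from \<open>harmonic_poly\<close>.\<close>

definition solid_harmonic :: "nat \<Rightarrow> (real^'n \<Rightarrow> complex) \<Rightarrow> bool" where
  "solid_harmonic k Y \<longleftrightarrow> hpoly k Y \<and> (\<forall>x. laplacian Y x = 0)"

text \<open>Restriction to the unit sphere, extended by 0. As total functions, restrictions agree if
  they agree on the sphere, so spans and linear independence on the sphere are those of the ambient
  function space.\<close>

definition restr :: "('a::real_normed_vector \<Rightarrow> complex) \<Rightarrow> 'a \<Rightarrow> complex" where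
  "restr Y x = (if norm x = 1 then Y x else 0)"

text \<open>Q is chosen so that (x \<bullet> x) Q and P have the same Laplacian. By
  \<open>laplacian_normsq\<close> this is the equation of \<open>hpoly_solve\<close> with the
  constant d.\<close>

lemma hpoly_harm_decomp:
  fixes P :: "real^'n \<Rightarrow> complex"
  assumes "hpoly (Suc (Suc k)) P"
  obtains h Q where "solid_harmonic (Suc (Suc k)) h" "hpoly k Q" "\<And>x. P x = h x + of_real (x \<bullet> x) * Q x"
proof -
  define d where "d = 2 * real CARD('n) + 4 * real k"
  have "d > 0" by (simp add: d_def add_pos_nonneg)
  moreover have "hpoly k (laplacian P)"
    using hpoly_laplacian[OF assms] by simp
  ultimately obtain Q where Q: "hpoly k Q" "\<And>x. of_real d * Q x + of_real (x \<bullet> x) * laplacian Q x = laplacian P x"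
    using hpoly_solve by metis
  note nQ = hpoly_normsq[OF Q(1)]
  define h where "h x = (-1) * (of_real (x \<bullet> x) * Q x) + P x" for x
  have "laplacian h x = 0" for x
    unfolding h_def laplacian_add_cmult[OF nQ assms] laplacian_normsq[OF Q(1)]
    using Q(2)[of x] by (simp add: d_def)
  moreover have "hpoly (Suc (Suc k)) h"
    unfolding h_def by (intro hpoly_add hpoly_cmult nQ assms)
  ultimately show ?thesis
    using that[of h Q] Q(1) by (simp add: solid_harmonic_def h_def)
qed

text \<open>On the sphere the factor x \<bullet> x is 1, so the remainder of
  \<open>hpoly_harm_decomp\<close> restricts like a polynomial two degrees lower.\<close>

lemma restr_hpoly_span:
  fixes P :: "real^'n \<Rightarrow> complex"
  assumes "hpoly k P" shows "restr P \<in> cfun.span (restr ` {Y. \<exists>k. solid_harmonic k Y})"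
  using assms
proof (induction k arbitrary: P rule: induct_nat_012)
  case (ge2 k)
  obtain h Q where hQ: "solid_harmonic (Suc (Suc k)) h" "hpoly k Q" "\<And>x. P x = h x + of_real (x \<bullet> x) * Q x"
    using hpoly_harm_decomp[OF ge2.prems] by metis
  have "restr P = (\<lambda>x. restr h x + restr Q x)"
    by (simp add: restr_def hQ(3) fun_eq_iff norm_eq_1)
  then show ?case
    using ge2.IH(1)[OF hQ(2)] hQ(1) by (auto intro!: span_addI intro: cfun.span_base)
qed (auto intro!: cfun.span_base imageI simp: solid_harmonic_def intro: laplacian_low_degree)

primrec mono_basis :: "nat \<Rightarrow> (real^'n \<Rightarrow> complex) set" where
  "mono_basis 0 = {\<lambda>_. 1}"
| "mono_basis (Suc k) = (\<lambda>(i, b) x. of_real (x $ i) * b x) ` (UNIV \<times> mono_basis k)"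

lemma finite_mono_basis: "finite (mono_basis k)"
  by (induction k) auto

lemma hpoly_mult_coord: "hpoly k f \<Longrightarrow> hpoly (Suc k) (\<lambda>x. of_real (x $ i) * f x)"
  using hpoly_mult[of k f "axis i 1"] by (simp add: inner_axis)

lemma hpoly_mono_basis: "b \<in> mono_basis k \<Longrightarrow> hpoly k b"
  by (induction k arbitrary: b) (auto intro: hpoly_const hpoly_mult_coord)

lemma hpoly_in_span_mono_basis: "hpoly k f \<Longrightarrow> f \<in> cfun.span (mono_basis k)"
proof (induction rule: hpoly.induct)
  case (hpoly_const c)
  have "(\<lambda>x. c * (\<lambda>_. 1) x) \<in> cfun.span (mono_basis 0)"
    by (intro span_cmultI cfun.span_base) simp
  then show ?case by simp
next
  case (hpoly_mult k f a)
  show ?case using hpoly_mult(2)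
  proof (induction rule: span_fun_induct)
    case zero
    then show ?case using span_zeroI by simp
  next
    case (add c f g)
    have "(\<lambda>x. c * (complex_of_real (x \<bullet> a) * f x) + complex_of_real (x \<bullet> a) * g x) \<in> cfun.span (mono_basis (Suc k))"
      using add by (intro span_addI span_cmultI)
    then show ?case by (simp add: algebra_simps)
  next
    case (base b)
    have "(\<lambda>x. \<Sum>i\<in>UNIV. of_real (a $ i) * (of_real (x $ i) * b x)) \<in> cfun.span (mono_basis (Suc k))"
      using base by (intro span_sumI span_cmultI cfun.span_base) auto
    then show ?case
      by (simp add: inner_vec_def sum_distrib_right sum_distrib_left mult_ac del: mono_basis.simps)
  qed
qed (auto intro: span_addI)

lemma hpoly_monomial:
  "finite A \<Longrightarrow> hpoly (sum \<alpha> A) (\<lambda>x::real^'n. \<Prod>i\<in>A. complex_of_real (x $ i) ^ \<alpha> i)"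
proof (induction rule: finite_induct)
  case (insert i A)
  have "hpoly (k + sum \<alpha> A) (\<lambda>x. complex_of_real (x $ i) ^ k * (\<Prod>i\<in>A. complex_of_real (x $ i) ^ \<alpha> i))" for k
  proof (induction k)
    case (Suc k)
    then show ?case using hpoly_mult_coord[OF Suc, of i] by (simp add: mult.assoc)
  qed (use insert in simp)
  then show ?case using insert by simp
qed (auto intro: hpoly_const)

lemma harmonic_poly_harm: "Y \<in> harmonic_poly k \<Longrightarrow> solid_harmonic k Y"
proof -
  assume Y: "Y \<in> harmonic_poly k"
  then obtain c where c: "\<And>x. Y x = (\<Sum>\<alpha> | sum \<alpha> UNIV = k. c \<alpha> * (\<Prod>i\<in>UNIV. complex_of_real (x $ i) ^ \<alpha> i))"
    by (auto simp: harmonic_poly_def homogeneous_poly_def)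
  have "hpoly k (\<lambda>x. \<Sum>\<alpha> | sum \<alpha> UNIV = k. c \<alpha> * (\<Prod>i\<in>UNIV. complex_of_real (x $ i) ^ \<alpha> i))"
    by (intro hpoly_sum hpoly_cmult) (use hpoly_monomial[OF finite[of UNIV]] in auto)
  moreover have "Y = (\<lambda>x. \<Sum>\<alpha> | sum \<alpha> UNIV = k. c \<alpha> * (\<Prod>i\<in>UNIV. complex_of_real (x $ i) ^ \<alpha> i))"
    using c by blast
  ultimately show ?thesis using Y by (simp add: solid_harmonic_def harmonic_poly_def)
qed

lemma harm_dird:
  assumes "solid_harmonic k Y" shows "solid_harmonic (k - 1) (dird v Y)"
proof -
  have Y: "hpoly k Y" "\<And>x. laplacian Y x = 0" using assms by (auto simp: solid_harmonic_def)
  have "laplacian (dird v Y) x = 0" for x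
  proof -
    have "dird w (dird w (dird v Y)) = dird v (dird w (dird w Y))" for w
      using dird_commute[OF Y(1), of w v] dird_commute[OF hpoly_dird[OF Y(1)], of w v] by metis
    then have "laplacian (dird v Y) x = (\<Sum>i\<in>UNIV. dird v (dird (axis i 1) (dird (axis i 1) Y)) x)"
      by (simp add: laplacian_eq)
    also have "\<dots> = dird v (laplacian Y) x"
    proof -
      have "((\<lambda>x. \<Sum>i\<in>UNIV. dird (axis i 1) (dird (axis i 1) Y) x) has_derivative
          (\<lambda>v. \<Sum>i\<in>UNIV. dird v (dird (axis i 1) (dird (axis i 1) Y)) x)) (at x)"
        by (intro has_derivative_sum hpoly_has_derivative[OF hpoly_dird[OF hpoly_dird[OF Y(1)]]])
      moreover have "laplacian Y = (\<lambda>x. \<Sum>i\<in>UNIV. dird (axis i 1) (dird (axis i 1) Y) x)"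
        by (simp add: fun_eq_iff laplacian_eq)
      ultimately show ?thesis by (simp add: dirdI)
    qed
    also have "laplacian Y = (\<lambda>_. 0)" using Y(2) by blast
    finally show ?thesis by simp
  qed
  then show ?thesis using hpoly_dird[OF Y(1)] by (simp add: solid_harmonic_def)
qed

subsection \<open>Integrals over hyperplanes\<close>

lemma nn_integral_lborel_shift:
  fixes f :: "'a::euclidean_space \<Rightarrow> ennreal"
  assumes [measurable]: "f \<in> borel_measurable borel"
  shows "(\<integral>\<^sup>+x. f (x + v) \<partial>lborel) = (\<integral>\<^sup>+x. f x \<partial>lborel)"
  by (subst (2) lborel_distr_plus[of v, symmetric], subst nn_integral_distr)
    (simp_all add: add.commute)

lemma nn_integral_lborel_reflect:
  fixes f :: "'a::euclidean_space \<Rightarrow> ennreal"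
  assumes [measurable]: "f \<in> borel_measurable borel"
  shows "(\<integral>\<^sup>+x. f (v - x) \<partial>lborel) = (\<integral>\<^sup>+x. f x \<partial>lborel)"
proof -
  have "(\<integral>\<^sup>+x. f x \<partial>lborel) = (\<integral>\<^sup>+x. f x \<partial>density (distr lborel borel (\<lambda>x. v + (-1) *\<^sub>R x)) (\<lambda>_. \<bar>-1::real\<bar> ^ DIM('a)))"
    using lborel_affine[of "-1" v] by simp
  also have "\<dots> = (\<integral>\<^sup>+x. f (v - x) \<partial>lborel)"
    by (simp add: density_1 nn_integral_distr)
  finally show ?thesis ..
qed

text \<open>
  The measure \<open>distr lborel borel h\<close> is translation invariant, hence proportional to
  Lebesgue measure by the usual double integral; the unit ball fixes the factor.
\<close>

lemma lborel_distr_orthogonal: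
  fixes h :: "'a::euclidean_space \<Rightarrow> 'a"
  assumes "orthogonal_transformation h"
  shows "distr lborel borel h = lborel"
proof (rule measure_eqI)
  have lin: "linear h" by (rule orthogonal_transformation_linear[OF assms])
  have [measurable]: "h \<in> borel_measurable borel"
    using lin by (intro borel_measurable_continuous_onI linear_continuous_on linear_conv_bounded_linear[THEN iffD1])
  fix A assume "A \<in> sets (distr lborel borel h)"
  then have [measurable]: "A \<in> sets borel" by simp
  define B where "B = ball (0::'a) 1"
  have [measurable]: "B \<in> sets borel" by (simp add: B_def)
  have surj: "\<exists>z. h z = y" for y
    using orthogonal_transformation_surj[OF assms] by (metis surjD)
  let ?a = "indicator A :: 'a \<Rightarrow> ennreal" and ?b = "indicator B :: 'a \<Rightarrow> ennreal"
  have "(\<integral>\<^sup>+x. ?a (h x) \<partial>lborel) * (\<integral>\<^sup>+y. ?b y \<partial>lborel) = (\<integral>\<^sup>+x. (\<integral>\<^sup>+y. ?a (h x) * ?b (y + h x) \<partial>lborel) \<partial>lborel)"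
    by (simp add: nn_integral_cmult nn_integral_multc nn_integral_lborel_shift[of ?b])
  also have "\<dots> = (\<integral>\<^sup>+y. (\<integral>\<^sup>+x. ?a (h x) * ?b (y + h x) \<partial>lborel) \<partial>lborel)"
    by (rule lborel_pair.Fubini'[symmetric]) measurable
  also have "\<dots> = (\<integral>\<^sup>+y. (\<integral>\<^sup>+x. ?a (h x - y) * ?b (h x) \<partial>lborel) \<partial>lborel)"
  proof (rule nn_integral_cong)
    fix y
    obtain z where z: "h z = y" using surj by blast
    have "(\<integral>\<^sup>+x. ?a (h x - y) * ?b (h x) \<partial>lborel) = (\<integral>\<^sup>+x. ?a (h (x + z) - y) * ?b (h (x + z)) \<partial>lborel)"
      by (rule nn_integral_lborel_shift[symmetric]) measurable
    then show "(\<integral>\<^sup>+x. ?a (h x) * ?b (y + h x) \<partial>lborel) = (\<integral>\<^sup>+x. ?a (h x - y) * ?b (h x) \<partial>lborel)"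
      by (simp add: linear_add[OF lin] z add.commute)
  qed
  also have "\<dots> = (\<integral>\<^sup>+x. (\<integral>\<^sup>+y. ?a (h x - y) * ?b (h x) \<partial>lborel) \<partial>lborel)"
    by (rule lborel_pair.Fubini') measurable
  also have "\<dots> = (\<integral>\<^sup>+y. ?a y \<partial>lborel) * (\<integral>\<^sup>+x. ?b (h x) \<partial>lborel)"
    by (simp add: nn_integral_multc nn_integral_cmult nn_integral_lborel_reflect[of ?a])
  also have "(\<lambda>x. ?b (h x)) = ?b"
    by (auto simp: B_def indicator_def fun_eq_iff orthogonal_transformation_norm[OF assms])
  finally have eq: "(\<integral>\<^sup>+x. ?a (h x) \<partial>lborel) * emeasure lborel B = emeasure lborel A * emeasure lborel B"
    by simp
  have "emeasure lborel B = ennreal (unit_ball_vol (DIM('a)))"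
    unfolding B_def by (subst emeasure_ball) auto
  then have "emeasure lborel B \<noteq> 0" "emeasure lborel B \<noteq> \<infinity>"
    by (metis ennreal_eq_0_iff not_less of_nat_0_le_iff unit_ball_vol_pos) (simp add: \<open>emeasure lborel B = _\<close>)
  then have "(\<integral>\<^sup>+x. ?a (h x) \<partial>lborel) = emeasure lborel A"
    using eq by (metis ennreal_mult_cancel_left infinity_ennreal_def mult.commute)
  moreover have "(\<integral>\<^sup>+x. ?a (h x) \<partial>lborel) = emeasure (distr lborel borel h) A"
    using nn_integral_distr[of h lborel borel ?a] by simp
  ultimately show "emeasure (distr lborel borel h) A = emeasure lborel A" by simp
qed simp

lemma sets_hyperplane_measure [simp, measurable_cong]: "sets (hyperplane_measure \<xi> t) = sets borel"
  by (simp add: hyperplane_measure_def)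

lemma space_hyperplane_measure [simp]: "space (hyperplane_measure \<xi> t) = UNIV"
  by (simp add: hyperplane_measure_def)

lemma integral_hyperplane_measure:
  fixes f :: "'a::euclidean_space \<Rightarrow> complex"
  assumes [measurable]: "f \<in> borel_measurable borel"
  shows "(LINT x|hyperplane_measure \<xi> t. f x) =
    (LBINT y. indicator {0..1} (\<xi> \<bullet> y - t) *\<^sub>R f (hyperplane_proj \<xi> t y))"
proof -
  have "(LINT x|hyperplane_measure \<xi> t. f x) =
      integral\<^sup>L (restrict_space lborel {y. t \<le> \<xi> \<bullet> y \<and> \<xi> \<bullet> y \<le> t + 1}) (\<lambda>y. f (hyperplane_proj \<xi> t y))"
    unfolding hyperplane_measure_def
    by (intro integral_distr measurable_restrict_space1) simp_all
  also have "\<dots> = (LBINT y. indicator {y. t \<le> \<xi> \<bullet> y \<and> \<xi> \<bullet> y \<le> t + 1} y *\<^sub>R f (hyperplane_proj \<xi> t y))"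
    by (rule integral_restrict_space) simp
  also have "\<dots> = (LBINT y. indicator {0..1} (\<xi> \<bullet> y - t) *\<^sub>R f (hyperplane_proj \<xi> t y))"
    by (rule Bochner_Integration.integral_cong) (auto simp: indicator_def)
  finally show ?thesis .
qed

lemma hyperplane_measure_translate:
  assumes "\<xi> \<bullet> a = 0"
  shows "distr (hyperplane_measure \<xi> t) borel (\<lambda>x. x + a) = hyperplane_measure \<xi> t"
proof (rule measure_eqI)
  fix A assume "A \<in> sets (distr (hyperplane_measure \<xi> t) borel (\<lambda>x. x + a))"
  then have [measurable]: "A \<in> sets borel" by simp
  have [measurable]: "(\<lambda>x. x + a) \<in> hyperplane_measure \<xi> t \<rightarrow>\<^sub>M borel" by simp
  have "emeasure (distr (hyperplane_measure \<xi> t) borel (\<lambda>x. x + a)) A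
      = (\<integral>\<^sup>+x. indicator A (x + a) \<partial>hyperplane_measure \<xi> t)"
    using nn_integral_distr[of "\<lambda>x. x + a" "hyperplane_measure \<xi> t" borel "indicator A"] by simp
  also have "\<dots> = emeasure (hyperplane_measure \<xi> t) A"
    by (subst hyperplane_measure_translation) (simp_all add: assms)
  finally show "emeasure (distr (hyperplane_measure \<xi> t) borel (\<lambda>x. x + a)) A = emeasure (hyperplane_measure \<xi> t) A" .
qed simp

lemma integral_hyperplane_translate:
  fixes f :: "'a::euclidean_space \<Rightarrow> complex"
  assumes "\<xi> \<bullet> a = 0" and [measurable]: "f \<in> borel_measurable borel"
  shows "(LINT x|hyperplane_measure \<xi> t. f (x + a)) = (LINT x|hyperplane_measure \<xi> t. f x)"
  by (subst (2) hyperplane_measure_translate[OF assms(1), symmetric], subst integral_distr) simp_all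

lemma emeasure_hyperplane_cball:
  fixes \<xi> :: "'a::euclidean_space"
  assumes "\<xi> \<noteq> 0"
  shows "emeasure (hyperplane_measure \<xi> t) (cball (0::'a) R) < \<infinity>"
proof -
  \<comment> \<open>The prism over the part of the hyperplane in the ball has height 1 / norm \<xi>,
    hence lies in the ball enlarged by that amount.\<close>
  define c where "c = R + inverse (norm \<xi>)"
  have [measurable]: "(indicator (cball 0 R) :: 'a \<Rightarrow> ennreal) \<in> borel_measurable borel"
    by (intro borel_measurable_indicator borel_closed closed_cball)
  have "emeasure (hyperplane_measure \<xi> t) (cball (0::'a) R)
      = (\<integral>\<^sup>+y. indicator (cball (0::'a) R) (hyperplane_proj \<xi> t y) * indicator {0..1} (\<xi> \<bullet> y - t) \<partial>lborel)"
    using nn_integral_indicator[of "cball (0::'a) R" "hyperplane_measure \<xi> t"] borel_closed[OF closed_cball, of "0::'a" R]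
    by (subst nn_integral_hyperplane_measure[symmetric]; measurable)
  also have "\<dots> \<le> (\<integral>\<^sup>+y. indicator (cball (0::'a) c) y \<partial>lborel)"
  proof (rule nn_integral_mono)
    fix y :: 'a
    have "norm y \<le> c" if "norm (hyperplane_proj \<xi> t y) \<le> R" "0 \<le> \<xi> \<bullet> y - t" "\<xi> \<bullet> y - t \<le> 1"
    proof -
      have "norm y \<le> norm (hyperplane_proj \<xi> t y) + norm (((\<xi> \<bullet> y - t) / (\<xi> \<bullet> \<xi>)) *\<^sub>R \<xi>)"
        unfolding hyperplane_proj_def by (metis diff_add_cancel norm_triangle_ineq)
      also have "norm (((\<xi> \<bullet> y - t) / (\<xi> \<bullet> \<xi>)) *\<^sub>R \<xi>) = (\<xi> \<bullet> y - t) / norm \<xi>"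
        using that assms by (simp add: dot_square_norm power2_eq_square)
      also have "\<dots> \<le> inverse (norm \<xi>)"
        using that assms by (simp add: divide_inverse mult_left_le_one_le)
      finally show ?thesis using that by (simp add: c_def)
    qed
    then show "indicator (cball (0::'a) R) (hyperplane_proj \<xi> t y) * indicator {0..1} (\<xi> \<bullet> y - t) \<le> (indicator (cball (0::'a) c) y :: ennreal)"
      by (auto simp: indicator_def)
  qed
  also have "\<dots> = emeasure lborel (cball (0::'a) c)" by simp
  also have "\<dots> < \<infinity>" by (rule emeasure_bounded_finite) simp
  finally show ?thesis .
qed

text \<open>What integration over hyperplanes off the origin needs of a function in
  \<open>C_plus\<close>; there is no control at 0.\<close>

definition bsupp :: "('a::real_normed_vector \<Rightarrow> complex) \<Rightarrow> bool" where
  "bsupp f \<longleftrightarrow> continuous_on (- {0}) f \<and> bounded {x. f x \<noteq> 0}"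

lemma bsupp_measurable [measurable_dest]:
  fixes f :: "'a::euclidean_space \<Rightarrow> complex"
  assumes "bsupp f" shows "f \<in> borel_measurable borel"
proof -
  have "(\<lambda>x. indicator (- {0}) x *\<^sub>R f x + indicator {0} x *\<^sub>R f 0) \<in> borel_measurable borel"
    using assms by (intro borel_measurable_add borel_measurable_continuous_on_indicator borel_measurable_scaleR)
      (auto simp: bsupp_def)
  moreover have "(\<lambda>x. indicator (- {0}) x *\<^sub>R f x + indicator {0} x *\<^sub>R f 0) = f"
    by (auto simp: indicator_def fun_eq_iff)
  ultimately show ?thesis by simp
qed

lemma bsupp_bound:
  fixes f :: "'a::euclidean_space \<Rightarrow> complex"
  assumes "bsupp f"
  obtains R where "R > 0" "\<And>x. norm x > R \<Longrightarrow> f x = 0"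
proof -
  obtain R where "\<forall>x\<in>{x. f x \<noteq> 0}. norm x \<le> R"
    using assms by (auto simp: bsupp_def bounded_iff)
  then show ?thesis using that[of "max R 1"] by fastforce
qed

lemma bsupp_bounded_annulus:
  fixes f :: "'a::euclidean_space \<Rightarrow> complex"
  assumes "bsupp f" "d > 0"
  obtains B where "B > 0" "\<And>x. norm x \<ge> d \<Longrightarrow> norm (f x) \<le> B"
proof -
  obtain R where R: "R > 0" "\<And>x. norm x > R \<Longrightarrow> f x = 0" using bsupp_bound[OF assms(1)] by blast
  have "compact (cball (0::'a) R - ball 0 d)" by (intro compact_diff compact_cball open_ball)
  moreover have "continuous_on (cball (0::'a) R - ball 0 d) f"
    using assms by (auto simp: bsupp_def intro: continuous_on_subset)
  ultimately have "bounded (f ` (cball (0::'a) R - ball 0 d))"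
    by (intro compact_imp_bounded compact_continuous_image)
  then obtain B where B: "B > 0" "\<And>x. x \<in> cball (0::'a) R - ball 0 d \<Longrightarrow> norm (f x) \<le> B"
    by (auto simp: bounded_pos)
  then have "norm (f x) \<le> B" if "norm x \<ge> d" for x
    using R(2)[of x] that by (cases "norm x > R") auto
  then show ?thesis using that B by blast
qed

lemma hyperplane_norm_ge:
  fixes \<xi> x :: "'a::real_inner"
  assumes "\<xi> \<noteq> 0" "\<xi> \<bullet> x = t" shows "norm x \<ge> \<bar>t\<bar> / norm \<xi>"
  using Cauchy_Schwarz_ineq2[of \<xi> x] assms by (simp add: pos_divide_le_eq mult.commute)

text \<open>The hyperplane keeps the distance \<bar>t\<bar> / norm \<xi> from the origin, where f is
  bounded, and f lives on a ball of finite measure.\<close>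

lemma integrable_hyperplane:
  fixes f :: "'a::euclidean_space \<Rightarrow> complex"
  assumes "bsupp f" "\<xi> \<noteq> 0" "t \<noteq> 0"
  shows "integrable (hyperplane_measure \<xi> t) f"
proof -
  have d: "\<bar>t\<bar> / norm \<xi> > 0" using assms by simp
  obtain R where R: "R > 0" "\<And>x. norm x > R \<Longrightarrow> f x = 0" using bsupp_bound[OF assms(1)] by blast
  obtain B where B: "B > 0" "\<And>x. norm x \<ge> \<bar>t\<bar> / norm \<xi> \<Longrightarrow> norm (f x) \<le> B"
    using bsupp_bounded_annulus[OF assms(1) d] by blast
  have [measurable]: "f \<in> borel_measurable borel" using assms(1) by (rule bsupp_measurable)
  show ?thesis
  proof (rule integrableI_bounded_set[where A = "cball 0 R" and B = B])
    show "AE x in hyperplane_measure \<xi> t. x \<in> cball 0 R \<longrightarrow> norm (f x) \<le> B"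
      using hyperplane_measure_concentrated[OF assms(2)]
      by eventually_elim (use B hyperplane_norm_ge[OF assms(2)] in auto)
    show "AE x in hyperplane_measure \<xi> t. x \<notin> cball 0 R \<longrightarrow> f x = 0"
      using R by auto
  qed (use emeasure_hyperplane_cball[OF assms(2)] in auto)
qed

lemma bsupp_mult_left:
  fixes f :: "'a::euclidean_space \<Rightarrow> complex"
  assumes "bsupp f" "continuous_on UNIV g" shows "bsupp (\<lambda>x. f x * g x)"
proof -
  have "bounded {x. f x * g x \<noteq> 0}"
    using assms(1) by (auto simp: bsupp_def intro: bounded_subset)
  moreover have "continuous_on (- {0}) g"
    using assms(2) continuous_on_subset by blast
  ultimately show ?thesis
    using assms(1) by (simp add: bsupp_def continuous_on_mult)
qed

lemma bsupp_add:
  fixes f :: "'a::euclidean_space \<Rightarrow> complex"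
  assumes "bsupp f" "bsupp g" shows "bsupp (\<lambda>x. f x + g x)"
proof -
  have "bounded ({x. f x \<noteq> 0} \<union> {x. g x \<noteq> 0})"
    using assms by (simp add: bsupp_def)
  then have "bounded {x. f x + g x \<noteq> 0}"
    by (rule bounded_subset) auto
  then show ?thesis
    using assms by (simp add: bsupp_def continuous_on_add)
qed

lemma has_vector_derivative_0_LIM:
  assumes "(f has_vector_derivative D) (at 0)"
  shows "((\<lambda>s. (f s - f 0) /\<^sub>R s) \<longlongrightarrow> D) (at 0)"
proof -
  have "((\<lambda>s. (1 / norm s) *\<^sub>R (f s - (f 0 + s *\<^sub>R D))) \<longlongrightarrow> 0) (at 0)"
    using assms by (simp add: has_vector_derivative_def has_derivative_at2)
  then have "((\<lambda>s. norm ((1 / norm s) *\<^sub>R (f s - (f 0 + s *\<^sub>R D)))) \<longlongrightarrow> 0) (at 0)"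
    by (rule tendsto_norm_zero)
  moreover have "\<forall>\<^sub>F s in at 0. norm ((1 / norm s) *\<^sub>R (f s - (f 0 + s *\<^sub>R D))) = norm ((f s - f 0) /\<^sub>R s - D)"
    unfolding eventually_at_filter
  proof (intro always_eventually allI impI)
    fix s :: real assume s: "s \<noteq> 0"
    have "(f s - f 0) /\<^sub>R s - D = (1 / s) *\<^sub>R (f s - (f 0 + s *\<^sub>R D))"
      using s by (simp add: scaleR_diff_right scaleR_add_right inverse_eq_divide)
    then show "norm ((1 / norm s) *\<^sub>R (f s - (f 0 + s *\<^sub>R D))) = norm ((f s - f 0) /\<^sub>R s - D)"
      by simp
  qed
  ultimately have "((\<lambda>s. norm ((f s - f 0) /\<^sub>R s - D)) \<longlongrightarrow> 0) (at 0)"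
    by (simp cong: tendsto_cong add: filterlim_cong)
  then show ?thesis
    by (simp add: tendsto_norm_zero_iff LIM_zero_iff)
qed

text \<open>Integration by parts along the hyperplane is translation invariance, differentiated.\<close>

lemma integral_hyperplane_dird:
  fixes F :: "'a::euclidean_space \<Rightarrow> complex"
  assumes F: "bsupp F" "bsupp (dird a F)" "\<And>x. x \<noteq> 0 \<Longrightarrow> F differentiable at x"
    and \<xi>: "\<xi> \<noteq> 0" "t \<noteq> 0" "\<xi> \<bullet> a = 0"
  shows "(LINT x|hyperplane_measure \<xi> t. dird a F x) = 0"
proof -
  have d: "\<bar>t\<bar> / norm \<xi> > 0" using \<xi> by simp
  obtain R where R: "R > 0" "\<And>x. norm x > R \<Longrightarrow> F x = 0" using bsupp_bound[OF F(1)] by blast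
  obtain B where B: "B > 0" "\<And>x. norm x \<ge> \<bar>t\<bar> / norm \<xi> \<Longrightarrow> norm (dird a F x) \<le> B"
    using bsupp_bounded_annulus[OF F(2) d] by blast
  have [measurable]: "F \<in> borel_measurable borel" "dird a F \<in> borel_measurable borel"
    using F by (auto intro: bsupp_measurable)
  define H where "H = hyperplane_measure \<xi> t"
  have [measurable_cong]: "sets H = sets borel" by (simp add: H_def)
  have H: "AE x in H. \<xi> \<bullet> x = t" unfolding H_def by (rule hyperplane_measure_concentrated[OF \<xi>(1)])
  define e where "e n = 1 / real (Suc n)" for n
  have e: "e n > 0" "e n \<le> 1" for n by (auto simp: e_def)
  define g where "g n x = of_real (1 / e n) * (F (x + e n *\<^sub>R a) - F x)" for n x
  have [measurable]: "g n \<in> borel_measurable H" for n unfolding g_def by measurable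
  have curve: "((\<lambda>s. F (x + s *\<^sub>R a)) has_vector_derivative dird a F (x + s *\<^sub>R a)) (at s)"
    if "\<xi> \<bullet> x = t" for x s
  proof -
    have "\<xi> \<bullet> (x + s *\<^sub>R a) = t" using that \<xi> by (simp add: inner_add_right)
    then have "x + s *\<^sub>R a \<noteq> 0" using \<xi> by auto
    then have "(F has_derivative (\<lambda>v. dird v F (x + s *\<^sub>R a))) (at (x + s *\<^sub>R a))"
      using F(3) dird_works by blast
    moreover have "((\<lambda>s. x + s *\<^sub>R a) has_derivative (\<lambda>v. v *\<^sub>R a)) (at s)"
      by (auto intro!: derivative_eq_intros)
    ultimately have "((\<lambda>s. F (x + s *\<^sub>R a)) has_derivative (\<lambda>v. dird (v *\<^sub>R a) F (x + s *\<^sub>R a))) (at s)"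
      using has_derivative_compose by blast
    moreover have "dird (v *\<^sub>R a) F (x + s *\<^sub>R a) = v *\<^sub>R dird a F (x + s *\<^sub>R a)" for v
      using \<open>(F has_derivative _) _\<close> has_derivative_linear linear_scale by blast
    ultimately show ?thesis by (simp add: has_vector_derivative_def)
  qed
  \<comment> \<open>The difference quotients are dominated: the segment from x to x + e n a stays in
    the hyperplane, hence away from 0, where the derivative is bounded by \<open>B\<close>. As e n
    \<le> 1, all quotients vanish outside the ball of radius \<open>R + norm a\<close>.\<close>
  have "(\<lambda>n. integral\<^sup>L H (g n)) \<longlonglongrightarrow> integral\<^sup>L H (dird a F)"
  proof (rule integral_dominated_convergence[where w = "\<lambda>x. B * indicator (cball 0 (R + norm a)) x"])
    show "integrable H (\<lambda>x. B * indicator (cball 0 (R + norm a)) x)"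
      using emeasure_hyperplane_cball[OF \<xi>(1)] by (intro integrable_mult_right integrable_real_indicator) (auto simp: H_def)
    show "AE x in H. (\<lambda>n. g n x) \<longlonglongrightarrow> dird a F x"
      using H
    proof eventually_elim
      fix x assume x: "\<xi> \<bullet> x = t"
      have "((\<lambda>s. (F (x + s *\<^sub>R a) - F x) /\<^sub>R s) \<longlongrightarrow> dird a F x) (at 0)"
        using has_vector_derivative_0_LIM[OF curve[OF x, of 0]] by simp
      moreover have "filterlim e (at 0) sequentially"
        unfolding e_def filterlim_at using LIMSEQ_inverse_real_of_nat by (simp add: inverse_eq_divide)
      ultimately have "(\<lambda>n. (F (x + e n *\<^sub>R a) - F x) /\<^sub>R e n) \<longlonglongrightarrow> dird a F x"
        by (rule filterlim_compose)
      then show "(\<lambda>n. g n x) \<longlonglongrightarrow> dird a F x"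
        by (simp add: g_def scaleR_conv_of_real divide_inverse)
    qed
    show "AE x in H. norm (g n x) \<le> B * indicator (cball 0 (R + norm a)) x" for n
      using H
    proof eventually_elim
      fix x assume x: "\<xi> \<bullet> x = t"
      show "norm (g n x) \<le> B * indicator (cball 0 (R + norm a)) x"
      proof (cases "norm x \<le> R + norm a")
        case True
        have "norm (F (x + e n *\<^sub>R a) - F (x + 0 *\<^sub>R a)) \<le> B * e n - B * 0"
        proof (rule differentiable_bound_general[of 0 "e n" "\<lambda>s. F (x + s *\<^sub>R a)" "\<lambda>s. B * s" "\<lambda>s. dird a F (x + s *\<^sub>R a)" "\<lambda>s. B"])
          show "continuous_on {0..e n} (\<lambda>s. F (x + s *\<^sub>R a))"
            using curve[OF x] by (meson continuous_at_imp_continuous_on has_vector_derivative_continuous)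
          fix s
          have "\<xi> \<bullet> (x + s *\<^sub>R a) = t" using x \<xi> by (simp add: inner_add_right)
          then show "norm (dird a F (x + s *\<^sub>R a)) \<le> B"
            using B(2) hyperplane_norm_ge[OF \<xi>(1)] by blast
          show "((*) B has_vector_derivative B) (at s)"
            by (auto intro!: derivative_eq_intros simp: has_real_derivative_iff_has_vector_derivative[symmetric])
        qed (use e curve[OF x] in \<open>auto intro!: continuous_intros\<close>)
        then have "norm (F (x + e n *\<^sub>R a) - F x) \<le> B * e n" by simp
        then show ?thesis
          using True e[of n] by (simp add: g_def norm_mult norm_divide pos_divide_le_eq)
      next
        case False
        have "norm (e n *\<^sub>R a) \<le> norm a" using e[of n] by (simp add: mult_left_le_one_le)
        then have "norm (x + e n *\<^sub>R a) > R"
          using False norm_triangle_ineq4[of "x + e n *\<^sub>R a" "e n *\<^sub>R a"] by simp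
        moreover have "norm x > R" using False by (smt (verit) norm_ge_zero)
        ultimately show ?thesis using False R(2) by (simp add: g_def)
      qed
    qed
  qed measurable
  moreover have "integral\<^sup>L H (g n) = 0" for n
  proof -
    have i: "integrable H F" unfolding H_def by (rule integrable_hyperplane[OF F(1) \<xi>(1,2)])
    have tr: "(\<lambda>x. x + e n *\<^sub>R a) \<in> measurable H borel" by simp
    have "integrable (distr H borel (\<lambda>x. x + e n *\<^sub>R a)) F"
      using i \<xi>(3) by (simp add: H_def hyperplane_measure_translate)
    then have i': "integrable H (\<lambda>x. F (x + e n *\<^sub>R a))"
      by (simp add: integrable_distr_eq[OF tr])
    have "(LINT x|H. F (x + e n *\<^sub>R a)) = (LINT x|H. F x)"
      unfolding H_def by (rule integral_hyperplane_translate) (use \<xi> in auto)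
    then show ?thesis
      unfolding g_def using i i' by simp
  qed
  ultimately show ?thesis
    unfolding H_def by (simp add: LIMSEQ_const_iff)
qed


section \<open>Radial functions on hyperplanes, integrated coordinate by coordinate\<close>

interpretation lborel_product: product_sigma_finite "\<lambda>_. lborel :: real measure"
  by standard

lemma integrable_PiM_bounded:
  fixes g :: "('i \<Rightarrow> real) \<Rightarrow> complex"
  assumes "finite J" "g \<in> borel_measurable (Pi\<^sub>M J (\<lambda>_. lborel))"
    and "\<And>f. norm (g f) \<le> B" "\<And>f j. j \<in> J \<Longrightarrow> f j \<notin> {l j..u j} \<Longrightarrow> g f = 0"
  shows "integrable (Pi\<^sub>M J (\<lambda>_. lborel)) g"
proof (rule integrableI_bounded_set[where A = "PiE J (\<lambda>j. {l j..u j})" and B = B])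
  show "PiE J (\<lambda>j. {l j..u j}) \<in> sets (Pi\<^sub>M J (\<lambda>_. lborel))"
    using assms(1) by (intro sets_PiM_I_finite) auto
  have "emeasure (Pi\<^sub>M J (\<lambda>_. lborel)) (PiE J (\<lambda>j. {l j..u j})) = (\<Prod>j\<in>J. emeasure lborel {l j..u j})"
    using assms(1) by (intro lborel_product.emeasure_PiM) auto
  also have "\<dots> < \<infinity>"
    by (auto simp: less_top[symmetric] ennreal_prod_eq_top emeasure_lborel_Icc_eq)
  finally show "emeasure (Pi\<^sub>M J (\<lambda>_. lborel)) (PiE J (\<lambda>j. {l j..u j})) < \<infinity>" .
  show "AE f in Pi\<^sub>M J (\<lambda>_. lborel). f \<notin> PiE J (\<lambda>j. {l j..u j}) \<longrightarrow> g f = 0"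
  proof (rule AE_I2, intro impI)
    fix f assume "f \<in> space (Pi\<^sub>M J (\<lambda>_. lborel :: real measure))" "f \<notin> PiE J (\<lambda>j. {l j..u j})"
    then obtain j where "j \<in> J" "f j \<notin> {l j..u j}"
      by (auto simp: space_PiM PiE_def Pi_def)
    then show "g f = 0" using assms(4) by blast
  qed
qed (use assms in auto)

lemma fplus_bounded_from:
  assumes "U \<in> fplus" "q > 0"
  obtains B where "\<And>x. x \<ge> q \<Longrightarrow> norm (U x) \<le> B"
proof -
  obtain R where R: "R > 0" "\<And>x. x \<ge> R \<Longrightarrow> U x = 0" using fplus_bound[OF assms(1)] by blast
  have "compact (U ` {q..R})"
    using assms by (intro compact_continuous_image fplus_continuous) auto
  then obtain B where B: "B > 0" "\<And>x. x \<in> {q..R} \<Longrightarrow> norm (U x) \<le> B"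
    using compact_imp_bounded[of "U ` {q..R}"] by (auto simp: bounded_pos)
  have "norm (U x) \<le> B" if "x \<ge> q" for x
    using B R(2)[of x] that by (cases "x \<le> R") auto
  then show ?thesis using that by blast
qed

text \<open>On the nonpositive reals U is arbitrary and may fail to be measurable. The indicator
  removes that part, and q plus a sum of squares never reaches it.\<close>

lemma fplus_measurable_from:
  assumes "U \<in> fplus" "q > 0"
  shows "(\<lambda>x. indicator {q..} x *\<^sub>R U x) \<in> borel_measurable borel"
  using assms by (intro borel_measurable_continuous_on_indicator fplus_continuous) auto

lemma measurable_fplus_sum_squares:
  assumes "finite J" "I \<subseteq> J" "U \<in> fplus" "q > 0"
  shows "(\<lambda>f. U (q + (\<Sum>i\<in>I. (f i)\<^sup>2))) \<in> borel_measurable (Pi\<^sub>M J (\<lambda>_. lborel))"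
proof -
  have "(\<lambda>f. q + (\<Sum>i\<in>I. (f i)\<^sup>2)) \<in> borel_measurable (Pi\<^sub>M J (\<lambda>_. lborel))"
    using assms(2) by (intro borel_measurable_add borel_measurable_sum borel_measurable_power
        measurable_component_singleton[of _ J "\<lambda>_. lborel", simplified]) auto
  from measurable_compose[OF this fplus_measurable_from[OF assms(3,4)]]
  show ?thesis by (simp add: sum_nonneg)
qed

text \<open>Integrating out one coordinate replaces U by \<open>line_int U\<close> and leaves an
  integral of the same form; therefore U varies in the induction.\<close>

lemma line_int_PiM:
  assumes "finite I" "U \<in> fplus" "q > 0"
  shows "(LINT f|Pi\<^sub>M I (\<lambda>_. lborel). U (q + (\<Sum>i\<in>I. (f i)\<^sup>2))) = (line_int ^^ card I) U q"
  using assms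
proof (induction I arbitrary: U rule: finite_induct)
  case empty
  then show ?case by (simp add: PiM_empty lebesgue_integral_count_space_finite)
next
  case (insert i I)
  obtain R where R: "R > 0" "\<And>x. x \<ge> R \<Longrightarrow> U x = 0" using fplus_bound[OF insert.prems(1)] by blast
  obtain B where B: "\<And>x. x \<ge> q \<Longrightarrow> norm (U x) \<le> B" using fplus_bounded_from[OF insert.prems] by blast
  have "integrable (Pi\<^sub>M (insert i I) (\<lambda>_. lborel)) (\<lambda>f. U (q + (\<Sum>i\<in>insert i I. (f i)\<^sup>2)))"
  proof (rule integrable_PiM_bounded[where B = B and l = "\<lambda>_. - (1 + R)" and u = "\<lambda>_. 1 + R"])
    show "norm (U (q + (\<Sum>i\<in>insert i I. (f i)\<^sup>2))) \<le> B" for f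
      by (rule B) (simp add: sum_nonneg)
    fix f j assume j: "j \<in> insert i I" "f j \<notin> {- (1 + R)..1 + R}"
    then have "R \<le> (f j)\<^sup>2" using square_ge[OF R(1), of "f j"] by auto
    also have "\<dots> \<le> (\<Sum>i\<in>insert i I. (f i)\<^sup>2)"
      using j insert by (intro member_le_sum) auto
    finally show "U (q + (\<Sum>i\<in>insert i I. (f i)\<^sup>2)) = 0"
      using insert.prems by (intro R(2)) simp
  qed (use insert in \<open>auto intro!: measurable_fplus_sum_squares simp del: sum.insert\<close>)
  then have "(LINT f|Pi\<^sub>M (insert i I) (\<lambda>_. lborel). U (q + (\<Sum>i\<in>insert i I. (f i)\<^sup>2)))
      = (LINT f|Pi\<^sub>M I (\<lambda>_. lborel). (LBINT y. U (q + (\<Sum>j\<in>insert i I. ((f(i := y)) j)\<^sup>2))))"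
    using insert by (intro lborel_product.product_integral_insert) auto
  also have "\<dots> = (LINT f|Pi\<^sub>M I (\<lambda>_. lborel). line_int U (q + (\<Sum>j\<in>I. (f j)\<^sup>2)))"
  proof (rule Bochner_Integration.integral_cong[OF refl])
    fix f
    have "(\<Sum>j\<in>insert i I. ((f(i := y)) j)\<^sup>2) = (\<Sum>j\<in>I. (f j)\<^sup>2) + y\<^sup>2" for y :: real
    proof -
      have "(\<Sum>j\<in>I. ((f(i := y)) j)\<^sup>2) = (\<Sum>j\<in>I. (f j)\<^sup>2)"
        using insert by (intro sum.cong) auto
      then show ?thesis
        by (simp only: sum.insert[OF insert.hyps(1,2)]) (simp add: add.commute)
    qed
    then show "(LBINT y. U (q + (\<Sum>j\<in>insert i I. ((f(i := y)) j)\<^sup>2))) = line_int U (q + (\<Sum>j\<in>I. (f j)\<^sup>2))"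
      by (simp add: line_int_def add.assoc)
  qed
  also have "\<dots> = (line_int ^^ card I) (line_int U) q"
    by (rule insert.IH[OF line_int_fplus[OF insert.prems(1)] insert.prems(2)])
  finally show ?case using insert by (simp add: funpow_swap1)
qed

lemma bsupp_radial:
  assumes "U \<in> fplus" shows "bsupp (\<lambda>x::'a::euclidean_space. U (x \<bullet> x))"
proof -
  obtain R where R: "R > 0" "\<And>x. x \<ge> R \<Longrightarrow> U x = 0" using fplus_bound[OF assms] by blast
  have "norm x \<le> 1 + R" if "U (x \<bullet> x) \<noteq> 0" for x :: 'a
    using square_ge[OF R(1), of "norm x"] R(2)[of "x \<bullet> x"] that by (force simp: power2_norm_eq_inner)
  then have "bounded {x::'a. U (x \<bullet> x) \<noteq> 0}" by (auto simp: bounded_iff)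
  moreover have "continuous_on (- {0}) (\<lambda>x::'a. U (x \<bullet> x))"
    by (rule continuous_on_compose2[OF fplus_continuous[OF assms, of "{0<..}"]])
      (auto intro!: continuous_intros)
  ultimately show ?thesis by (simp add: bsupp_def)
qed

text \<open>Rotate \<xi> to a multiple of a coordinate vector e. The coordinate along e then enters
  only through the slab of the prism and contributes its thickness 1 / norm \<xi>; each of the n - 1
  others contributes one \<open>line_int\<close>, starting from the squared distance of the
  hyperplane to the origin.\<close>

lemma integral_hyperplane_radial:
  fixes \<xi> :: "real^'n"
  assumes U: "U \<in> fplus" and \<xi>: "\<xi> \<noteq> 0"
  shows "(LINT x|hyperplane_measure \<xi> 1. U (x \<bullet> x))
    = of_real (1 / norm \<xi>) * (line_int ^^ (CARD('n) - 1)) U ((1 / norm \<xi>)\<^sup>2)"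
proof -
  define \<rho> where "\<rho> = norm \<xi>"
  have \<rho>: "\<rho> > 0" using \<xi> by (simp add: \<rho>_def)
  define q where "q = (1 / \<rho>)\<^sup>2"
  have q: "q > 0" using \<rho> by (simp add: q_def)
  obtain i :: 'n where True by blast
  define e :: "real^'n" where "e = axis i 1"
  have e: "norm e = 1" "e \<in> Basis" by (auto simp: e_def Basis_vec_def)
  obtain h where h: "orthogonal_transformation h" "h e = \<xi> /\<^sub>R \<rho>"
    using orthogonal_transformation_exists_1[of e "\<xi> /\<^sub>R \<rho>"] e \<rho> by (auto simp: \<rho>_def)
  have \<xi>h: "\<xi> = \<rho> *\<^sub>R h e" using h \<rho> by simp
  have inner_h: "h v \<bullet> h w = v \<bullet> w" for v w
    using h(1) by (simp add: orthogonal_transformation_def)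
  have [measurable]: "h \<in> borel_measurable borel"
    using orthogonal_transformation_linear[OF h(1)]
    by (intro borel_measurable_continuous_onI linear_continuous_on linear_conv_bounded_linear[THEN iffD1])
  have [measurable]: "(\<lambda>x::real^'n. U (x \<bullet> x)) \<in> borel_measurable borel"
    by (rule bsupp_measurable[OF bsupp_radial[OF U]])
  let ?V = "\<lambda>z. indicator {0..1} (\<rho> * (e \<bullet> z) - 1) *\<^sub>R U (q + (z \<bullet> z - (e \<bullet> z)\<^sup>2)) :: complex"
  have V: "indicator {0..1} (\<xi> \<bullet> h z - 1) *\<^sub>R U (hyperplane_proj \<xi> 1 (h z) \<bullet> hyperplane_proj \<xi> 1 (h z)) = ?V z" for z
  proof -
    have s: "\<xi> \<bullet> h z = \<rho> * (e \<bullet> z)" by (simp add: \<xi>h inner_h)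
    have r: "\<xi> \<bullet> \<xi> = \<rho>\<^sup>2" by (simp add: \<rho>_def power2_norm_eq_inner)
    have "hyperplane_proj \<xi> 1 (h z) \<bullet> hyperplane_proj \<xi> 1 (h z)
        = z \<bullet> z - 2 * ((\<rho> * (e \<bullet> z) - 1) / \<rho>\<^sup>2) * (\<rho> * (e \<bullet> z)) + ((\<rho> * (e \<bullet> z) - 1) / \<rho>\<^sup>2)\<^sup>2 * \<rho>\<^sup>2"
    proof -
      have "(v - c *\<^sub>R \<xi>) \<bullet> (v - c *\<^sub>R \<xi>) = v \<bullet> v - 2 * c * (\<xi> \<bullet> v) + c\<^sup>2 * (\<xi> \<bullet> \<xi>)" for v c
        by (simp add: inner_diff_left inner_diff_right inner_commute[of v \<xi>] power2_eq_square algebra_simps)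
      then show ?thesis by (simp only: hyperplane_proj_def s r inner_h)
    qed
    also have "\<dots> = q + (z \<bullet> z - (e \<bullet> z)\<^sup>2)"
      unfolding q_def using \<rho> by (simp add: field_simps power2_eq_square)
    finally show ?thesis by (simp add: s)
  qed
  have V_meas: "?V \<in> borel_measurable borel"
  proof -
    have "(\<lambda>z. indicator {0..1} (\<xi> \<bullet> h z - 1) *\<^sub>R U (hyperplane_proj \<xi> 1 (h z) \<bullet> hyperplane_proj \<xi> 1 (h z))) \<in> borel_measurable borel"
      by (intro borel_measurable_scaleR measurable_compose[OF _ \<open>(\<lambda>x. U (x \<bullet> x)) \<in> _\<close>]) measurable
    then show ?thesis by (simp only: V)
  qed
  define I where "I = (Basis :: (real^'n) set) - {e}"
  have Basis: "Basis = insert e I" "finite I" "e \<notin> I" using e by (auto simp: I_def)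
  have card_I: "card I = CARD('n) - 1" using e by (simp add: I_def card_Diff_singleton)
  let ?S = "\<lambda>f. \<Sum>b\<in>Basis. f b *\<^sub>R b :: real^'n"
  let ?W = "\<lambda>f. indicator {0..1} (\<rho> * f e - 1) *\<^sub>R U (q + (\<Sum>b\<in>I. (f b)\<^sup>2)) :: complex"
  have W: "?V (?S f) = ?W f" for f
  proof -
    have "e \<bullet> ?S f = f e" using e by (simp add: inner_sum_right inner_Basis if_distrib cong: if_cong)
    moreover have "?S f \<bullet> ?S f = (\<Sum>b\<in>Basis. (f b)\<^sup>2)"
      by (simp add: euclidean_inner[of "?S f" "?S f"] power2_eq_square)
    moreover have "(\<Sum>b\<in>Basis. (f b)\<^sup>2) = (f e)\<^sup>2 + (\<Sum>b\<in>I. (f b)\<^sup>2)"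
      by (simp only: Basis(1) sum.insert[OF Basis(2,3)])
    ultimately show ?thesis by simp
  qed
  have S_meas: "?S \<in> measurable (Pi\<^sub>M Basis (\<lambda>_. lborel)) borel" by measurable
  have "(LINT x|hyperplane_measure \<xi> 1. U (x \<bullet> x))
      = (LBINT y. indicator {0..1} (\<xi> \<bullet> y - 1) *\<^sub>R U (hyperplane_proj \<xi> 1 y \<bullet> hyperplane_proj \<xi> 1 y))"
    by (rule integral_hyperplane_measure) measurable
  also have "\<dots> = (LBINT z. ?V z)"
    unfolding V[symmetric]
    by (subst lborel_distr_orthogonal[OF h(1), symmetric], rule integral_distr)
      (auto intro!: borel_measurable_scaleR measurable_compose[OF _ \<open>(\<lambda>x. U (x \<bullet> x)) \<in> _\<close>])
  also have "\<dots> = (LINT f|Pi\<^sub>M Basis (\<lambda>_. lborel). ?V (?S f))"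
    by (subst lborel_eq, rule integral_distr[OF S_meas V_meas])
  also have "\<dots> = (LINT f|Pi\<^sub>M (insert e I) (\<lambda>_. lborel). ?W f)"
    by (simp only: W Basis(1)[symmetric])
  also have "\<dots> = (LINT f|Pi\<^sub>M I (\<lambda>_. lborel). (LBINT y. ?W (f(e := y))))"
  proof (rule lborel_product.product_integral_insert[OF Basis(2,3)])
    obtain R where R: "R > 0" "\<And>x. x \<ge> R \<Longrightarrow> U x = 0" using fplus_bound[OF U] by blast
    obtain B where B: "\<And>x. x \<ge> q \<Longrightarrow> norm (U x) \<le> B" using fplus_bounded_from[OF U q] by blast
    have B0: "B \<ge> 0" using B[of q] norm_ge_zero order_trans by blast
    show "integrable (Pi\<^sub>M (insert e I) (\<lambda>_. lborel)) ?W"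
    proof (rule integrable_PiM_bounded[where B = B
          and l = "\<lambda>j. if j = e then 1 / \<rho> else - (1 + R)" and u = "\<lambda>j. if j = e then 2 / \<rho> else 1 + R"])
      show "finite (insert e I)" using Basis by simp
      show "?W \<in> borel_measurable (Pi\<^sub>M (insert e I) (\<lambda>_. lborel))"
      proof (intro borel_measurable_scaleR measurable_fplus_sum_squares)
        have "(\<lambda>f. \<rho> * f e - 1) \<in> borel_measurable (Pi\<^sub>M (insert e I) (\<lambda>_. lborel))"
          by (intro borel_measurable_diff borel_measurable_times borel_measurable_const
              measurable_component_singleton[of _ "insert e I" "\<lambda>_. lborel", simplified]) simp
        then show "(\<lambda>f. indicator {0..1} (\<rho> * f e - 1) :: real) \<in> borel_measurable (Pi\<^sub>M (insert e I) (\<lambda>_. lborel))"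
          by (rule measurable_compose) simp
      qed (use Basis U q in auto)
      show "norm (?W f) \<le> B" for f
        using B[of "q + (\<Sum>b\<in>I. (f b)\<^sup>2)"] B0 by (auto simp: indicator_def sum_nonneg)
      fix f j assume j: "j \<in> insert e I"
        "f j \<notin> {if j = e then 1 / \<rho> else - (1 + R)..if j = e then 2 / \<rho> else 1 + R}"
      show "?W f = 0"
      proof (cases "j = e")
        case True
        then have "\<rho> * f e - 1 \<notin> {0..1}" using j \<rho> by (auto simp: field_simps)
        then show ?thesis by simp
      next
        case False
        then have "R \<le> (f j)\<^sup>2" using j square_ge[OF R(1), of "f j"] by auto
        also have "\<dots> \<le> (\<Sum>i\<in>I. (f i)\<^sup>2)"
          using j False Basis by (intro member_le_sum) auto
        finally show ?thesis using R(2)[of "q + (\<Sum>i\<in>I. (f i)\<^sup>2)"] q by simp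
      qed
    qed
  qed
  also have "\<dots> = (LINT f|Pi\<^sub>M I (\<lambda>_. lborel). of_real (1 / \<rho>) * U (q + (\<Sum>b\<in>I. (f b)\<^sup>2)))"
  proof (rule Bochner_Integration.integral_cong[OF refl])
    fix f :: "real^'n \<Rightarrow> real"
    have "(\<Sum>b\<in>I. ((f(e := y)) b)\<^sup>2) = (\<Sum>b\<in>I. (f b)\<^sup>2)" for y
      using Basis by (intro sum.cong) auto
    moreover have "indicator {0..1} (\<rho> * y - 1) = (indicator {1 / \<rho>..2 / \<rho>} y :: real)" for y
      using \<rho> by (auto simp: indicator_def field_simps)
    ultimately have "(LBINT y. ?W (f(e := y))) = (LBINT y. indicator {1 / \<rho>..2 / \<rho>} y *\<^sub>R U (q + (\<Sum>b\<in>I. (f b)\<^sup>2)))"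
      by simp
    also have "\<dots> = of_real (1 / \<rho>) * U (q + (\<Sum>b\<in>I. (f b)\<^sup>2))"
      using \<rho> by (simp add: scaleR_conv_of_real divide_right_mono diff_divide_distrib[symmetric])
    finally show "(LBINT y. ?W (f(e := y))) = of_real (1 / \<rho>) * U (q + (\<Sum>b\<in>I. (f b)\<^sup>2))" .
  qed
  also have "\<dots> = of_real (1 / \<rho>) * (line_int ^^ card I) U q"
    using line_int_PiM[OF Basis(2) U q] by simp
  finally show ?thesis by (simp add: card_I q_def \<rho>_def)
qed

lemma hpoly_bsupp:
  assumes "U \<in> fplus" "hpoly k Q" shows "bsupp (\<lambda>x. U (x \<bullet> x) * Q x)"
  by (intro bsupp_mult_left bsupp_radial assms
      smooth_on_imp_continuous_on[OF hpoly_smooth[OF assms(2) open_UNIV]])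

text \<open>The derivative of \<open>tail_int U (x \<bullet> x)\<close> in the direction a is -2 (x
  \<bullet> a) U (x \<bullet> x). Since a is parallel to the hyperplane,
  \<open>integral_hyperplane_dird\<close> shifts this derivative to Q.\<close>

lemma integral_hyperplane_perp:
  fixes Q :: "'a::euclidean_space \<Rightarrow> complex"
  assumes U: "U \<in> fplus" and Q: "hpoly k Q" and \<xi>: "\<xi> \<noteq> 0" "\<xi> \<bullet> a = 0"
  shows "(LINT x|hyperplane_measure \<xi> 1. U (x \<bullet> x) * (of_real (x \<bullet> a) * Q x))
    = (1/2) * (LINT x|hyperplane_measure \<xi> 1. tail_int U (x \<bullet> x) * dird a Q x)"
proof -
  note V = tail_int_fplus[OF U]
  let ?F = "\<lambda>x. tail_int U (x \<bullet> x) * Q x"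
  have der: "(?F has_derivative (\<lambda>v. tail_int U (x \<bullet> x) * dird v Q x
      + ((2 * (x \<bullet> v)) *\<^sub>R (- U (x \<bullet> x))) * Q x)) (at x)" if "x \<noteq> 0" for x
  proof -
    have "((\<lambda>x. x \<bullet> x) has_derivative (\<lambda>v. 2 * (x \<bullet> v))) (at x)"
      using has_derivative_inner[OF has_derivative_ident has_derivative_ident, of x UNIV]
      by (simp add: inner_commute)
    moreover have "(tail_int U has_derivative (\<lambda>s. s *\<^sub>R (- U (x \<bullet> x)))) (at (x \<bullet> x))"
      using tail_int_has_vd[OF U, of "x \<bullet> x"] that by (simp add: has_vector_derivative_def)
    ultimately have "((\<lambda>x. tail_int U (x \<bullet> x)) has_derivative (\<lambda>v. (2 * (x \<bullet> v)) *\<^sub>R (- U (x \<bullet> x)))) (at x)"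
      by (rule has_derivative_compose)
    then show ?thesis by (intro has_derivative_mult hpoly_has_derivative[OF Q])
  qed
  let ?G = "\<lambda>x. tail_int U (x \<bullet> x) * dird a Q x" and ?H = "\<lambda>x. U (x \<bullet> x) * (of_real (x \<bullet> a) * Q x)"
  have F': "dird a ?F x = ?G x + (-2) * ?H x" if "x \<noteq> 0" for x
    using dirdI[OF der[OF that], of a] by (simp add: scaleR_conv_of_real algebra_simps)
  have bG: "bsupp ?G" by (rule hpoly_bsupp[OF V hpoly_dird[OF Q]])
  have bH: "bsupp ?H" by (rule hpoly_bsupp[OF U hpoly_mult[OF Q]])
  have bH2: "bsupp (\<lambda>x. ?H x * (-2))" by (rule bsupp_mult_left[OF bH]) auto
  have bsum: "bsupp (\<lambda>x. ?G x + ?H x * (-2))" by (rule bsupp_add[OF bG bH2])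
  have bF': "bsupp (dird a ?F)"
  proof -
    have "continuous_on (- {0}) (dird a ?F) = continuous_on (- {0}) (\<lambda>x. ?G x + ?H x * (-2))"
      by (rule continuous_on_cong) (use F' in auto)
    \<comment> \<open>At the origin F need not be differentiable and its derivative is unspecified,
      so that point is added to the support.\<close>
    moreover have "bounded (insert 0 {x. ?G x + ?H x * (-2) \<noteq> 0})"
      using bsum by (simp add: bsupp_def)
    then have "bounded {x. dird a ?F x \<noteq> 0}"
      by (rule bounded_subset) (use F' in \<open>force\<close>)
    ultimately show ?thesis using bsum by (simp add: bsupp_def)
  qed
  have "0 = (LINT x|hyperplane_measure \<xi> 1. dird a ?F x)"
    using integral_hyperplane_dird[OF hpoly_bsupp[OF V Q] bF' differentiableI[OF der] \<xi>(1) _ \<xi>(2), of 1] by simp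
  also have "\<dots> = (LINT x|hyperplane_measure \<xi> 1. ?G x + (-2) * ?H x)"
  proof (rule integral_cong_AE)
    show "AE x in hyperplane_measure \<xi> 1. dird a ?F x = ?G x + (-2) * ?H x"
      using hyperplane_measure_concentrated[OF \<xi>(1)] by eventually_elim (rule F', auto)
    show "dird a ?F \<in> borel_measurable (hyperplane_measure \<xi> 1)"
      using bsupp_measurable[OF bF'] by simp
    show "(\<lambda>x. ?G x + (-2) * ?H x) \<in> borel_measurable (hyperplane_measure \<xi> 1)"
      using bsupp_measurable[OF bsum] by (simp add: mult.commute)
  qed
  also have "\<dots> = (LINT x|hyperplane_measure \<xi> 1. ?G x) + (-2) * (LINT x|hyperplane_measure \<xi> 1. ?H x)"
    using integrable_hyperplane[OF bG \<xi>(1)] integrable_hyperplane[OF bH \<xi>(1)]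
    by (subst Bochner_Integration.integral_add) auto
  finally show ?thesis by (simp add: field_simps)
qed


lemma dird_linear:
  assumes "f differentiable at x" shows "linear (\<lambda>v. dird v f x)"
  using assms dird_works has_derivative_linear by blast

lemma dird_sum_axis:
  fixes f :: "real^'n \<Rightarrow> complex"
  assumes "f differentiable at x"
  shows "(\<Sum>i\<in>UNIV. of_real (v $ i) * dird (axis i 1) f x) = dird v f x"
proof -
  note lin = dird_linear[OF assms]
  have "dird v f x = dird (\<Sum>i\<in>UNIV. v $ i *s axis i 1) f x"
    by (simp only: basis_expansion)
  also have "\<dots> = (\<Sum>i\<in>UNIV. of_real (v $ i) * dird (axis i 1) f x)"
    by (simp only: linear_sum[OF lin] scalar_mult_eq_scaleR linear_scale[OF lin])
      (simp add: scaleR_conv_of_real)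
  finally show ?thesis ..
qed

text \<open>
  The Funk--Hecke theorem by induction on the degree: Euler's identity splits off a linear
  factor, whose components along the hyperplane are integrated by parts.  Harmonicity turns
  the resulting tangential Laplacian into minus the second normal derivative.
\<close>

lemma integral_hyperplane_harm:
  fixes \<xi> :: "real^'n"
  assumes "U \<in> fplus" "solid_harmonic k Y" "\<xi> \<noteq> 0"
  shows "(LINT x|hyperplane_measure \<xi> 1. U (x \<bullet> x) * Y x)
    = Y (\<xi> /\<^sub>R norm \<xi>) * of_real (1 / norm \<xi>) * lam (CARD('n) - 1) k U (1 / norm \<xi>)"
  using assms(1,2)
proof (induction k arbitrary: U Y rule: less_induct)
  case (less k)
  define r where "r = 1 / norm \<xi>"
  define \<omega> where "\<omega> = \<xi> /\<^sub>R norm \<xi>"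
  have r: "r > 0" using assms by (simp add: r_def)
  have \<omega>: "\<omega> \<bullet> \<omega> = 1" "\<xi> = norm \<xi> *\<^sub>R \<omega>"
    using assms by (simp_all add: \<omega>_def dot_square_norm power2_eq_square)
  have Y: "hpoly k Y" "\<And>x. laplacian Y x = 0" using less.prems by (auto simp: solid_harmonic_def)
  let ?H = "hyperplane_measure \<xi> 1" and ?m = "CARD('n) - 1"
  show ?case
  proof (cases k)
    case 0
    then obtain c where "Y = (\<lambda>_. c)" using hpoly_0_const Y(1) by blast
    then show ?thesis
      using integral_hyperplane_radial[OF less.prems(1) assms(3)] by (simp add: lam_def 0)
  next
    case (Suc j)
    \<comment> \<open>Projections of the coordinate vectors to the complement of \<omega>. The sum
      of their outer squares is that projection itself, which gives the splitting of x in
      \<open>x_split\<close> and the trace formula \<open>aa\<close>. A single orthonormal basis of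
      the complement would have to be chosen; this family is explicit.\<close>
    define a where "a i = axis i 1 - (\<omega> $ i) *\<^sub>R \<omega>" for i
    have \<xi>a: "\<xi> \<bullet> a i = 0" for i
      using \<omega>(1) by (subst \<omega>(2)) (simp add: a_def inner_diff_right inner_axis)
    have diff: "f differentiable at x" if "hpoly l f" for l x and f :: "real^'n \<Rightarrow> complex"
      using hpoly_differentiable[OF that] .
    have x_split: "(\<Sum>i\<in>UNIV. (x \<bullet> a i) *\<^sub>R a i) = x - (x \<bullet> \<omega>) *\<^sub>R \<omega>" for x :: "real^'n"
    proof -
      have "(\<Sum>i\<in>UNIV. (x \<bullet> a i) *\<^sub>R a i) $ l = (x - (x \<bullet> \<omega>) *\<^sub>R \<omega>) $ l" for l
      proof -
        let ?y = "\<lambda>i. x $ i - \<omega> $ i * (x \<bullet> \<omega>)"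
        have "(\<Sum>i\<in>UNIV. (x \<bullet> a i) *\<^sub>R a i) $ l = (\<Sum>i\<in>UNIV. ?y i * ((if i = l then 1 else 0) - \<omega> $ i * \<omega> $ l))"
        proof -
          have "x \<bullet> a i = ?y i" and "a i $ l = (if i = l then 1 else 0) - \<omega> $ i * \<omega> $ l" for i
            by (simp_all add: a_def inner_diff_right inner_axis) (simp add: axis_def eq_commute)
          then show ?thesis by simp
        qed
        also have "\<dots> = (\<Sum>i\<in>UNIV. if i = l then ?y i else 0) - (\<Sum>i\<in>UNIV. ?y i * \<omega> $ i) * \<omega> $ l"
        proof -
          have "?y i * ((if i = l then 1 else 0) - \<omega> $ i * \<omega> $ l) = (if i = l then ?y i else 0) - ?y i * \<omega> $ i * \<omega> $ l" for i
            by (simp add: right_diff_distrib)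
          then show ?thesis by (simp only: sum_subtractf sum_distrib_right)
        qed
        also have "(\<Sum>i\<in>UNIV. ?y i * \<omega> $ i) = x \<bullet> \<omega> - (\<omega> \<bullet> \<omega>) * (x \<bullet> \<omega>)"
        proof -
          have "(\<Sum>i\<in>UNIV. (x $ i - \<omega> $ i * s) * \<omega> $ i) = (\<Sum>i\<in>UNIV. x $ i * \<omega> $ i) - (\<Sum>i\<in>UNIV. \<omega> $ i * \<omega> $ i) * s" for s
            by (simp add: algebra_simps sum_subtractf sum_distrib_left)
          then show ?thesis by (simp add: inner_vec_def)
        qed
        finally show ?thesis using \<omega>(1) by (simp add: mult.commute)
      qed
      then show ?thesis by (simp add: vec_eq_iff)
    qed
    have D\<omega>: "solid_harmonic (k - 1) (dird \<omega> Y)" "solid_harmonic (k - 1 - 1) (dird \<omega> (dird \<omega> Y))"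
      using harm_dird[OF less.prems(2)] harm_dird by blast+
    have aa: "(\<Sum>i\<in>UNIV. dird (a i) (dird (a i) Y) x) = - dird \<omega> (dird \<omega> Y) x" for x
    proof -
      have da: "dird (a i) f = (\<lambda>x. (- of_real (\<omega> $ i)) * dird \<omega> f x + dird (axis i 1) f x)"
        if "hpoly l f" for i l f
        unfolding a_def using linear_diff[OF dird_linear[OF diff[OF that]]] linear_scale[OF dird_linear[OF diff[OF that]]]
        by (simp add: fun_eq_iff scaleR_conv_of_real)
      have dv: "dird v (dird (a i) Y) = (\<lambda>x. (- of_real (\<omega> $ i)) * dird v (dird \<omega> Y) x + dird v (dird (axis i 1) Y) x)"
        for v i
        unfolding da[OF Y(1)] dird_add[OF diff[OF hpoly_cmult[OF hpoly_dird[OF Y(1)]]] diff[OF hpoly_dird[OF Y(1)]]]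
          dird_cmult[OF diff[OF hpoly_dird[OF Y(1)]]] ..
      have "dird (a i) (dird (a i) Y) x = of_real ((\<omega> $ i)\<^sup>2) * dird \<omega> (dird \<omega> Y) x
          - 2 * (of_real (\<omega> $ i) * dird (axis i 1) (dird \<omega> Y) x) + dird (axis i 1) (dird (axis i 1) Y) x" for i
        unfolding da[OF hpoly_dird[OF Y(1)]] dv
        using dird_commute[OF Y(1), of \<omega> "axis i 1"] by (simp add: power2_eq_square algebra_simps)
      then have "(\<Sum>i\<in>UNIV. dird (a i) (dird (a i) Y) x)
          = (\<Sum>i\<in>UNIV. of_real ((\<omega> $ i)\<^sup>2)) * dird \<omega> (dird \<omega> Y) x
            - 2 * (\<Sum>i\<in>UNIV. of_real (\<omega> $ i) * dird (axis i 1) (dird \<omega> Y) x) + laplacian Y x"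
        by (simp add: sum.distrib sum_subtractf sum_distrib_left sum_distrib_right laplacian_eq)
      also have "(\<Sum>i\<in>UNIV. complex_of_real ((\<omega> $ i)\<^sup>2)) = of_real (\<omega> \<bullet> \<omega>)"
        by (simp add: inner_vec_def power2_eq_square)
      finally show ?thesis
        using \<omega>(1) Y(2) dird_sum_axis[OF diff[OF hpoly_dird[OF Y(1)]]] by simp
    qed
    note U = less.prems(1) tail_int_fplus[OF less.prems(1)]
    have int: "integrable ?H (\<lambda>x. V (x \<bullet> x) * Q x)" if "V \<in> fplus" "hpoly l Q" for V l Q
      using integrable_hyperplane[OF hpoly_bsupp[OF that] assms(3)] by simp
    have ip: "integrable ?H (\<lambda>x. U (x \<bullet> x) * (of_real (x \<bullet> a i) * dird (a i) Y x))" for i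
      by (rule int[OF U(1) hpoly_mult[OF hpoly_dird[OF Y(1)]]])
    have "of_nat k * (LINT x|?H. U (x \<bullet> x) * Y x) = (LINT x|?H. of_nat k * (U (x \<bullet> x) * Y x))"
      by simp
    also have "\<dots> = (LINT x|?H. of_real r * (U (x \<bullet> x) * dird \<omega> Y x)
        + (\<Sum>i\<in>UNIV. U (x \<bullet> x) * (of_real (x \<bullet> a i) * dird (a i) Y x)))"
    proof (rule integral_cong_AE)
      show "AE x in ?H. of_nat k * (U (x \<bullet> x) * Y x) = of_real r * (U (x \<bullet> x) * dird \<omega> Y x)
          + (\<Sum>i\<in>UNIV. U (x \<bullet> x) * (of_real (x \<bullet> a i) * dird (a i) Y x))"
        using hyperplane_measure_concentrated[OF assms(3), of 1]
      proof eventually_elim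
        fix x assume "\<xi> \<bullet> x = 1"
        then have "norm \<xi> * (\<omega> \<bullet> x) = 1" by (subst (asm) \<omega>(2)) simp
        then have x\<omega>: "x \<bullet> \<omega> = r" using assms by (simp add: r_def field_simps inner_commute)
        note lin = dird_linear[OF diff[OF Y(1)], of x]
        have "of_nat k * Y x = dird x Y x" by (rule hpoly_euler[OF Y(1), symmetric])
        also have "x = r *\<^sub>R \<omega> + (\<Sum>i\<in>UNIV. (x \<bullet> a i) *\<^sub>R a i)"
          by (simp add: x_split x\<omega>)
        then have "dird x Y x = dird (r *\<^sub>R \<omega> + (\<Sum>i\<in>UNIV. (x \<bullet> a i) *\<^sub>R a i)) Y x"
          by simp
        also have "\<dots> = of_real r * dird \<omega> Y x + (\<Sum>i\<in>UNIV. of_real (x \<bullet> a i) * dird (a i) Y x)"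
          by (simp only: linear_add[OF lin] linear_sum[OF lin] linear_scale[OF lin])
            (simp add: scaleR_conv_of_real)
        finally have "of_nat k * Y x = of_real r * dird \<omega> Y x + (\<Sum>i\<in>UNIV. of_real (x \<bullet> a i) * dird (a i) Y x)" .
        then have "U (x \<bullet> x) * (of_nat k * Y x) = U (x \<bullet> x) * (of_real r * dird \<omega> Y x + (\<Sum>i\<in>UNIV. of_real (x \<bullet> a i) * dird (a i) Y x))"
          by simp
        then show "of_nat k * (U (x \<bullet> x) * Y x) = of_real r * (U (x \<bullet> x) * dird \<omega> Y x)
            + (\<Sum>i\<in>UNIV. U (x \<bullet> x) * (of_real (x \<bullet> a i) * dird (a i) Y x))"
          by (simp add: distrib_left sum_distrib_left mult.left_commute)
      qed
    qed (use int[OF U(1) Y(1)] int[OF U(1) hpoly_dird[OF Y(1)]] ip in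
        \<open>auto intro!: borel_measurable_add borel_measurable_sum borel_measurable_times borel_measurable_const
          dest: borel_measurable_integrable\<close>)
    also have "\<dots> = of_real r * (LINT x|?H. U (x \<bullet> x) * dird \<omega> Y x)
        + (\<Sum>i\<in>UNIV. LINT x|?H. U (x \<bullet> x) * (of_real (x \<bullet> a i) * dird (a i) Y x))"
      using int[OF U(1) hpoly_dird[OF Y(1)]] ip
      by (subst Bochner_Integration.integral_add) (auto intro!: Bochner_Integration.integrable_sum Bochner_Integration.integral_sum)
    also have "(\<Sum>i\<in>UNIV. LINT x|?H. U (x \<bullet> x) * (of_real (x \<bullet> a i) * dird (a i) Y x))
        = (\<Sum>i\<in>UNIV. (1/2) * (LINT x|?H. tail_int U (x \<bullet> x) * dird (a i) (dird (a i) Y) x))"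
      by (simp only: integral_hyperplane_perp[OF U(1) hpoly_dird[OF Y(1)] assms(3) \<xi>a])
    also have "\<dots> = (1/2) * (LINT x|?H. (\<Sum>i\<in>UNIV. tail_int U (x \<bullet> x) * dird (a i) (dird (a i) Y) x))"
      using int[OF U(2) hpoly_dird[OF hpoly_dird[OF Y(1)]]]
      by (subst Bochner_Integration.integral_sum) (auto simp: sum_distrib_left)
    also have "(LINT x|?H. (\<Sum>i\<in>UNIV. tail_int U (x \<bullet> x) * dird (a i) (dird (a i) Y) x))
        = - (LINT x|?H. tail_int U (x \<bullet> x) * dird \<omega> (dird \<omega> Y) x)"
      by (simp only: sum_distrib_left[symmetric] aa) simp
    also have "(LINT x|?H. tail_int U (x \<bullet> x) * dird \<omega> (dird \<omega> Y) x)
        = dird \<omega> (dird \<omega> Y) \<omega> * of_real r * lam ?m (k - 1 - 1) (tail_int U) r"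
      unfolding r_def \<omega>_def[symmetric] using less.IH[OF _ U(2) D\<omega>(2)] Suc by (simp add: \<omega>_def)
    also have "(LINT x|?H. U (x \<bullet> x) * dird \<omega> Y x) = dird \<omega> Y \<omega> * of_real r * lam ?m (k - 1) U r"
      unfolding r_def \<omega>_def[symmetric] using less.IH[OF _ U(1) D\<omega>(1)] Suc by (simp add: \<omega>_def)
    \<comment> \<open>Euler's identity at \<omega> itself turns the derivatives of Y that remain
      into multiples of Y \<omega>. The factor k then cancels, and the two terms match
      \<open>lam_Suc\<close>.\<close>
    also have "dird \<omega> Y \<omega> = of_nat k * Y \<omega>" by (rule hpoly_euler[OF Y(1)])
    also have "dird \<omega> (dird \<omega> Y) \<omega> = of_nat j * (of_nat k * Y \<omega>)"
      using hpoly_euler[OF hpoly_dird[OF Y(1)], of \<omega> \<omega>] hpoly_euler[OF Y(1), of \<omega>] Suc by simp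
    finally have "of_nat k * (LINT x|?H. U (x \<bullet> x) * Y x)
        = of_nat k * (Y \<omega> * of_real r * (of_real r * lam ?m j U r - of_nat j / 2 * lam ?m (j - 1) (tail_int U) r))"
      using Suc by (simp add: algebra_simps add_divide_distrib)
    then have "(LINT x|?H. U (x \<bullet> x) * Y x)
        = Y \<omega> * of_real r * (of_real r * lam ?m j U r - of_nat j / 2 * lam ?m (j - 1) (tail_int U) r)"
      using Suc by (simp del: of_nat_Suc)
    then show ?thesis
      using lam_Suc[OF U(1) r, of ?m j] by (simp add: Suc r_def \<omega>_def)
  qed
qed

subsection \<open>K-finite functions on spheres\<close>

text \<open>A finite-dimensional space of functions has nodes whose values determine each member.
  The coefficients of v are its values at the nodes, hence depend on parameters of v exactly as v
  does. Nodes are found one at a time, at a point where the interpolation error of a new generator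
  is not 0.\<close>

lemma interpolation_basis:
  fixes B :: "('a \<Rightarrow> complex) set"
  assumes "finite B"
  obtains P b where "finite P" "\<And>p. p \<in> P \<Longrightarrow> b p \<in> cfun.span B"
    "\<And>v x. v \<in> cfun.span B \<Longrightarrow> v x = (\<Sum>p\<in>P. v p * b p x)"
proof -
  have "\<exists>P b. finite P \<and> (\<forall>p\<in>P. b p \<in> cfun.span B)
    \<and> (\<forall>p\<in>P. \<forall>q\<in>P. b p q = (if p = q then 1 else 0))
    \<and> (\<forall>v\<in>cfun.span B. \<forall>x. v x = (\<Sum>p\<in>P. v p * b p x))"
    using assms
  proof (induction B rule: finite_induct)
    case empty
    show ?case by (rule exI[of _ "{}"]) (auto simp: zero_fun_def)
  next
    case (insert f B)
    then obtain P b where P: "finite P" "\<forall>p\<in>P. b p \<in> cfun.span B"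
      "\<forall>p\<in>P. \<forall>q\<in>P. b p q = (if p = q then 1 else 0)"
      "\<forall>v\<in>cfun.span B. \<forall>x. v x = (\<Sum>p\<in>P. v p * b p x)" by blast
    \<comment> \<open>The interpolation error of f. It vanishes at the old nodes, so any point where
      it is nonzero is a new node.\<close>
    define g where "g x = f x - (\<Sum>p\<in>P. f p * b p x)" for x
    have sub: "cfun.span B \<subseteq> cfun.span (insert f B)" by (rule cfun.span_mono) auto
    have P2: "b p \<in> cfun.span (insert f B)" if "p \<in> P" for p
      using P(2) sub that by blast
    have g_span: "g \<in> cfun.span (insert f B)"
      unfolding g_def using P2 by (intro span_diffI span_sumI span_cmultI) (auto intro: cfun.span_base)
    have dec: "\<exists>c w. w \<in> cfun.span B \<and> (\<forall>x. v x = c * g x + w x)" if v: "v \<in> cfun.span (insert f B)" for v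
    proof -
      obtain c where c: "v - cscale c f \<in> cfun.span B"
        using v unfolding cfun.span_insert by blast
      have "(\<lambda>x. (v - cscale c f) x + (\<Sum>p\<in>P. (c * f p) * b p x)) \<in> cfun.span B"
        using P(2) c by (intro span_addI[of "v - cscale c f"] span_sumI span_cmultI) blast+
      moreover have "v x = c * g x + ((v - cscale c f) x + (\<Sum>p\<in>P. (c * f p) * b p x))" for x
        by (simp add: g_def cscale_def fun_diff_def right_diff_distrib sum_distrib_left mult.assoc)
      ultimately show ?thesis by blast
    qed
    show ?case
    proof (cases "\<exists>q. g q \<noteq> 0")
      case False
      then have "\<forall>v\<in>cfun.span (insert f B). v \<in> cfun.span B"
        using dec by (metis add_0 ext mult_zero_right)
      then show ?thesis using P P2 by (intro exI[of _ P] exI[of _ b]) blast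
    next
      case True
      then obtain q where q: "g q \<noteq> 0" by blast
      have gP: "g p = 0" if "p \<in> P" for p
      proof -
        have "(\<Sum>r\<in>P. f r * b r p) = (\<Sum>r\<in>P. if r = p then f r else 0)"
          by (rule sum.cong) (use P(3) that in auto)
        then show ?thesis using P(1) that by (simp add: g_def)
      qed
      then have qP: "q \<notin> P" using q by blast
      \<comment> \<open>The normalized error is the dual function of q; subtracting multiples of it
        makes the old dual functions vanish at q.\<close>
      define b' where "b' p x = (if p = q then g x / g q else b p x - b p q * (g x / g q))" for p x
      have b'_span: "b' p \<in> cfun.span (insert f B)" if "p \<in> insert q P" for p
      proof -
        have "(\<lambda>x. (1 / g q) * g x) \<in> cfun.span (insert f B)"
          by (intro span_cmultI g_span)
        then have 1: "(\<lambda>x. g x / g q) \<in> cfun.span (insert f B)" by simp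
        show ?thesis
        proof (cases "p = q")
          case True
          then show ?thesis using 1 by (simp add: b'_def[abs_def])
        next
          case False
          then have "(\<lambda>x. b p x - b p q * (g x / g q)) \<in> cfun.span (insert f B)"
            using that P2 1 by (intro span_diffI span_cmultI) auto
          then show ?thesis using False by (simp add: b'_def[abs_def])
        qed
      qed
      have dual: "b' p r = (if p = r then 1 else 0)" if "p \<in> insert q P" "r \<in> insert q P" for p r
        using that P(3) gP qP q by (auto simp: b'_def)
      have expand: "v x = (\<Sum>p\<in>insert q P. v p * b' p x)" if v: "v \<in> cfun.span (insert f B)" for v x
      proof -
        obtain c w where w: "w \<in> cfun.span B" "\<And>x. v x = c * g x + w x" using dec[OF v] by blast
        have vP: "v p = w p" if "p \<in> P" for p using w(2) gP that by simp
        have "(\<Sum>p\<in>insert q P. v p * b' p x) = v q * (g x / g q) + (\<Sum>p\<in>P. w p * (b p x - b p q * (g x / g q)))"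
          using P(1) qP vP by (auto simp: b'_def intro!: sum.cong)
        also have "\<dots> = v q * (g x / g q) + ((\<Sum>p\<in>P. w p * b p x) - (\<Sum>p\<in>P. w p * b p q) * (g x / g q))"
          by (simp add: right_diff_distrib sum_subtractf sum_distrib_right sum_divide_distrib mult.assoc)
        also have "\<dots> = v q * (g x / g q) + (w x - w q * (g x / g q))"
          using P(4) w(1) by (metis (no_types, lifting))
        also have "\<dots> = v x"
          using q w(2) by (simp add: field_simps)
        finally show ?thesis ..
      qed
      show ?thesis
        by (rule exI[of _ "insert q P"], rule exI[of _ b']) (use P(1) b'_span dual expand in auto)
    qed
  qed
  then show ?thesis
  proof (elim exE conjE)
    fix P b
    assume "finite P" "\<forall>p\<in>P. b p \<in> cfun.span B" "\<forall>v\<in>cfun.span B. \<forall>x. v x = (\<Sum>p\<in>P. v p * b p x)"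
    then show thesis by (intro that[of P b]) auto
  qed
qed

section \<open>Periodic solutions of linear equations with constant coefficients\<close>

definition trig :: "nat \<Rightarrow> (real \<Rightarrow> complex) set" where
  "trig N = cfun.span {\<lambda>\<theta>. cis (of_int m * \<theta>) | m. \<bar>m\<bar> \<le> int N}"

lemma trig_mono: "N \<le> N' \<Longrightarrow> trig N \<subseteq> trig N'"
  unfolding trig_def by (rule cfun.span_mono) force

lemma cis_in_trig: "\<bar>m\<bar> \<le> int N \<Longrightarrow> (\<lambda>\<theta>. cis (of_int m * \<theta>)) \<in> trig N"
  unfolding trig_def by (rule cfun.span_base) blast

lemma cis_has_vd:
  "((\<lambda>\<theta>. cis (of_int m * \<theta>)) has_vector_derivative \<i> * of_int m * cis (of_int m * \<theta>)) (at \<theta>)"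
proof -
  have "((\<lambda>\<theta>. exp (\<theta> *\<^sub>R (\<i> * of_int m))) has_vector_derivative exp (\<theta> *\<^sub>R (\<i> * of_int m)) * (\<i> * of_int m)) (at \<theta>)"
    by (rule exp_scaleR_has_vector_derivative_right)
  then show ?thesis
    by (simp add: cis_conv_exp scaleR_conv_of_real mult_ac)
qed

text \<open>Solves z' = \<mu> z + T frequency by frequency. A term of T whose frequency is \<mu>
  itself has no periodic solution; it is left over as the defect with coefficient \<kappa>, which
  can be nonzero only if \<mu> is an integer multiple of the imaginary unit.\<close>

lemma trig_solve:
  assumes "T \<in> trig N"
  shows "\<exists>z\<in>trig N. \<exists>\<kappa>. (\<kappa> = 0 \<or> (\<exists>m. \<mu> = \<i> * of_int m)) \<and>
    (\<forall>\<theta>. (z has_vector_derivative (\<mu> * z \<theta> + T \<theta> - \<kappa> * exp (\<theta> *\<^sub>R \<mu>))) (at \<theta>))"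
  using assms unfolding trig_def
proof (induction rule: span_fun_induct)
  case zero
  show ?case
    by (intro bexI[of _ "\<lambda>_. 0"] exI[of _ 0]) (auto intro: span_zeroI)
next
  case (add c f g)
  then obtain z1 k1 z2 k2 where z: "z1 \<in> trig N" "z2 \<in> trig N"
    and k: "k1 = 0 \<or> (\<exists>m. \<mu> = \<i> * of_int m)" "k2 = 0 \<or> (\<exists>m. \<mu> = \<i> * of_int m)"
    and d: "\<forall>\<theta>. (z1 has_vector_derivative (\<mu> * z1 \<theta> + f \<theta> - k1 * exp (\<theta> *\<^sub>R \<mu>))) (at \<theta>)"
      "\<forall>\<theta>. (z2 has_vector_derivative (\<mu> * z2 \<theta> + g \<theta> - k2 * exp (\<theta> *\<^sub>R \<mu>))) (at \<theta>)"
    unfolding trig_def by blast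
  have "((\<lambda>\<theta>. c * z1 \<theta> + z2 \<theta>) has_vector_derivative
      c * (\<mu> * z1 \<theta> + f \<theta> - k1 * exp (\<theta> *\<^sub>R \<mu>)) + (\<mu> * z2 \<theta> + g \<theta> - k2 * exp (\<theta> *\<^sub>R \<mu>))) (at \<theta>)" for \<theta>
    using d by (intro has_vector_derivative_add has_vector_derivative_mult_right) auto
  moreover have "c * (\<mu> * z1 \<theta> + f \<theta> - k1 * exp (\<theta> *\<^sub>R \<mu>)) + (\<mu> * z2 \<theta> + g \<theta> - k2 * exp (\<theta> *\<^sub>R \<mu>))
      = \<mu> * (c * z1 \<theta> + z2 \<theta>) + (c * f \<theta> + g \<theta>) - (c * k1 + k2) * exp (\<theta> *\<^sub>R \<mu>)" for \<theta>
    by (simp add: algebra_simps)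
  ultimately have "\<forall>\<theta>. ((\<lambda>\<theta>. c * z1 \<theta> + z2 \<theta>) has_vector_derivative
      \<mu> * (c * z1 \<theta> + z2 \<theta>) + (c * f \<theta> + g \<theta>) - (c * k1 + k2) * exp (\<theta> *\<^sub>R \<mu>)) (at \<theta>)"
    by simp
  moreover have "(\<lambda>\<theta>. c * z1 \<theta> + z2 \<theta>) \<in> trig N"
    using z unfolding trig_def by (intro span_addI span_cmultI)
  moreover have "c * k1 + k2 = 0 \<or> (\<exists>m. \<mu> = \<i> * of_int m)" using k by auto
  ultimately show ?case unfolding trig_def by blast
next
  case (base f)
  then obtain m where m: "f = (\<lambda>\<theta>. cis (of_int m * \<theta>))" "\<bar>m\<bar> \<le> int N" by blast
  show ?case
  proof (cases "\<mu> = \<i> * of_int m")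
    case True
    have "f \<theta> = exp (\<theta> *\<^sub>R \<mu>)" for \<theta>
      by (simp add: m True cis_conv_exp scaleR_conv_of_real mult_ac)
    then show ?thesis using True
      by (intro bexI[of _ "\<lambda>_. 0"] exI[of _ 1]) (auto intro: span_zeroI)
  next
    case False
    define d where "d = 1 / (\<i> * of_int m - \<mu>)"
    have "(\<lambda>\<theta>. d * f \<theta>) \<in> trig N"
      using cis_in_trig[OF m(2)] unfolding trig_def m(1) by (rule span_cmultI)
    moreover have "((\<lambda>\<theta>. d * f \<theta>) has_vector_derivative (\<mu> * (d * f \<theta>) + f \<theta> - 0 * exp (\<theta> *\<^sub>R \<mu>))) (at \<theta>)" for \<theta>
    proof -
      have "((\<lambda>\<theta>. d * f \<theta>) has_vector_derivative d * (\<i> * of_int m * f \<theta>)) (at \<theta>)"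
        unfolding m(1) by (intro has_vector_derivative_mult_right cis_has_vd)
      moreover have "d * (\<i> * of_int m * f \<theta>) = \<mu> * (d * f \<theta>) + f \<theta>"
        using False by (simp add: d_def field_simps)
      ultimately show ?thesis by simp
    qed
    ultimately show ?thesis
      unfolding trig_def by blast
  qed
qed

text \<open>The difference w of y and the solution from \<open>trig_solve\<close> is exp(\<theta>
  \<mu>) (v0 + \<theta> \<kappa>). Periodicity forces \<kappa> = 0 if \<mu> is an integral frequency
  and v0 = 0 if it is not, so the only frequency that can be new has absolute value norm
  \<mu>.\<close>

lemma periodic_first_order_trig:
  assumes "T \<in> trig N" "\<And>\<theta>. (y has_vector_derivative (\<mu> * y \<theta> + T \<theta>)) (at \<theta>)"
    "\<And>\<theta>. y (\<theta> + 2 * pi) = y \<theta>" "N \<le> N'" "norm \<mu> \<le> real N'"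
  shows "y \<in> trig N'"
proof -
  obtain z \<kappa> where z: "z \<in> trig N" "\<kappa> = 0 \<or> (\<exists>m. \<mu> = \<i> * of_int m)"
    "\<And>\<theta>. (z has_vector_derivative (\<mu> * z \<theta> + T \<theta> - \<kappa> * exp (\<theta> *\<^sub>R \<mu>))) (at \<theta>)"
    using trig_solve[OF assms(1), of \<mu>] by blast
  have trig_periodic: "f (\<theta> + 2 * pi) = f \<theta>" if "f \<in> trig N" for f \<theta>
    using that unfolding trig_def
  proof (induction rule: span_fun_induct)
    case (base f)
    then obtain m where "f = (\<lambda>\<theta>. cis (of_int m * \<theta>))" by blast
    moreover have "cis (of_int m * (\<theta> + 2 * pi)) = cis (of_int m * \<theta>) * cis (2 * pi * of_int m)"
      by (simp add: cis_mult algebra_simps)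
    ultimately show ?case by simp
  qed auto
  define w where "w \<theta> = y \<theta> - z \<theta>" for \<theta>
  have w_per: "w (\<theta> + 2 * pi) = w \<theta>" for \<theta>
    using assms(3) trig_periodic[OF z(1)] by (simp add: w_def)
  define v where "v \<theta> = exp (\<theta> *\<^sub>R (- \<mu>)) * w \<theta> - \<theta> *\<^sub>R \<kappa>" for \<theta>
  have e: "exp (\<theta> *\<^sub>R (- \<mu>)) * exp (\<theta> *\<^sub>R \<mu>) = 1" for \<theta> :: real
    by (simp add: exp_add[symmetric])
  have "(v has_vector_derivative 0) (at \<theta>)" for \<theta>
  proof -
    have "((\<lambda>\<theta>. exp (\<theta> *\<^sub>R (- \<mu>)) * w \<theta> - \<theta> *\<^sub>R \<kappa>) has_vector_derivative
        (exp (\<theta> *\<^sub>R (- \<mu>)) * ((\<mu> * y \<theta> + T \<theta>) - (\<mu> * z \<theta> + T \<theta> - \<kappa> * exp (\<theta> *\<^sub>R \<mu>)))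
          + exp (\<theta> *\<^sub>R (- \<mu>)) * (- \<mu>) * w \<theta>) - 1 *\<^sub>R \<kappa>) (at \<theta>)"
      unfolding w_def
      by (intro has_vector_derivative_diff has_vector_derivative_mult exp_scaleR_has_vector_derivative_right
          assms(2) z(3)) (simp add: has_vector_derivative_def bounded_linear_imp_has_derivative[OF bounded_linear_scaleR_left])
    moreover have "exp (\<theta> *\<^sub>R (- \<mu>)) * ((\<mu> * y \<theta> + T \<theta>) - (\<mu> * z \<theta> + T \<theta> - \<kappa> * exp (\<theta> *\<^sub>R \<mu>)))
          + exp (\<theta> *\<^sub>R (- \<mu>)) * (- \<mu>) * w \<theta> = \<kappa> * (exp (\<theta> *\<^sub>R (- \<mu>)) * exp (\<theta> *\<^sub>R \<mu>))"
      by (simp add: w_def algebra_simps)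
    ultimately show ?thesis unfolding v_def[abs_def] e by simp
  qed
  then obtain v0 where v0: "\<And>\<theta>. v \<theta> = v0"
    using has_vector_derivative_zero_constant[of UNIV v] by auto
  have w_eq: "w \<theta> = exp (\<theta> *\<^sub>R \<mu>) * (v0 + \<theta> *\<^sub>R \<kappa>)" for \<theta>
  proof -
    have "exp (\<theta> *\<^sub>R (- \<mu>)) * w \<theta> = v0 + \<theta> *\<^sub>R \<kappa>" using v0[of \<theta>] by (simp add: v_def algebra_simps)
    then have "exp (\<theta> *\<^sub>R \<mu>) * (v0 + \<theta> *\<^sub>R \<kappa>) = (exp (\<theta> *\<^sub>R (- \<mu>)) * exp (\<theta> *\<^sub>R \<mu>)) * w \<theta>"
      by (simp add: mult_ac)
    then show ?thesis by (simp only: e mult_1)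
  qed
  have per: "exp ((2 * pi) *\<^sub>R \<mu>) * (v0 + (2 * pi) *\<^sub>R \<kappa>) = v0"
    using w_per[of 0] w_eq[of 0] w_eq[of "2 * pi"] by simp
  have "w \<in> trig N'"
  proof (cases "\<exists>m. \<mu> = \<i> * of_int m")
    case True
    then obtain m where m: "\<mu> = \<i> * of_int m" by blast
    have ecis: "exp (\<theta> *\<^sub>R \<mu>) = cis (of_int m * \<theta>)" for \<theta>
      by (simp add: m cis_conv_exp scaleR_conv_of_real mult_ac)
    have "cis (of_int m * (2 * pi)) = 1"
      using cis_multiple_2pi[of "of_int m"] by (simp add: mult.commute)
    then have "\<kappa> = 0" using per unfolding ecis by simp
    then have "w = (\<lambda>\<theta>. v0 * cis (of_int m * \<theta>))" by (simp add: w_eq[abs_def] ecis mult.commute fun_eq_iff)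
    moreover have "\<bar>m\<bar> \<le> int N'"
    proof -
      have "norm \<mu> = real_of_int \<bar>m\<bar>" by (simp add: m norm_mult)
      then show ?thesis using assms(5) by linarith
    qed
    ultimately show ?thesis
      using cis_in_trig[of m N'] unfolding trig_def by (auto intro: span_cmultI)
  next
    case False
    then have "\<kappa> = 0" using z(2) by blast
    moreover have "exp ((2 * pi) *\<^sub>R \<mu>) \<noteq> 1"
    proof
      assume "exp ((2 * pi) *\<^sub>R \<mu>) = 1"
      then obtain n :: int where "Re ((2 * pi) *\<^sub>R \<mu>) = 0" "Im ((2 * pi) *\<^sub>R \<mu>) = of_int (2 * n) * pi"
        unfolding exp_eq_1 by blast
      then have "\<mu> = \<i> * of_int n" by (simp add: complex_eq_iff)
      then show False using False by blast
    qed
    ultimately have "v0 = 0" using per by simp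
    then show ?thesis
      using \<open>\<kappa> = 0\<close> w_eq span_zeroI unfolding trig_def by (simp add: w_eq[abs_def])
  qed
  moreover have "z \<in> trig N'" using z(1) trig_mono[OF assms(4)] by blast
  ultimately have "(\<lambda>\<theta>. w \<theta> + z \<theta>) \<in> trig N'" unfolding trig_def by (intro span_addI)
  then show ?thesis by (simp add: w_def)
qed

text \<open>A root \<mu> of q splits off a first order equation: z = y' - \<mu> y satisfies the
  equation of the quotient, and \<open>periodic_first_order_trig\<close> recovers y from z. The
  quantifiers matter: N depends on q alone and serves all solutions.\<close>

lemma periodic_ode_trig:
  fixes q :: "complex poly"
  assumes "q \<noteq> 0"
  shows "\<exists>N. \<forall>y. smooth_on y UNIV \<longrightarrow> (\<forall>\<theta>. y (\<theta> + 2 * pi) = y \<theta>) \<longrightarrow>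
    (\<forall>\<theta>. (\<Sum>j\<le>degree q. coeff q j * (vd ^^ j) y \<theta>) = 0) \<longrightarrow> y \<in> trig N"
  using assms
proof (induction "degree q" arbitrary: q)
  case 0
  then have "coeff q 0 \<noteq> 0" by (metis leading_coeff_0_iff)
  then have "y = (\<lambda>_. 0)" if "\<forall>\<theta>. (\<Sum>j\<le>degree q. coeff q j * (vd ^^ j) y \<theta>) = 0" for y
    using that 0 by (simp add: fun_eq_iff)
  then have "y \<in> trig 0" if "\<forall>\<theta>. (\<Sum>j\<le>degree q. coeff q j * (vd ^^ j) y \<theta>) = 0" for y
  proof -
    have "y = (\<lambda>_. 0)" using that by fact
    then show ?thesis unfolding trig_def by (simp add: span_zeroI del: of_nat_0)
  qed
  then show ?case by (intro exI[of _ 0]) simp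
next
  case (Suc n)
  have "\<not> constant (poly q)" using Suc.hyps(2) by (simp add: constant_degree)
  then obtain \<mu> where "poly q \<mu> = 0" using fundamental_theorem_of_algebra by blast
  then obtain q1 where q1: "q = [:- \<mu>, 1:] * q1" by (metis dvdE poly_eq_0_iff_dvd)
  have q1_0: "q1 \<noteq> 0" using q1 Suc.prems by auto
  have deg: "degree q1 = n"
  proof -
    have "degree q = degree [:- \<mu>, 1:] + degree q1"
      unfolding q1 by (rule degree_mult_eq) (use q1_0 in auto)
    then show ?thesis using Suc.hyps(2) by simp
  qed
  obtain N where N: "\<And>y. smooth_on y UNIV \<Longrightarrow> (\<And>\<theta>. y (\<theta> + 2 * pi) = y \<theta>) \<Longrightarrow>
    (\<And>\<theta>. (\<Sum>j\<le>degree q1. coeff q1 j * (vd ^^ j) y \<theta>) = 0) \<Longrightarrow> y \<in> trig N"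
    using Suc.hyps(1)[OF deg[symmetric] q1_0] by blast
  define N' where "N' = max N (nat \<lceil>norm \<mu>\<rceil>)"
  have N': "N \<le> N'" "norm \<mu> \<le> real N'" unfolding N'_def by (auto simp: le_max_iff_disj) linarith
  have "y \<in> trig N'" if y: "smooth_on y UNIV" "\<And>\<theta>. y (\<theta> + 2 * pi) = y \<theta>"
    "\<And>\<theta>. (\<Sum>j\<le>degree q. coeff q j * (vd ^^ j) y \<theta>) = 0" for y
  proof -
    define z where "z \<theta> = vd y \<theta> + (- \<mu>) * y \<theta>" for \<theta>
    have sm: "smooth_on (vd y) UNIV" "smooth_on (\<lambda>\<theta>. (- \<mu>) * y \<theta>) UNIV"
      using y(1) by (auto intro!: smooth_on_vd smooth_on_cmult[of _ _ "- \<mu>", simplified])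
    have "smooth_on z UNIV" unfolding z_def[abs_def] by (rule smooth_on_add[OF open_UNIV sm])
    moreover have "z (\<theta> + 2 * pi) = z \<theta>" for \<theta>
    proof -
      have "((\<lambda>\<theta>. y (\<theta> + 2 * pi)) has_vector_derivative 1 *\<^sub>R vd y (\<theta> + 2 * pi)) (at \<theta>)"
        by (rule vd_compose[OF open_UNIV y(1)]) (auto intro!: derivative_eq_intros)
      then have "vd y \<theta> = vd y (\<theta> + 2 * pi)" using y(2) by (simp add: vdI)
      then show ?thesis using y(2) by (simp add: z_def)
    qed
    moreover have "(\<Sum>j\<le>degree q1. coeff q1 j * (vd ^^ j) z \<theta>) = 0" for \<theta>
    proof -
      have zj: "(vd ^^ j) z \<theta> = (vd ^^ Suc j) y \<theta> - \<mu> * (vd ^^ j) y \<theta>" for j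
        unfolding z_def[abs_def] vd_funpow_add[OF open_UNIV sm UNIV_I] vd_funpow_cmult[OF open_UNIV y(1) UNIV_I]
        by (simp add: funpow_swap1)
      have "(\<Sum>j\<le>Suc n. coeff q j * (vd ^^ j) y \<theta>)
          = (\<Sum>j\<le>Suc n. coeff (pCons 0 q1) j * (vd ^^ j) y \<theta>) - \<mu> * (\<Sum>j\<le>Suc n. coeff q1 j * (vd ^^ j) y \<theta>)"
        unfolding q1 by (simp add: sum_subtractf[symmetric] sum_distrib_left algebra_simps del: sum.atMost_Suc)
      also have "(\<Sum>j\<le>Suc n. coeff (pCons 0 q1) j * (vd ^^ j) y \<theta>) = (\<Sum>j\<le>n. coeff q1 j * (vd ^^ Suc j) y \<theta>)"
        by (subst sum.atMost_Suc_shift) simp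
      also have "(\<Sum>j\<le>Suc n. coeff q1 j * (vd ^^ j) y \<theta>) = (\<Sum>j\<le>n. coeff q1 j * (vd ^^ j) y \<theta>)"
        using deg by (simp add: coeff_eq_0)
      finally show ?thesis
        using y(3)[of \<theta>] Suc.hyps(2) deg
        by (simp add: zj right_diff_distrib sum_subtractf sum_distrib_left mult.left_commute del: funpow.simps)
    qed
    ultimately have "z \<in> trig N" by (rule N)
    moreover have "(y has_vector_derivative (\<mu> * y \<theta> + z \<theta>)) (at \<theta>)" for \<theta>
      using smooth_on_has_vd[OF y(1) open_UNIV UNIV_I, of \<theta>] by (simp add: z_def)
    ultimately show ?thesis
      using periodic_first_order_trig[of z N y \<mu> N'] y(2) N' by blast
  qed
  then show ?case by blast
qed

lemma finite_dim_relation: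
  fixes L :: "nat \<Rightarrow> 'a \<Rightarrow> complex"
  assumes "finite S" "\<And>j. L j \<in> cfun.span S"
  obtains q :: "complex poly" where "q \<noteq> 0" "\<And>x. (\<Sum>j\<le>degree q. coeff q j * L j x) = 0"
proof -
  define d where "d = card S"
  have "\<exists>u. (\<exists>j\<le>d. u j \<noteq> 0) \<and> (\<forall>x. (\<Sum>j\<le>d. u j * L j x) = 0)"
  \<comment> \<open>Linear dependence is a property of sets, so a repetition among the
    \<open>L j\<close> is a separate case. There are d + 1 indices and at most d dimensions.\<close>
  proof (cases "inj_on L {..d}")
    case True
    have "cfun.dependent (L ` {..d})"
    proof (rule ccontr)
      assume "\<not> cfun.dependent (L ` {..d})"
      then have "card (L ` {..d}) \<le> card S"
        using cfun.independent_span_bound[OF assms(1), of "L ` {..d}"] assms(2) by blast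
      then show False using True by (simp add: card_image d_def)
    qed
    then obtain u where u: "\<exists>v\<in>L ` {..d}. u v \<noteq> 0" "(\<Sum>v\<in>L ` {..d}. cscale (u v) v) = 0"
      using cfun.dependent_finite[of "L ` {..d}"] by auto
    have sum_app: "(\<Sum>v\<in>A. cscale (u v) v) x = (\<Sum>v\<in>A. u v * v x)" for A x
      by (induction A rule: infinite_finite_induct) (auto simp: cscale_def)
    have "(\<Sum>j\<le>d. u (L j) * L j x) = 0" for x
    proof -
      have "(\<Sum>j\<le>d. u (L j) * L j x) = (\<Sum>v\<in>L ` {..d}. u v * v x)"
        using True by (simp add: sum.reindex)
      also have "\<dots> = 0" using fun_cong[OF u(2), of x] by (simp only: sum_app zero_fun_apply)
      finally show ?thesis .
    qed
    then show ?thesis using u(1) by (intro exI[of _ "\<lambda>j. u (L j)"]) auto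
  next
    case False
    then obtain i j where ij: "i \<le> d" "j \<le> d" "i \<noteq> j" "L i = L j" by (auto simp: inj_on_def)
    let ?u = "\<lambda>l. (if l = i then 1 else 0) + (if l = j then - 1 else 0) :: complex"
    have "(\<Sum>l\<le>d. ?u l * L l x) = 0" for x
    proof -
      have "(\<Sum>l\<le>d. ?u l * L l x) = (\<Sum>l\<le>d. (if l = i then L i x else 0) + (if l = j then - L i x else 0))"
        by (rule sum.cong) (use ij(4) in auto)
      also have "\<dots> = 0"
        using ij(1,2) by (simp only: sum.distrib sum.delta finite_atMost) simp
      finally show ?thesis .
    qed
    then show ?thesis using ij by (intro exI[of _ ?u]) auto
  qed
  then obtain u where u: "\<exists>j\<le>d. u j \<noteq> 0" "\<And>x. (\<Sum>j\<le>d. u j * L j x) = 0" by blast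
  define q where "q = (\<Sum>j\<le>d. monom (u j) j)"
  have coeff_q: "coeff q j = (if j \<le> d then u j else 0)" for j
    by (simp add: q_def coeff_sum sum.delta)
  have "q \<noteq> 0" using u(1) coeff_q by (metis coeff_0)
  moreover have "(\<Sum>j\<le>degree q. coeff q j * L j x) = 0" for x
  proof -
    have "degree q \<le> d" by (rule degree_le) (simp add: coeff_q)
    then have "(\<Sum>j\<le>degree q. coeff q j * L j x) = (\<Sum>j\<le>d. coeff q j * L j x)"
      by (intro sum.mono_neutral_left) (auto simp: coeff_eq_0)
    also have "\<dots> = (\<Sum>j\<le>d. u j * L j x)" by (rule sum.cong) (auto simp: coeff_q)
    finally show ?thesis using u(2) by simp
  qed
  ultimately show ?thesis using that by blast
qed

text \<open>
  All translates of \<open>F\<close> in the angle span a finite-dimensional space, which therefore contains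
  all derivatives; a linear relation among these is an equation with constant coefficients
  that does not depend on the parameter.
\<close>

lemma uniform_trig:
  fixes F :: "'r \<Rightarrow> real \<Rightarrow> complex"
  assumes B: "finite B" "\<And>\<theta>. (\<lambda>(r, \<phi>). F r (\<phi> + \<theta>)) \<in> cfun.span B"
    and F: "\<And>r. smooth_on (F r) UNIV" "\<And>r \<theta>. F r (\<theta> + 2 * pi) = F r \<theta>"
  obtains N where "\<And>r. F r \<in> trig N"
proof -
  obtain P b where P: "finite P" "\<And>v x. v \<in> cfun.span B \<Longrightarrow> v x = (\<Sum>p\<in>P. v p * b p x)"
  proof (rule interpolation_basis[OF B(1)])
    fix P b
    assume "finite P" "\<And>v x. v \<in> cfun.span B \<Longrightarrow> v x = (\<Sum>p\<in>P. v p * b p x)"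
    then show thesis by (rule that)
  qed
  define L where "L j = (\<lambda>(r, \<phi>). (vd ^^ j) (F r) \<phi>)" for j
  have F_exp: "F r (\<phi> + \<theta>) = (\<Sum>p\<in>P. F (fst p) (snd p + \<theta>) * b p (r, \<phi>))" for r \<phi> \<theta>
    using P(2)[OF B(2)[of \<theta>], of "(r, \<phi>)"] by (simp add: split_beta)
  \<comment> \<open>In \<open>F_exp\<close> the shift \<theta> enters the right-hand side only
    through values of F at the nodes. The finite sum is therefore differentiated in \<theta> term by
    term, although nothing is known about regularity of \<open>b p\<close>.\<close>
  have deriv: "(vd ^^ j) (F r) (\<phi> + \<theta>) = (\<Sum>p\<in>P. (vd ^^ j) (F (fst p)) (snd p + \<theta>) * b p (r, \<phi>))" for j r \<phi> \<theta>
  proof (induction j arbitrary: \<theta>)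
    case 0
    show ?case unfolding funpow_0 by (rule F_exp)
  next
    case (Suc j)
    have shift: "((\<lambda>\<theta>. (vd ^^ j) (F r) (a + \<theta>)) has_vector_derivative (vd ^^ Suc j) (F r) (a + \<theta>)) (at \<theta>)" for a r
    proof -
      have "((\<lambda>\<theta>. a + \<theta>) has_real_derivative 1) (at \<theta>)"
        by (auto intro!: derivative_eq_intros)
      from vd_compose[OF open_UNIV smooth_on_vd_funpow[OF open_UNIV F(1)] UNIV_I this, of j r]
      show ?thesis by simp
    qed
    have "((\<lambda>\<theta>. \<Sum>p\<in>P. (vd ^^ j) (F (fst p)) (snd p + \<theta>) * b p (r, \<phi>)) has_vector_derivative
        (\<Sum>p\<in>P. (vd ^^ Suc j) (F (fst p)) (snd p + \<theta>) * b p (r, \<phi>))) (at \<theta>)"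
      by (intro has_vector_derivative_sum has_vector_derivative_mult_left shift)
    then show ?case
      using shift[of r \<phi>] unfolding Suc.IH by (rule vector_derivative_unique_at[rotated])
  qed
  have "L j \<in> cfun.span (b ` P)" for j
  proof -
    have "(\<lambda>x. \<Sum>p\<in>P. L j p * b p x) \<in> cfun.span (b ` P)"
      by (intro span_sumI span_cmultI cfun.span_base) auto
    moreover have "L j = (\<lambda>x. \<Sum>p\<in>P. L j p * b p x)"
    proof
      fix x
      show "L j x = (\<Sum>p\<in>P. L j p * b p x)"
        using deriv[of j "fst x" "snd x" 0] unfolding L_def split_beta add_0_right prod.collapse .
    qed
    ultimately show ?thesis by simp
  qed
  then obtain q where q: "q \<noteq> 0" "\<And>x. (\<Sum>j\<le>degree q. coeff q j * L j x) = 0"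
    using finite_dim_relation[of "b ` P" L] P(1) by blast
  obtain N where "\<And>y. smooth_on y UNIV \<Longrightarrow> (\<And>\<theta>. y (\<theta> + 2 * pi) = y \<theta>) \<Longrightarrow>
    (\<And>\<theta>. (\<Sum>j\<le>degree q. coeff q j * (vd ^^ j) y \<theta>) = 0) \<Longrightarrow> y \<in> trig N"
    using periodic_ode_trig[OF q(1)] by blast
  moreover have "(\<Sum>j\<le>degree q. coeff q j * (vd ^^ j) (F r) \<theta>) = 0" for r \<theta>
    using q(2)[of "(r, \<theta>)"] by (simp add: L_def)
  ultimately have "F r \<in> trig N" for r using F by blast
  then show ?thesis using that by blast
qed


section \<open>Restriction of K-finite functions to circles\<close>

lemma smooth_on_cos_sin: "smooth_on cos (UNIV :: real set)" "smooth_on sin (UNIV :: real set)"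
proof -
  have "smooth_on (\<lambda>x. c * cos x + d * sin x) (UNIV :: real set)" for c d :: real
  proof (rule smooth_on_real_coinduct[where X = "{\<lambda>x. c * cos x + d * sin x | c d. True}"])
    fix g assume "g \<in> {\<lambda>x::real. c * cos x + d * sin x | c d. True}"
    then obtain c d where g: "g = (\<lambda>x. c * cos x + d * sin x)" by blast
    have "(g has_vector_derivative d * cos x + (- c) * sin x) (at x)" for x
      unfolding g has_real_derivative_iff_has_vector_derivative[symmetric]
      by (auto intro!: derivative_eq_intros)
    then show "\<exists>g'\<in>{\<lambda>x::real. c * cos x + d * sin x | c d. True}. \<forall>x\<in>UNIV. (g has_vector_derivative g' x) (at x)"
      by (intro bexI[of _ "\<lambda>x. d * cos x + (- c) * sin x"]) blast+
  next
    fix g and e :: real assume "g \<in> {\<lambda>x::real. c * cos x + d * sin x | c d. True}"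
    then obtain c d where g: "g = (\<lambda>x. c * cos x + d * sin x)" by blast
    have "(\<lambda>x. e *\<^sub>R g x) = (\<lambda>x. (e * c) * cos x + (e * d) * sin x)"
      by (simp add: g fun_eq_iff algebra_simps)
    then show "(\<lambda>x. e *\<^sub>R g x) \<in> {\<lambda>x::real. c * cos x + d * sin x | c d. True}" by blast
  qed auto
  from this[of 1 0] this[of 0 1] show "smooth_on cos (UNIV :: real set)" "smooth_on sin (UNIV :: real set)"
    by simp_all
qed

lemma orthogonal_transformation_reflection:
  fixes v :: "'a::euclidean_space"
  assumes "v \<noteq> 0"
  shows "orthogonal_transformation (\<lambda>x. x - (2 * (x \<bullet> v) / (v \<bullet> v)) *\<^sub>R v)"
proof -
  have "linear (\<lambda>x. x - (2 * (x \<bullet> v) / (v \<bullet> v)) *\<^sub>R v)"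
    by (rule linearI) (simp_all add: inner_add_left algebra_simps add_divide_distrib)
  moreover have "(x - (2 * (x \<bullet> v) / (v \<bullet> v)) *\<^sub>R v) \<bullet> (y - (2 * (y \<bullet> v) / (v \<bullet> v)) *\<^sub>R v) = x \<bullet> y" for x y
  proof -
    have "(x - c *\<^sub>R v) \<bullet> (y - d *\<^sub>R v) = x \<bullet> y - d * (x \<bullet> v) - c * (y \<bullet> v) + c * d * (v \<bullet> v)" for c d
      by (simp add: inner_diff_left inner_diff_right inner_commute[of v y] algebra_simps)
    then show ?thesis using assms by (simp only:) (simp add: field_simps)
  qed
  ultimately show ?thesis by (simp add: orthogonal_transformation_def)
qed

text \<open>After a has been moved to a', the reflection in the hyperplane orthogonal to b1 - b'
  exchanges b1 and b'. It fixes a', which is orthogonal to both.\<close>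

lemma orthonormal_pair_map:
  fixes a b a' b' :: "real^'n"
  assumes "norm a = 1" "norm b = 1" "a \<bullet> b = 0" "norm a' = 1" "norm b' = 1" "a' \<bullet> b' = 0"
  obtains h where "orthogonal_transformation h" "h a = a'" "h b = b'"
proof -
  obtain h where h: "orthogonal_transformation h" "h a = a'"
    using orthogonal_transformation_exists_1[OF assms(1,4)] by blast
  define b1 where "b1 = h b"
  have b1: "norm b1 = 1" "a' \<bullet> b1 = 0"
    using h assms by (auto simp: b1_def orthogonal_transformation_norm orthogonal_transformation_def)
  show ?thesis
  proof (cases "b1 = b'")
    case True
    then show ?thesis using that[of h] h by (simp add: b1_def)
  next
    case False
    define v where "v = b1 - b'"
    have v: "v \<noteq> 0" using False by (simp add: v_def)
    let ?R = "\<lambda>x. x - (2 * (x \<bullet> v) / (v \<bullet> v)) *\<^sub>R v"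
    have "b1 \<bullet> b1 = 1" "b' \<bullet> b' = 1" using b1 assms by (simp_all add: norm_eq_1)
    then have "2 * (b1 \<bullet> v) = v \<bullet> v"
      by (simp add: v_def inner_diff_left inner_diff_right inner_commute[of b' b1])
    then have "?R b1 = b'" using v by (simp add: v_def)
    moreover have "?R a' = a'" using b1 assms by (simp add: v_def inner_diff_right)
    ultimately show ?thesis
      using that[of "?R \<circ> h"] h orthogonal_transformation_compose[OF orthogonal_transformation_reflection[OF v] h(1)]
      by (simp add: b1_def)
  qed
qed

lemma matrix_inv_orthogonal:
  fixes A :: "real^'n^'n"
  assumes "orthogonal_matrix A" shows "matrix_inv A = transpose A"
proof -
  have A: "transpose A ** A = mat 1" "A ** transpose A = mat 1"
    using assms by (auto simp: orthogonal_matrix_def)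
  show ?thesis
    unfolding matrix_inv_def
  proof (rule some_equality)
    fix B assume "A ** B = mat 1 \<and> B ** A = mat 1"
    then show "B = transpose A"
      using A by (metis matrix_mul_assoc matrix_mul_lid matrix_mul_rid)
  qed (use A in simp)
qed

lemma K_finite_orthogonal_span:
  fixes f :: "real^'n \<Rightarrow> complex"
  assumes "K_finite f"
  obtains B where "finite B" "\<And>h :: real^'n \<Rightarrow> real^'n. orthogonal_transformation h \<Longrightarrow> (\<lambda>x. f (h x)) \<in> cfun.span B"
proof -
  obtain B where B: "finite B" "cfun.span {mat_act g f | g. orthogonal_matrix g} \<subseteq> cfun.span B"
    using assms by (auto simp: K_finite_def)
  have "(\<lambda>x. f (h x)) \<in> cfun.span B" if h: "orthogonal_transformation h" for h :: "real^'n \<Rightarrow> real^'n"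
  proof -
    let ?A = "matrix h"
    have A: "orthogonal_matrix ?A" "h = (\<lambda>x. ?A *v x)"
      using h orthogonal_transformation_matrix[of h] by (auto simp: matrix_works fun_eq_iff)
    then have t: "orthogonal_matrix (transpose ?A)" by simp
    have "matrix_inv (transpose ?A) = ?A"
      using matrix_inv_orthogonal[OF t] by simp
    then have "mat_act (transpose ?A) f = (\<lambda>x. f (h x))"
      using A(2) by (simp add: mat_act_def)
    then have "(\<lambda>x. f (h x)) \<in> {mat_act g f | g. orthogonal_matrix g}"
      using t by (intro CollectI exI[of _ "transpose ?A"] conjI) simp_all
    then show ?thesis by (intro subsetD[OF B(2)] cfun.span_base)
  qed
  then show ?thesis by (rule that[OF B(1)])
qed

text \<open>A common N for all circles and all radii comes from treating them as one family, indexed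
  by an orthogonal map h and a radius and consisting of images of a fixed coordinate circle.
  \<open>uniform_trig\<close> applies once the angular shifts of the whole family are known to lie
  in one finite-dimensional span.\<close>

lemma K_finite_circle_trig:
  fixes f :: "real^'n \<Rightarrow> complex"
  assumes "CARD('n) \<ge> 2" "K_finite f" "smooth_on f (- {0})"
  obtains N where "\<And>\<rho> a b. \<rho> > 0 \<Longrightarrow> norm a = 1 \<Longrightarrow> norm b = 1 \<Longrightarrow> a \<bullet> b = 0 \<Longrightarrow>
    (\<lambda>\<theta>. f ((\<rho> * cos \<theta>) *\<^sub>R a + (\<rho> * sin \<theta>) *\<^sub>R b)) \<in> trig N"
proof -
  have "\<not> is_singleton (UNIV :: 'n set)"
    using assms(1) by (auto simp: is_singleton_altdef)
  then obtain i j :: 'n where "i \<noteq> j" by (metis UNIV_I is_singletonI' UNIV_not_empty)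
  define a0 :: "real^'n" where "a0 = axis i 1"
  define b0 :: "real^'n" where "b0 = axis j 1"
  have ab0: "norm a0 = 1" "norm b0 = 1" "a0 \<bullet> b0 = 0"
    using \<open>i \<noteq> j\<close> by (auto simp: a0_def b0_def inner_axis_axis)
  obtain B0 where B0: "finite B0" "\<And>h :: real^'n \<Rightarrow> real^'n. orthogonal_transformation h \<Longrightarrow> (\<lambda>x. f (h x)) \<in> cfun.span B0"
  proof (rule K_finite_orthogonal_span[OF assms(2)])
    fix B0
    assume "finite B0" "\<And>h :: real^'n \<Rightarrow> real^'n. orthogonal_transformation h \<Longrightarrow> (\<lambda>x. f (h x)) \<in> cfun.span B0"
    then show thesis by (rule that)
  qed
  obtain P and b :: "real^'n \<Rightarrow> real^'n \<Rightarrow> complex" where P: "finite P" "\<And>p. p \<in> P \<Longrightarrow> b p \<in> cfun.span B0"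
    "\<And>v x. v \<in> cfun.span B0 \<Longrightarrow> v x = (\<Sum>p\<in>P. v p * b p x)"
  proof (rule interpolation_basis[OF B0(1)])
    fix P b
    assume "finite P" "\<And>p. p \<in> P \<Longrightarrow> b p \<in> cfun.span B0"
      "\<And>v x. v \<in> cfun.span B0 \<Longrightarrow> v x = (\<Sum>p\<in>P. v p * b p x)"
    then show thesis by (rule that)
  qed
  \<comment> \<open>The index set is a whole type; inadmissible indices get the zero function, which
    is smooth and periodic.\<close>
  define ok where "ok r = (orthogonal_transformation (fst r) \<and> snd r > 0)" for r :: "((real^'n) \<Rightarrow> (real^'n)) \<times> real"
  define z where "z \<rho> \<theta> = (\<rho> * cos \<theta>) *\<^sub>R a0 + (\<rho> * sin \<theta>) *\<^sub>R b0" for \<rho> \<theta>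
  define F where "F r \<theta> = (if ok r then f (fst r (z (snd r) \<theta>)) else 0)" for r \<theta>
  define E where "E = (\<lambda>(p, q) (r, \<phi>). if ok r then f (fst r q) * b p (z (snd r) \<phi>) else 0)"
  have hz: "h (z \<rho> \<theta>) = (\<rho> * cos \<theta>) *\<^sub>R h a0 + (\<rho> * sin \<theta>) *\<^sub>R h b0" if "orthogonal_transformation h" for h \<rho> \<theta>
    using orthogonal_transformation_linear[OF that] by (simp add: z_def linear_add linear_scale)
  have span: "(\<lambda>(r, \<phi>). F r (\<phi> + \<theta>)) \<in> cfun.span (E ` (P \<times> P))" for \<theta>
  proof -
    let ?a = "cos \<theta> *\<^sub>R a0 + sin \<theta> *\<^sub>R b0" and ?b = "(- sin \<theta>) *\<^sub>R a0 + cos \<theta> *\<^sub>R b0"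
    have "a0 \<bullet> a0 = 1" "b0 \<bullet> b0 = 1" "b0 \<bullet> a0 = 0" using ab0 by (simp_all add: norm_eq_1 inner_commute)
    then have "norm ?a = 1" "norm ?b = 1" "?a \<bullet> ?b = 0"
      using ab0(3) by (simp_all add: norm_eq_1 inner_add_left inner_add_right inner_diff_left inner_diff_right
          power2_eq_square[symmetric] add.commute)
    then obtain R where R: "orthogonal_transformation R" "R a0 = ?a" "R b0 = ?b"
      using orthonormal_pair_map[OF ab0] by metis
    have Rz: "R (z \<rho> \<phi>) = z \<rho> (\<phi> + \<theta>)" for \<rho> \<phi>
      unfolding hz[OF R(1)] R(2,3) by (simp add: z_def cos_add sin_add algebra_simps)
    \<comment> \<open>Two interpolations: of x \<mapsto> f (h (R x)) at the point of the circle,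
      then of x \<mapsto> f (h x) at \<open>R p\<close>. Afterwards the angle \<theta> occurs only
      in the scalars \<open>b q (R p)\<close>.\<close>
    have "F r (\<phi> + \<theta>) = (\<Sum>p\<in>P. \<Sum>q\<in>P. b q (R p) * E (p, q) (r, \<phi>))" for r \<phi>
    proof (cases "ok r")
      case True
      let ?h = "fst r"
      have h: "orthogonal_transformation ?h" using True by (simp add: ok_def)
      have hR: "orthogonal_transformation (?h \<circ> R)" by (rule orthogonal_transformation_compose[OF h R(1)])
      have "F r (\<phi> + \<theta>) = f (?h (R (z (snd r) \<phi>)))" using True by (simp add: F_def Rz)
      also have "\<dots> = (\<Sum>p\<in>P. f (?h (R p)) * b p (z (snd r) \<phi>))"
        using P(3)[OF B0(2)[OF hR], of "z (snd r) \<phi>"] by simp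
      also have "\<dots> = (\<Sum>p\<in>P. (\<Sum>q\<in>P. f (?h q) * b q (R p)) * b p (z (snd r) \<phi>))"
        by (intro sum.cong refl arg_cong2[where f = "(*)"] P(3)[OF B0(2)[OF h]])
      also have "\<dots> = (\<Sum>p\<in>P. \<Sum>q\<in>P. b q (R p) * E (p, q) (r, \<phi>))"
        using True by (simp add: E_def sum_distrib_left sum_distrib_right mult_ac)
      finally show ?thesis .
    qed (simp add: F_def E_def)
    then have "(\<lambda>(r, \<phi>). F r (\<phi> + \<theta>)) = (\<lambda>x. \<Sum>p\<in>P. \<Sum>q\<in>P. b q (R p) * E (p, q) x)"
      by (simp add: fun_eq_iff)
    moreover have "\<dots> \<in> cfun.span (E ` (P \<times> P))"
      by (intro span_sumI span_cmultI cfun.span_base) auto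
    ultimately show ?thesis by simp
  qed
  have sm: "smooth_on (F r) UNIV" for r
  proof (cases "ok r")
    case True
    let ?h = "fst r"
    have h: "orthogonal_transformation ?h" and \<rho>: "snd r > 0" using True by (simp_all add: ok_def)
    have eq: "F r = (\<lambda>\<theta>. f ((snd r * cos \<theta>) *\<^sub>R ?h a0 + (snd r * sin \<theta>) *\<^sub>R ?h b0 + 0))"
      using True by (intro ext) (simp add: F_def hz[OF h])
    have nz: "z (snd r) \<theta> \<noteq> 0" for \<theta>
    proof
      assume "z (snd r) \<theta> = 0"
      then have "z (snd r) \<theta> \<bullet> a0 = 0" "z (snd r) \<theta> \<bullet> b0 = 0" by simp_all
      moreover have "a0 \<bullet> a0 = 1" "b0 \<bullet> b0 = 1" "b0 \<bullet> a0 = 0"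
        using ab0 by (simp_all add: norm_eq_1 inner_commute)
      ultimately have "snd r * cos \<theta> = 0" "snd r * sin \<theta> = 0"
        using ab0(3) by (simp_all add: z_def inner_add_left)
      then have "cos \<theta> = 0" "sin \<theta> = 0" using \<rho> by auto
      then show False using sin_cos_squared_add[of \<theta>] by simp
    qed
    have "(snd r * cos \<theta>) *\<^sub>R ?h a0 + (snd r * sin \<theta>) *\<^sub>R ?h b0 + 0 \<in> - {0}" for \<theta>
      using nz[of \<theta>] hz[OF h, of "snd r" \<theta>] orthogonal_transformation_norm[OF h, of "z (snd r) \<theta>"]
      by auto
    then show ?thesis unfolding eq
      using assms(3) by (intro smooth_on_compose_curve[where S = "- {0}"] smooth_on_cmult smooth_on_cos_sin) auto
  next
    case False
    then have "F r = (\<lambda>_. 0)" by (simp add: F_def fun_eq_iff)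
    then show ?thesis by simp
  qed
  have per: "F r (\<theta> + 2 * pi) = F r \<theta>" for r \<theta>
    by (simp add: F_def z_def)
  obtain N where N: "\<And>r. F r \<in> trig N"
  proof (rule uniform_trig[OF _ span sm per])
    show "finite (E ` (P \<times> P))" using P(1) by simp
    fix N assume "\<And>r. F r \<in> trig N"
    then show thesis by (rule that)
  qed
  have "(\<lambda>\<theta>. f ((\<rho> * cos \<theta>) *\<^sub>R a + (\<rho> * sin \<theta>) *\<^sub>R b)) \<in> trig N"
    if ab: "\<rho> > 0" "norm a = 1" "norm b = 1" "a \<bullet> b = 0" for \<rho> a b
  proof -
    obtain h where h: "orthogonal_transformation h" "h a0 = a" "h b0 = b"
      using orthonormal_pair_map[OF ab0 ab(2-4)] by blast
    have "F (h, \<rho>) = (\<lambda>\<theta>. f ((\<rho> * cos \<theta>) *\<^sub>R a + (\<rho> * sin \<theta>) *\<^sub>R b))"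
      using h ab hz[OF h(1)] by (simp add: F_def ok_def fun_eq_iff)
    then show ?thesis using N[of "(h, \<rho>)"] by simp
  qed
  then show ?thesis by (rule that)
qed

section \<open>From trigonometric polynomials on great circles to polynomials on spheres\<close>

lemma cis_power_poly:
  "\<exists>p. degree p \<le> k + l \<and> (\<forall>s \<rho> \<theta>. s + \<alpha> = \<rho> * cos \<theta> \<longrightarrow> \<beta> = \<rho> * sin \<theta> \<longrightarrow>
    poly p (complex_of_real s) = of_real (\<rho> ^ (k + l)) * cis ((real k - real l) * \<theta>))"
proof (intro exI conjI allI impI)
  \<comment> \<open>With \<zeta> = \<alpha> + i \<beta> the point of the line is \<zeta> + s =
    \<rho> exp(i \<theta>). The polynomial (\<zeta> + s)^k (cnj \<zeta> + s)^l in s thus has the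
    modulus \<rho>^(k + l) and the frequency k - l.\<close>
  let ?\<zeta> = "Complex \<alpha> \<beta>"
  let ?p = "[:?\<zeta>, 1:] ^ k * [:cnj ?\<zeta>, 1:] ^ l"
  have "degree ?p \<le> degree ([:?\<zeta>, 1:] ^ k) + degree ([:cnj ?\<zeta>, 1:] ^ l)" by (rule degree_mult_le)
  also have "\<dots> \<le> k + l"
    using degree_power_le[of "[:?\<zeta>, 1:]" k] degree_power_le[of "[:cnj ?\<zeta>, 1:]" l] by simp
  finally show "degree ?p \<le> k + l" .
  fix s \<rho> \<theta> assume s: "s + \<alpha> = \<rho> * cos \<theta>" "\<beta> = \<rho> * sin \<theta>"
  have "?\<zeta> + of_real s = of_real \<rho> * cis \<theta>" "cnj ?\<zeta> + of_real s = of_real \<rho> * cis (- \<theta>)"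
    using s by (simp_all add: complex_eq_iff algebra_simps)
  then have "poly ?p (of_real s) = (of_real \<rho> * cis \<theta>) ^ k * (of_real \<rho> * cis (- \<theta>)) ^ l"
    by (simp add: poly_mult poly_power)
  also have "\<dots> = of_real (\<rho> ^ (k + l)) * (cis (real k * \<theta>) * cis (real l * (- \<theta>)))"
    by (simp only: power_mult_distrib Complex.DeMoivre power_add of_real_mult of_real_power mult_ac)
  also have "cis (real k * \<theta>) * cis (real l * (- \<theta>)) = cis ((real k - real l) * \<theta>)"
    by (simp add: cis_mult algebra_simps)
  finally show "poly ?p (of_real s) = of_real (\<rho> ^ (k + l)) * cis ((real k - real l) * \<theta>)" .
qed

text \<open>
  Homogenizing a trigonometric polynomial: terms with the parity of \<open>N\<close> get the factor
  \<open>\<rho> ^ N\<close>, the others \<open>\<rho> ^ (N + 1)\<close>.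
\<close>

definition homogenize :: "nat \<Rightarrow> real \<Rightarrow> complex \<Rightarrow> complex \<Rightarrow> complex" where
  "homogenize N \<rho> u v = (of_real (\<rho> ^ N) * (u + (-1) ^ N * v) + of_real (\<rho> ^ Suc N) * (u - (-1) ^ N * v)) / 2"

text \<open>The shift by pi multiplies the frequency m by (-1)^m, so the combination in
  \<open>homogenize\<close> sorts frequencies by parity. With L = N or L = N + 1 of the same parity
  as m, the exponents (L + m) / 2 and (L - m) / 2 in \<open>cis_power_poly\<close> are natural
  numbers because \<bar>m\<bar> \<le> N.\<close>

lemma trig_line_poly:
  assumes "T \<in> trig N"
  shows "\<exists>p. degree p \<le> Suc N \<and> (\<forall>s \<rho> \<theta>. s + \<alpha> = \<rho> * cos \<theta> \<longrightarrow> \<beta> = \<rho> * sin \<theta> \<longrightarrow>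
    poly p (complex_of_real s) = homogenize N \<rho> (T \<theta>) (T (\<theta> + pi)))"
  using assms unfolding trig_def
proof (induction rule: span_fun_induct)
  case zero
  show ?case by (rule exI[of _ 0]) (simp add: homogenize_def)
next
  case (add c f g)
  then obtain p q where "degree p \<le> Suc N" "degree q \<le> Suc N"
    and p: "\<And>s \<rho> \<theta>. s + \<alpha> = \<rho> * cos \<theta> \<Longrightarrow> \<beta> = \<rho> * sin \<theta> \<Longrightarrow>
      poly p (complex_of_real s) = homogenize N \<rho> (f \<theta>) (f (\<theta> + pi))"
    and q: "\<And>s \<rho> \<theta>. s + \<alpha> = \<rho> * cos \<theta> \<Longrightarrow> \<beta> = \<rho> * sin \<theta> \<Longrightarrow>
      poly q (complex_of_real s) = homogenize N \<rho> (g \<theta>) (g (\<theta> + pi))" by blast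
  then have "degree (smult c p + q) \<le> Suc N"
    by (meson degree_add_le degree_smult_le order_trans)
  moreover have "poly (smult c p + q) (complex_of_real s)
      = homogenize N \<rho> (c * f \<theta> + g \<theta>) (c * f (\<theta> + pi) + g (\<theta> + pi))"
    if "s + \<alpha> = \<rho> * cos \<theta>" "\<beta> = \<rho> * sin \<theta>" for s \<rho> \<theta>
    unfolding poly_add poly_smult p[OF that] q[OF that] homogenize_def
    by (simp add: algebra_simps add_divide_distrib diff_divide_distrib)
  ultimately show ?case by blast
next
  case (base f)
  then obtain m where m: "f = (\<lambda>\<theta>. cis (of_int m * \<theta>))" "\<bar>m\<bar> \<le> int N" by blast
  have shift: "f (\<theta> + pi) = (if even m then 1 else - 1) * f \<theta>" for \<theta>
  proof -
    have "f (\<theta> + pi) = cis (of_int m * pi) * f \<theta>"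
      by (simp add: m cis_mult algebra_simps)
    moreover have "cis (of_int m * pi) = (if even m then 1 else - 1)"
      using cos_npi_int[of m] sin_npi_int[of m] by (simp add: complex_eq_iff mult.commute)
    ultimately show ?thesis by simp
  qed
  have N: "(-1) ^ N = (if even N then 1 else - 1 :: complex)" by simp
  obtain k l where kl: "real k - real l = of_int m"
    "homogenize N \<rho> (f \<theta>) (f (\<theta> + pi)) = of_real (\<rho> ^ (k + l)) * f \<theta>" "k + l \<le> Suc N" for \<rho> \<theta>
  proof (cases "even (int N + m)")
    case True
    then obtain k where k: "int N + m = 2 * k" by blast
    show ?thesis
    proof (rule that[of "nat k" "nat (int N - k)"])
      have "k \<ge> 0" "int N - k \<ge> 0" using k m(2) by linarith+
      then show "real (nat k) - real (nat (int N - k)) = of_int m" and *: "nat k + nat (int N - k) \<le> Suc N"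
        using k by linarith+
      have "nat k + nat (int N - k) = N" using \<open>k \<ge> 0\<close> \<open>int N - k \<ge> 0\<close> by linarith
      then show "homogenize N \<rho> (f \<theta>) (f (\<theta> + pi)) = of_real (\<rho> ^ (nat k + nat (int N - k))) * f \<theta>" for \<rho> \<theta>
        using True by (auto simp: homogenize_def shift N)
    qed
  next
    case False
    then have "even (int N + 1 + m)" by simp
    then obtain k where k: "int N + 1 + m = 2 * k" by blast
    show ?thesis
    proof (rule that[of "nat k" "nat (int N + 1 - k)"])
      have "k \<ge> 0" "int N + 1 - k \<ge> 0" using k m(2) by linarith+
      then show "real (nat k) - real (nat (int N + 1 - k)) = of_int m" and *: "nat k + nat (int N + 1 - k) \<le> Suc N"
        using k by linarith+
      have "nat k + nat (int N + 1 - k) = Suc N" using \<open>k \<ge> 0\<close> \<open>int N + 1 - k \<ge> 0\<close> by linarith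
      then show "homogenize N \<rho> (f \<theta>) (f (\<theta> + pi)) = of_real (\<rho> ^ (nat k + nat (int N + 1 - k))) * f \<theta>" for \<rho> \<theta>
        using False by (auto simp: homogenize_def shift N)
    qed
  qed
  obtain p where "degree p \<le> k + l" "\<And>s \<rho> \<theta>. s + \<alpha> = \<rho> * cos \<theta> \<Longrightarrow> \<beta> = \<rho> * sin \<theta> \<Longrightarrow>
    poly p (complex_of_real s) = of_real (\<rho> ^ (k + l)) * cis ((real k - real l) * \<theta>)"
    using cis_power_poly[of k l \<alpha> \<beta>] by blast
  then show ?case using kl by (intro exI[of _ p]) (auto simp: m(1))
qed


text \<open>A line parallel to a coordinate axis lies in a plane through the origin, spanned by the
  axis and a unit vector b orthogonal to it. The directions of its points lie on the great circle of
  that plane, where f is a trigonometric polynomial.\<close>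

lemma homogenized_line_poly:
  fixes f :: "real^'n \<Rightarrow> complex"
  assumes n: "CARD('n) \<ge> 2" and N: "N \<ge> 1"
    and T: "\<And>a b. norm a = 1 \<Longrightarrow> norm b = 1 \<Longrightarrow> a \<bullet> b = 0 \<Longrightarrow>
      (\<lambda>\<theta>. f ((r * cos \<theta>) *\<^sub>R a + (r * sin \<theta>) *\<^sub>R b)) \<in> trig N"
  shows "\<exists>p. degree p \<le> Suc N \<and> (\<forall>s. homogenize N (norm (x + s *\<^sub>R axis i 1))
      (f (r *\<^sub>R ((x + s *\<^sub>R axis i 1) /\<^sub>R norm (x + s *\<^sub>R axis i 1))))
      (f (- (r *\<^sub>R ((x + s *\<^sub>R axis i 1) /\<^sub>R norm (x + s *\<^sub>R axis i 1))))) = poly p (of_real s))"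
proof -
  define a :: "real^'n" where "a = axis i 1"
  define \<alpha> where "\<alpha> = x $ i"
  define x' where "x' = x - \<alpha> *\<^sub>R a"
  have a: "norm a = 1" "a \<bullet> a = 1" by (simp_all add: a_def inner_axis_axis)
  have ax': "a \<bullet> x' = 0" using a by (simp add: x'_def \<alpha>_def inner_diff_right a_def inner_axis' inner_axis)
  obtain b \<beta> where b: "norm b = 1" "a \<bullet> b = 0" "x' = \<beta> *\<^sub>R b"
  proof (cases "x' = 0")
    case True
    \<comment> \<open>A line through the origin determines no plane; any second coordinate axis
      serves as b, and this takes dimension at least 2.\<close>
    have "\<exists>j. j \<noteq> i"
    proof (rule ccontr)
      assume "\<not> (\<exists>j. j \<noteq> i)"
      then have "(UNIV :: 'n set) = {i}" by auto
      then have "CARD('n) = card {i}" by simp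
      then show False using n by simp
    qed
    then obtain j where "j \<noteq> i" by blast
    then show ?thesis
      using that[of "axis j 1" 0] True by (simp add: a_def inner_axis_axis)
  next
    case False
    then show ?thesis using that[of "x' /\<^sub>R norm x'" "norm x'"] ax' by simp
  qed
  define T where "T \<theta> = f ((r * cos \<theta>) *\<^sub>R a + (r * sin \<theta>) *\<^sub>R b)" for \<theta>
  have "T \<in> trig N" unfolding T_def[abs_def] by (rule assms(3)[OF a(1) b(1,2)])
  from trig_line_poly[OF this, of \<alpha> \<beta>] obtain p where p: "degree p \<le> Suc N"
    "\<And>s \<rho> \<theta>. s + \<alpha> = \<rho> * cos \<theta> \<Longrightarrow> \<beta> = \<rho> * sin \<theta> \<Longrightarrow>
      poly p (complex_of_real s) = homogenize N \<rho> (T \<theta>) (T (\<theta> + pi))" by blast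
  have "homogenize N (norm (x + s *\<^sub>R a)) (f (r *\<^sub>R ((x + s *\<^sub>R a) /\<^sub>R norm (x + s *\<^sub>R a))))
      (f (- (r *\<^sub>R ((x + s *\<^sub>R a) /\<^sub>R norm (x + s *\<^sub>R a))))) = poly p (of_real s)" for s
  proof -
    define \<rho> where "\<rho> = norm (x + s *\<^sub>R a)"
    obtain \<theta> where \<theta>: "s + \<alpha> = cmod (Complex (s + \<alpha>) \<beta>) * cos \<theta>" "\<beta> = cmod (Complex (s + \<alpha>) \<beta>) * sin \<theta>"
      using rcis_cmod_Arg[of "Complex (s + \<alpha>) \<beta>"] by (metis Re_rcis Im_rcis complex.sel)
    have xs: "x + s *\<^sub>R a = (s + \<alpha>) *\<^sub>R a + \<beta> *\<^sub>R b"
      using b(3) by (simp add: x'_def algebra_simps)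
    have "b \<bullet> b = 1" "b \<bullet> a = 0" using b by (simp_all add: norm_eq_1 inner_commute)
    then have "\<rho> = sqrt ((s + \<alpha>)\<^sup>2 + \<beta>\<^sup>2)"
      using a b(2) by (simp add: \<rho>_def xs norm_eq_sqrt_inner inner_add_left inner_add_right power2_eq_square)
    then have "\<rho> = cmod (Complex (s + \<alpha>) \<beta>)" by (simp add: complex_norm)
    then have \<theta>': "s + \<alpha> = \<rho> * cos \<theta>" "\<beta> = \<rho> * sin \<theta>" using \<theta> by simp_all
    show ?thesis
    proof (cases "\<rho> = 0")
      case True
      \<comment> \<open>At the origin there is no direction, but N \<ge> 1 makes both sides
        vanish.\<close>
      then show ?thesis using p(2)[OF \<theta>'] N by (simp add: \<rho>_def[symmetric] homogenize_def)
    next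
      case False
      have "(x + s *\<^sub>R a) /\<^sub>R \<rho> = cos \<theta> *\<^sub>R a + sin \<theta> *\<^sub>R b"
        unfolding xs \<theta>' using False by (simp add: scaleR_add_right mult.assoc[symmetric])
      then have "r *\<^sub>R ((x + s *\<^sub>R a) /\<^sub>R \<rho>) = (r * cos \<theta>) *\<^sub>R a + (r * sin \<theta>) *\<^sub>R b"
        by (simp add: scaleR_add_right)
      moreover have "- ((r * cos \<theta>) *\<^sub>R a + (r * sin \<theta>) *\<^sub>R b) = (r * cos (\<theta> + pi)) *\<^sub>R a + (r * sin (\<theta> + pi)) *\<^sub>R b"
        by simp
      ultimately show ?thesis
        using p(2)[OF \<theta>'] by (simp only: \<rho>_def[symmetric] T_def)
    qed
  qed
  then show ?thesis using p(1) unfolding a_def by blast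
qed

text \<open>Along each axis G is a combination of its values at fixed nodes, with coefficients
  polynomial in that coordinate. The bound D is uniform, so the nodes are the same on all lines, and
  the coordinates can be replaced by nodes one after the other until only constants remain of
  G.\<close>

lemma separately_poly_imp_poly:
  fixes G :: "real^'n \<Rightarrow> complex"
  assumes "\<And>x i. \<exists>p. degree p \<le> D \<and> (\<forall>s. G (x + s *\<^sub>R axis i 1) = poly p (of_real s))"
  shows "G \<in> cfun.span {Q. \<exists>m\<le>D * CARD('n). hpoly m Q}"
proof -
  define B where "B = (\<lambda>k (s::real). complex_of_real s ^ k) ` {..D}"
  have line_span: "(\<lambda>s. G (x + s *\<^sub>R axis i 1)) \<in> cfun.span B" for x i
  proof -
    obtain p where p: "degree p \<le> D" "\<And>s. G (x + s *\<^sub>R axis i 1) = poly p (of_real s)"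
      using assms by blast
    have "(\<lambda>s. \<Sum>k\<le>degree p. coeff p k * complex_of_real s ^ k) \<in> cfun.span B"
      using p(1) by (intro span_sumI span_cmultI cfun.span_base) (auto simp: B_def)
    then show ?thesis by (simp add: p(2) poly_altdef)
  qed
  obtain P and b :: "real \<Rightarrow> real \<Rightarrow> complex" where P: "finite P" "\<And>p. p \<in> P \<Longrightarrow> b p \<in> cfun.span B"
    "\<And>v x. v \<in> cfun.span B \<Longrightarrow> v x = (\<Sum>p\<in>P. v p * b p x)"
  proof (rule interpolation_basis[of B])
    show "finite B" by (simp add: B_def)
    fix P b
    assume "finite P" "\<And>p. p \<in> P \<Longrightarrow> b p \<in> cfun.span B"
      "\<And>v x. v \<in> cfun.span B \<Longrightarrow> v x = (\<Sum>p\<in>P. v p * b p x)"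
    then show thesis by (rule that)
  qed
  define repl :: "'n set \<Rightarrow> ('n \<Rightarrow> real) \<Rightarrow> real^'n \<Rightarrow> real^'n" where
    "repl A c x = (\<chi> j. if j \<in> A then c j else x $ j)" for A c x
  \<comment> \<open>Products of a polynomial with G, the coordinates in \<open>A\<close> being
    frozen. Freezing one more coordinate costs at most D in degree.\<close>
  define W where "W A = {\<lambda>x. Q x * G (repl A c x) | Q c. \<exists>m\<le>D * card A. hpoly m Q}" for A
  have "G \<in> cfun.span (W A)" if "finite A" for A
    using that
  proof (induction A rule: finite_induct)
    case empty
    have "repl {} c x = x" for c x by (simp add: repl_def vec_eq_iff)
    then have "G = (\<lambda>x. 1 * G (repl {} (\<lambda>_. 0) x))" by simp
    then have "G \<in> W {}"
      unfolding W_def by (intro CollectI exI[of _ "\<lambda>_. 1"] exI[of _ "\<lambda>_. 0"]) (use hpoly_const in auto)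
    then show ?case by (rule cfun.span_base)
  next
    case (insert i A)
    have "W A \<subseteq> cfun.span (W (insert i A))"
    proof
      fix F assume "F \<in> W A"
      then obtain Q c m where F: "F = (\<lambda>x. Q x * G (repl A c x))" "m \<le> D * card A" "hpoly m Q"
        unfolding W_def by blast
      let ?K = "\<lambda>p x. G (repl (insert i A) (c(i := p)) x)"
      have step: "(\<lambda>x. Q x * g (x $ i) * ?K p x) \<in> cfun.span (W (insert i A))" if "g \<in> cfun.span B" for g p
        using that
      proof (induction rule: span_fun_induct)
        case zero
        then show ?case by (simp add: span_zeroI)
      next
        case (add d g h)
        have "(\<lambda>x. d * (Q x * g (x $ i) * ?K p x) + Q x * h (x $ i) * ?K p x) \<in> cfun.span (W (insert i A))"
          using add by (intro span_addI span_cmultI)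
        moreover have "Q x * (d * u + v) * y = d * (Q x * u * y) + Q x * v * y" for x u v y
          by (simp add: algebra_simps)
        ultimately show ?case by (simp only:)
      next
        case (base g)
        then obtain k where k: "g = (\<lambda>s. complex_of_real s ^ k)" "k \<le> D" unfolding B_def by blast
        have "hpoly (m + l) (\<lambda>x. Q x * complex_of_real (x $ i) ^ l)" for l
        proof (induction l)
          case (Suc l)
          then show ?case using hpoly_mult_coord[OF Suc, of i] by (simp add: mult_ac)
        qed (simp add: F(3))
        moreover have "m + k \<le> D * card (insert i A)" using insert F(2) k(2) by simp
        ultimately have "(\<lambda>x. Q x * g (x $ i) * ?K p x) \<in> W (insert i A)"
          unfolding W_def k(1)
          by (intro CollectI exI[of _ "\<lambda>x. Q x * complex_of_real (x $ i) ^ k"] exI[of _ "c(i := p)"] conjI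
              exI[of _ "m + k"] refl)
        then show ?case by (rule cfun.span_base)
      qed
      have "F x = (\<Sum>p\<in>P. Q x * b p (x $ i) * ?K p x)" for x
      proof -
        let ?y = "repl A c x - (x $ i) *\<^sub>R axis i 1"
        have "?y + p *\<^sub>R axis i 1 = repl (insert i A) (c(i := p)) x" for p
          using insert(2) by (auto simp: vec_eq_iff repl_def axis_def)
        then have "G (repl A c x) = (\<Sum>p\<in>P. ?K p x * b p (x $ i))"
          using P(3)[OF line_span[of ?y i], of "x $ i"] by simp
        then show ?thesis by (simp add: F(1) sum_distrib_left mult_ac)
      qed
      then have "F = (\<lambda>x. \<Sum>p\<in>P. Q x * b p (x $ i) * ?K p x)" by blast
      also have "\<dots> \<in> cfun.span (W (insert i A))"
        using step P(2) by (intro span_sumI) auto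
      finally show "F \<in> cfun.span (W (insert i A))" .
    qed
    then have "cfun.span (W A) \<subseteq> cfun.span (W (insert i A))"
      by (intro cfun.span_minimal cfun.subspace_span)
    then show ?case using insert.IH by blast
  qed
  then have "G \<in> cfun.span (W UNIV)" by simp
  also have "W UNIV \<subseteq> cfun.span {Q. \<exists>m\<le>D * CARD('n). hpoly m Q}"
  proof
    fix F assume "F \<in> W UNIV"
    then obtain Q c m where F: "F = (\<lambda>x. Q x * G (repl UNIV c x))" "m \<le> D * CARD('n)" "hpoly m Q"
      unfolding W_def by blast
    have "F = (\<lambda>x. G (\<chi> j. c j) * Q x)" by (simp add: F(1) repl_def mult.commute)
    then show "F \<in> cfun.span {Q. \<exists>m\<le>D * CARD('n). hpoly m Q}"
      using F(2,3) hpoly_cmult[of m Q] by (auto intro!: cfun.span_base)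
  qed
  then have "cfun.span (W UNIV) \<subseteq> cfun.span {Q. \<exists>m\<le>D * CARD('n). hpoly m Q}"
    by (intro cfun.span_minimal cfun.subspace_span)
  finally show ?thesis .
qed

lemma restr_in_span:
  assumes "f \<in> cfun.span S" "\<And>g. g \<in> S \<Longrightarrow> restr g \<in> cfun.span T"
  shows "restr f \<in> cfun.span T"
  using assms(1)
proof (induction rule: span_fun_induct)
  case zero
  then show ?case using span_zeroI by (simp add: restr_def[abs_def])
next
  case (add c f g)
  have "restr (\<lambda>x. c * f x + g x) = (\<lambda>x. c * restr f x + restr g x)"
    by (auto simp: restr_def fun_eq_iff)
  then show ?case using add by (simp add: span_addI span_cmultI)
qed (use assms in auto)

text \<open>For each r the homogenization of f on the sphere of radius r is a polynomial of degree
  at most D, with D independent of r. One finite set of harmonic restrictions therefore serves all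
  spheres; it is thinned out to an independent set so that components can be compared in
  \<open>M_op_kernel\<close>.\<close>

lemma sphere_decomposition:
  fixes f :: "real^'n \<Rightarrow> complex"
  assumes n: "CARD('n) \<ge> 2" and f: "f \<in> C_space"
  obtains B where "finite B" "cfun.independent B" "B \<subseteq> restr ` {Y. \<exists>k. solid_harmonic k Y}"
    "\<And>r. r > 0 \<Longrightarrow> restr (\<lambda>\<omega>. f (r *\<^sub>R \<omega>)) \<in> cfun.span B"
proof -
  have fK: "K_finite f" and fs: "smooth_on f (- {0})" using f by (auto simp: C_space_def)
  obtain N0 where N0: "\<And>\<rho> a b. \<rho> > 0 \<Longrightarrow> norm a = 1 \<Longrightarrow> norm b = 1 \<Longrightarrow> a \<bullet> b = 0 \<Longrightarrow>
    (\<lambda>\<theta>. f ((\<rho> * cos \<theta>) *\<^sub>R a + (\<rho> * sin \<theta>) *\<^sub>R b)) \<in> trig N0"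
    using K_finite_circle_trig[OF n fK fs] by blast
  \<comment> \<open>The successor ensures N \<ge> 1, which \<open>homogenized_line_poly\<close>
    requires at the origin.\<close>
  define N where "N = Suc N0"
  define D where "D = Suc N * CARD('n)"
  define S where "S = (\<Union>m\<le>D. mono_basis m :: (real^'n \<Rightarrow> complex) set)"
  let ?H = "restr ` {Y :: real^'n \<Rightarrow> complex. \<exists>k. solid_harmonic k Y}"
  have finS: "finite S" by (simp add: S_def finite_mono_basis)
  have "\<exists>T. finite T \<and> T \<subseteq> ?H \<and> restr Q \<in> cfun.span T" if q: "Q \<in> S" for Q
  proof -
    obtain m where "hpoly m Q" using q hpoly_mono_basis by (auto simp: S_def)
    then have "restr Q \<in> cfun.span ?H" by (rule restr_hpoly_span)
    then obtain T u where T: "finite T" "T \<subseteq> ?H" "restr Q = (\<Sum>a\<in>T. cscale (u a) a)"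
      unfolding cfun.span_explicit by blast
    then have "restr Q \<in> cfun.span T"
      by (simp add: cfun.span_sum cfun.span_scale cfun.span_base)
    then show ?thesis using T by blast
  qed
  then obtain T where T: "\<And>Q. Q \<in> S \<Longrightarrow> finite (T Q)" "\<And>Q. Q \<in> S \<Longrightarrow> T Q \<subseteq> ?H"
    "\<And>Q. Q \<in> S \<Longrightarrow> restr Q \<in> cfun.span (T Q)" by metis
  define H0 where "H0 = (\<Union>Q\<in>S. T Q)"
  have H0: "finite H0" unfolding H0_def using finS T(1) by auto
  have H0': "H0 \<subseteq> ?H" unfolding H0_def by (intro UN_least T(2))
  have SH0: "restr Q \<in> cfun.span H0" if "Q \<in> S" for Q
    using T(3)[OF that] cfun.span_mono[of "T Q" H0] that by (auto simp: H0_def)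
  obtain B where B: "B \<subseteq> H0" "cfun.independent B" "H0 \<subseteq> cfun.span B"
    using cfun.maximal_independent_subset[of H0] by blast
  have spanB: "cfun.span H0 \<subseteq> cfun.span B"
    by (rule cfun.span_minimal[OF B(3) cfun.subspace_span])
  have "restr (\<lambda>\<omega>. f (r *\<^sub>R \<omega>)) \<in> cfun.span B" if r: "r > 0" for r
  proof -
    define G where "G x = homogenize N (norm x) (f (r *\<^sub>R (x /\<^sub>R norm x))) (f (- (r *\<^sub>R (x /\<^sub>R norm x))))" for x
    have "G \<in> cfun.span {Q. \<exists>m\<le>Suc N * CARD('n). hpoly m Q}"
    proof (rule separately_poly_imp_poly)
      fix x i
      show "\<exists>p. degree p \<le> Suc N \<and> (\<forall>s. G (x + s *\<^sub>R axis i 1) = poly p (of_real s))"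
        unfolding G_def
      proof (rule homogenized_line_poly[OF n])
        show "1 \<le> N" by (simp add: N_def)
        fix a b :: "real^'n" assume "norm a = 1" "norm b = 1" "a \<bullet> b = 0"
        then show "(\<lambda>\<theta>. f ((r * cos \<theta>) *\<^sub>R a + (r * sin \<theta>) *\<^sub>R b)) \<in> trig N"
          using N0[OF r] trig_mono[of N0 N] by (auto simp: N_def)
      qed
    qed
    then have "restr G \<in> cfun.span H0"
    proof (rule restr_in_span)
      fix Q :: "real^'n \<Rightarrow> complex" assume "Q \<in> {Q. \<exists>m\<le>Suc N * CARD('n). hpoly m Q}"
      then obtain m where m: "m \<le> D" "hpoly m Q" by (auto simp: D_def)
      have "Q \<in> cfun.span S"
        using hpoly_in_span_mono_basis[OF m(2)] cfun.span_mono[of "mono_basis m" S] m(1) by (auto simp: S_def)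
      then show "restr Q \<in> cfun.span H0" using SH0 by (rule restr_in_span)
    qed
    \<comment> \<open>For \<rho> = 1 the two parity parts in \<open>homogenize\<close> add up to the
      first argument.\<close>
    moreover have "restr G = restr (\<lambda>\<omega>. f (r *\<^sub>R \<omega>))"
      by (auto simp: restr_def G_def homogenize_def fun_eq_iff)
    ultimately show ?thesis using spanB by auto
  qed
  moreover have "finite B" using B(1) H0 by (rule finite_subset)
  moreover have "B \<subseteq> ?H" using B(1) H0' by blast
  ultimately show ?thesis using B(2) that by blast
qed

subsection \<open>The distribution of the inversion formula\<close>

text \<open>For k = 0 the standard function that is flat at 0; the powers make the linear span of
  the family closed under differentiation.\<close>

definition flat_exp :: "nat \<Rightarrow> real \<Rightarrow> real" where
  "flat_exp k x = (if x > 0 then inverse x ^ k * exp (- inverse x) else 0)"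

lemma flat_exp_has_vd:
  "(flat_exp k has_vector_derivative (flat_exp (Suc (Suc k)) x + (- real k) * flat_exp (Suc k) x)) (at x)"
proof -
  consider "x > 0" | "x < 0" | "x = 0" by linarith
  then have "(flat_exp k has_real_derivative (flat_exp (Suc (Suc k)) x + (- real k) * flat_exp (Suc k) x)) (at x)"
  proof cases
    case 1
    have d: "(inverse has_real_derivative - (inverse x * inverse x)) (at x)"
      using 1 by (auto intro!: derivative_eq_intros)
    have "((\<lambda>x. inverse x ^ k * exp (- inverse x)) has_real_derivative
        (inverse x ^ k * (exp (- inverse x) * (- (- (inverse x * inverse x))))
          + (real k * inverse x ^ (k - 1) * (- (inverse x * inverse x))) * exp (- inverse x))) (at x)"
      using DERIV_mult[OF DERIV_power[OF d, of k] DERIV_chain2[OF DERIV_exp DERIV_minus[OF d]]]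
      by (simp add: mult_ac add.commute)
    moreover have "inverse x ^ k * (exp (- inverse x) * (- (- (inverse x * inverse x))))
          + (real k * inverse x ^ (k - 1) * (- (inverse x * inverse x))) * exp (- inverse x)
        = flat_exp (Suc (Suc k)) x + (- real k) * flat_exp (Suc k) x"
      using 1 by (cases k) (simp_all add: flat_exp_def algebra_simps)
    ultimately have "((\<lambda>x. inverse x ^ k * exp (- inverse x)) has_real_derivative
        (flat_exp (Suc (Suc k)) x + (- real k) * flat_exp (Suc k) x)) (at x)" by simp
    then show ?thesis
      by (rule has_field_derivative_transform_within_open[where S = "{0<..}"]) (use 1 in \<open>auto simp: flat_exp_def\<close>)
  next
    case 2
    have "((\<lambda>_. 0) has_real_derivative 0) (at x)" by simp
    then have "(flat_exp k has_real_derivative 0) (at x)"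
      by (rule has_field_derivative_transform_within_open[where S = "{..<0}"]) (use 2 in \<open>auto simp: flat_exp_def\<close>)
    then show ?thesis using 2 by (simp add: flat_exp_def)
  next
    case 3
    \<comment> \<open>Off 0 the difference quotient of \<open>flat_exp k\<close> at 0 is
      \<open>flat_exp (Suc k)\<close>, so this limit is half of its derivative statement.\<close>
    have "(flat_exp (Suc k) \<longlongrightarrow> 0) (at_right 0)"
    proof -
      have "((\<lambda>x::real. inverse x ^ Suc k / exp (inverse x)) \<longlongrightarrow> 0) (at_right 0)"
        by (rule filterlim_compose[OF tendsto_power_div_exp_0 filterlim_inverse_at_top_right])
      moreover have "\<forall>\<^sub>F x in at_right 0. inverse x ^ Suc k / exp (inverse x) = flat_exp (Suc k) x"
        unfolding eventually_at_filter by (auto simp: flat_exp_def exp_minus divide_inverse)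
      ultimately show ?thesis by (rule Lim_transform_eventually)
    qed
    moreover have "(flat_exp (Suc k) \<longlongrightarrow> 0) (at_left 0)"
    proof (rule Lim_transform_eventually[OF tendsto_const])
      show "\<forall>\<^sub>F x in at_left 0. 0 = flat_exp (Suc k) x"
        unfolding eventually_at_filter by (auto simp: flat_exp_def)
    qed
    ultimately have "(flat_exp (Suc k) \<longlongrightarrow> 0) (at 0)" by (rule filterlim_split_at[rotated])
    moreover have "\<forall>\<^sub>F x in at 0. flat_exp (Suc k) x = (flat_exp k x - flat_exp k 0) / (x - 0)"
      unfolding eventually_at_filter by (auto simp: flat_exp_def divide_inverse)
    ultimately have "((\<lambda>x. (flat_exp k x - flat_exp k 0) / (x - 0)) \<longlongrightarrow> 0) (at 0)"
      by (rule Lim_transform_eventually)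
    then show ?thesis using 3 by (simp add: has_field_derivative_iff flat_exp_def)
  qed
  then show ?thesis by (simp add: has_real_derivative_iff_has_vector_derivative)
qed

lemma smooth_on_flat_exp: "smooth_on (flat_exp k) UNIV"
proof -
  have "Ck_on n (flat_exp k) UNIV" for n
  proof (induction n arbitrary: k)
    case 0
    have "continuous_on UNIV (flat_exp k)"
      using flat_exp_has_vd by (meson continuous_at_imp_continuous_on has_vector_derivative_continuous)
    then show ?case by simp
  next
    case (Suc n)
    have "vd (flat_exp k) = (\<lambda>x. flat_exp (Suc (Suc k)) x + (- real k) * flat_exp (Suc k) x)"
      using vdI[OF flat_exp_has_vd] by blast
    moreover have "Ck_on n (\<lambda>x. flat_exp (Suc (Suc k)) x + (- real k) * flat_exp (Suc k) x) UNIV"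
      by (intro Ck_on_add Ck_on_linear_comp[OF bounded_linear_mult_right] open_UNIV Suc.IH)
    ultimately show ?case
      unfolding Ck_on_Suc_real[OF open_UNIV] using flat_exp_has_vd by simp
  qed
  then show ?thesis by (simp add: smooth_on_def)
qed

text \<open>Turns a function that vanishes near 0 into a test function that agrees with it beyond t
  = 1, as \<open>dist_apply\<close> demands.\<close>

lemma smooth_cutoff:
  obtains \<eta> :: "real \<Rightarrow> real" where "smooth_on \<eta> UNIV" "\<And>t. t \<le> 2 \<Longrightarrow> \<eta> t = 1" "\<And>t. t \<ge> 3 \<Longrightarrow> \<eta> t = 0"
proof
  let ?f = "\<lambda>t. flat_exp 0 (3 - t)" and ?g = "\<lambda>t. flat_exp 0 (t - 2)"
  have pos: "?f t + ?g t > 0" for t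
    by (cases "t < 3"; cases "t > 2") (auto simp: flat_exp_def add_pos_pos)
  have sm: "smooth_on ?f UNIV" "smooth_on ?g UNIV"
    by (rule smooth_on_compose_real[OF open_UNIV open_UNIV UNIV_I smooth_on_flat_exp],
        auto intro!: smooth_on_diff smooth_on_ident)+
  have "smooth_on (\<lambda>t. inverse (?f t + ?g t)) UNIV"
    by (rule smooth_on_compose_real[OF open_UNIV _ _ smooth_on_inverse])
      (use pos sm in \<open>auto intro!: smooth_on_add\<close>)
  then show "smooth_on (\<lambda>t. ?f t * inverse (?f t + ?g t)) UNIV"
    using sm by (intro smooth_on_mult) auto
  show "?f t * inverse (?f t + ?g t) = 1" if "t \<le> 2" for t
    using that pos[of t] by (simp add: flat_exp_def)
  show "?f t * inverse (?f t + ?g t) = 0" if "t \<ge> 3" for t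
    using that by (simp add: flat_exp_def)
qed

section \<open>Derivatives under t \<mapsto> 1 / t, and functions vanishing near 0\<close>

lemma vd_funpow_scale:
  fixes w :: "real \<Rightarrow> complex"
  assumes "smooth_on w {0<..}" "r > 0" "z > 0"
  shows "(vd ^^ N) (\<lambda>z. w (r * z)) z = of_real (r ^ N) * (vd ^^ N) w (r * z)"
  using assms(3)
proof (induction N arbitrary: z)
  case (Suc N)
  have "(vd ^^ Suc N) (\<lambda>z. w (r * z)) z = vd (\<lambda>z. of_real (r ^ N) * (vd ^^ N) w (r * z)) z"
    using vd_cong_open[of "{0<..}" z "(vd ^^ N) (\<lambda>z. w (r * z))"] Suc by simp
  also have "\<dots> = of_real (r ^ N) * (r *\<^sub>R vd ((vd ^^ N) w) (r * z))"
  proof (intro vdI has_vector_derivative_mult_right)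
    have "((\<lambda>z. r * z) has_real_derivative r) (at z)"
      by (auto intro!: derivative_eq_intros)
    then show "((\<lambda>z. (vd ^^ N) w (r * z)) has_vector_derivative r *\<^sub>R vd ((vd ^^ N) w) (r * z)) (at z)"
      using assms Suc.prems by (intro vd_compose[where T = "{0<..}"] smooth_on_vd_funpow) auto
  qed
  finally show ?case by (simp add: scaleR_conv_of_real)
qed simp

lemma smooth_on_inverse_compose:
  fixes h :: "real \<Rightarrow> complex"
  assumes "smooth_on h {0<..}" shows "smooth_on (\<lambda>t. h (inverse t)) {0<..}"
  by (rule smooth_on_compose_real[OF _ _ _ assms smooth_on_inverse]) auto

text \<open>The power t^m is the one for which the derivative of order m + 1 has a single term. In
  the induction the Leibniz term from the additional factor t cancels the derivative of the power of
  1 / t.\<close>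

lemma vd_funpow_inverse:
  fixes h :: "real \<Rightarrow> complex"
  assumes h: "smooth_on h {0<..}" and "t > 0"
  shows "(vd ^^ Suc m) (\<lambda>t. of_real (t ^ m) * h (inverse t)) t
    = (-1) ^ Suc m * of_real (inverse t ^ (m + 2)) * (vd ^^ Suc m) h (inverse t)"
  using assms(2)
proof (induction m arbitrary: t)
  case 0
  have "(inverse has_real_derivative - (inverse t * inverse t)) (at t)"
    using 0 by (auto intro!: derivative_eq_intros)
  then have "((\<lambda>t. h (inverse t)) has_vector_derivative (- (inverse t * inverse t)) *\<^sub>R vd h (inverse t)) (at t)"
    using h 0 by (intro vd_compose[where T = "{0<..}"]) auto
  then show ?case by (simp add: vdI scaleR_conv_of_real power2_eq_square)
next
  case (Suc m)
  define X where "X t = of_real (t ^ m) * h (inverse t)" for t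
  define Z where "Z t = (-1) ^ Suc m * of_real (inverse t ^ (m + 2)) * (vd ^^ Suc m) h (inverse t)" for t
  have smX: "smooth_on X {0<..}"
    unfolding X_def[abs_def]
    by (intro smooth_on_mult smooth_on_of_real smooth_on_power smooth_on_ident smooth_on_inverse_compose h) auto
  have XZ: "(vd ^^ Suc m) X s = Z s" if "s > 0" for s
    using Suc.IH[OF that] by (simp add: X_def[abs_def] Z_def)
  have "(vd ^^ Suc (Suc m)) (\<lambda>t. of_real (t ^ Suc m) * h (inverse t)) t
      = (vd ^^ Suc (Suc m)) (\<lambda>t. of_real t * X t) t"
    by (simp add: X_def[abs_def] mult.assoc)
  also have "\<dots> = of_real t * vd ((vd ^^ Suc m) X) t + of_nat (Suc (Suc m)) * (vd ^^ Suc m) X t"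
    using vd_funpow_times_id[OF _ smX, of t "Suc (Suc m)"] Suc.prems by simp
  also have "vd ((vd ^^ Suc m) X) t = vd Z t"
    by (rule vd_cong_open[of "{0<..}"]) (use XZ Suc.prems in auto)
  also have "(vd ^^ Suc m) X t = Z t" by (rule XZ[OF Suc.prems])
  also have "vd Z t = (-1) ^ Suc m * (of_real (inverse t ^ (m + 2)) * ((- (inverse t * inverse t)) *\<^sub>R vd ((vd ^^ Suc m) h) (inverse t))
      + of_real (real (m + 2) * inverse t ^ (m + 1) * (- (inverse t * inverse t))) * (vd ^^ Suc m) h (inverse t))"
    unfolding Z_def[abs_def] mult.assoc
  proof (intro vdI has_vector_derivative_mult_right has_vector_derivative_mult has_vector_derivative_of_real)
    have d: "(inverse has_real_derivative - (inverse t * inverse t)) (at t)"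
      using Suc.prems by (auto intro!: derivative_eq_intros)
    then show "((\<lambda>t. (vd ^^ Suc m) h (inverse t)) has_vector_derivative (- (inverse t * inverse t)) *\<^sub>R vd ((vd ^^ Suc m) h) (inverse t)) (at t)"
      using Suc.prems by (intro vd_compose[where T = "{0<..}"] smooth_on_vd_funpow h) auto
    show "((\<lambda>t. inverse t ^ (m + 2)) has_real_derivative real (m + 2) * (inverse t ^ (m + 1) * - (inverse t * inverse t))) (at t)"
      using DERIV_power[OF d, of "m + 2"] by (simp add: mult_ac)
  qed
  finally show ?case
    using Suc.prems unfolding Z_def by (simp add: scaleR_conv_of_real field_simps)
qed

text \<open>The class of the functions t \<mapsto> Inv \<phi> (x / t) for \<phi> in the tensor
  spaces over \<open>Cpos_minus\<close>: zero near 0, unrestricted at infinity, so that they are in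
  general no test functions.\<close>

definition vanish0 :: "(real \<Rightarrow> complex) \<Rightarrow> bool" where
  "vanish0 g \<longleftrightarrow> smooth_on g {0<..} \<and> (\<exists>d>0. \<forall>t. 0 < t \<longrightarrow> t < d \<longrightarrow> g t = 0)"

lemma vanish0_vd:
  assumes "vanish0 g" shows "vanish0 (vd g)"
proof -
  obtain d where d: "d > 0" "\<And>t. 0 < t \<Longrightarrow> t < d \<Longrightarrow> g t = 0" using assms by (auto simp: vanish0_def)
  have "vd g t = 0" if "0 < t" "t < d" for t
    using vd_cong_open[of "{0<..<d}" t g "\<lambda>_. 0"] d that vdI[of "\<lambda>_. 0::complex" 0 t] by auto
  then show ?thesis using assms d(1) by (auto simp: vanish0_def intro: smooth_on_vd)
qed

lemma vanish0_vd_funpow: "vanish0 g \<Longrightarrow> vanish0 ((vd ^^ N) g)"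
  by (induction N) (auto intro: vanish0_vd)

lemma vanish0_mult:
  "smooth_on a {0<..} \<Longrightarrow> vanish0 g \<Longrightarrow> vanish0 (\<lambda>t. a t * g t)"
  unfolding vanish0_def by (auto intro!: smooth_on_mult)

lemma vanish0_add: "vanish0 f \<Longrightarrow> vanish0 g \<Longrightarrow> vanish0 (\<lambda>t. f t + g t)"
proof -
  assume f: "vanish0 f" and g: "vanish0 g"
  obtain d e where "d > 0" "\<And>t. 0 < t \<Longrightarrow> t < d \<Longrightarrow> f t = 0" "e > 0" "\<And>t. 0 < t \<Longrightarrow> t < e \<Longrightarrow> g t = 0"
    using f g unfolding vanish0_def by blast
  then have "min d e > 0 \<and> (\<forall>t. 0 < t \<longrightarrow> t < min d e \<longrightarrow> f t + g t = 0)" by simp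
  then show ?thesis using f g unfolding vanish0_def by (blast intro: smooth_on_add open_greaterThan)
qed

lemma vanish0_cmult: "vanish0 g \<Longrightarrow> vanish0 (\<lambda>t. c * g t)"
  by (rule vanish0_mult) auto

lemma smooth_on_powi: "smooth_on (\<lambda>t. complex_of_real (t powi k)) {0<..}"
proof (cases "k \<ge> 0")
  case True
  then show ?thesis by (auto simp: power_int_def intro!: smooth_on_of_real smooth_on_power smooth_on_ident)
next
  case False
  have "smooth_on (\<lambda>t. complex_of_real (inverse t ^ nat (- k))) {0<..}"
    by (intro smooth_on_of_real smooth_on_power smooth_on_inverse) auto
  then show ?thesis
    by (rule smooth_on_cong_imp[rotated 2]) (use False in \<open>auto simp: power_int_def\<close>)
qed

text \<open>The substitution \<open>t = r / sqrt (r\<^sup>2 + y\<^sup>2)\<close> removes the singularity at \<open>t = 1\<close>.\<close>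

lemma abel_substitution:
  fixes H :: "real \<Rightarrow> complex"
  assumes r: "r > 0" and j: "j \<ge> 1" and H: "continuous_on {0<..} H"
    and d: "d > 0" "\<And>t. 0 < t \<Longrightarrow> t < d \<Longrightarrow> H t = 0"
  defines "s \<equiv> real j / 2 - 1"
  defines "f \<equiv> \<lambda>t. complex_of_real ((1 - t) powr s) * (complex_of_real ((1 + t) powr s) * H t)"
  shows "set_integrable lborel {0..1} f"
    and "(LBINT t:{0..1}. f t)
      = integral {0..} (\<lambda>y. of_real (r * y ^ (j - 1) / sqrt (r\<^sup>2 + y\<^sup>2) ^ (j + 1)) * H (r / sqrt (r\<^sup>2 + y\<^sup>2)))"
proof -
  define \<sigma> where "\<sigma> y = sqrt (r\<^sup>2 + y\<^sup>2)" for y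
  define g where "g y = r / \<sigma> y" for y
  define g' where "g' y = - (r * y / \<sigma> y ^ 3)" for y
  define K where "K y = of_real (r * y ^ (j - 1) / \<sigma> y ^ (j + 1)) * H (g y)" for y
  have \<sigma>: "\<sigma> y > 0" "\<sigma> y ^ 2 = r\<^sup>2 + y\<^sup>2" for y
    using r by (auto simp: \<sigma>_def add_pos_nonneg)
  have \<sigma>_gr: "\<sigma> y > r" if "y > 0" for y
    using that r \<sigma>[of y] by (smt (verit, best) power2_le_imp_le zero_less_power power_mono)
  have der: "(g has_real_derivative g' y) (at y)" for y
  proof -
    have "((\<lambda>y. r / \<sigma> y) has_real_derivative (0 * \<sigma> y - r * (y / \<sigma> y)) / (\<sigma> y * \<sigma> y)) (at y)"
      unfolding \<sigma>_def using r by (intro DERIV_divide DERIV_const hyp_deriv r) auto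
    moreover have "(0 * \<sigma> y - r * (y / \<sigma> y)) / (\<sigma> y * \<sigma> y) = g' y"
      using \<sigma>(1)[of y] by (simp add: g'_def field_simps power3_eq_cube)
    ultimately show ?thesis unfolding g_def[abs_def] by simp
  qed
  have g01: "0 < g y \<and> g y < 1" if "y > 0" for y
    using that r \<sigma>(1)[of y] \<sigma>_gr[OF that] by (simp add: g_def)
  have g_pos: "g y > 0" for y using r \<sigma>(1) by (simp add: g_def)
  have inj: "inj_on g {0<..}"
  proof (rule inj_onI)
    fix x y assume xy: "x \<in> {0<..}" "y \<in> {0<..}" "g x = g y"
    then have "\<sigma> x = \<sigma> y" using r \<sigma>(1)[of x] \<sigma>(1)[of y] by (simp add: g_def field_simps)
    then have "x\<^sup>2 = y\<^sup>2" using \<sigma>(2)[of x] \<sigma>(2)[of y] by simp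
    then show "x = y" using xy by (simp add: power2_eq_iff_nonneg)
  qed
  have image: "g ` {0<..} = {0<..<1}"
  proof
    show "g ` {0<..} \<subseteq> {0<..<1}" using g01 by auto
    show "{0<..<1} \<subseteq> g ` {0<..}"
    proof
      fix t :: real assume t: "t \<in> {0<..<1}"
      define y where "y = r * sqrt (1 - t\<^sup>2) / t"
      have t1: "t\<^sup>2 < 1" using t by (simp add: power2_less_imp_less abs_square_less_1)
      have y: "y > 0" using t t1 r by (simp add: y_def)
      have "r\<^sup>2 + y\<^sup>2 = (r / t)\<^sup>2"
        using t t1 by (simp add: y_def power_divide power_mult_distrib field_simps)
      then have "\<sigma> y = r / t" using t r by (simp add: \<sigma>_def)
      then have "g y = t" using r t by (simp add: g_def)
      then show "t \<in> g ` {0<..}" using y by auto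
    qed
  qed
  \<comment> \<open>For t = r / \<sigma> one has 1 - t^2 = (y / \<sigma>)^2, which makes the power s
    = j/2 - 1 the integral power j - 2 of y / \<sigma>. The Jacobian r y / \<sigma>^3 adds one more
    y, so the exponent j - 1 is never negative.\<close>
  have trans: "\<bar>g' y\<bar> *\<^sub>R f (g y) = K y" if y: "y > 0" for y
  proof -
    have g1: "g y < 1" "g y > 0" using g01[OF y] by auto
    have "(1 - g y) * (1 + g y) = (y / \<sigma> y)\<^sup>2"
      using \<sigma>[of y] by (simp add: g_def field_simps power2_eq_square) 
    then have "(1 - g y) powr s * (1 + g y) powr s = ((y / \<sigma> y)\<^sup>2) powr s"
      using g1 by (simp add: powr_mult[symmetric])
    also have "\<dots> = (y / \<sigma> y) powr (2 * s)"
      using y \<sigma>(1)[of y] by (simp add: powr_powr[symmetric] powr_numeral[symmetric] del: powr_numeral)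
    also have "2 * s = real j - 2" by (simp add: s_def)
    also have "(y / \<sigma> y) powr (real j - 2) = (y / \<sigma> y) ^ j / (y / \<sigma> y)\<^sup>2"
      using y \<sigma>(1)[of y] by (simp add: powr_diff powr_realpow)
    finally have p: "(1 - g y) powr s * (1 + g y) powr s = (y / \<sigma> y) ^ j / (y / \<sigma> y)\<^sup>2" .
    have "\<bar>g' y\<bar> * ((1 - g y) powr s * (1 + g y) powr s) = r * y ^ (j - 1) / \<sigma> y ^ (j + 1)"
    proof -
      obtain i where i: "j = Suc i" using j by (cases j) auto
      have "\<bar>g' y\<bar> = r * y / \<sigma> y ^ 3" using y r \<sigma>(1)[of y] by (simp add: g'_def)
      then show ?thesis unfolding p i using y r \<sigma>(1)[of y]
        by (simp add: field_simps power_divide power2_eq_square power3_eq_cube)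
    qed
    then show ?thesis
      unfolding f_def K_def scaleR_conv_of_real by (metis (no_types, opaque_lifting) mult.assoc of_real_mult)
  qed
  \<comment> \<open>Large y corresponds to t near 0, where H vanishes; so the transformed integrand
    lives on a compact interval.\<close>
  obtain Y where Y: "Y > 0" "\<And>y. y > Y \<Longrightarrow> K y = 0"
  proof (rule that[of "r / d"])
    show "r / d > 0" using r d by simp
    fix y assume y: "y > r / d"
    then have "y > 0" using r d by (meson divide_pos_pos less_trans)
    have "y\<^sup>2 \<le> r\<^sup>2 + y\<^sup>2" by simp
    then have "y \<le> \<sigma> y" using \<open>y > 0\<close> unfolding \<sigma>_def by (intro real_le_rsqrt)
    then have "g y \<le> r / y" using r \<open>y > 0\<close> by (simp add: g_def frac_le)
    also have "\<dots> < d" using y d r \<open>y > 0\<close> by (simp add: field_simps)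
    finally show "K y = 0" using d(2)[OF g_pos] by (simp add: K_def)
  qed
  have contK: "continuous_on A K" for A
  proof -
    have c\<sigma>: "continuous_on A \<sigma>" unfolding \<sigma>_def[abs_def] by (intro continuous_intros)
    have cg: "continuous_on A g"
      unfolding g_def[abs_def] using \<sigma>(1) by (intro continuous_on_divide continuous_on_const c\<sigma>) (metis less_irrefl)
    have "continuous_on A (\<lambda>y. H (g y))"
      by (rule continuous_on_compose2[OF H cg]) (use g_pos in auto)
    moreover have "continuous_on A (\<lambda>y. complex_of_real (r * y ^ (j - 1) / \<sigma> y ^ (j + 1)))"
      using \<sigma>(1) by (intro continuous_on_of_real continuous_on_divide continuous_on_mult continuous_on_power
          continuous_on_const continuous_on_id c\<sigma>) (metis less_irrefl power_not_zero)
    ultimately show ?thesis unfolding K_def[abs_def] by (intro continuous_on_mult)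
  qed
  have K_abs: "K absolutely_integrable_on {0..Y}"
    by (intro absolutely_integrable_continuous_real contK)
  have K_int: "integral {0<..} K = integral {0..} K" and K_abs': "K absolutely_integrable_on {0<..}"
  proof -
    show "integral {0<..} K = integral {0..} K" 
      by (intro integral_spike_set) (auto intro: negligible_subset[of "{0}"])
    have "(\<lambda>x. if x \<in> {0..Y} then K x else 0) absolutely_integrable_on UNIV"
      using K_abs absolutely_integrable_restrict_UNIV by blast
    moreover have "(\<lambda>x. if x \<in> {0..Y} then K x else 0) = (\<lambda>x. if x \<in> {0..} then K x else 0)"
      using Y by auto
    ultimately have "K absolutely_integrable_on {0..}"
      using absolutely_integrable_restrict_UNIV by metis
    then show "K absolutely_integrable_on {0<..}"
      by (rule set_integrable_subset) auto
  qed
  have "(\<lambda>y. \<bar>g' y\<bar> *\<^sub>R f (g y)) absolutely_integrable_on {0<..} \<and>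
      integral {0<..} (\<lambda>y. \<bar>g' y\<bar> *\<^sub>R f (g y)) = integral {0..} K"
  proof
    show "(\<lambda>y. \<bar>g' y\<bar> *\<^sub>R f (g y)) absolutely_integrable_on {0<..}"
      using K_abs' by (rule absolutely_integrable_spike[where S = "{}"]) (use trans in auto)
    show "integral {0<..} (\<lambda>y. \<bar>g' y\<bar> *\<^sub>R f (g y)) = integral {0..} K"
      unfolding K_int[symmetric] by (rule Henstock_Kurzweil_Integration.integral_cong) (use trans in auto)
  qed
  then have f_abs: "f absolutely_integrable_on {0<..<1}" and f_int: "integral {0<..<1} f = integral {0..} K"
    using has_absolute_integral_change_of_variables_real[of "{0<..}" g g' f "integral {0..} K"]
      der inj image by (auto intro: has_field_derivative_at_within)
  have f_meas: "(\<lambda>t. indicator {0<..<1} t *\<^sub>R f t) \<in> borel_measurable borel"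
    unfolding f_def
    by (intro borel_measurable_continuous_on_indicator continuous_on_mult continuous_on_of_real)
      (auto intro!: continuous_intros continuous_on_subset[OF H])
  have f_01: "set_integrable lborel {0<..<1} f"
    using f_abs f_meas unfolding set_integrable_def by (simp add: integrable_completion)
  have ae: "AE t in lborel. indicator {0<..<1} t *\<^sub>R f t = indicator {0..1} t *\<^sub>R f t"
    using AE_lborel_singleton[of 0] AE_lborel_singleton[of 1]
    by eventually_elim (auto simp: indicator_def)
  have f_meas': "(\<lambda>t. indicator {0..1} t *\<^sub>R f t) \<in> borel_measurable borel"
  proof -
    have "(\<lambda>t. indicator {0..1} t *\<^sub>R f t) = (\<lambda>t. indicator {0<..<1} t *\<^sub>R f t + indicator {0} t *\<^sub>R f 0 + indicator {1} t *\<^sub>R f 1)"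
      by (auto simp: indicator_def fun_eq_iff)
    then show ?thesis
      by (simp only:) (intro borel_measurable_add f_meas
          borel_measurable_scaleR borel_measurable_indicator borel_measurable_const; simp)
  qed
  show "set_integrable lborel {0..1} f"
    using f_01 integrable_cong_AE[of _ lborel, OF _ _ ae] f_meas f_meas' unfolding set_integrable_def by simp
  have "(LBINT t:{0..1}. f t) = (LBINT t:{0<..<1}. f t)"
    unfolding set_lebesgue_integral_def
    by (rule integral_cong_AE) (use ae f_meas f_meas' in \<open>auto elim: eventually_mono\<close>)
  also have "\<dots> = integral {0..} K"
    using set_borel_integral_eq_integral(2)[OF f_01] f_int by simp
  finally show "(LBINT t:{0..1}. f t)
      = integral {0..} (\<lambda>y. of_real (r * y ^ (j - 1) / sqrt (r\<^sup>2 + y\<^sup>2) ^ (j + 1)) * H (r / sqrt (r\<^sup>2 + y\<^sup>2)))"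
    unfolding K_def[abs_def] g_def \<sigma>_def .
qed


text \<open>What the derivatives and the powers of t in the distribution make of the test function,
  once they have been moved onto it; it remains to be integrated against the power of 1 -
  t^2.\<close>

definition beta_density :: "nat \<Rightarrow> nat \<Rightarrow> (real \<Rightarrow> complex) \<Rightarrow> real \<Rightarrow> complex" where
  "beta_density n k g t = complex_of_real (t powi (1 - int k)) *
    (vd ^^ (n + k - 1)) (\<lambda>t. complex_of_real (t powi (int k - 1)) * g t) t"

text \<open>The sign in - d/dt cancels the one in the definition of the weak derivative.\<close>

lemma uminus_gf_deriv_funpow:
  "((\<lambda>G. - gf_deriv G) ^^ N) G f = G ((vd ^^ N) f)"
proof (induction N arbitrary: f)
  case (Suc N)
  have "((\<lambda>G. - gf_deriv G) ^^ Suc N) G f = ((\<lambda>G. - gf_deriv G) ^^ N) G (vd f)"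
    by (simp only: funpow.simps o_apply fun_Compl_def gf_deriv_def vd_def minus_minus)
  also have "\<dots> = G ((vd ^^ N) (vd f))" by (rule Suc)
  also have "\<dots> = G ((vd ^^ Suc N) f)" by (simp add: funpow_swap1)
  finally show ?case .
qed simp

definition beta_const :: "nat \<Rightarrow> nat \<Rightarrow> real" where
  "beta_const n k = 1 / (2 ^ (n + k - 2) * pi powr ((real n - 1) / 2) * Gamma ((real n + 2 * real k - 1) / 2))"

lemma beta_dist_eq:
  "beta_dist n k g = of_real (beta_const n k) * (LBINT t:{0..1}.
    complex_of_real ((1 - t) powr ((real n + 2 * real k - 3) / 2)) *
    (complex_of_real ((1 + t) powr ((real n + 2 * real k - 3) / 2)) * beta_density n k g t))"
  by (simp only: beta_dist_def cscale_def gf_mult_def uminus_gf_deriv_funpow one_minus_sq_plus_def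
      one_minus_plus_def beta_density_def beta_const_def)

lemma vanish0_beta_density:
  "vanish0 g \<Longrightarrow> vanish0 (beta_density n k g)"
  unfolding beta_density_def[abs_def] by (intro vanish0_mult smooth_on_powi vanish0_vd_funpow)

lemma beta_substitution:
  assumes "n \<ge> 2" "r > 0" "vanish0 g"
  shows "set_integrable lborel {0..1} (\<lambda>t. complex_of_real ((1 - t) powr ((real n + 2 * real k - 3) / 2)) *
    (complex_of_real ((1 + t) powr ((real n + 2 * real k - 3) / 2)) * beta_density n k g t))"
    and "beta_dist n k g = of_real (beta_const n k) * integral {0..} (\<lambda>y.
      of_real (r * y ^ (n + 2 * k - 2) / sqrt (r\<^sup>2 + y\<^sup>2) ^ (n + 2 * k)) * beta_density n k g (r / sqrt (r\<^sup>2 + y\<^sup>2)))"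
proof -
  \<comment> \<open>For this order j/2 - 1 is the exponent of 1 - t^2 in the distribution.\<close>
  let ?j = "n + 2 * k - 1"
  have v: "vanish0 (beta_density n k g)" by (rule vanish0_beta_density[OF assms(3)])
  then obtain d where d: "d > 0" "\<And>t. 0 < t \<Longrightarrow> t < d \<Longrightarrow> beta_density n k g t = 0"
    by (auto simp: vanish0_def)
  have c: "continuous_on {0<..} (beta_density n k g)"
    using v by (auto simp: vanish0_def intro: smooth_on_imp_continuous_on)
  have e: "real ?j / 2 - 1 = (real n + 2 * real k - 3) / 2"
    using assms(1) by (simp add: of_nat_diff field_simps)
  have j: "?j \<ge> 1" "?j - 1 = n + 2 * k - 2" "?j + 1 = n + 2 * k" using assms(1) by auto
  note sub = abel_substitution[OF assms(2) j(1) c d, unfolded e j(2,3)]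
  show "set_integrable lborel {0..1} (\<lambda>t. complex_of_real ((1 - t) powr ((real n + 2 * real k - 3) / 2)) *
    (complex_of_real ((1 + t) powr ((real n + 2 * real k - 3) / 2)) * beta_density n k g t))"
    by (rule sub(1))
  show "beta_dist n k g = of_real (beta_const n k) * integral {0..} (\<lambda>y.
      of_real (r * y ^ (n + 2 * k - 2) / sqrt (r\<^sup>2 + y\<^sup>2) ^ (n + 2 * k)) * beta_density n k g (r / sqrt (r\<^sup>2 + y\<^sup>2)))"
    unfolding beta_dist_eq by (simp only: sub(2))
qed

lemma beta_density_linear:
  assumes "vanish0 f" "vanish0 g" "t > 0"
  shows "beta_density n k (\<lambda>t. c * f t + g t) t = c * beta_density n k f t + beta_density n k g t"
proof -
  let ?a = "\<lambda>t. complex_of_real (t powi (int k - 1))"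
  have sm: "smooth_on (\<lambda>t. ?a t * f t) {0<..}" "smooth_on (\<lambda>t. ?a t * g t) {0<..}"
    using assms by (auto simp only: vanish0_def intro!: smooth_on_mult[OF open_greaterThan smooth_on_powi])
  have "(\<lambda>t. ?a t * (c * f t + g t)) = (\<lambda>t. c * (?a t * f t) + ?a t * g t)"
    by (simp add: fun_eq_iff algebra_simps)
  moreover have "(vd ^^ N) (\<lambda>t. c * (?a t * f t) + ?a t * g t) t
      = c * (vd ^^ N) (\<lambda>t. ?a t * f t) t + (vd ^^ N) (\<lambda>t. ?a t * g t) t" for N
    using assms(3) sm vd_funpow_add[of "{0<..}" "\<lambda>t. c * (?a t * f t)" "\<lambda>t. ?a t * g t" t N]
      vd_funpow_cmult[of "{0<..}" "\<lambda>t. ?a t * f t" t N c] smooth_on_cmult[of "{0<..}" "\<lambda>t. ?a t * f t" c] by simp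
  ultimately show ?thesis by (simp only: beta_density_def distrib_left mult.left_commute)
qed

text \<open>The value at t = 0 is outside the domain of the integrands and may be anything.
  Measurability of the second integrand is inherited from the first.\<close>

lemma LBINT_01_cong:
  fixes f g :: "real \<Rightarrow> complex"
  assumes "set_integrable lborel {0..1} f" "\<And>t. 0 < t \<Longrightarrow> t \<le> 1 \<Longrightarrow> f t = g t"
  shows "(LBINT t:{0..1}. g t) = (LBINT t:{0..1}. f t)"
proof -
  have f: "(\<lambda>t. indicator {0..1} t *\<^sub>R f t) \<in> borel_measurable borel"
    using assms(1) unfolding set_integrable_def by (auto dest: borel_measurable_integrable)
  have "(\<lambda>t. indicator {0..1} t *\<^sub>R g t) = (\<lambda>t. indicator (- {0}) t *\<^sub>R (indicator {0..1} t *\<^sub>R f t) + indicator {0} t *\<^sub>R g 0)"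
    using assms(2) by (auto simp: indicator_def fun_eq_iff)
  then have g: "(\<lambda>t. indicator {0..1} t *\<^sub>R g t) \<in> borel_measurable borel"
    by (simp only:) (intro borel_measurable_add borel_measurable_scaleR[OF _ f]
        borel_measurable_scaleR borel_measurable_indicator borel_measurable_const; simp)
  show ?thesis
    unfolding set_lebesgue_integral_def
  proof (rule integral_cong_AE)
    show "AE t in lborel. indicator {0..1} t *\<^sub>R g t = indicator {0..1} t *\<^sub>R f t"
      using AE_lborel_singleton[of 0] by eventually_elim (use assms(2) in \<open>auto simp: indicator_def\<close>)
  qed (use f g in auto)
qed

text \<open>Only values of derivatives on (0, 1] enter the integral; agreement past 1 is needed for
  the derivatives at 1.\<close>

lemma beta_dist_cong:
  assumes "n \<ge> 2" "vanish0 g" "b > 1" "\<And>t. 0 < t \<Longrightarrow> t < b \<Longrightarrow> h t = g t"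
  shows "beta_dist n k h = beta_dist n k g"
proof -
  have "beta_density n k g t = beta_density n k h t" if "0 < t" "t \<le> 1" for t
    unfolding beta_density_def
    by (intro arg_cong2[where f = "(*)"] refl vd_funpow_cong_open[of "{0<..<b}"]) (use that assms in auto)
  then show ?thesis
    unfolding beta_dist_eq
    by (intro arg_cong2[where f = "(*)"] refl LBINT_01_cong[OF beta_substitution(1)[OF assms(1) zero_less_one assms(2)]]) auto
qed

lemma beta_dist_linear:
  assumes "n \<ge> 2" "vanish0 f" "vanish0 g"
  shows "beta_dist n k (\<lambda>t. c * f t + g t) = c * beta_dist n k f + beta_dist n k g"
proof -
  let ?I = "\<lambda>g t. complex_of_real ((1 - t) powr ((real n + 2 * real k - 3) / 2)) *
    (complex_of_real ((1 + t) powr ((real n + 2 * real k - 3) / 2)) * beta_density n k g t)"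
  have i: "set_integrable lborel {0..1} (?I f)" "set_integrable lborel {0..1} (?I g)"
    by (rule beta_substitution(1)[OF assms(1) zero_less_one assms(2)], rule beta_substitution(1)[OF assms(1) zero_less_one assms(3)])
  have i': "set_integrable lborel {0..1} (\<lambda>t. c * ?I f t)"
    by (rule set_integrable_mult_right) (rule i(1))
  have "(LBINT t:{0..1}. ?I (\<lambda>t. c * f t + g t) t) = (LBINT t:{0..1}. c * ?I f t + ?I g t)"
  proof (rule LBINT_01_cong)
    show "set_integrable lborel {0..1} (\<lambda>t. c * ?I f t + ?I g t)"
      by (rule set_integral_add(1)[OF i' i(2)])
    fix t :: real assume "0 < t"
    then show "c * ?I f t + ?I g t = ?I (\<lambda>t. c * f t + g t) t"
      by (simp only: beta_density_linear[OF assms(2,3)] distrib_left mult.left_commute)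
  qed
  also have "\<dots> = c * (LBINT t:{0..1}. ?I f t) + (LBINT t:{0..1}. ?I g t)"
    unfolding set_integral_add(2)[OF i' i(2)] set_integral_mult_right ..
  finally show ?thesis
    unfolding beta_dist_eq by (simp only: distrib_left mult.left_commute)
qed

text \<open>The formula for \<open>beta_dist\<close> makes sense for every function vanishing near 0
  and is local, so all admissible test functions give the same value. A cut-off shows that there is
  at least one, hence the description determines the value.\<close>

lemma dist_apply_beta:
  assumes "n \<ge> 2" "vanish0 g"
  shows "dist_apply (beta_dist n k) g = beta_dist n k g"
  unfolding dist_apply_def
proof (rule the_equality)
  show "\<forall>h\<in>Cpos_c. (\<exists>b>1. \<forall>t\<in>{0<..<b}. h t = g t) \<longrightarrow> beta_dist n k h = beta_dist n k g"
  proof (intro ballI impI, elim exE conjE)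
    fix h b assume "b > 1" "\<forall>t\<in>{0<..<b}. h t = g t"
    then show "beta_dist n k h = beta_dist n k g" by (intro beta_dist_cong[OF assms, of b]) auto
  qed
  fix c assume c: "\<forall>h\<in>Cpos_c. (\<exists>b>1. \<forall>t\<in>{0<..<b}. h t = g t) \<longrightarrow> beta_dist n k h = c"
  obtain \<eta> :: "real \<Rightarrow> real" where \<eta>: "smooth_on \<eta> UNIV" "\<And>t. t \<le> 2 \<Longrightarrow> \<eta> t = 1" "\<And>t. t \<ge> 3 \<Longrightarrow> \<eta> t = 0"
  proof (rule smooth_cutoff)
    fix \<eta> :: "real \<Rightarrow> real"
    assume "smooth_on \<eta> UNIV" "\<And>t. t \<le> 2 \<Longrightarrow> \<eta> t = 1" "\<And>t. t \<ge> 3 \<Longrightarrow> \<eta> t = 0"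
    then show thesis by (rule that)
  qed
  define h where "h t = (if t > 0 then complex_of_real (\<eta> t) * g t else 0)" for t
  obtain d where d: "d > 0" "\<And>t. 0 < t \<Longrightarrow> t < d \<Longrightarrow> g t = 0" using assms(2) by (auto simp: vanish0_def)
  have "smooth_on \<eta> {0<..}"
    using \<eta>(1) smooth_on_compose_real[of "{0<..}" UNIV "\<lambda>t. t" \<eta>] smooth_on_ident[of "{0<..}"] by simp
  then have "smooth_on (\<lambda>t. complex_of_real (\<eta> t) * g t) {0<..}"
    using assms(2) by (intro smooth_on_mult smooth_on_of_real) (auto simp: vanish0_def)
  then have "smooth_on h {0<..}"
    by (rule smooth_on_cong_imp[rotated 2]) (auto simp: h_def)
  moreover have "\<forall>\<^sub>F r in at_top. h r = 0"
    using eventually_ge_at_top[of 3] by eventually_elim (simp add: h_def \<eta>(3))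
  moreover have "\<forall>\<^sub>F r in at_right 0. h r = 0"
    unfolding eventually_at_right_field using d by (intro exI[of _ d]) (auto simp: h_def)
  ultimately have h: "h \<in> Cpos_c"
    by (auto simp: Cpos_c_def Cpos_plus_def Cpos_minus_def Cpos_def h_def)
  have hg: "h t = g t" if "0 < t" "t < 2" for t using that by (simp add: h_def \<eta>(2))
  have "beta_dist n k h = c"
    by (rule c[rule_format, OF h]) (use hg in \<open>intro exI[of _ 2]; auto\<close>)
  moreover have "beta_dist n k h = beta_dist n k g"
    by (rule beta_dist_cong[OF assms, of 2]) (use hg in auto)
  ultimately show "c = beta_dist n k g" by simp
qed

text \<open>At order n + 2 k - 1 the two Gamma factors coincide, and the powers of 2 and of pi
  differ by k each. The surplus (2 pi)^k is the denominator in \<open>lam_inverse\<close>.\<close>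

lemma beta_const_abel_const:
  assumes "n \<ge> 2"
  shows "beta_const n k * abel_const (n + 2 * k - 1) = (2 * pi) ^ k"
proof -
  have e: "real (n + 2 * k - 1) / 2 = (real n - 1) / 2 + real k" "(real n + 2 * real k - 1) / 2 = (real n - 1) / 2 + real k"
    using assms by (simp_all add: of_nat_diff field_simps)
  have G: "Gamma ((real n - 1) / 2 + real k) > 0" using assms by (intro Gamma_real_pos add_pos_nonneg) auto
  have "n + 2 * k - 1 - 1 = (n + k - 2) + k" using assms by simp
  then have "abel_const (n + 2 * k - 1)
      = pi powr ((real n - 1) / 2) * pi ^ k * (2 ^ (n + k - 2) * 2 ^ k) * Gamma ((real n - 1) / 2 + real k)"
    unfolding abel_const_def e by (simp add: powr_add powr_realpow power_add)
  then show ?thesis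
    unfolding beta_const_def e using G by (simp add: power_mult_distrib field_simps)
qed

lemma mult_regroup:
  fixes a :: complex
  shows "a * b = d * e \<Longrightarrow> a * (b * w * c) = (d * c) * (e * w)"
    and "a * b = d \<Longrightarrow> a * (s * c * b * w) = s * c * d * w"
    and "a * b = d * e \<Longrightarrow> a * (s * c * b * w) = (s * c * d) * (e * w)"
proof -
  have 1: "a * (b * w * c) = (a * b) * (w * c)" and 2: "a * (s * c * b * w) = (a * b) * (s * c * w)"
    by (simp_all only: mult_ac)
  show "a * b = d * e \<Longrightarrow> a * (b * w * c) = (d * c) * (e * w)" by (simp only: 1, simp only: mult_ac)
  show "a * b = d \<Longrightarrow> a * (s * c * b * w) = s * c * d * w" by (simp only: 2, simp only: mult_ac)
  show "a * b = d * e \<Longrightarrow> a * (s * c * b * w) = (s * c * d) * (e * w)" by (simp only: 2, simp only: mult_ac)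
qed

text \<open>
  For the profile \<open>v \<rho> = w (1 / \<rho>) / \<rho>\<close> the function \<open>t \<mapsto> (Inv \<phi>)(x / t)\<close> is the one below; the
  powers of \<open>t\<close> in \<open>\<beta>\<^sub>k\<close> are those for which its derivative of order \<open>n + k - 1\<close> is again
  expressed through \<open>t\<^sup>-\<^sup>1\<close> alone.
\<close>

lemma beta_dist_profile:
  fixes w :: "real \<Rightarrow> complex" and c :: complex
  assumes n: "n \<ge> 2" and r: "r > 0" and w: "w \<in> fplus"
  defines "g \<equiv> \<lambda>t. of_real ((t / r) ^ (n - 1)) * w (r / t) * c"
  shows "vanish0 g"
    and "beta_dist n k g = of_real (beta_const n k) * (-1) ^ (n + k - 1) * c
      * of_real (r powi (2 - int n - int k)) * abel_int (n + 2 * k - 1) ((vd ^^ (n + k - 1)) w) r"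
proof -
  obtain R where R: "R > 0" "\<And>x. x \<ge> R \<Longrightarrow> w x = 0" using fplus_bound[OF w] by blast
  have sw: "smooth_on w {0<..}" by (rule fplus_smooth[OF w])
  have swr: "smooth_on (\<lambda>z. w (r * z)) {0<..}"
    by (rule smooth_on_compose_real[OF _ _ _ sw]) (use r in \<open>auto intro!: smooth_on_cmult smooth_on_ident\<close>)
  have "smooth_on (\<lambda>t. of_real ((inverse r * t) ^ (n - 1)) * w (r * inverse t)) {0<..}"
    by (intro smooth_on_mult smooth_on_of_real smooth_on_power smooth_on_cmult smooth_on_ident
        smooth_on_inverse_compose[OF swr]) auto
  then have "smooth_on (\<lambda>t. c * (of_real ((inverse r * t) ^ (n - 1)) * w (r * inverse t))) {0<..}"
    by (intro smooth_on_cmult) auto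
  then have "smooth_on g {0<..}"
    by (rule smooth_on_cong_imp[rotated 2]) (auto simp: g_def divide_inverse mult_ac)
  moreover have "g t = 0" if "0 < t" "t < r / R" for t
  proof -
    have "r / t \<ge> R" using that R r by (simp add: field_simps)
    then show ?thesis using R by (simp add: g_def)
  qed
  ultimately show v: "vanish0 g"
    unfolding vanish0_def using r R(1) by (intro conjI exI[of _ "r / R"]) auto
  define N where "N = n + k - 1"
  define j where "j = n + 2 * k - 1"
  obtain m where m: "N = Suc m" "n + k - 2 = m" using n unfolding N_def by (cases "n + k - 1") auto
  have dens: "beta_density n k g t = (-1) ^ N * c * of_real (r powi (int k) * inverse t ^ j) * (vd ^^ N) w (r / t)" if t: "t > 0" for t
  proof -
    let ?d = "of_real (inverse r ^ (n - 1)) * c"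
    have "(vd ^^ N) (\<lambda>t. complex_of_real (t powi (int k - 1)) * g t) t
        = (vd ^^ N) (\<lambda>t. ?d * (of_real (t ^ m) * w (r * inverse t))) t"
    proof (rule vd_funpow_cong_open[of "{0<..}"])
      fix s :: real assume "s \<in> {0<..}"
      then have s: "s > 0" by simp
      \<comment> \<open>The power k - 1 from the distribution and n - 1 from the profile add up to N
        - 1, the exponent that \<open>vd_funpow_inverse\<close> requires for a derivative of order
        N.\<close>
      have "s powi (int k - 1) * s ^ (n - 1) = s powi (int k - 1 + int (n - 1))"
        using s by (simp add: power_int_add)
      also have "int k - 1 + int (n - 1) = int m" using m n by linarith
      finally have "s powi (int k - 1) * s ^ (n - 1) = s powi int m" .
      then have "s powi (int k - 1) * (s / r) ^ (n - 1) = inverse r ^ (n - 1) * s ^ m"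
      proof -
        assume e: "s powi (int k - 1) * s ^ (n - 1) = s powi int m"
        have "s powi (int k - 1) * (s / r) ^ (n - 1) = (s powi (int k - 1) * s ^ (n - 1)) * inverse r ^ (n - 1)"
          by (simp add: divide_inverse power_mult_distrib power_inverse)
        then show ?thesis unfolding e power_int_of_nat by (metis mult.commute)
      qed
      then have "complex_of_real (s powi (int k - 1)) * of_real ((s / r) ^ (n - 1)) = of_real (inverse r ^ (n - 1)) * of_real (s ^ m)"
        by (metis of_real_mult)
      then show "complex_of_real (s powi (int k - 1)) * g s = ?d * (of_real (s ^ m) * w (r * inverse s))"
        unfolding g_def divide_inverse by (rule mult_regroup(1))
    qed (use t in auto)
    also have "\<dots> = ?d * (vd ^^ N) (\<lambda>t. of_real (t ^ m) * w (r * inverse t)) t"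
      by (rule vd_funpow_cmult[of "{0<..}"])
        (use t in \<open>auto intro!: smooth_on_mult smooth_on_of_real smooth_on_power smooth_on_ident smooth_on_inverse_compose[OF swr]\<close>)
    also have "(vd ^^ N) (\<lambda>t. of_real (t ^ m) * w (r * inverse t)) t
        = (-1) ^ N * of_real (inverse t ^ (m + 2)) * (vd ^^ N) (\<lambda>z. w (r * z)) (inverse t)"
      unfolding m(1) by (rule vd_funpow_inverse[OF swr t])
    also have "(vd ^^ N) (\<lambda>z. w (r * z)) (inverse t) = of_real (r ^ N) * (vd ^^ N) w (r * inverse t)"
      by (rule vd_funpow_scale[OF sw r]) (use t in simp)
    finally have D: "(vd ^^ N) (\<lambda>t. complex_of_real (t powi (int k - 1)) * g t) t
        = (-1) ^ N * c * of_real (inverse r ^ (n - 1) * r ^ N * inverse t ^ (m + 2)) * (vd ^^ N) w (r / t)"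
      by (simp add: divide_inverse mult_ac)
    have "inverse r ^ (n - 1) * r ^ N = r powi (int k)"
    proof -
      have "N = (n - 1) + k" using n by (simp add: N_def)
      then have "inverse r ^ (n - 1) * r ^ N = (inverse r * r) ^ (n - 1) * r ^ k"
        by (simp add: power_add power_mult_distrib)
      then show ?thesis using r by simp
    qed
    moreover have "t powi (1 - int k) * inverse t ^ (m + 2) = inverse t ^ j"
    proof -
      have L: "inverse t ^ l = t powi (- int l)" for l
        using t by (simp add: power_int_minus power_inverse)
      have A: "t powi ((1 - int k) + (- int (m + 2))) = t powi (1 - int k) * t powi (- int (m + 2))"
        by (rule power_int_add) (use t in simp)
      have "(1 - int k) + (- int (m + 2)) = - int j" using m n by (simp add: j_def of_nat_diff N_def)
      then show ?thesis using A unfolding L by metis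
    qed
    ultimately have "t powi (1 - int k) * (inverse r ^ (n - 1) * r ^ N * inverse t ^ (m + 2)) = r powi (int k) * inverse t ^ j"
      by (simp add: mult_ac)
    then have "complex_of_real (t powi (1 - int k)) * of_real (inverse r ^ (n - 1) * r ^ N * inverse t ^ (m + 2))
        = of_real (r powi (int k) * inverse t ^ j)"
      by (metis of_real_mult)
    then show ?thesis
      unfolding beta_density_def N_def[symmetric] D by (rule mult_regroup(2))
  qed
  have "beta_dist n k g = of_real (beta_const n k) * integral {0..} (\<lambda>y.
      of_real (r * y ^ (n + 2 * k - 2) / sqrt (r\<^sup>2 + y\<^sup>2) ^ (n + 2 * k)) * beta_density n k g (r / sqrt (r\<^sup>2 + y\<^sup>2)))"
    by (rule beta_substitution(2)[OF n r v])
  also have "integral {0..} (\<lambda>y.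
      of_real (r * y ^ (n + 2 * k - 2) / sqrt (r\<^sup>2 + y\<^sup>2) ^ (n + 2 * k)) * beta_density n k g (r / sqrt (r\<^sup>2 + y\<^sup>2)))
    = integral {0..} (\<lambda>y. ((-1) ^ N * c * of_real (r powi (2 - int n - int k))) *
        (of_real (y ^ (j - 1) / sqrt (r\<^sup>2 + y\<^sup>2)) * (vd ^^ N) w (sqrt (r\<^sup>2 + y\<^sup>2))))"
  proof (rule Henstock_Kurzweil_Integration.integral_cong)
    fix y
    define \<sigma> where "\<sigma> = sqrt (r\<^sup>2 + y\<^sup>2)"
    have \<sigma>: "\<sigma> > 0" unfolding \<sigma>_def by (rule hyp_pos[OF r])
    have q: "r / (r / \<sigma>) = \<sigma>" "inverse (r / \<sigma>) = \<sigma> / r" using r \<sigma> by simp_all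
    have j: "n + 2 * k = Suc j" "Suc j - 2 = j - 1" using n by (auto simp: j_def)
    have "r * y ^ (j - 1) / \<sigma> ^ Suc j * (r powi (int k) * (\<sigma> / r) ^ j)
        = r powi (2 - int n - int k) * (y ^ (j - 1) / \<sigma>)"
    proof -
      have e: "2 - int n - int k = int k + (1 - int j)" using n by (simp add: j_def of_nat_diff)
      have "r powi (int k + (1 - int j)) = r powi int k * r powi (1 - int j)"
        by (rule power_int_add) (use r in simp)
      also have "r powi (1 - int j) = r powi 1 / r powi int j" by (rule power_int_diff) (use r in simp)
      finally have "r powi (2 - int n - int k) = r powi int k * (r / r ^ j)"
        unfolding e power_int_1_right power_int_of_nat .
      then show ?thesis using r \<sigma> by (simp add: field_simps power_divide)
    qed
    then have "complex_of_real (r * y ^ (j - 1) / \<sigma> ^ Suc j) * of_real (r powi (int k) * (\<sigma> / r) ^ j)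
        = of_real (r powi (2 - int n - int k)) * of_real (y ^ (j - 1) / \<sigma>)"
      by (metis of_real_mult)
    note pw = this
    have bd: "beta_density n k g (r / \<sigma>) = (-1) ^ N * c * of_real (r powi (int k) * (\<sigma> / r) ^ j) * (vd ^^ N) w \<sigma>"
      using dens[of "r / \<sigma>"] r \<sigma> unfolding q by simp
    show "complex_of_real (r * y ^ (n + 2 * k - 2) / sqrt (r\<^sup>2 + y\<^sup>2) ^ (n + 2 * k)) * beta_density n k g (r / sqrt (r\<^sup>2 + y\<^sup>2))
        = ((-1) ^ N * c * of_real (r powi (2 - int n - int k))) *
        (of_real (y ^ (j - 1) / sqrt (r\<^sup>2 + y\<^sup>2)) * (vd ^^ N) w (sqrt (r\<^sup>2 + y\<^sup>2)))"
      unfolding \<sigma>_def[symmetric] j bd by (rule mult_regroup(3)[OF pw])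
  qed
  also have "\<dots> = ((-1) ^ N * c * of_real (r powi (2 - int n - int k))) * abel_int j ((vd ^^ N) w) r"
    unfolding abel_int_def by (rule Henstock_Kurzweil_Integration.integral_mult_right)
  finally show "beta_dist n k g = of_real (beta_const n k) * (-1) ^ (n + k - 1) * c
      * of_real (r powi (2 - int n - int k)) * abel_int (n + 2 * k - 1) ((vd ^^ (n + k - 1)) w) r"
    by (simp only: N_def j_def mult.assoc)
qed

subsection \<open>Separation of variables\<close>

text \<open>Passes from u(r) Y(x / r) to U (x \<bullet> x) Y x with p = r^2: the homogeneity of Y
  costs the factor r^(-k), harmless because profiles are free near 0.\<close>

definition prof :: "nat \<Rightarrow> (real \<Rightarrow> complex) \<Rightarrow> real \<Rightarrow> complex" where
  "prof k u p = of_real (inverse (sqrt p) ^ k) * u (sqrt p)"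

lemma smooth_on_inverse_sqrt_power: "smooth_on (\<lambda>p. complex_of_real (inverse (sqrt p) ^ k)) {0<..}"
  by (intro smooth_on_of_real smooth_on_power smooth_on_compose_real[OF _ _ _ smooth_on_inverse smooth_on_sqrt]) auto

lemma smooth_on_prof:
  assumes "u \<in> Cpos" shows "smooth_on (prof k u) {0<..}"
proof -
  have "smooth_on u {0<..}" using assms by (simp add: Cpos_def)
  then have "smooth_on (\<lambda>p. u (sqrt p)) {0<..}"
    by (rule smooth_on_compose_real[OF _ _ _ _ smooth_on_sqrt, rotated 3]) auto
  then show ?thesis
    unfolding prof_def[abs_def] by (intro smooth_on_mult smooth_on_inverse_sqrt_power) auto
qed

lemma Cpos_plus_fplus: "u \<in> Cpos_plus \<Longrightarrow> u \<in> fplus"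
  by (simp add: Cpos_plus_def Cpos_def fplus_def)

lemma prof_fplus: "u \<in> Cpos_plus \<Longrightarrow> prof k u \<in> fplus"
  unfolding prof_def[abs_def]
  by (intro fplus_smooth_mult smooth_on_inverse_sqrt_power fplus_compose_sqrt Cpos_plus_fplus)

lemma radial_tensor_eq_prof:
  assumes "hpoly k Y" "x \<noteq> 0" shows "radial_tensor u Y x = prof k u (x \<bullet> x) * Y x"
  using hpoly_scale[OF assms(1), of "inverse (norm x)" x]
  by (simp add: radial_tensor_def prof_def norm_eq_sqrt_inner[symmetric] mult_ac)

lemma radial_tensor_smooth:
  assumes "hpoly k Y" "u \<in> Cpos" shows "smooth_on (radial_tensor u Y) (- {0})"
proof -
  have "smooth_on (\<lambda>x. prof k u (x \<bullet> x) * Y x) (- {0})"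
    by (intro smooth_on_mult smooth_on_compose_real[OF _ _ _ smooth_on_prof[OF assms(2)]]
        smooth_on_norm_sq hpoly_smooth[OF assms(1)]) auto
  then show ?thesis
    by (rule smooth_on_cong_imp[rotated 2]) (use radial_tensor_eq_prof[OF assms(1)] in auto)
qed

lemma K_finiteI:
  fixes f :: "real^'n \<Rightarrow> complex"
  assumes "finite B" "\<And>h :: real^'n \<Rightarrow> real^'n. orthogonal_transformation h \<Longrightarrow> (\<lambda>x. f (h x)) \<in> cfun.span B"
  shows "K_finite f"
proof -
  have "{mat_act g f | g. orthogonal_matrix g} \<subseteq> cfun.span B"
  proof
    fix F assume "F \<in> {mat_act g f | g. orthogonal_matrix g}"
    then obtain g where g: "F = mat_act g f" "orthogonal_matrix g" by blast
    have "orthogonal_transformation (\<lambda>x. transpose g *v x)"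
      using g(2) by (simp add: orthogonal_transformation_matrix del: transpose_matrix_vector)
    then show "F \<in> cfun.span B"
      using assms(2) by (simp add: g(1) mat_act_def matrix_inv_orthogonal[OF g(2)])
  qed
  then have "cfun.span {mat_act g f | g. orthogonal_matrix g} \<subseteq> cfun.span B"
    by (intro cfun.span_minimal cfun.subspace_span)
  then show ?thesis using assms(1) unfolding K_finite_def by blast
qed

text \<open>Orthogonal maps preserve the norm, hence act on Y alone and within the homogeneous
  polynomials of degree k, which have a finite spanning set.\<close>

lemma radial_tensor_K_finite:
  fixes Y :: "real^'n \<Rightarrow> complex"
  assumes "hpoly k Y" shows "K_finite (radial_tensor u Y)"
proof (rule K_finiteI)
  show "finite (radial_tensor u ` (mono_basis k :: (real^'n \<Rightarrow> complex) set))"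
    by (simp add: finite_mono_basis)
  fix h :: "real^'n \<Rightarrow> real^'n" assume h: "orthogonal_transformation h"
  have lin: "radial_tensor u Q \<in> cfun.span (radial_tensor u ` T)" if "Q \<in> cfun.span T"
    for Q :: "real^'n \<Rightarrow> complex" and T
    using that
  proof (induction rule: span_fun_induct)
    case zero
    have "radial_tensor u (\<lambda>x. 0) = (\<lambda>x :: real^'n. 0)" by (simp add: radial_tensor_def fun_eq_iff)
    then show ?case using span_zeroI by metis
  next
    case (add c f g)
    have "radial_tensor u (\<lambda>x. c * f x + g x) = (\<lambda>x. c * radial_tensor u f x + radial_tensor u g x)"
      by (simp add: radial_tensor_def fun_eq_iff algebra_simps)
    then show ?case using span_addI[OF span_cmultI[OF add(1), of c] add(2)] by simp
  qed (auto intro: cfun.span_base)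
  have "hpoly k (\<lambda>x. Y (h x))"
    by (rule hpoly_linear_compose[OF assms orthogonal_transformation_linear[OF h]])
  then have "radial_tensor u (\<lambda>x. Y (h x)) \<in> cfun.span (radial_tensor u ` mono_basis k)"
    by (intro lin hpoly_in_span_mono_basis)
  moreover have "radial_tensor u (\<lambda>x. Y (h x)) = (\<lambda>x. radial_tensor u Y (h x))"
    using h by (simp add: radial_tensor_def fun_eq_iff orthogonal_transformation_norm orthogonal_transformation_scaleR)
  ultimately show "(\<lambda>x. radial_tensor u Y (h x)) \<in> cfun.span (radial_tensor u ` mono_basis k)" by simp
qed

lemma radial_tensor_C_space:
  assumes "hpoly k Y" "u \<in> Cpos" shows "radial_tensor u Y \<in> C_space"
  using assms radial_tensor_smooth radial_tensor_K_finite by (auto simp: C_space_def radial_tensor_def Cpos_def)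

lemma radial_tensor_C_plus:
  fixes Y :: "real^'n \<Rightarrow> complex"
  assumes "hpoly k Y" "u \<in> Cpos_plus" shows "radial_tensor u Y \<in> C_plus"
proof -
  obtain R where R: "R > 0" "\<And>x. x \<ge> R \<Longrightarrow> u x = 0" using fplus_bound[OF Cpos_plus_fplus[OF assms(2)]] by blast
  have "norm x \<le> R" if "radial_tensor u Y x \<noteq> 0" for x
    using R(2)[of "norm x"] that by (force simp: radial_tensor_def)
  then have "bounded {x. radial_tensor u Y x \<noteq> 0}" by (auto simp: bounded_iff)
  then show ?thesis using radial_tensor_C_space assms by (auto simp: C_plus_def Cpos_plus_def)
qed

lemma radial_tensor_C_minus:
  fixes Y :: "real^'n \<Rightarrow> complex"
  assumes "hpoly k Y" "v \<in> Cpos_minus" shows "radial_tensor v Y \<in> C_minus"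
proof -
  obtain d where d: "d > 0" "\<And>r. 0 < r \<Longrightarrow> r < d \<Longrightarrow> v r = 0"
    using assms(2) by (auto simp: Cpos_minus_def eventually_at_right_field)
  have "\<forall>\<^sub>F x in at 0. radial_tensor v Y x = 0"
    unfolding eventually_at using d by (intro exI[of _ d]) (auto simp: radial_tensor_def)
  then show ?thesis using radial_tensor_C_space assms by (auto simp: C_minus_def Cpos_minus_def)
qed

section \<open>Linearity of the function spaces and of the operator\<close>

lemma C_space_lin:
  fixes f g :: "real^'n \<Rightarrow> complex"
  assumes "f \<in> C_space" "g \<in> C_space" shows "(\<lambda>x. c * f x + g x) \<in> C_space"
proof -
  obtain B1 where B1: "finite B1" "\<And>h :: real^'n \<Rightarrow> real^'n. orthogonal_transformation h \<Longrightarrow> (\<lambda>x. f (h x)) \<in> cfun.span B1"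
  proof (rule K_finite_orthogonal_span)
    show "K_finite f" using assms by (simp add: C_space_def)
    fix B assume "finite B" "\<And>h :: real^'n \<Rightarrow> real^'n. orthogonal_transformation h \<Longrightarrow> (\<lambda>x. f (h x)) \<in> cfun.span B"
    then show thesis by (rule that)
  qed
  obtain B2 where B2: "finite B2" "\<And>h :: real^'n \<Rightarrow> real^'n. orthogonal_transformation h \<Longrightarrow> (\<lambda>x. g (h x)) \<in> cfun.span B2"
  proof (rule K_finite_orthogonal_span)
    show "K_finite g" using assms by (simp add: C_space_def)
    fix B assume "finite B" "\<And>h :: real^'n \<Rightarrow> real^'n. orthogonal_transformation h \<Longrightarrow> (\<lambda>x. g (h x)) \<in> cfun.span B"
    then show thesis by (rule that)
  qed
  have "K_finite (\<lambda>x. c * f x + g x)"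
  proof (rule K_finiteI)
    show "finite (B1 \<union> B2)" using B1 B2 by simp
    fix h :: "real^'n \<Rightarrow> real^'n" assume h: "orthogonal_transformation h"
    have "(\<lambda>x. f (h x)) \<in> cfun.span (B1 \<union> B2)" "(\<lambda>x. g (h x)) \<in> cfun.span (B1 \<union> B2)"
      using B1(2)[OF h] B2(2)[OF h] cfun.span_mono[of B1 "B1 \<union> B2"] cfun.span_mono[of B2 "B1 \<union> B2"] by auto
    then show "(\<lambda>x. c * f (h x) + g (h x)) \<in> cfun.span (B1 \<union> B2)"
      by (intro span_addI span_cmultI)
  qed
  moreover have "smooth_on (\<lambda>x. c * f x + g x) (- {0})"
    using assms by (intro smooth_on_add smooth_on_cmult) (auto simp: C_space_def)
  ultimately show ?thesis using assms by (simp add: C_space_def)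
qed

lemma C_plus_lin:
  fixes f g :: "real^'n \<Rightarrow> complex"
  assumes "f \<in> C_plus" "g \<in> C_plus" shows "(\<lambda>x. c * f x + g x) \<in> C_plus"
proof -
  have "bounded ({x. f x \<noteq> 0} \<union> {x. g x \<noteq> 0})" using assms by (simp add: C_plus_def)
  then have "bounded {x. c * f x + g x \<noteq> 0}" by (rule bounded_subset) auto
  then show ?thesis using assms C_space_lin by (auto simp: C_plus_def)
qed

lemma C_minus_lin:
  fixes f g :: "real^'n \<Rightarrow> complex"
  assumes "f \<in> C_minus" "g \<in> C_minus" shows "(\<lambda>x. c * f x + g x) \<in> C_minus"
proof -
  have "\<forall>\<^sub>F x in at 0. f x = 0" "\<forall>\<^sub>F x in at 0. g x = 0" using assms by (auto simp: C_minus_def)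
  then have "\<forall>\<^sub>F x in at 0. c * f x + g x = 0" by eventually_elim simp
  then show ?thesis using assms C_space_lin by (auto simp: C_minus_def)
qed

lemma C_space_zero: "(\<lambda>x :: real^'n. 0) \<in> C_space"
  using hpoly_zero[of 0] radial_tensor_C_space[of 0 "\<lambda>x :: real^'n. 0" "\<lambda>_. 0"]
  by (simp add: Cpos_def radial_tensor_def[abs_def])

lemma C_plus_zero: "(\<lambda>x :: real^'n. 0) \<in> C_plus"
  using C_space_zero by (simp add: C_plus_def)

lemma C_minus_zero: "(\<lambda>x :: real^'n. 0) \<in> C_minus"
  using C_space_zero by (simp add: C_minus_def)

lemma C_plus_sum:
  fixes F :: "'i \<Rightarrow> real^'n \<Rightarrow> complex"
  shows "(\<And>i. i \<in> I \<Longrightarrow> F i \<in> C_plus) \<Longrightarrow> (\<lambda>x. \<Sum>i\<in>I. F i x) \<in> C_plus"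
proof (induction I rule: infinite_finite_induct)
  case (insert i I)
  then show ?case using C_plus_lin[of "F i" "\<lambda>x. \<Sum>i\<in>I. F i x" 1] by simp
qed (simp_all add: C_plus_zero)

lemma C_minus_sum:
  fixes F :: "'i \<Rightarrow> real^'n \<Rightarrow> complex"
  shows "(\<And>i. i \<in> I \<Longrightarrow> F i \<in> C_minus) \<Longrightarrow> (\<lambda>x. \<Sum>i\<in>I. F i x) \<in> C_minus"
proof (induction I rule: infinite_finite_induct)
  case (insert i I)
  then show ?case using C_minus_lin[of "F i" "\<lambda>x. \<Sum>i\<in>I. F i x" 1] by simp
qed (simp_all add: C_minus_zero)

lemma C_plus_bsupp: "f \<in> C_plus \<Longrightarrow> bsupp f"
  by (auto simp: C_plus_def C_space_def bsupp_def intro: smooth_on_imp_continuous_on)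

lemma M_op_lin:
  fixes f g :: "real^'n \<Rightarrow> complex"
  assumes "f \<in> C_plus" "g \<in> C_plus"
  shows "M_op (\<lambda>x. c * f x + g x) = (\<lambda>\<xi>. c * M_op f \<xi> + M_op g \<xi>)"
proof
  fix \<xi> :: "real^'n"
  have "integrable (hyperplane_measure \<xi> 1) f" "integrable (hyperplane_measure \<xi> 1) g" if "\<xi> \<noteq> 0"
    using that assms by (auto intro!: integrable_hyperplane C_plus_bsupp)
  then show "M_op (\<lambda>x. c * f x + g x) \<xi> = c * M_op f \<xi> + M_op g \<xi>"
    by (simp add: M_op_def)
qed

lemma M_op_zero: "M_op (\<lambda>x. 0) = (\<lambda>\<xi>. 0)"
  by (simp add: M_op_def fun_eq_iff)

lemma M_op_sum:
  fixes F :: "'i \<Rightarrow> real^'n \<Rightarrow> complex"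
  shows "(\<And>i. i \<in> I \<Longrightarrow> F i \<in> C_plus) \<Longrightarrow> M_op (\<lambda>x. \<Sum>i\<in>I. F i x) = (\<lambda>\<xi>. \<Sum>i\<in>I. M_op (F i) \<xi>)"
proof (induction I rule: infinite_finite_induct)
  case (insert i I)
  then show ?case using M_op_lin[of "F i" "\<lambda>x. \<Sum>i\<in>I. F i x" 1] C_plus_sum[of I F] by simp
qed (simp_all add: M_op_zero)

section \<open>The radial part of the operator on a harmonic component\<close>

definition M_rad :: "nat \<Rightarrow> nat \<Rightarrow> (real \<Rightarrow> complex) \<Rightarrow> real \<Rightarrow> complex" where
  "M_rad n k u \<rho> = (if \<rho> > 0 then of_real (1 / \<rho>) * lam (n - 1) k (prof k u) (1 / \<rho>) else 0)"

lemma M_op_radial_tensor: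
  fixes Y :: "real^'n \<Rightarrow> complex"
  assumes "solid_harmonic k Y" "u \<in> Cpos_plus"
  shows "M_op (radial_tensor u Y) = radial_tensor (M_rad CARD('n) k u) Y"
proof
  fix \<xi> :: "real^'n"
  have Y: "hpoly k Y" using assms(1) by (simp add: solid_harmonic_def)
  show "M_op (radial_tensor u Y) \<xi> = radial_tensor (M_rad CARD('n) k u) Y \<xi>"
  proof (cases "\<xi> = 0")
    case True
    then show ?thesis by (simp add: M_op_def radial_tensor_def M_rad_def)
  next
    case False
    have "(LINT x|hyperplane_measure \<xi> 1. radial_tensor u Y x)
        = (LINT x|hyperplane_measure \<xi> 1. prof k u (x \<bullet> x) * Y x)"
    proof (rule integral_cong_AE)
      show "radial_tensor u Y \<in> borel_measurable (hyperplane_measure \<xi> 1)"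
        using bsupp_measurable[OF C_plus_bsupp[OF radial_tensor_C_plus[OF Y assms(2)]]] by simp
      show "(\<lambda>x. prof k u (x \<bullet> x) * Y x) \<in> borel_measurable (hyperplane_measure \<xi> 1)"
        using bsupp_measurable[OF hpoly_bsupp[OF prof_fplus[OF assms(2)] Y]] by simp
      show "AE x in hyperplane_measure \<xi> 1. radial_tensor u Y x = prof k u (x \<bullet> x) * Y x"
        using hyperplane_measure_concentrated[OF False]
        by eventually_elim (rule radial_tensor_eq_prof[OF Y], auto)
    qed
    also have "\<dots> = Y (\<xi> /\<^sub>R norm \<xi>) * of_real (1 / norm \<xi>) * lam (CARD('n) - 1) k (prof k u) (1 / norm \<xi>)"
      by (rule integral_hyperplane_harm[OF prof_fplus[OF assms(2)] assms(1) False])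
    finally have "M_op (radial_tensor u Y) \<xi> = Y (\<xi> /\<^sub>R norm \<xi>) * of_real (1 / norm \<xi>)
        * lam (CARD('n) - 1) k (prof k u) (1 / norm \<xi>)"
      using False by (simp only: M_op_def if_False)
    then show ?thesis using False by (simp add: radial_tensor_def M_rad_def)
  qed
qed

lemma M_rad_Cpos_minus:
  assumes "u \<in> Cpos_plus" shows "M_rad n k u \<in> Cpos_minus"
proof -
  define w where "w = lam (n - 1) k (prof k u)"
  have w: "w \<in> fplus" unfolding w_def by (intro lam_fplus prof_fplus assms)
  obtain R where R: "R > 0" "\<And>x. x \<ge> R \<Longrightarrow> w x = 0" using fplus_bound[OF w] by blast
  have "smooth_on (\<lambda>\<rho>. complex_of_real (inverse \<rho>) * w (inverse \<rho>)) {0<..}"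
    by (intro smooth_on_mult smooth_on_of_real smooth_on_inverse smooth_on_inverse_compose fplus_smooth[OF w]) auto
  then have "smooth_on (M_rad n k u) {0<..}"
    by (rule smooth_on_cong_imp[rotated 2]) (auto simp: M_rad_def w_def inverse_eq_divide)
  moreover have "M_rad n k u r = 0" if "0 < r" "r < 1 / R" for r
  proof -
    have "1 / r \<ge> R" using that R(1) by (simp add: field_simps)
    then have "w (1 / r) = 0" by (rule R(2))
    then show ?thesis unfolding M_rad_def w_def[symmetric] by simp
  qed
  then have "\<forall>\<^sub>F r in at_right 0. M_rad n k u r = 0"
    unfolding eventually_at_right_field using R(1) by (intro exI[of _ "1 / R"]) auto
  ultimately show ?thesis by (auto simp: Cpos_minus_def Cpos_def M_rad_def)
qed

text \<open>The argument is the inversion of the transformed function along the ray through a point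
  of norm r: the n-th power of t / r from Inv meets the factor r / t of \<open>M_rad\<close>,
  leaving n - 1. By \<open>beta_const_abel_const\<close> all constants cancel, and the powers of r
  combine to r^k, which undoes \<open>prof\<close>.\<close>

lemma M_rad_inverse:
  assumes "u \<in> Cpos_plus" "n \<ge> 2" "r > 0"
  shows "u r = beta_dist n k (\<lambda>t. of_real ((t / r) ^ (n - 1)) * lam (n - 1) k (prof k u) (r / t) * 1)"
proof -
  define U where "U = prof k u"
  define j where "j = n + 2 * k - 1"
  have U: "U \<in> fplus" unfolding U_def by (rule prof_fplus[OF assms(1)])
  have n: "n - 1 \<ge> 1" "n - 1 + 2 * k = j" "n - 1 + k = n + k - 1" "j \<ge> 1" using assms(2) by (auto simp: j_def)
  have inv: "abel_int j ((vd ^^ (n + k - 1)) (lam (n - 1) k U)) r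
      = (-1) ^ (n + k - 1) * of_real (abel_const j * r ^ (j - 1) / (2 * pi) ^ k) * U (r\<^sup>2)"
    using lam_inverse[OF U assms(3) n(1), of k] unfolding n(2,3) .
  have real_id: "beta_const n k * r powi (2 - int n - int k) * (abel_const j * r ^ (j - 1) / (2 * pi) ^ k) = r ^ k"
  proof -
    have "r powi (2 - int n - int k) * r ^ (j - 1) = r powi (2 - int n - int k + int (j - 1))"
      using assms(3) by (simp add: power_int_add)
    also have "2 - int n - int k + int (j - 1) = int k" using assms(2) by (simp add: j_def of_nat_diff)
    finally have "r powi (2 - int n - int k) * r ^ (j - 1) = r ^ k" by simp
    moreover have "beta_const n k * abel_const j = (2 * pi) ^ k"
      unfolding j_def by (rule beta_const_abel_const[OF assms(2)])
    moreover have "b * x * (a * y / q) = y'" if "x * y = y'" "b * a = q" "q \<noteq> 0" for b x a y q y' :: real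
      using that by (auto simp: field_simps)
    ultimately show ?thesis by simp
  qed
  have "beta_dist n k (\<lambda>t. of_real ((t / r) ^ (n - 1)) * lam (n - 1) k U (r / t) * 1)
      = of_real (beta_const n k) * (-1) ^ (n + k - 1) * 1 * of_real (r powi (2 - int n - int k))
        * ((-1) ^ (n + k - 1) * of_real (abel_const j * r ^ (j - 1) / (2 * pi) ^ k) * U (r\<^sup>2))"
    using beta_dist_profile(2)[where w = "lam (n - 1) k U" and c = 1 and k = k, OF assms(2,3) lam_fplus[OF U]]
    unfolding j_def[symmetric] inv .
  also have "\<dots> = ((-1) ^ (n + k - 1) * (-1) ^ (n + k - 1)) *
      of_real (beta_const n k * r powi (2 - int n - int k) * (abel_const j * r ^ (j - 1) / (2 * pi) ^ k)) * U (r\<^sup>2)"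
    by (simp add: mult_ac)
  also have "\<dots> = of_real (r ^ k) * U (r\<^sup>2)"
    unfolding real_id by (simp flip: power_mult_distrib)
  also have "\<dots> = u r"
    using assms(3) by (simp add: U_def prof_def flip: power_mult_distrib)
  finally show ?thesis by (simp add: U_def)
qed

lemma M_rad_inj:
  assumes "u \<in> Cpos_plus" "n \<ge> 2" "\<And>\<rho>. \<rho> > 0 \<Longrightarrow> M_rad n k u \<rho> = 0" "r > 0"
  shows "u r = 0"
proof -
  have w0: "lam (n - 1) k (prof k u) x = 0" if "x > 0" for x
    using assms(3)[of "1 / x"] that by (simp add: M_rad_def)
  have "u r = beta_dist n k (\<lambda>t. of_real ((t / r) ^ (n - 1)) * lam (n - 1) k (prof k u) (r / t) * 1)"
    by (rule M_rad_inverse[OF assms(1,2,4)])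
  also have "\<dots> = beta_dist n k (\<lambda>t. 0)"
    by (rule beta_dist_cong[OF assms(2), of _ 2])
      (use w0 assms(4) in \<open>auto simp: vanish0_def intro!: exI[of _ 1]\<close>)
  also have "\<dots> = 0"
  proof -
    have z: "vanish0 (\<lambda>t. 0)" by (auto simp: vanish0_def intro!: exI[of _ 1])
    show ?thesis using beta_dist_linear[OF assms(2) z z, of k 1] by simp
  qed
  finally show ?thesis .
qed

lemma M_rad_surj:
  assumes "v \<in> Cpos_minus"
  obtains u where "u \<in> Cpos_plus" "M_rad n k u = v"
proof -
  have v: "smooth_on v {0<..}" "\<And>r. r \<le> 0 \<Longrightarrow> v r = 0" using assms by (auto simp: Cpos_minus_def Cpos_def)
  obtain d where d: "d > 0" "\<And>r. 0 < r \<Longrightarrow> r < d \<Longrightarrow> v r = 0"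
    using assms by (auto simp: Cpos_minus_def eventually_at_right_field)
  \<comment> \<open>The equation for u, with \<rho> = 1 / t, asks for a profile whose
    \<open>lam\<close> is this function; vanishing of v near 0 becomes vanishing of w far
    out.\<close>
  define w where "w t = of_real (inverse t) * v (inverse t)" for t
  have "w \<in> fplus"
  proof (rule fplusI)
    show "smooth_on w {0<..}"
      unfolding w_def[abs_def]
      by (intro smooth_on_mult smooth_on_of_real smooth_on_inverse smooth_on_inverse_compose v) auto
    fix x :: real assume "x \<ge> 1 / d + 1"
    then have x: "x > 1 / d" by simp
    then have x0: "x > 0" using d(1) by (meson less_trans zero_less_divide_1_iff)
    then have "inverse x < d" using x d(1) by (simp add: field_simps)
    then show "w x = 0" using d(2)[of "inverse x"] x0 by (simp add: w_def)
  qed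
  then obtain U where U: "U \<in> fplus" "\<forall>t>0. lam (n - 1) k U t = w t" using lam_surj by blast
  \<comment> \<open>The inverse of \<open>prof\<close> on positive arguments, with the convention of
    \<open>Cpos\<close> elsewhere.\<close>
  define u where "u r = (if r > 0 then of_real (r ^ k) * U (r\<^sup>2) else 0)" for r
  have "(\<lambda>r. of_real (r ^ k) * U (r\<^sup>2)) \<in> fplus"
    by (intro fplus_smooth_mult fplus_compose_square U smooth_on_of_real smooth_on_power smooth_on_ident) auto
  then have "smooth_on (\<lambda>r. of_real (r ^ k) * U (r\<^sup>2)) {0<..}" and ev: "\<forall>\<^sub>F r in at_top. of_real (r ^ k) * U (r\<^sup>2) = 0"
    by (auto simp: fplus_def)
  then have "smooth_on u {0<..}" by (intro smooth_on_cong_imp[of "{0<..}" _ u]) (auto simp: u_def)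
  moreover have "\<forall>\<^sub>F r in at_top. u r = 0" using ev by eventually_elim (auto simp: u_def)
  ultimately have u: "u \<in> Cpos_plus" by (auto simp: Cpos_plus_def Cpos_def u_def)
  have prof_U: "prof k u p = U p" if "p > 0" for p
    using that by (simp add: prof_def u_def power_mult_distrib[symmetric] flip: of_real_mult of_real_power)
  have "M_rad n k u \<rho> = v \<rho>" for \<rho>
  proof (cases "\<rho> > 0")
    case True
    have "lam (n - 1) k (prof k u) (1 / \<rho>) = lam (n - 1) k U (1 / \<rho>)"
      unfolding lam_def
      by (intro arg_cong2[where f = "(*)"] refl vd_funpow_cong_open[of "{0<..}"] line_int_funpow_cong
          tail_int_funpow_cong prof_U) (use True in auto)
    then show ?thesis using True U(2) by (simp add: M_rad_def w_def divide_inverse)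
  next
    case False
    then show ?thesis using v(2) by (simp add: M_rad_def)
  qed
  then show ?thesis using that[OF u] by blast
qed

text \<open>The coefficient of a harmonic at radius r is a fixed linear combination of values of f
  at the points r p, p running through the nodes. It is therefore smooth in r and 0 whenever f
  vanishes on the sphere of radius r; the latter yields the versions for \<open>C_plus\<close> and
  \<open>C_minus\<close>.\<close>

lemma C_space_decomposition:
  fixes f :: "real^'n \<Rightarrow> complex"
  assumes n: "CARD('n) \<ge> 2" and f: "f \<in> C_space"
  obtains B :: "(real^'n \<Rightarrow> complex) set" and u k Y where
    "finite B" "cfun.independent B"
    "\<And>\<beta>. \<beta> \<in> B \<Longrightarrow> solid_harmonic (k \<beta>) (Y \<beta>)" "\<And>\<beta>. \<beta> \<in> B \<Longrightarrow> \<beta> = restr (Y \<beta>)"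
    "\<And>\<beta>. \<beta> \<in> B \<Longrightarrow> u \<beta> \<in> Cpos"
    "\<And>\<beta> r. r > 0 \<Longrightarrow> (\<And>x. norm x = r \<Longrightarrow> f x = 0) \<Longrightarrow> u \<beta> r = 0"
    "f = (\<lambda>x. \<Sum>\<beta>\<in>B. radial_tensor (u \<beta>) (Y \<beta>) x)"
proof -
  obtain B where B: "finite B" "cfun.independent B" "B \<subseteq> restr ` {Y. \<exists>k. solid_harmonic k Y}"
    and fB: "\<And>r. r > 0 \<Longrightarrow> restr (\<lambda>\<omega>. f (r *\<^sub>R \<omega>)) \<in> cfun.span B"
  proof (rule sphere_decomposition[OF n f])
    fix B
    assume "finite B" "cfun.independent B" "B \<subseteq> restr ` {Y. \<exists>k. solid_harmonic k Y}"
      "\<And>r. r > 0 \<Longrightarrow> restr (\<lambda>\<omega>. f (r *\<^sub>R \<omega>)) \<in> cfun.span B"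
    then show thesis by (rule that)
  qed
  have "\<forall>\<beta>\<in>B. \<exists>Y k. solid_harmonic k Y \<and> \<beta> = restr Y" using B(3) by blast
  then obtain Y k where Y: "\<And>\<beta>. \<beta> \<in> B \<Longrightarrow> solid_harmonic (k \<beta>) (Y \<beta>)" "\<And>\<beta>. \<beta> \<in> B \<Longrightarrow> \<beta> = restr (Y \<beta>)"
    by metis
  obtain P b where P: "finite P" "\<And>p. p \<in> P \<Longrightarrow> b p \<in> cfun.span B"
    and Pb: "\<And>v x. v \<in> cfun.span B \<Longrightarrow> v x = (\<Sum>p\<in>P. v p * b p x)"
  proof (rule interpolation_basis[OF B(1)])
    fix P :: "(real^'n) set" and b
    assume "finite P" "\<And>p. p \<in> P \<Longrightarrow> b p \<in> cfun.span B"
      "\<And>v x. v \<in> cfun.span B \<Longrightarrow> v x = (\<Sum>p\<in>P. v p * b p x)"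
    then show thesis by (rule that)
  qed
  have "\<forall>p\<in>P. \<exists>m. b p = (\<Sum>\<beta>\<in>B. cscale (m \<beta>) \<beta>)"
    using P(2) cfun.span_finite[OF B(1)] by blast
  then obtain m where m: "\<And>p. p \<in> P \<Longrightarrow> b p = (\<Sum>\<beta>\<in>B. cscale (m p \<beta>) \<beta>)" by metis
  have sum_at: "(\<Sum>\<beta>\<in>B. cscale (a \<beta>) \<beta>) x = (\<Sum>\<beta>\<in>B. a \<beta> * \<beta> x)" for a x
    using B(1) by (induction B rule: finite_induct) (simp_all add: cscale_def)
  \<comment> \<open>Nodes and numbers \<open>m p \<beta>\<close> depend on B only. A node off the
    unit sphere contributes nothing, since \<open>restr\<close> is 0 there.\<close>
  define u where "u \<beta> r = (if r > 0 then \<Sum>p\<in>P. m p \<beta> * restr (\<lambda>\<omega>. f (r *\<^sub>R \<omega>)) p else 0)" for \<beta> r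
  have fs: "smooth_on f (- {0})" "f 0 = 0" using f by (auto simp: C_space_def)
  have sm: "smooth_on (\<lambda>r. restr (\<lambda>\<omega>. f (r *\<^sub>R \<omega>)) p) {0<..}" for p
  proof (cases "norm p = 1")
    case True
    then have "p \<noteq> 0" by auto
    have "smooth_on (\<lambda>r. f (r *\<^sub>R p + r *\<^sub>R 0 + 0)) {0<..}"
      by (rule smooth_on_compose_curve[where S = "- {0}"])
        (use fs \<open>p \<noteq> 0\<close> in \<open>auto intro: smooth_on_ident\<close>)
    then show ?thesis using True by (simp add: restr_def)
  qed (simp add: restr_def)
  have "smooth_on (u \<beta>) {0<..}" for \<beta>
  proof -
    have "smooth_on (\<lambda>r. \<Sum>p\<in>P. m p \<beta> * restr (\<lambda>\<omega>. f (r *\<^sub>R \<omega>)) p) {0<..}"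
      by (intro smooth_on_sum smooth_on_cmult sm) auto
    then show ?thesis by (rule smooth_on_cong_imp[rotated 2]) (auto simp: u_def)
  qed
  then have u: "u \<beta> \<in> Cpos" for \<beta> by (auto simp: Cpos_def u_def)
  have u0: "u \<beta> r = 0" if "r > 0" "\<And>x. norm x = r \<Longrightarrow> f x = 0" for \<beta> r
    unfolding u_def using that by (auto simp: restr_def intro!: sum.neutral)
  have "f x = (\<Sum>\<beta>\<in>B. radial_tensor (u \<beta>) (Y \<beta>) x)" for x
  proof (cases "x = 0")
    case True
    then show ?thesis using fs by (simp add: radial_tensor_def u_def)
  next
    case False
    define r where "r = norm x"
    define \<omega> where "\<omega> = x /\<^sub>R r"
    have r: "r > 0" "norm \<omega> = 1" "r *\<^sub>R \<omega> = x" using False by (simp_all add: r_def \<omega>_def)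
    let ?F = "restr (\<lambda>\<omega>. f (r *\<^sub>R \<omega>))"
    have "f x = ?F \<omega>" using r by (simp add: restr_def)
    also have "\<dots> = (\<Sum>p\<in>P. ?F p * b p \<omega>)" by (rule Pb[OF fB[OF r(1)]])
    also have "\<dots> = (\<Sum>p\<in>P. \<Sum>\<beta>\<in>B. ?F p * (m p \<beta> * \<beta> \<omega>))"
      by (intro sum.cong refl) (simp add: m sum_at sum_distrib_left)
    also have "\<dots> = (\<Sum>\<beta>\<in>B. \<Sum>p\<in>P. ?F p * (m p \<beta> * \<beta> \<omega>))" by (rule sum.swap)
    also have "\<dots> = (\<Sum>\<beta>\<in>B. u \<beta> r * \<beta> \<omega>)"
      using r(1) by (intro sum.cong refl) (simp add: u_def, simp only: sum_distrib_right, simp only: mult_ac)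
    also have "\<dots> = (\<Sum>\<beta>\<in>B. radial_tensor (u \<beta>) (Y \<beta>) x)"
    proof (rule sum.cong[OF refl])
      fix \<beta> assume "\<beta> \<in> B"
      then have "\<beta> \<omega> = Y \<beta> \<omega>" using Y(2) r(2) by (metis restr_def)
      then show "u \<beta> r * \<beta> \<omega> = radial_tensor (u \<beta>) (Y \<beta>) x"
        by (simp add: radial_tensor_def r_def[symmetric] \<omega>_def[symmetric])
    qed
    finally show ?thesis .
  qed
  then have eq: "f = (\<lambda>x. \<Sum>\<beta>\<in>B. radial_tensor (u \<beta>) (Y \<beta>) x)" by blast
  show thesis by (rule that[OF B(1,2) Y u u0 eq])
qed

lemma C_plus_decomposition:
  fixes f :: "real^'n \<Rightarrow> complex"
  assumes n: "CARD('n) \<ge> 2" and f: "f \<in> C_plus"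
  obtains B :: "(real^'n \<Rightarrow> complex) set" and u k Y where
    "finite B" "cfun.independent B"
    "\<And>\<beta>. \<beta> \<in> B \<Longrightarrow> solid_harmonic (k \<beta>) (Y \<beta>)" "\<And>\<beta>. \<beta> \<in> B \<Longrightarrow> \<beta> = restr (Y \<beta>)"
    "\<And>\<beta>. \<beta> \<in> B \<Longrightarrow> u \<beta> \<in> Cpos_plus"
    "f = (\<lambda>x. \<Sum>\<beta>\<in>B. radial_tensor (u \<beta>) (Y \<beta>) x)"
proof (rule C_space_decomposition[OF n, of f])
  show "f \<in> C_space" using f by (simp add: C_plus_def)
  fix B :: "(real^'n \<Rightarrow> complex) set" and k Y and u :: "(real^'n \<Rightarrow> complex) \<Rightarrow> real \<Rightarrow> complex"
  assume B: "finite B" "cfun.independent B"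
    "\<And>\<beta>. \<beta> \<in> B \<Longrightarrow> solid_harmonic (k \<beta>) (Y \<beta>)" "\<And>\<beta>. \<beta> \<in> B \<Longrightarrow> \<beta> = restr (Y \<beta>)"
    and u: "\<And>\<beta>. \<beta> \<in> B \<Longrightarrow> u \<beta> \<in> Cpos"
    and u0: "\<And>\<beta> r. r > 0 \<Longrightarrow> (\<And>x. norm x = r \<Longrightarrow> f x = 0) \<Longrightarrow> u \<beta> r = 0"
    and eq: "f = (\<lambda>x. \<Sum>\<beta>\<in>B. radial_tensor (u \<beta>) (Y \<beta>) x)"
  have "bounded {x. f x \<noteq> 0}" using f by (simp add: C_plus_def)
  then obtain R where R: "\<And>x. f x \<noteq> 0 \<Longrightarrow> norm x \<le> R" by (auto simp: bounded_iff)
  have "\<forall>\<^sub>F r in at_top. u \<beta> r = 0" for \<beta>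
    using eventually_gt_at_top[of "max 0 R"]
  proof eventually_elim
    case (elim r)
    then have "f x = 0" if "norm x = r" for x using R[of x] that by fastforce
    then show ?case using u0[of r \<beta>] elim by simp
  qed
  then have up: "\<And>\<beta>. \<beta> \<in> B \<Longrightarrow> u \<beta> \<in> Cpos_plus" using u by (simp add: Cpos_plus_def)
  show thesis by (rule that[OF B up eq])
qed

lemma C_minus_decomposition:
  fixes f :: "real^'n \<Rightarrow> complex"
  assumes n: "CARD('n) \<ge> 2" and f: "f \<in> C_minus"
  obtains B :: "(real^'n \<Rightarrow> complex) set" and u k Y where
    "\<And>\<beta>. \<beta> \<in> B \<Longrightarrow> solid_harmonic (k \<beta>) (Y \<beta>)"
    "\<And>\<beta>. \<beta> \<in> B \<Longrightarrow> u \<beta> \<in> Cpos_minus"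
    "f = (\<lambda>x. \<Sum>\<beta>\<in>B. radial_tensor (u \<beta>) (Y \<beta>) x)"
proof (rule C_space_decomposition[OF n, of f])
  show "f \<in> C_space" using f by (simp add: C_minus_def)
  fix B :: "(real^'n \<Rightarrow> complex) set" and k Y and u :: "(real^'n \<Rightarrow> complex) \<Rightarrow> real \<Rightarrow> complex"
  assume B: "\<And>\<beta>. \<beta> \<in> B \<Longrightarrow> solid_harmonic (k \<beta>) (Y \<beta>)"
    and u: "\<And>\<beta>. \<beta> \<in> B \<Longrightarrow> u \<beta> \<in> Cpos"
    and u0: "\<And>\<beta> r. r > 0 \<Longrightarrow> (\<And>x. norm x = r \<Longrightarrow> f x = 0) \<Longrightarrow> u \<beta> r = 0"
    and eq: "f = (\<lambda>x. \<Sum>\<beta>\<in>B. radial_tensor (u \<beta>) (Y \<beta>) x)"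
  have "\<forall>\<^sub>F x in at 0. f x = 0" using f by (simp add: C_minus_def)
  then obtain d where d: "d > 0" "\<And>x. x \<noteq> 0 \<Longrightarrow> norm x < d \<Longrightarrow> f x = 0"
    by (auto simp: eventually_at)
  have "u \<beta> r = 0" if r: "0 < r" "r < d" for r \<beta>
    by (rule u0[OF r(1)], rule d(2)) (use r in auto)
  then have "\<forall>\<^sub>F r in at_right 0. u \<beta> r = 0" for \<beta>
    unfolding eventually_at_right_field using d(1) by (intro exI[of _ d]) auto
  then have up: "\<And>\<beta>. \<beta> \<in> B \<Longrightarrow> u \<beta> \<in> Cpos_minus" using u by (simp add: Cpos_minus_def)
  show thesis by (rule that[OF B up eq])
qed

section \<open>Bijectivity and the inversion formula, assembled from the harmonic components\<close>

lemma solid_harmonic_hpoly: "solid_harmonic k Y \<Longrightarrow> hpoly k Y"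
  by (simp add: solid_harmonic_def)

lemma M_op_C_minus:
  fixes f :: "real^'n \<Rightarrow> complex"
  assumes n: "CARD('n) \<ge> 2" and f: "f \<in> C_plus"
  shows "M_op f \<in> C_minus"
proof (rule C_plus_decomposition[OF n f])
  fix B :: "(real^'n \<Rightarrow> complex) set" and k Y and u :: "(real^'n \<Rightarrow> complex) \<Rightarrow> real \<Rightarrow> complex"
  assume Y: "\<And>\<beta>. \<beta> \<in> B \<Longrightarrow> solid_harmonic (k \<beta>) (Y \<beta>)"
    and u: "\<And>\<beta>. \<beta> \<in> B \<Longrightarrow> u \<beta> \<in> Cpos_plus"
    and eq: "f = (\<lambda>x. \<Sum>\<beta>\<in>B. radial_tensor (u \<beta>) (Y \<beta>) x)"
  have "M_op f = (\<lambda>\<xi>. \<Sum>\<beta>\<in>B. M_op (radial_tensor (u \<beta>) (Y \<beta>)) \<xi>)"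
    unfolding eq by (intro M_op_sum radial_tensor_C_plus u) (auto intro: solid_harmonic_hpoly Y)
  moreover have "M_op (radial_tensor (u \<beta>) (Y \<beta>)) \<in> C_minus" if \<beta>: "\<beta> \<in> B" for \<beta>
    unfolding M_op_radial_tensor[OF Y[OF \<beta>] u[OF \<beta>]]
    by (rule radial_tensor_C_minus[OF solid_harmonic_hpoly[OF Y[OF \<beta>]] M_rad_Cpos_minus[OF u[OF \<beta>]]])
  ultimately show ?thesis by (simp add: C_minus_sum)
qed

lemma M_op_surj:
  fixes \<phi> :: "real^'n \<Rightarrow> complex"
  assumes n: "CARD('n) \<ge> 2" and \<phi>: "\<phi> \<in> C_minus"
  shows "\<exists>f\<in>C_plus. M_op f = \<phi>"
proof (rule C_minus_decomposition[OF n \<phi>])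
  fix B :: "(real^'n \<Rightarrow> complex) set" and k Y and v :: "(real^'n \<Rightarrow> complex) \<Rightarrow> real \<Rightarrow> complex"
  assume Y: "\<And>\<beta>. \<beta> \<in> B \<Longrightarrow> solid_harmonic (k \<beta>) (Y \<beta>)"
    and v: "\<And>\<beta>. \<beta> \<in> B \<Longrightarrow> v \<beta> \<in> Cpos_minus"
    and eq: "\<phi> = (\<lambda>x. \<Sum>\<beta>\<in>B. radial_tensor (v \<beta>) (Y \<beta>) x)"
  have "\<exists>u. u \<in> Cpos_plus \<and> M_rad CARD('n) (k \<beta>) u = v \<beta>" if "\<beta> \<in> B" for \<beta>
    using M_rad_surj[OF v[OF that]] by metis
  then obtain u where u: "\<And>\<beta>. \<beta> \<in> B \<Longrightarrow> u \<beta> \<in> Cpos_plus"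
    "\<And>\<beta>. \<beta> \<in> B \<Longrightarrow> M_rad CARD('n) (k \<beta>) (u \<beta>) = v \<beta>" by metis
  have C: "radial_tensor (u \<beta>) (Y \<beta>) \<in> C_plus" if "\<beta> \<in> B" for \<beta>
    by (rule radial_tensor_C_plus[OF solid_harmonic_hpoly[OF Y[OF that]] u(1)[OF that]])
  let ?f = "\<lambda>x. \<Sum>\<beta>\<in>B. radial_tensor (u \<beta>) (Y \<beta>) x"
  have "M_op ?f = (\<lambda>\<xi>. \<Sum>\<beta>\<in>B. M_op (radial_tensor (u \<beta>) (Y \<beta>)) \<xi>)"
    by (rule M_op_sum[OF C])
  also have "\<dots> = \<phi>"
    unfolding eq by (intro ext sum.cong refl) (simp add: M_op_radial_tensor[OF Y u(1)] u(2))
  finally have "M_op ?f = \<phi>" .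
  moreover have "?f \<in> C_plus" by (rule C_plus_sum[OF C])
  ultimately show ?thesis by blast
qed

text \<open>The operator acts on each component through its radial part and keeps the harmonic
  factor. Linear independence on the unit sphere separates the components of the transform at every
  radius, and \<open>M_rad_inj\<close> finishes each of them.\<close>

lemma M_op_kernel:
  fixes f :: "real^'n \<Rightarrow> complex"
  assumes n: "CARD('n) \<ge> 2" and f: "f \<in> C_plus" and Mf: "M_op f = (\<lambda>\<xi>. 0)"
  shows "f = (\<lambda>x. 0)"
proof (rule C_plus_decomposition[OF n f])
  fix B :: "(real^'n \<Rightarrow> complex) set" and k Y and u :: "(real^'n \<Rightarrow> complex) \<Rightarrow> real \<Rightarrow> complex"
  assume B: "finite B" "cfun.independent B"
    and Y: "\<And>\<beta>. \<beta> \<in> B \<Longrightarrow> solid_harmonic (k \<beta>) (Y \<beta>)" "\<And>\<beta>. \<beta> \<in> B \<Longrightarrow> \<beta> = restr (Y \<beta>)"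
    and u: "\<And>\<beta>. \<beta> \<in> B \<Longrightarrow> u \<beta> \<in> Cpos_plus"
    and eq: "f = (\<lambda>x. \<Sum>\<beta>\<in>B. radial_tensor (u \<beta>) (Y \<beta>) x)"
  let ?M = "\<lambda>\<beta>. M_rad CARD('n) (k \<beta>) (u \<beta>)"
  have C: "radial_tensor (u \<beta>) (Y \<beta>) \<in> C_plus" if "\<beta> \<in> B" for \<beta>
    by (rule radial_tensor_C_plus[OF solid_harmonic_hpoly[OF Y(1)[OF that]] u[OF that]])
  have "M_op f = (\<lambda>\<xi>. \<Sum>\<beta>\<in>B. M_op (radial_tensor (u \<beta>) (Y \<beta>)) \<xi>)"
    unfolding eq by (rule M_op_sum[OF C])
  also have "\<dots> = (\<lambda>\<xi>. \<Sum>\<beta>\<in>B. radial_tensor (?M \<beta>) (Y \<beta>) \<xi>)"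
    by (intro ext sum.cong refl) (simp add: M_op_radial_tensor[OF Y(1) u])
  finally have M0: "(\<Sum>\<beta>\<in>B. radial_tensor (?M \<beta>) (Y \<beta>) \<xi>) = 0" for \<xi>
    using Mf by (metis (no_types, lifting))
  have sum_at: "(\<Sum>\<beta>\<in>B. cscale (a \<beta>) \<beta>) x = (\<Sum>\<beta>\<in>B. a \<beta> * \<beta> x)" for a x
    using B(1) by (induction B rule: finite_induct) (simp_all add: cscale_def)
  have M_0: "?M \<beta> \<rho> = 0" if "\<beta> \<in> B" "\<rho> > 0" for \<beta> \<rho>
  proof -
    have "(\<Sum>\<beta>\<in>B. cscale (?M \<beta> \<rho>) \<beta>) = 0"
    proof
      fix \<omega>
      have "(\<Sum>\<beta>\<in>B. ?M \<beta> \<rho> * \<beta> \<omega>) = 0"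
      proof (cases "norm \<omega> = 1")
        case True
        have "(\<Sum>\<beta>\<in>B. ?M \<beta> \<rho> * \<beta> \<omega>) = (\<Sum>\<beta>\<in>B. radial_tensor (?M \<beta>) (Y \<beta>) (\<rho> *\<^sub>R \<omega>))"
        proof (rule sum.cong[OF refl])
          fix \<beta> assume "\<beta> \<in> B"
          then have "\<beta> \<omega> = Y \<beta> \<omega>" using Y(2) True by (metis restr_def)
          then show "?M \<beta> \<rho> * \<beta> \<omega> = radial_tensor (?M \<beta>) (Y \<beta>) (\<rho> *\<^sub>R \<omega>)"
            using True that(2) by (simp add: radial_tensor_def)
        qed
        then show ?thesis using M0 by simp
      next
        case False
        then have "\<beta> \<omega> = 0" if "\<beta> \<in> B" for \<beta> using Y(2)[OF that] by (metis restr_def)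
        then show ?thesis by (intro sum.neutral) simp
      qed
      then show "(\<Sum>\<beta>\<in>B. cscale (?M \<beta> \<rho>) \<beta>) \<omega> = 0 \<omega>" by (simp add: sum_at)
    qed
    then show ?thesis
      by (rule cfun.independentD[OF B(2,1) subset_refl, where u = "\<lambda>\<beta>. ?M \<beta> \<rho>", OF _ that(1)])
  qed
  have "u \<beta> r = 0" if "\<beta> \<in> B" for \<beta> r
  proof (cases "r > 0")
    case True
    show ?thesis by (rule M_rad_inj[OF u[OF that] n M_0[OF that] True])
  next
    case False
    then show ?thesis using u[OF that] by (auto simp: Cpos_plus_def Cpos_def)
  qed
  then show ?thesis unfolding eq by (simp add: radial_tensor_def)
qed

lemma M_op_inj:
  assumes n: "CARD('n::finite) \<ge> 2"
  shows "inj_on M_op (C_plus :: (real^'n \<Rightarrow> complex) set)"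
proof (rule inj_onI)
  fix f g :: "real^'n \<Rightarrow> complex"
  assume f: "f \<in> C_plus" and g: "g \<in> C_plus" and e: "M_op f = M_op g"
  have "M_op (\<lambda>x. (-1) * g x + f x) = (\<lambda>\<xi>. 0)"
    unfolding M_op_lin[OF g f] e by simp
  then have z: "(\<lambda>x. (-1) * g x + f x) = (\<lambda>x. 0)" by (rule M_op_kernel[OF n C_plus_lin[OF g f]])
  show "f = g"
  proof
    fix x show "f x = g x" using fun_cong[OF z, of x] by simp
  qed
qed

text \<open>Inversion and positive scaling preserve the direction of x, so the harmonic factor is a
  constant in t. What remains is the profile of \<open>M_rad_inverse\<close>.\<close>

lemma inversion_radial_tensor:
  fixes Y :: "real^'n \<Rightarrow> complex"
  assumes n: "CARD('n) \<ge> 2" and Y: "solid_harmonic k Y" and u: "u \<in> Cpos_plus" and x: "x \<noteq> 0"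
  defines "v \<equiv> M_rad CARD('n) k u"
  shows "vanish0 (\<lambda>t. Inv_op (radial_tensor v Y) (x /\<^sub>R t))"
    and "beta_dist CARD('n) k (\<lambda>t. Inv_op (radial_tensor v Y) (x /\<^sub>R t)) = radial_tensor u Y x"
proof -
  define r where "r = norm x"
  define c where "c = Y (x /\<^sub>R r)"
  define g where "g t = of_real ((t / r) ^ (CARD('n) - 1)) * lam (CARD('n) - 1) k (prof k u) (r / t) * 1" for t
  have r: "r > 0" using x by (simp add: r_def)
  have g: "vanish0 g"
    unfolding g_def[abs_def] by (rule beta_dist_profile(1)[OF n r lam_fplus[OF prof_fplus[OF u]]])
  have Suc: "CARD('n) = Suc (CARD('n) - 1)" using n by simp
  have eq: "Inv_op (radial_tensor v Y) (x /\<^sub>R t) = c * g t" if t: "t > 0" for t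
  proof -
    have nt: "norm (x /\<^sub>R t) = r / t" using t by (simp add: r_def divide_inverse)
    have y: "(x /\<^sub>R t) /\<^sub>R (r / t)\<^sup>2 = (t / r\<^sup>2) *\<^sub>R x"
      using t r by (simp add: field_simps power2_eq_square)
    have ny: "norm ((t / r\<^sup>2) *\<^sub>R x) = t / r" using t r by (simp add: r_def power2_eq_square)
    have yr: "((t / r\<^sup>2) *\<^sub>R x) /\<^sub>R (t / r) = x /\<^sub>R r" using t r by (simp add: field_simps power2_eq_square)
    have "Inv_op (radial_tensor v Y) (x /\<^sub>R t) = v (t / r) * c / of_real ((r / t) ^ CARD('n))"
      unfolding Inv_op_def nt y radial_tensor_def ny yr c_def ..
    also have "v (t / r) = of_real (r / t) * lam (CARD('n) - 1) k (prof k u) (r / t)"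
      using t r by (simp add: v_def M_rad_def)
    also have "(r / t) ^ CARD('n) = (r / t) * (r / t) ^ (CARD('n) - 1)"
      using arg_cong[OF Suc, of "\<lambda>m. (r / t) ^ m"] by (simp only: power_Suc)
    finally show ?thesis using t r by (simp add: g_def power_divide field_simps)
  qed
  have cg: "vanish0 (\<lambda>t. c * g t)" by (rule vanish0_cmult[OF g])
  then obtain d where d: "smooth_on (\<lambda>t. c * g t) {0<..}" "d > 0" "\<And>t. 0 < t \<Longrightarrow> t < d \<Longrightarrow> c * g t = 0"
    unfolding vanish0_def by blast
  have "smooth_on (\<lambda>t. Inv_op (radial_tensor v Y) (x /\<^sub>R t)) {0<..}"
    by (rule smooth_on_cong_imp[OF _ _ d(1)]) (use eq in auto)
  then show "vanish0 (\<lambda>t. Inv_op (radial_tensor v Y) (x /\<^sub>R t))"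
    unfolding vanish0_def using d eq by (intro conjI exI[of _ d]) auto
  have "beta_dist CARD('n) k (\<lambda>t. Inv_op (radial_tensor v Y) (x /\<^sub>R t)) = beta_dist CARD('n) k (\<lambda>t. c * g t + 0 * g t)"
  proof (rule beta_dist_cong[OF n, of _ 2])
    show "vanish0 (\<lambda>t. c * g t + 0 * g t)" using cg by simp
  qed (use eq in auto)
  also have "\<dots> = c * beta_dist CARD('n) k g"
  proof -
    have z: "vanish0 (\<lambda>t. 0 * g t)" by (rule vanish0_cmult[OF g])
    have "beta_dist CARD('n) k (\<lambda>t. 0 * g t + 0 * g t) = 0 * beta_dist CARD('n) k g + beta_dist CARD('n) k (\<lambda>t. 0 * g t)"
      by (rule beta_dist_linear[OF n g z])
    moreover have "beta_dist CARD('n) k (\<lambda>t. (-1) * (0 * g t) + 0 * g t) = (-1) * beta_dist CARD('n) k (\<lambda>t. 0 * g t) + beta_dist CARD('n) k (\<lambda>t. 0 * g t)"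
      by (rule beta_dist_linear[OF n z z])
    ultimately show ?thesis unfolding beta_dist_linear[OF n g z] by simp
  qed
  also have "beta_dist CARD('n) k g = u r"
    unfolding g_def[abs_def] by (rule M_rad_inverse[OF u n r, symmetric])
  finally show "beta_dist CARD('n) k (\<lambda>t. Inv_op (radial_tensor v Y) (x /\<^sub>R t)) = radial_tensor u Y x"
    by (simp only: radial_tensor_def[of u] c_def r_def mult.commute)
qed

lemma beta_dist_zero: "n \<ge> 2 \<Longrightarrow> beta_dist n k (\<lambda>t. 0) = 0"
proof -
  assume n: "n \<ge> 2"
  have z: "vanish0 (\<lambda>t. 0)" by (auto simp: vanish0_def intro!: exI[of _ 1])
  show ?thesis using beta_dist_linear[OF n z z, of k 1] by simp
qed

text \<open>The condition \<open>vanish0\<close> is carried through the span because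
  \<open>beta_dist\<close> is additive only where its integrals converge.\<close>

lemma inversion_tensor_space:
  fixes \<phi> :: "real^'n \<Rightarrow> complex"
  assumes n: "CARD('n) \<ge> 2" and \<phi>: "\<phi> \<in> tensor_space Cpos_minus (harmonic_poly k)"
  shows "\<exists>f\<in>C_plus. M_op f = \<phi> \<and> (\<forall>x. x \<noteq> 0 \<longrightarrow> vanish0 (\<lambda>t. Inv_op \<phi> (x /\<^sub>R t))
    \<and> f x = beta_dist CARD('n) k (\<lambda>t. Inv_op \<phi> (x /\<^sub>R t)))"
  using \<phi> unfolding tensor_space_def
proof (induction rule: span_fun_induct)
  case zero
  have "vanish0 (\<lambda>t. 0)" by (auto simp: vanish0_def intro!: exI[of _ 1])
  then show ?case
    by (intro bexI[OF _ C_plus_zero]) (simp add: M_op_zero Inv_op_def beta_dist_zero[OF n])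
next
  case (add c \<phi> \<psi>)
  obtain f where f: "f \<in> C_plus" "M_op f = \<phi>"
    "\<And>x. x \<noteq> 0 \<Longrightarrow> vanish0 (\<lambda>t. Inv_op \<phi> (x /\<^sub>R t))"
    "\<And>x. x \<noteq> 0 \<Longrightarrow> f x = beta_dist CARD('n) k (\<lambda>t. Inv_op \<phi> (x /\<^sub>R t))" using add(1) by blast
  obtain g where g: "g \<in> C_plus" "M_op g = \<psi>"
    "\<And>x. x \<noteq> 0 \<Longrightarrow> vanish0 (\<lambda>t. Inv_op \<psi> (x /\<^sub>R t))"
    "\<And>x. x \<noteq> 0 \<Longrightarrow> g x = beta_dist CARD('n) k (\<lambda>t. Inv_op \<psi> (x /\<^sub>R t))" using add(2) by blast
  have I: "Inv_op (\<lambda>x. c * \<phi> x + \<psi> x) = (\<lambda>x. c * Inv_op \<phi> x + Inv_op \<psi> x)"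
    by (simp add: Inv_op_def fun_eq_iff add_divide_distrib)
  show ?case
  proof (intro bexI[of _ "\<lambda>x. c * f x + g x"] conjI allI impI)
    show "(\<lambda>x. c * f x + g x) \<in> C_plus" by (rule C_plus_lin[OF f(1) g(1)])
    show "M_op (\<lambda>x. c * f x + g x) = (\<lambda>x. c * \<phi> x + \<psi> x)"
      unfolding M_op_lin[OF f(1) g(1)] f(2) g(2) ..
    fix x :: "real^'n" assume x: "x \<noteq> 0"
    show "vanish0 (\<lambda>t. Inv_op (\<lambda>x. c * \<phi> x + \<psi> x) (x /\<^sub>R t))"
      unfolding I by (intro vanish0_add vanish0_cmult f(3) g(3) x)
    show "c * f x + g x = beta_dist CARD('n) k (\<lambda>t. Inv_op (\<lambda>x. c * \<phi> x + \<psi> x) (x /\<^sub>R t))"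
      unfolding I beta_dist_linear[OF n f(3)[OF x] g(3)[OF x]] f(4)[OF x, symmetric] g(4)[OF x, symmetric] ..
  qed
next
  case (base \<phi>)
  then obtain v Y where v: "\<phi> = radial_tensor v Y" "v \<in> Cpos_minus" "Y \<in> harmonic_poly k" by blast
  have Y: "solid_harmonic k Y" by (rule harmonic_poly_harm[OF v(3)])
  obtain u where u: "u \<in> Cpos_plus" "M_rad CARD('n) k u = v" by (rule M_rad_surj[OF v(2)])
  have "M_op (radial_tensor u Y) = \<phi>" unfolding M_op_radial_tensor[OF Y u(1)] u(2) v(1) ..
  then show ?case
    using radial_tensor_C_plus[OF solid_harmonic_hpoly[OF Y] u(1)]
      inversion_radial_tensor[OF n Y u(1)] unfolding u(2) v(1) by metis
qed

theorem theorem4p3p3: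
  assumes "CARD('n::finite) \<ge> 2"
  shows "bij_betw M_op (C_plus :: (real^'n \<Rightarrow> complex) set) C_minus
    \<and> (\<forall>f \<in> (C_plus :: (real^'n \<Rightarrow> complex) set). \<forall>g \<in> C_plus. M_op (f + g) = M_op f + M_op g)
    \<and> (\<forall>c. \<forall>f \<in> (C_plus :: (real^'n \<Rightarrow> complex) set). M_op (cscale c f) = cscale c (M_op f))
    \<and> (\<forall>k. \<forall>\<phi> \<in> tensor_space Cpos_minus (harmonic_poly k :: (real^'n \<Rightarrow> complex) set).
          inv_into C_plus M_op \<phi> = mult_conv (beta_dist CARD('n) k) (Inv_op \<phi>))"
proof (intro conjI ballI allI)
  show "bij_betw M_op (C_plus :: (real^'n \<Rightarrow> complex) set) C_minus"
    unfolding bij_betw_def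
  proof
    show "inj_on M_op (C_plus :: (real^'n \<Rightarrow> complex) set)" by (rule M_op_inj[OF assms])
    show "M_op ` (C_plus :: (real^'n \<Rightarrow> complex) set) = C_minus"
      using M_op_C_minus[OF assms] M_op_surj[OF assms] by blast
  qed
next
  fix f g :: "real^'n \<Rightarrow> complex" assume "f \<in> C_plus" "g \<in> C_plus"
  then show "M_op (f + g) = M_op f + M_op g"
    using M_op_lin[of f g 1] by (simp add: plus_fun_def)
next
  fix c and f :: "real^'n \<Rightarrow> complex" assume "f \<in> C_plus"
  then show "M_op (cscale c f) = cscale c (M_op f)"
    using M_op_lin[OF _ C_plus_zero, of f c] by (simp add: cscale_def M_op_zero)
next
  fix k and \<phi> :: "real^'n \<Rightarrow> complex" assume "\<phi> \<in> tensor_space Cpos_minus (harmonic_poly k)"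
  then obtain f where f: "f \<in> C_plus" "M_op f = \<phi>"
    "\<And>x. x \<noteq> 0 \<Longrightarrow> vanish0 (\<lambda>t. Inv_op \<phi> (x /\<^sub>R t))"
    "\<And>x. x \<noteq> 0 \<Longrightarrow> f x = beta_dist CARD('n) k (\<lambda>t. Inv_op \<phi> (x /\<^sub>R t))"
    using inversion_tensor_space[OF assms] by blast
  have "f = mult_conv (beta_dist CARD('n) k) (Inv_op \<phi>)"
  proof
    fix x
    \<comment> \<open>At the origin both functions have the conventional value 0; elsewhere
      \<open>dist_apply_beta\<close> replaces the description by the integral formula.\<close>
    have "f 0 = 0" using f(1) by (simp add: C_plus_def C_space_def)
    then show "f x = mult_conv (beta_dist CARD('n) k) (Inv_op \<phi>) x"
      using f(4)[of x] dist_apply_beta[OF assms f(3)[of x], of k] by (simp add: mult_conv_def)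
  qed
  then show "inv_into C_plus M_op \<phi> = mult_conv (beta_dist CARD('n) k) (Inv_op \<phi>)"
    using inv_into_f_f[OF M_op_inj[OF assms] f(1)] f(2) by simp
qed

end
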